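(* Let $\kappa\ge2$ be an integer, $\lambda\in(0,\kappa^{-1}]$, let $T=T_{\kappa,\lambda}$ be a $(\kappa,\lambda)$ Baker's transformation of $M=[0,1]^2$ and let $\mathcal L$ be its transfer operator. Then $\mathcal L$ is quasi-compact as an operator on $\mathcal B$: its spectral radius is $1$ and its essential spectral radius is bounded by $\rho=\max\{\lambda^\alpha,\kappa^{-\beta}\}<1$. Moreover: (a) $\mathcal L$ has a spectral gap: the eigenvalue $1$ is simple, and all other eigenvalues have modulus strictly less than $1$. (b) The unique element $\mu_0$ of $\mathcal B$ such that $\mathcal L\mu_0=\mu_0$ with $\mu_0(\mathbf 1)=1$ is a measure. It is the unique physical measure for $T$, and its conditional measures on unstable leaves are equal to arclength. (c) There exist $\sigma<1$ and $C>0$ such that for any $f\in\mathcal B$ satisfying $f(\mathbf 1)=1$, we have $\|\mathcal L^nf-\mu_0\|_{\mathcal B}\le C\sigma^n\|f\|_{\mathcal B}$ for all $n\ge0$.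
   Context: Baker's map. $M=[0,1]^2$, $m$ is Lebesgue measure on $M$. Divide $M$ into $\kappa$ vertical rectangles $R_1,\dots,R_\kappa$ of width $1/\kappa$ and height $1$. A $(\kappa,\lambda)$ Baker's transformation is a map $T:M\to M$ such that each $T|_{R_i}$ is affine, expanding by $\kappa$ in the horizontal direction and contracting by $\lambda$ in the vertical direction (so $T(R_i)$ is a horizontal rectangle of length $1$ and height $\lambda$ in $M$), and the images $T(R_i)$ are pairwise disjoint up to Lebesgue null sets. The order and orientation of the images are arbitrary. (Values on common sides of the $R_i$ are not specified; leafwise formulas are understood via the $\kappa$ affine branches.) Spaces. $\mathcal W^s$ (resp. $\mathcal W^u$) is the set of full vertical (resp. horizontal) line segments of length $1$ in $M$, called stable (resp. unstable) leaves. For $W\in\mathcal W^s$ and $\alpha\in[0,1]$, $|\varphi|_{C^\alpha(W)}=\sup_W|\varphi|+H^\alpha_W(\varphi)$, with $H^\alpha_W(\varphi)=\sup_{x\ne y\in W}|\varphi(x)-\varphi(y)|/|x-y|^\alpha$; $|\varphi|_{C^\alpha(\mathcal W^s)}=\sup_{W\in\mathcal W^s}|\varphi|_{C^\alpha(W)}$. $C^1$ always means Lipschitz: $C^1(W)$ is the set of Lipschitz functions on $W$ and $C^1(\mathcal W^s)$ the set of measurable functions on $M$ with $|\varphi|_{C^1(\mathcal W^s)}<\infty$; for $\alpha<1$, $C^\alpha(W)$, $C^\alpha(\mathcal W^s)$ are the completions of $C^1(W)$, $C^1(\mathcal W^s)$ in the respective norms. $C^\alpha(\mathcal W^u)$ is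 defined in the same way with unstable leaves. $m_W$ is arclength on $W$. Write $W=\{(s_W,t):t\in[0,1]\}$ for $W\in\mathcal W^s$, $d(W_1,W_2)=|s_{W_1}-s_{W_2}|$, and for functions $\varphi_i$ on $W_i$, $d_0(\varphi_1,\varphi_2)=\sup_t|\varphi_1(s_{W_1},t)-\varphi_2(s_{W_2},t)|$. Fix $\alpha,\beta\in(0,1)$ with $\beta\le1-\alpha$. For $f\in C^1(\mathcal W^u)$ set $|f|_w=\sup_{W\in\mathcal W^s}\sup\{\int_Wf\varphi\,dm_W:|\varphi|_{C^1(W)}\le1\}$, $\|f\|_s=\sup_{W\in\mathcal W^s}\sup\{\int_Wf\varphi\,dm_W:\varphi\in C^\alpha(W),|\varphi|_{C^\alpha(W)}\le1\}$, $\|f\|_u=\sup_{W_1,W_2\in\mathcal W^s}\sup\{d(W_1,W_2)^{-\beta}|\int_{W_1}f\varphi_1\,dm_{W_1}-\int_{W_2}f\varphi_2\,dm_{W_2}|:|\varphi_i|_{C^1(W_i)}\le1,\ d_0(\varphi_1,\varphi_2)=0\}$, $\|f\|_{\mathcal B}=\|f\|_s+\|f\|_u$. $\mathcal B_w$ and $\mathcal B$ are the completions of $C^1(\mathcal W^u)$ in $|\cdot|_w$ and $\|\cdot\|_{\mathcal B}$. A function $f\in C^1(\mathcal W^u)$ is identified with the measure $f\,dm$, $f(\varphi)=\int_Mf\varphi\,dm$; via this identification $\mathcal B\subset\mathcal B_w\subset(C^1(\mathcal W^s))^*$. $\mathbf 1$ is the constant function $1$ on $M$. Transfer operator. $\mathcal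 Lf(\varphi)=f(\varphi\circ T)$; for $f\in C^1(\mathcal W^u)$, $\mathcal Lf$ has density $f\circ T^{-1}/(\kappa\lambda)$ on $T(M)$ and $0$ on $M\setminus T(M)$. It extends to bounded operators on $\mathcal B$ and $\mathcal B_w$. As usual, spectra refer to complexifications. An invariant measure $\mu$ is a physical measure for $T$ if there is a set $B\subseteq M$ with $m(B)>0$ such that $\frac1n\sum_{k=0}^{n-1}\psi(T^kx)\to\mu(\psi)$ for all $x\in B$ and all $\psi\in C^0(M)$. *)

theory Defs
  imports "HOL-Probability.Probability"
begin

section \<open>Operators on complex normed spaces given by a carrier\<close>

text \<open>
  A complex normed space is given by a set \<open>V\<close> of complex valued functions, a linear subspace
  for the pointwise operations, and a norm \<open>N\<close> on \<open>V\<close>. An operator \<open>A\<close> is only considered on \<open>V\<close>.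
  A carrier is used because the spaces below depend on real parameters.
\<close>

definition bounded_operator ::
  "('a \<Rightarrow> complex) set \<Rightarrow> (('a \<Rightarrow> complex) \<Rightarrow> real) \<Rightarrow> (('a \<Rightarrow> complex) \<Rightarrow> ('a \<Rightarrow> complex)) \<Rightarrow> bool"
  where "bounded_operator V N A \<longleftrightarrow>
    (\<forall>v\<in>V. A v \<in> V) \<and>
    (\<forall>u\<in>V. \<forall>v\<in>V. A (\<lambda>a. u a + v a) = (\<lambda>a. A u a + A v a)) \<and>
    (\<forall>c. \<forall>v\<in>V. A (\<lambda>a. c * v a) = (\<lambda>a. c * A v a)) \<and>
    (\<exists>C. \<forall>v\<in>V. N (A v) \<le> C * N v)"

definition shifted ::
  "complex \<Rightarrow> (('a \<Rightarrow> complex) \<Rightarrow> ('a \<Rightarrow> complex)) \<Rightarrow> ('a \<Rightarrow> complex) \<Rightarrow> ('a \<Rightarrow> complex)"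
  where "shifted z A v = (\<lambda>a. z * v a - A v a)"

definition resolvent_set ::
  "('a \<Rightarrow> complex) set \<Rightarrow> (('a \<Rightarrow> complex) \<Rightarrow> real) \<Rightarrow> (('a \<Rightarrow> complex) \<Rightarrow> ('a \<Rightarrow> complex)) \<Rightarrow> complex set"
  where "resolvent_set V N A =
    {z. \<exists>R. bounded_operator V N R \<and>
        (\<forall>v\<in>V. R (shifted z A v) = v) \<and> (\<forall>v\<in>V. shifted z A (R v) = v)}"

definition spectrum_on ::
  "('a \<Rightarrow> complex) set \<Rightarrow> (('a \<Rightarrow> complex) \<Rightarrow> real) \<Rightarrow> (('a \<Rightarrow> complex) \<Rightarrow> ('a \<Rightarrow> complex)) \<Rightarrow> complex set"
  where "spectrum_on V N A = - resolvent_set V N A"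

definition spectral_radius_on ::
  "('a \<Rightarrow> complex) set \<Rightarrow> (('a \<Rightarrow> complex) \<Rightarrow> real) \<Rightarrow> (('a \<Rightarrow> complex) \<Rightarrow> ('a \<Rightarrow> complex)) \<Rightarrow> real"
  where "spectral_radius_on V N A = (SUP z\<in>spectrum_on V N A. cmod z)"

definition eigenvalue_on ::
  "('a \<Rightarrow> complex) set \<Rightarrow> (('a \<Rightarrow> complex) \<Rightarrow> ('a \<Rightarrow> complex)) \<Rightarrow> complex \<Rightarrow> bool"
  where "eigenvalue_on V A z \<longleftrightarrow> (\<exists>v\<in>V. v \<noteq> (\<lambda>_. 0) \<and> A v = (\<lambda>a. z * v a))"

text \<open>Simple means of algebraic multiplicity one: the generalized eigenspace is a line.\<close>

definition simple_eigenvalue_on ::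
  "('a \<Rightarrow> complex) set \<Rightarrow> (('a \<Rightarrow> complex) \<Rightarrow> ('a \<Rightarrow> complex)) \<Rightarrow> complex \<Rightarrow> bool"
  where "simple_eigenvalue_on V A z \<longleftrightarrow>
    (\<exists>v\<in>V. v \<noteq> (\<lambda>_. 0) \<and>
       {u \<in> V. \<exists>k. (shifted z A ^^ k) u = (\<lambda>_. 0)} = range (\<lambda>c. (\<lambda>a. c * v a)))"

definition finite_dimensional :: "('a \<Rightarrow> complex) set \<Rightarrow> bool"
  where "finite_dimensional U \<longleftrightarrow>
    (\<exists>S. finite S \<and> S \<subseteq> U \<and> (\<forall>u\<in>U. \<exists>c. u = (\<lambda>a. \<Sum>s\<in>S. c s * s a)))"

text \<open>
  Isolated eigenvalues of finite algebraic multiplicity. The operator \<open>P\<close> is the Riesz projection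
  of \<open>z\<close>; finiteness of the dimension of the generalized eigenspace alone would not imply that
  it has finite rank.
\<close>

definition discrete_eigenvalue ::
  "('a \<Rightarrow> complex) set \<Rightarrow> (('a \<Rightarrow> complex) \<Rightarrow> real) \<Rightarrow> (('a \<Rightarrow> complex) \<Rightarrow> ('a \<Rightarrow> complex)) \<Rightarrow> complex \<Rightarrow> bool"
  where "discrete_eigenvalue V N A z \<longleftrightarrow>
    z isolated_in spectrum_on V N A \<and> eigenvalue_on V A z \<and>
    (\<exists>P. bounded_operator V N P \<and> (\<forall>v\<in>V. P (P v) = P v) \<and> (\<forall>v\<in>V. P (A v) = A (P v)) \<and>
         finite_dimensional (P ` V) \<and>
         (\<exists>k. \<forall>v\<in>P ` V. (shifted z A ^^ k) v = (\<lambda>_. 0)) \<and>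
         z \<in> resolvent_set {v \<in> V. P v = (\<lambda>_. 0)} N A)"

definition essential_spectral_radius ::
  "('a \<Rightarrow> complex) set \<Rightarrow> (('a \<Rightarrow> complex) \<Rightarrow> real) \<Rightarrow> (('a \<Rightarrow> complex) \<Rightarrow> ('a \<Rightarrow> complex)) \<Rightarrow> real"
  where "essential_spectral_radius V N A =
    Inf {r. 0 \<le> r \<and> (\<forall>z\<in>spectrum_on V N A. r < cmod z \<longrightarrow> discrete_eigenvalue V N A z)}"

definition quasi_compact ::
  "('a \<Rightarrow> complex) set \<Rightarrow> (('a \<Rightarrow> complex) \<Rightarrow> real) \<Rightarrow> (('a \<Rightarrow> complex) \<Rightarrow> ('a \<Rightarrow> complex)) \<Rightarrow> bool"
  where "quasi_compact V N A \<longleftrightarrow>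
    bounded_operator V N A \<and> essential_spectral_radius V N A < spectral_radius_on V N A"

text \<open>Complexification of a real space of real valued functions; the norm is Taylor's.\<close>

definition complexify_space :: "('a \<Rightarrow> real) set \<Rightarrow> ('a \<Rightarrow> complex) set"
  where "complexify_space V = {G. (\<lambda>a. Re (G a)) \<in> V \<and> (\<lambda>a. Im (G a)) \<in> V}"

definition complexify_norm :: "(('a \<Rightarrow> real) \<Rightarrow> real) \<Rightarrow> ('a \<Rightarrow> complex) \<Rightarrow> real"
  where "complexify_norm N G = (SUP \<theta>. N (\<lambda>a. Re (cis \<theta> * G a)))"

definition complexify_op ::
  "(('a \<Rightarrow> real) \<Rightarrow> ('a \<Rightarrow> real)) \<Rightarrow> ('a \<Rightarrow> complex) \<Rightarrow> ('a \<Rightarrow> complex)"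
  where "complexify_op A G = (\<lambda>a. Complex (A (\<lambda>b. Re (G b)) a) (A (\<lambda>b. Im (G b)) a))"


section \<open>Baker's transformations\<close>

type_synonym point = "real \<times> real"

definition square :: "point set"
  where "square = {0..1} \<times> {0..1}"

definition rectangle :: "nat \<Rightarrow> nat \<Rightarrow> point set"
  where "rectangle \<kappa> i = {real i / real \<kappa> .. real (Suc i) / real \<kappa>} \<times> {0..1}"

text \<open>
  \<open>b i\<close>, for \<open>i < \<kappa>\<close>, is the affine branch of \<open>T\<close> on the \<open>i\<close>-th closed rectangle (counted from 0).
  On the common sides of the rectangles \<open>T\<close> is an arbitrary measurable map into the square.
\<close>

definition baker ::
  "nat \<Rightarrow> real \<Rightarrow> (nat \<Rightarrow> point \<Rightarrow> point) \<Rightarrow> (point \<Rightarrow> point) \<Rightarrow> bool"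
  where "baker \<kappa> l b T \<longleftrightarrow>
    (\<forall>i<\<kappa>. \<exists>p q. \<exists>\<epsilon>\<in>{1, -1}. \<exists>\<delta>\<in>{1, -1}.
        \<forall>x y. b i (x, y) = (p + \<epsilon> * real \<kappa> * x, q + \<delta> * l * y)) \<and>
    (\<forall>i<\<kappa>. b i ` rectangle \<kappa> i \<subseteq> square) \<and>
    (\<forall>i<\<kappa>. \<forall>j<\<kappa>. i \<noteq> j \<longrightarrow>
        b i ` rectangle \<kappa> i \<inter> b j ` rectangle \<kappa> j \<in> null_sets lborel) \<and>
    (\<forall>i<\<kappa>. \<forall>x \<in> rectangle \<kappa> i - (\<Union>j\<in>{..<\<kappa>} - {i}. rectangle \<kappa> j). T x = b i x) \<and>
    T \<in> measurable (restrict_space borel square) (restrict_space borel square)"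

text \<open>
  The version of \<open>T\<close> that is affine on every vertical leaf: a common side is assigned to the
  rectangle on its right. It differs from \<open>T\<close> at most on the common sides.
\<close>

definition leafwise :: "nat \<Rightarrow> (nat \<Rightarrow> point \<Rightarrow> point) \<Rightarrow> point \<Rightarrow> point"
  where "leafwise \<kappa> b x = b (min (nat \<lfloor>real \<kappa> * fst x\<rfloor>) (\<kappa> - 1)) x"


section \<open>Function spaces on leaves\<close>

text \<open>
  A function on a leaf of length 1 is identified with a function of the arclength parameter in
  \<open>{0..1}\<close>; its values outside \<open>{0..1}\<close> are irrelevant.
\<close>

definition holder_norm :: "real \<Rightarrow> (real \<Rightarrow> real) \<Rightarrow> ennreal"
  where "holder_norm a g =
    (SUP t\<in>{0..1}. ennreal \<bar>g t\<bar>) +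
    (SUP t\<in>{0..1}. SUP u\<in>{0..1} - {t}. ennreal (\<bar>g t - g u\<bar> / \<bar>t - u\<bar> powr a))"

definition lipschitz_leaf :: "(real \<Rightarrow> real) set"
  where "lipschitz_leaf = {g. holder_norm 1 g < \<infinity>}"

text \<open>
  The completion of the Lipschitz functions in the Hoelder norm of exponent \<open>a < 1\<close>: their closure
  in the (complete) space of Hoelder functions, not the whole Hoelder space.
\<close>

definition holder_leaf :: "real \<Rightarrow> (real \<Rightarrow> real) set"
  where "holder_leaf a =
    {g. \<exists>h. (\<forall>n. h n \<in> lipschitz_leaf) \<and> (\<lambda>n::nat. holder_norm a (\<lambda>t. g t - h n t)) \<longlonglongrightarrow> 0}"

definition C1_stable :: "(point \<Rightarrow> real) set"
  where "C1_stable = {\<phi> \<in> borel_measurable (restrict_space borel square).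
    (SUP s\<in>{0..1}. holder_norm 1 (\<lambda>t. \<phi> (s, t))) < \<infinity>}"

definition C1_unstable :: "(point \<Rightarrow> real) set"
  where "C1_unstable = {f \<in> borel_measurable (restrict_space borel square).
    (SUP y\<in>{0..1}. holder_norm 1 (\<lambda>x. f (x, y))) < \<infinity>}"


section \<open>The Banach space\<close>

text \<open>\<open>leaf_integral s f g\<close> integrates \<open>f\<close> against \<open>g\<close> over the vertical leaf at abscissa \<open>s\<close>.\<close>

definition leaf_integral :: "real \<Rightarrow> (point \<Rightarrow> real) \<Rightarrow> (real \<Rightarrow> real) \<Rightarrow> real"
  where "leaf_integral s f g = set_lebesgue_integral lborel {0..1} (\<lambda>t. f (s, t) * g t)"

definition leaf_distance0 :: "(real \<Rightarrow> real) \<Rightarrow> (real \<Rightarrow> real) \<Rightarrow> ennreal"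
  where "leaf_distance0 g h = (SUP t\<in>{0..1}. ennreal \<bar>g t - h t\<bar>)"

definition stable_norm :: "real \<Rightarrow> (point \<Rightarrow> real) \<Rightarrow> real"
  where "stable_norm \<alpha> f =
    Sup {leaf_integral s f g | s g. s \<in> {0..1} \<and> g \<in> holder_leaf \<alpha> \<and> holder_norm \<alpha> g \<le> 1}"

text \<open>
  The case \<open>s = s'\<close> contributes only 0, because then both integrals agree (and \<open>0 powr _ = 0\<close>).
\<close>

definition unstable_norm :: "real \<Rightarrow> (point \<Rightarrow> real) \<Rightarrow> real"
  where "unstable_norm \<beta> f =
    Sup {\<bar>s - s'\<bar> powr (- \<beta>) * \<bar>leaf_integral s f g - leaf_integral s' f h\<bar> | s s' g h.
      s \<in> {0..1} \<and> s' \<in> {0..1} \<and> holder_norm 1 g \<le> 1 \<and> holder_norm 1 h \<le> 1 \<and>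
      leaf_distance0 g h = 0}"

definition strong_norm :: "real \<Rightarrow> real \<Rightarrow> (point \<Rightarrow> real) \<Rightarrow> real"
  where "strong_norm \<alpha> \<beta> f = stable_norm \<alpha> f + unstable_norm \<beta> f"

text \<open>
  The completion of \<open>C1_unstable\<close> is realised inside the dual of \<open>C1_stable\<close>, through the
  identification of \<open>f\<close> with the measure \<open>f dm\<close>: its elements are the limits of Cauchy sequences.
  Functionals are extended by 0 outside \<open>C1_stable\<close>.
\<close>

type_synonym functional = "(point \<Rightarrow> real) \<Rightarrow> real"

definition strong_Cauchy :: "real \<Rightarrow> real \<Rightarrow> (nat \<Rightarrow> point \<Rightarrow> real) \<Rightarrow> bool"
  where "strong_Cauchy \<alpha> \<beta> f \<longleftrightarrow> (\<forall>n. f n \<in> C1_unstable) \<and>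
    (\<forall>\<epsilon>>0. \<exists>K. \<forall>m\<ge>K. \<forall>n\<ge>K. strong_norm \<alpha> \<beta> (\<lambda>x. f m x - f n x) < \<epsilon>)"

definition approximates :: "(nat \<Rightarrow> point \<Rightarrow> real) \<Rightarrow> functional \<Rightarrow> bool"
  where "approximates f F \<longleftrightarrow>
    (\<forall>\<phi>\<in>C1_stable. (\<lambda>n. set_lebesgue_integral lborel square (\<lambda>x. f n x * \<phi> x)) \<longlonglongrightarrow> F \<phi>) \<and>
    (\<forall>\<phi>. \<phi> \<notin> C1_stable \<longrightarrow> F \<phi> = 0)"

definition banach_B :: "real \<Rightarrow> real \<Rightarrow> functional set"
  where "banach_B \<alpha> \<beta> = {F. \<exists>f. strong_Cauchy \<alpha> \<beta> f \<and> approximates f F}"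

text \<open>
  The norm of the completion. It does not depend on the sequence: a Cauchy sequence that
  approximates the functional 0 tends to 0 in \<open>strong_norm\<close>, since its leaf integrals against a
  fixed Lipschitz function converge uniformly to a function that is continuous in the leaf.
\<close>

definition B_norm :: "real \<Rightarrow> real \<Rightarrow> functional \<Rightarrow> real"
  where "B_norm \<alpha> \<beta> F = (THE r. \<exists>f. strong_Cauchy \<alpha> \<beta> f \<and> approximates f F \<and>
    (\<lambda>n. strong_norm \<alpha> \<beta> (f n)) \<longlonglongrightarrow> r)"

definition transfer_op :: "nat \<Rightarrow> (nat \<Rightarrow> point \<Rightarrow> point) \<Rightarrow> functional \<Rightarrow> functional"
  where "transfer_op \<kappa> b F = (\<lambda>\<phi>. if \<phi> \<in> C1_stable then F (\<phi> \<circ> leafwise \<kappa> b) else 0)"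


section \<open>Measures\<close>

definition measure_on_square :: "point measure \<Rightarrow> bool"
  where "measure_on_square \<nu> \<longleftrightarrow>
    finite_measure \<nu> \<and> sets \<nu> = sets (restrict_space borel square)"

definition functional_of_measure :: "point measure \<Rightarrow> functional"
  where "functional_of_measure \<nu> = (\<lambda>\<phi>. if \<phi> \<in> C1_stable then (\<integral>x. \<phi> x \<partial>\<nu>) else 0)"

definition physical_measure :: "(point \<Rightarrow> point) \<Rightarrow> point measure \<Rightarrow> bool"
  where "physical_measure T \<nu> \<longleftrightarrow>
    measure_on_square \<nu> \<and> T \<in> measurable \<nu> \<nu> \<and> distr \<nu> \<nu> T = \<nu> \<and>
    (\<exists>B. B \<subseteq> square \<and> B \<in> sets lebesgue \<and> 0 < emeasure lebesgue B \<and>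
      (\<forall>x\<in>B. \<forall>\<psi>. continuous_on square \<psi> \<longrightarrow>
        (\<lambda>n. (\<Sum>k<n. \<psi> ((T ^^ k) x)) / real n) \<longlonglongrightarrow> (\<integral>x. \<psi> x \<partial>\<nu>)))"

definition unstable_leaf :: "real \<Rightarrow> point set"
  where "unstable_leaf y = {0..1} \<times> {y}"

text \<open>
  \<open>\<theta>\<close> is a disintegration of \<open>\<nu>\<close> with respect to the partition into horizontal leaves, which are
  labelled by their ordinate; \<open>\<theta> y\<close> is the conditional measure on the leaf at height \<open>y\<close>.
\<close>

definition conditional_measures_unstable :: "point measure \<Rightarrow> (real \<Rightarrow> point measure) \<Rightarrow> bool"
  where "conditional_measures_unstable \<nu> \<theta> \<longleftrightarrow>
    (let \<eta> = distr \<nu> (restrict_space borel {0..1}) snd in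
      (AE y in \<eta>. prob_space (\<theta> y) \<and> sets (\<theta> y) = sets (restrict_space borel square) \<and>
                  emeasure (\<theta> y) (square - unstable_leaf y) = 0) \<and>
      (\<forall>A\<in>sets \<nu>. (\<lambda>y. emeasure (\<theta> y) A) \<in> borel_measurable \<eta> \<and>
                   emeasure \<nu> A = (\<integral>\<^sup>+ y. emeasure (\<theta> y) A \<partial>\<eta>)))"

definition arclength_unstable :: "real \<Rightarrow> point measure"
  where "arclength_unstable y =
    distr (restrict_space lborel {0..1}) (restrict_space borel square) (\<lambda>x. (x, y))"

end

theory Submission
  imports Defs
begin

text \<open>
  Integrating \<open>L f\<close> over the vertical leaf at \<open>s\<close> against \<open>g\<close> gives the average over the \<open>\<kappa>\<close> branches
  of the integrals of \<open>f\<close> over the preimage leaves at \<open>X i s\<close> against \<open>g \<circ> V i\<close>, where \<open>X i\<close> contracts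
  by \<open>1 / \<kappa>\<close> and \<open>V i\<close> by \<open>l\<close>. Hence the unstable seminorm contracts by \<open>\<kappa> powr - \<beta>\<close>. If \<open>f\<close> has zero
  mass, its leaf averages are bounded by the unstable seminorm; writing \<open>g \<circ> V i\<close> as a constant plus a
  remainder of Hoelder constant at most \<open>l powr \<alpha>\<close> times that of \<open>g\<close> and iterating shows that \<open>L ^^ n\<close>
  decays like \<open>(n + 1) * \<rho> ^ n\<close> on functionals of zero mass. So \<open>L\<close> is the rank one projection
  \<open>f \<mapsto> f 1 * \<mu>\<^sub>0\<close> plus an operator of spectral radius at most \<open>\<rho>\<close>, and all spectral statements follow
  from Neumann series; neither compactness nor a Lasota--Yorke inequality is needed.

  The densities \<open>L ^^ n 1\<close> do not depend on the horizontal coordinate, so a weak limit of them has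
  the form Lebesgue times \<open>\<eta>\<close>, which is \<open>\<mu>\<^sub>0\<close>. The decay also bounds the correlations of Lipschitz
  observables along Lebesgue typical orbits, and a strong law for such sequences, applied to the
  monomials together with the Stone--Weierstrass theorem, shows that the time averages of Lebesgue
  almost every point converge to \<open>\<mu>\<^sub>0\<close>.
\<close>

section \<open>Hoelder bounds on leaves\<close>

text \<open>The obstacle is that composition with \<open>V i\<close> shrinks the Hoelder constant of
  a test function but not its supremum, so the stable norm itself does not contract. Measuring test
  functions by the Hoelder constant alone removes this, provided that constant test functions are
  controlled by other means; zero mass is what makes that possible. Two sequences with the same rate
  \<rho> then feed into each other, which is the origin of the factor \<open>n + 1\<close>; n-th
  roots do not see it.

  The elements of the space are functionals, reached only as limits of densities, and their norm is
  a definite description. Every estimate is therefore made for densities and carried to the limit,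
  which rests on one fact: a strong Cauchy sequence with zero limit functional is null in norm.

  The space gives no pointwise information. Orbits of Lebesgue points are reached through
  correlations because the densities \<open>h j\<close> times a fixed Lipschitz function are bounded
  in the strong norm uniformly in \<open>j\<close>. The arbitrary values of \<open>T\<close> on
  common sides matter only over a countable set of abscissae.\<close>

abbreviation borel_square :: "point measure" where "borel_square \<equiv> restrict_space borel square"

text \<open>The supremum and the Hoelder constant are bounded by separate reals, since they behave
  differently under composition with a branch, and suprema in \<open>ennreal\<close> are avoided.
  The multiplied form makes no exception for \<open>t = u\<close>.\<close>

definition holder_bounds :: "real \<Rightarrow> (real \<Rightarrow> real) \<Rightarrow> real \<Rightarrow> real \<Rightarrow> bool"
  where "holder_bounds a g A H \<longleftrightarrow> 0 \<le> A \<and> 0 \<le> H \<and> (\<forall>t\<in>{0..1}. \<bar>g t\<bar> \<le> A) \<and>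
    (\<forall>t\<in>{0..1}. \<forall>u\<in>{0..1}. \<bar>g t - g u\<bar> \<le> H * \<bar>t - u\<bar> powr a)"

lemma holder_boundsI:
  assumes "0 \<le> A" "0 \<le> H" "\<And>t. t \<in> {0..1} \<Longrightarrow> \<bar>g t\<bar> \<le> A"
    "\<And>t u. t \<in> {0..1} \<Longrightarrow> u \<in> {0..1} \<Longrightarrow> \<bar>g t - g u\<bar> \<le> H * \<bar>t - u\<bar> powr a"
  shows "holder_bounds a g A H"
  using assms unfolding holder_bounds_def by blast

lemma holder_boundsD:
  assumes "holder_bounds a g A H"
  shows "0 \<le> A" "0 \<le> H" "\<And>t. t \<in> {0..1} \<Longrightarrow> \<bar>g t\<bar> \<le> A"
    "\<And>t u. t \<in> {0..1} \<Longrightarrow> u \<in> {0..1} \<Longrightarrow> \<bar>g t - g u\<bar> \<le> H * \<bar>t - u\<bar> powr a"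
  using assms unfolding holder_bounds_def by blast+

lemma holder_bounds_mono:
  assumes "holder_bounds a g A H" "A \<le> A'" "H \<le> H'"
  shows "holder_bounds a g A' H'"
proof (rule holder_boundsI)
  show "0 \<le> A'" "0 \<le> H'" using holder_boundsD(1,2)[OF assms(1)] assms by auto
  show "\<bar>g t\<bar> \<le> A'" if "t \<in> {0..1}" for t using holder_boundsD(3)[OF assms(1) that] assms by simp
  show "\<bar>g t - g u\<bar> \<le> H' * \<bar>t - u\<bar> powr a" if "t \<in> {0..1}" "u \<in> {0..1}" for t u
    using holder_boundsD(4)[OF assms(1) that] mult_right_mono[OF assms(3), of "\<bar>t - u\<bar> powr a"] by simp
qed

lemma holder_norm_le:
  assumes "holder_bounds a g A H"
  shows "holder_norm a g \<le> ennreal (A + H)"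
proof -
  note D = holder_boundsD[OF assms]
  have "(SUP t\<in>{0..1}. ennreal \<bar>g t\<bar>) \<le> ennreal A"
    using D by (intro SUP_least ennreal_leI) auto
  moreover have "(SUP t\<in>{0..1}. SUP u\<in>{0..1} - {t}. ennreal (\<bar>g t - g u\<bar> / \<bar>t - u\<bar> powr a)) \<le> ennreal H"
  proof (intro SUP_least ennreal_leI)
    fix t u :: real assume "t \<in> {0..1}" "u \<in> {0..1} - {t}"
    then show "\<bar>g t - g u\<bar> / \<bar>t - u\<bar> powr a \<le> H"
      using D(4)[of t u] by (simp add: divide_le_eq)
  qed
  ultimately show ?thesis
    unfolding holder_norm_def using D(1,2) by (simp add: ennreal_plus add_mono)
qed

text \<open>The two suprema in the norm are themselves admissible bounds, so the norm is attained as
  \<open>A + H\<close> and estimates in terms of \<open>A + H\<close> lose nothing.\<close>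

lemma holder_norm_finiteE:
  assumes "holder_norm a g < \<infinity>"
  obtains A H where "holder_bounds a g A H" "holder_norm a g = ennreal (A + H)"
proof -
  define S1 where "S1 = (SUP t\<in>{0..1}. ennreal \<bar>g t\<bar>)"
  define S2 where "S2 = (SUP t\<in>{0..1}. SUP u\<in>{0..1} - {t}. ennreal (\<bar>g t - g u\<bar> / \<bar>t - u\<bar> powr a))"
  have S: "holder_norm a g = S1 + S2" unfolding holder_norm_def S1_def S2_def ..
  have fin: "S1 < \<infinity>" "S2 < \<infinity>" using assms unfolding S by auto
  obtain A where A: "0 \<le> A" "S1 = ennreal A" using fin(1) by (cases S1) auto
  obtain H where H: "0 \<le> H" "S2 = ennreal H" using fin(2) by (cases S2) auto
  have "holder_bounds a g A H"
  proof (rule holder_boundsI)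
    show "\<bar>g t\<bar> \<le> A" if "t \<in> {0..1}" for t
    proof -
      have "ennreal \<bar>g t\<bar> \<le> S1" unfolding S1_def using that by (rule SUP_upper)
      then show ?thesis using A by simp
    qed
    show "\<bar>g t - g u\<bar> \<le> H * \<bar>t - u\<bar> powr a" if "t \<in> {0..1}" "u \<in> {0..1}" for t u
    proof (cases "t = u")
      case False
      then have "ennreal (\<bar>g t - g u\<bar> / \<bar>t - u\<bar> powr a) \<le> S2"
        unfolding S2_def using that by (intro SUP_upper2[of t] SUP_upper2[of u]) auto
      then show ?thesis using H False by (simp add: divide_le_eq)
    qed simp
  qed (use A H in auto)
  moreover have "holder_norm a g = ennreal (A + H)" using S A H by simp
  ultimately show thesis by (rule that)
qed

lemma holder_norm_leE:
  assumes "holder_norm a g \<le> ennreal C" "0 \<le> C"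
  obtains A H where "holder_bounds a g A H" "A + H \<le> C"
proof -
  have "holder_norm a g < \<infinity>" using assms(1) by (simp add: le_less_trans)
  then obtain A H where *: "holder_bounds a g A H" "holder_norm a g = ennreal (A + H)"
    by (rule holder_norm_finiteE)
  have "A + H \<le> C"
    using assms holder_boundsD(1,2)[OF *(1)] unfolding *(2) by (subst (asm) ennreal_le_iff) auto
  with * that show thesis by blast
qed

lemma lipschitz_leaf_iff: "g \<in> lipschitz_leaf \<longleftrightarrow> (\<exists>A H. holder_bounds 1 g A H)"
proof
  assume "g \<in> lipschitz_leaf"
  then have "holder_norm 1 g < \<infinity>" unfolding lipschitz_leaf_def by simp
  then show "\<exists>A H. holder_bounds 1 g A H" by (rule holder_norm_finiteE) blast
next
  assume "\<exists>A H. holder_bounds 1 g A H"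
  then obtain A H where "holder_norm 1 g \<le> ennreal (A + H)" using holder_norm_le by blast
  also have "\<dots> < \<infinity>" by simp
  finally show "g \<in> lipschitz_leaf" unfolding lipschitz_leaf_def by simp
qed

text \<open>Membership in the closure as approximability within every \<open>e\<close>, in the
  supremum and in the Hoelder constant at once. In this form affine images and shifts are treated by
  transforming the approximating Lipschitz function.\<close>

lemma holder_leaf_iff:
  "g \<in> holder_leaf a \<longleftrightarrow> (\<forall>e>0. \<exists>h\<in>lipschitz_leaf. holder_bounds a (\<lambda>t. g t - h t) e e)"
proof safe
  fix e :: real assume g: "g \<in> holder_leaf a" and e: "0 < e"
  then obtain h where h: "\<And>n. h n \<in> lipschitz_leaf" "(\<lambda>n::nat. holder_norm a (\<lambda>t. g t - h n t)) \<longlonglongrightarrow> 0"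
    unfolding holder_leaf_def by auto
  have "\<forall>\<^sub>F n in sequentially. holder_norm a (\<lambda>t. g t - h n t) < ennreal e"
    using h(2) e by (intro order_tendstoD) auto
  then obtain n where "holder_norm a (\<lambda>t. g t - h n t) < ennreal e"
    unfolding eventually_sequentially by auto
  then obtain A H where *: "holder_bounds a (\<lambda>t. g t - h n t) A H" "A + H \<le> e"
    using e by (meson holder_norm_leE less_imp_le)
  have "A \<le> e" "H \<le> e" using *(2) holder_boundsD(1,2)[OF *(1)] by auto
  then show "\<exists>h\<in>lipschitz_leaf. holder_bounds a (\<lambda>t. g t - h t) e e"
    using holder_bounds_mono[OF *(1)] h(1) by blast
next
  assume *: "\<forall>e>0. \<exists>h\<in>lipschitz_leaf. holder_bounds a (\<lambda>t. g t - h t) e e"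
  have "\<forall>n::nat. \<exists>h\<in>lipschitz_leaf. holder_bounds a (\<lambda>t. g t - h t) (1 / Suc n) (1 / Suc n)"
    using * by simp
  then obtain h where h: "\<And>n::nat. h n \<in> lipschitz_leaf"
      "\<And>n. holder_bounds a (\<lambda>t. g t - h n t) (1 / Suc n) (1 / Suc n)"
    by metis
  have "(\<lambda>n::nat. ennreal (1 / Suc n + 1 / Suc n)) \<longlonglongrightarrow> ennreal (0 + 0)"
    by (intro tendsto_ennrealI tendsto_add LIMSEQ_Suc lim_1_over_n)
  then have lim: "(\<lambda>n::nat. ennreal (1 / Suc n + 1 / Suc n)) \<longlonglongrightarrow> 0" by simp
  have le: "holder_norm a (\<lambda>t. g t - h n t) \<le> ennreal (1 / Suc n + 1 / Suc n)" for n
    by (rule holder_norm_le[OF h(2)])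
  have "(\<lambda>n. holder_norm a (\<lambda>t. g t - h n t)) \<longlonglongrightarrow> 0"
    by (rule tendsto_sandwich[OF always_eventually always_eventually tendsto_const lim])
      (rule allI, rule zero_le, rule allI, rule le)
  then show "g \<in> holder_leaf a" unfolding holder_leaf_def using h by blast
qed

lemma holder_bounds_zero: "holder_bounds a (\<lambda>t. 0) 0 0"
  by (simp add: holder_bounds_def)

lemma holder_bounds_const: "holder_bounds a (\<lambda>t. c) \<bar>c\<bar> 0"
  by (simp add: holder_bounds_def)

lemma holder_bounds_add:
  assumes "holder_bounds a g A H" "holder_bounds a g' A' H'"
  shows "holder_bounds a (\<lambda>t. g t + g' t) (A + A') (H + H')"
proof (rule holder_boundsI)
  show "\<bar>g t + g' t\<bar> \<le> A + A'" if "t \<in> {0..1}" for t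
    using holder_boundsD(3)[OF assms(1) that] holder_boundsD(3)[OF assms(2) that] by simp
  show "\<bar>g t + g' t - (g u + g' u)\<bar> \<le> (H + H') * \<bar>t - u\<bar> powr a" if "t \<in> {0..1}" "u \<in> {0..1}" for t u
    using holder_boundsD(4)[OF assms(1) that] holder_boundsD(4)[OF assms(2) that]
    by (simp add: algebra_simps)
  show "0 \<le> A + A'" "0 \<le> H + H'"
    using holder_boundsD(1,2)[OF assms(1)] holder_boundsD(1,2)[OF assms(2)] by auto
qed

lemma holder_bounds_scale:
  assumes "holder_bounds a g A H"
  shows "holder_bounds a (\<lambda>t. c * g t) (\<bar>c\<bar> * A) (\<bar>c\<bar> * H)"
proof (rule holder_boundsI)
  note D = holder_boundsD[OF assms]
  show "0 \<le> \<bar>c\<bar> * A" "0 \<le> \<bar>c\<bar> * H" using D by auto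
  show "\<bar>c * g t\<bar> \<le> \<bar>c\<bar> * A" if "t \<in> {0..1}" for t
    using D(3)[OF that] by (simp add: abs_mult mult_left_mono)
  show "\<bar>c * g t - c * g u\<bar> \<le> \<bar>c\<bar> * H * \<bar>t - u\<bar> powr a" if "t \<in> {0..1}" "u \<in> {0..1}" for t u
    using mult_left_mono[OF D(4)[OF that], of "\<bar>c\<bar>"]
    by (simp add: abs_mult[symmetric] algebra_simps)
qed

lemma holder_bounds_diff:
  assumes "holder_bounds a g A H" "holder_bounds a g' A' H'"
  shows "holder_bounds a (\<lambda>t. g t - g' t) (A + A') (H + H')"
  using holder_bounds_add[OF assms(1) holder_bounds_scale[OF assms(2), of "-1"]] by simp

text \<open>The set of values can only shrink, and distances are multiplied by |c|. With |c| equal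
  to \<open>l\<close> this is the whole gain in the vertical direction.\<close>

lemma holder_bounds_affine:
  assumes "holder_bounds a g A H" "\<And>t. t \<in> {0..1} \<Longrightarrow> q + c * t \<in> {0..1}"
  shows "holder_bounds a (\<lambda>t. g (q + c * t)) A (H * \<bar>c\<bar> powr a)"
proof (rule holder_boundsI)
  note D = holder_boundsD[OF assms(1)]
  show "0 \<le> A" "0 \<le> H * \<bar>c\<bar> powr a" using D by auto
  show "\<bar>g (q + c * t)\<bar> \<le> A" if "t \<in> {0..1}" for t using D(3) assms(2)[OF that] by simp
  show "\<bar>g (q + c * t) - g (q + c * u)\<bar> \<le> H * \<bar>c\<bar> powr a * \<bar>t - u\<bar> powr a"
    if "t \<in> {0..1}" "u \<in> {0..1}" for t u
  proof -
    have "q + c * t - (q + c * u) = c * (t - u)" by (simp add: algebra_simps)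
    then have "\<bar>q + c * t - (q + c * u)\<bar> powr a = \<bar>c\<bar> powr a * \<bar>t - u\<bar> powr a"
      by (simp only: abs_mult powr_mult)
    then show ?thesis
      using D(4)[OF assms(2)[OF that(1)] assms(2)[OF that(2)]] by (simp only: mult.assoc)
  qed
qed

text \<open>Points of a leaf are at distance at most 1, where a smaller exponent gives a larger
  power.\<close>

lemma holder_bounds_of_lipschitz:
  assumes "holder_bounds 1 g A H" "a \<le> 1"
  shows "holder_bounds a g A H"
proof (rule holder_boundsI)
  note D = holder_boundsD[OF assms(1)]
  show "0 \<le> A" "0 \<le> H" by (fact D)+
  show "\<bar>g t\<bar> \<le> A" if "t \<in> {0..1}" for t by (rule D(3)[OF that])
  show "\<bar>g t - g u\<bar> \<le> H * \<bar>t - u\<bar> powr a" if "t \<in> {0..1}" "u \<in> {0..1}" for t u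
  proof -
    have "\<bar>t - u\<bar> powr 1 \<le> \<bar>t - u\<bar> powr a"
    proof (cases "t = u")
      case False
      then show ?thesis using that assms(2) by (intro powr_mono') auto
    qed simp
    then show ?thesis using D(4)[OF that] mult_left_mono[OF _ D(2)] by (meson order_trans)
  qed
qed

lemma lipschitz_imp_holder_leaf:
  assumes "holder_bounds 1 g A H" shows "g \<in> holder_leaf a"
  unfolding holder_leaf_iff
proof (intro allI impI bexI)
  show "g \<in> lipschitz_leaf" using assms lipschitz_leaf_iff by blast
  show "holder_bounds a (\<lambda>t. g t - g t) e e" if "0 < e" for e using that by (simp add: holder_bounds_def)
qed

lemma holder_leaf_finite:
  assumes "g \<in> holder_leaf a" "a \<le> 1"
  obtains A H where "holder_bounds a g A H"
proof -
  obtain h where h: "h \<in> lipschitz_leaf" "holder_bounds a (\<lambda>t. g t - h t) 1 1"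
    using assms(1) zero_less_one unfolding holder_leaf_iff by blast
  then obtain A H where "holder_bounds 1 h A H" unfolding lipschitz_leaf_iff by blast
  from holder_bounds_add[OF h(2) holder_bounds_of_lipschitz[OF this assms(2)]]
  have "holder_bounds a (\<lambda>t. g t - h t + h t) (1 + A) (1 + H)" .
  then have "holder_bounds a g (1 + A) (1 + H)" by simp
  then show thesis by (rule that)
qed

lemma holder_bounds_continuous:
  assumes "holder_bounds a g A H" "0 < a"
  shows "continuous_on {0..1} g"
proof -
  note D = holder_boundsD[OF assms(1)]
  show ?thesis unfolding continuous_on_def
  proof
    fix x :: real assume x: "x \<in> {0..1}"
    have "((\<lambda>y. \<bar>y - x\<bar>) \<longlongrightarrow> \<bar>x - x\<bar>) (at x within {0..1})"
      by (rule tendsto_rabs, rule tendsto_diff, rule tendsto_ident_at, rule tendsto_const)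
    then have "((\<lambda>y. \<bar>y - x\<bar> powr a) \<longlongrightarrow> 0) (at x within {0..1})"
      using assms(2) by (intro tendsto_zero_powrI[where b = a]) auto
    then have lim: "((\<lambda>y. H * \<bar>y - x\<bar> powr a) \<longlongrightarrow> 0) (at x within {0..1})"
      by (rule tendsto_mult_right_zero)
    have "\<forall>\<^sub>F y in at x within {0..1}. norm (g y - g x) \<le> H * \<bar>y - x\<bar> powr a"
      unfolding eventually_at_filter using D(4) x by (intro always_eventually) auto
    from Lim_null_comparison[OF this lim]
    have "((\<lambda>y. g y - g x) \<longlongrightarrow> 0) (at x within {0..1})" .
    then show "(g \<longlongrightarrow> g x) (at x within {0..1})" by (rule LIM_zero_cancel)
  qed
qed

lemma holder_leaf_continuous:
  assumes "g \<in> holder_leaf a" "0 < a" "a \<le> 1"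
  shows "continuous_on {0..1} g"
  using assms by (meson holder_leaf_finite holder_bounds_continuous)

lemma holder_leaf_affine:
  assumes "g \<in> holder_leaf a" "\<And>t. t \<in> {0..1} \<Longrightarrow> q + c * t \<in> {0..1}" "\<bar>c\<bar> \<le> 1" "0 \<le> a"
  shows "(\<lambda>t. g (q + c * t)) \<in> holder_leaf a"
  unfolding holder_leaf_iff
proof (intro allI impI)
  fix e :: real assume e: "0 < e"
  then obtain h where h: "h \<in> lipschitz_leaf" "holder_bounds a (\<lambda>t. g t - h t) e e"
    using assms(1) unfolding holder_leaf_iff by blast
  then obtain A H where "holder_bounds 1 h A H" unfolding lipschitz_leaf_iff by blast
  from holder_bounds_affine[OF this assms(2)] have "(\<lambda>t. h (q + c * t)) \<in> lipschitz_leaf"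
    unfolding lipschitz_leaf_iff by blast
  moreover have "holder_bounds a (\<lambda>t. g (q + c * t) - h (q + c * t)) e (e * \<bar>c\<bar> powr a)"
    by (rule holder_bounds_affine[OF h(2) assms(2)])
  moreover have "\<bar>c\<bar> powr a \<le> 1" using assms(3,4) by (intro powr_le1) auto
  ultimately show "\<exists>h\<in>lipschitz_leaf. holder_bounds a (\<lambda>t. g (q + c * t) - h t) e e"
    using e by (meson holder_bounds_mono mult_left_le order_refl less_imp_le)
qed

text \<open>Keeps rescaled test functions and normalised ones such as \<open>g t - g 0\<close> in
  the closure.\<close>

lemma holder_leaf_scale_shift:
  assumes "g \<in> holder_leaf a"
  shows "(\<lambda>t. c * g t + k) \<in> holder_leaf a"
  unfolding holder_leaf_iff
proof (intro allI impI)
  fix e :: real assume e: "0 < e"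
  \<comment> \<open>The added 1 keeps the quotient meaningful for \<open>c = 0\<close>.\<close>
  define e' where "e' = e / (\<bar>c\<bar> + 1)"
  have e': "0 < e'" "\<bar>c\<bar> * e' \<le> e" using e by (auto simp: e'_def field_simps)
  obtain h where h: "h \<in> lipschitz_leaf" "holder_bounds a (\<lambda>t. g t - h t) e' e'"
    using assms e' unfolding holder_leaf_iff by blast
  then obtain A H where "holder_bounds 1 h A H" unfolding lipschitz_leaf_iff by blast
  from holder_bounds_add[OF holder_bounds_scale[OF this, of c] holder_bounds_const[of 1 k]]
  have "(\<lambda>t. c * h t + k) \<in> lipschitz_leaf" unfolding lipschitz_leaf_iff by blast
  moreover have "holder_bounds a (\<lambda>t. c * g t + k - (c * h t + k)) e e"
    using holder_bounds_mono[OF holder_bounds_scale[OF h(2), of c] e'(2) e'(2)]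
    by (simp add: algebra_simps)
  ultimately show "\<exists>h\<in>lipschitz_leaf. holder_bounds a (\<lambda>t. c * g t + k - h t) e e"
    by (intro bexI[of _ "\<lambda>t. c * h t + k"])
qed

section \<open>Leaf integrals and the stable and unstable seminorms\<close>

lemma C1_unstableE:
  assumes "f \<in> C1_unstable"
  obtains K where "f \<in> borel_measurable borel_square" "0 \<le> K"
    "\<And>s t. s \<in> {0..1} \<Longrightarrow> t \<in> {0..1} \<Longrightarrow> \<bar>f (s, t)\<bar> \<le> K"
    "\<And>s s' t. s \<in> {0..1} \<Longrightarrow> s' \<in> {0..1} \<Longrightarrow> t \<in> {0..1} \<Longrightarrow> \<bar>f (s, t) - f (s', t)\<bar> \<le> K * \<bar>s - s'\<bar>"
proof -
  define S where "S = (SUP y\<in>{0..1}. holder_norm 1 (\<lambda>x. f (x, y)))"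
  have m: "f \<in> borel_measurable borel_square" and "S < \<infinity>"
    using assms unfolding C1_unstable_def S_def by auto
  then obtain K where K: "0 \<le> K" "S = ennreal K" by (cases S) auto
  have *: "holder_bounds 1 (\<lambda>x. f (x, t)) K K" if "t \<in> {0..1}" for t
  proof -
    have "holder_norm 1 (\<lambda>x. f (x, t)) \<le> ennreal K"
      unfolding K(2)[symmetric] S_def using that by (rule SUP_upper)
    then obtain A H where *: "holder_bounds 1 (\<lambda>x. f (x, t)) A H" "A + H \<le> K"
      using K(1) by (rule holder_norm_leE)
    show ?thesis using holder_boundsD(1,2)[OF *(1)] *(2) by (intro holder_bounds_mono[OF *(1)]) auto
  qed
  show thesis
    by (rule that[OF m K(1)]) (use holder_boundsD(3,4)[OF *] in auto)
qed

lemma C1_unstable_measurable: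
  "f \<in> C1_unstable \<Longrightarrow> f \<in> borel_measurable borel_square"
  unfolding C1_unstable_def by simp

lemma C1_stable_measurable:
  "\<phi> \<in> C1_stable \<Longrightarrow> \<phi> \<in> borel_measurable borel_square"
  unfolding C1_stable_def by simp

lemma C1_unstable_bounded:
  assumes "f \<in> C1_unstable"
  obtains K where "0 \<le> K" "\<And>s t. s \<in> {0..1} \<Longrightarrow> t \<in> {0..1} \<Longrightarrow> \<bar>f (s, t)\<bar> \<le> K"
proof -
  obtain K where K: "f \<in> borel_measurable borel_square" "0 \<le> K"
    "\<And>s t. s \<in> {0..1} \<Longrightarrow> t \<in> {0..1} \<Longrightarrow> \<bar>f (s, t)\<bar> \<le> K"
    "\<And>s s' t. s \<in> {0..1} \<Longrightarrow> s' \<in> {0..1} \<Longrightarrow> t \<in> {0..1} \<Longrightarrow> \<bar>f (s, t) - f (s', t)\<bar> \<le> K * \<bar>s - s'\<bar>"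
    using C1_unstableE[OF assms] by blast
  show thesis by (rule that[OF K(2,3)])
qed

lemma C1_unstable_lipschitz:
  assumes "f \<in> C1_unstable"
  obtains K where "0 \<le> K"
    "\<And>s s' t. s \<in> {0..1} \<Longrightarrow> s' \<in> {0..1} \<Longrightarrow> t \<in> {0..1} \<Longrightarrow> \<bar>f (s, t) - f (s', t)\<bar> \<le> K * \<bar>s - s'\<bar>"
proof -
  obtain K where K: "f \<in> borel_measurable borel_square" "0 \<le> K"
    "\<And>s t. s \<in> {0..1} \<Longrightarrow> t \<in> {0..1} \<Longrightarrow> \<bar>f (s, t)\<bar> \<le> K"
    "\<And>s s' t. s \<in> {0..1} \<Longrightarrow> s' \<in> {0..1} \<Longrightarrow> t \<in> {0..1} \<Longrightarrow> \<bar>f (s, t) - f (s', t)\<bar> \<le> K * \<bar>s - s'\<bar>"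
    using C1_unstableE[OF assms] by blast
  show thesis by (rule that[OF K(2,4)])
qed

lemma C1_unstableI:
  assumes "f \<in> borel_measurable borel_square"
    "\<And>s t. s \<in> {0..1} \<Longrightarrow> t \<in> {0..1} \<Longrightarrow> \<bar>f (s, t)\<bar> \<le> A"
    "\<And>s s' t. s \<in> {0..1} \<Longrightarrow> s' \<in> {0..1} \<Longrightarrow> t \<in> {0..1} \<Longrightarrow> \<bar>f (s, t) - f (s', t)\<bar> \<le> H * \<bar>s - s'\<bar>"
  shows "f \<in> C1_unstable"
proof -
  have "holder_norm 1 (\<lambda>x. f (x, y)) \<le> ennreal (A + H)" if "y \<in> {0..1}" for y
  proof (rule holder_norm_le[OF holder_boundsI])
    show "0 \<le> A" using assms(2)[of 0 0] by simp
    show "0 \<le> H" using assms(3)[of 0 1 0] by simp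
  qed (use assms that in auto)
  then have "(SUP y\<in>{0..1}. holder_norm 1 (\<lambda>x. f (x, y))) \<le> ennreal (A + H)" by (rule SUP_least)
  also have "\<dots> < \<infinity>" by simp
  finally show ?thesis using assms(1) unfolding C1_unstable_def by simp
qed

lemma C1_stableE:
  assumes "\<phi> \<in> C1_stable"
  obtains A H where "\<phi> \<in> borel_measurable borel_square" "0 \<le> A" "0 \<le> H"
    "\<And>s. s \<in> {0..1} \<Longrightarrow> holder_bounds 1 (\<lambda>t. \<phi> (s, t)) A H"
proof -
  define S where "S = (SUP s\<in>{0..1}. holder_norm 1 (\<lambda>t. \<phi> (s, t)))"
  have m: "\<phi> \<in> borel_measurable borel_square" and "S < \<infinity>"
    using assms unfolding C1_stable_def S_def by auto
  then obtain K where K: "0 \<le> K" "S = ennreal K" by (cases S) auto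
  have "holder_bounds 1 (\<lambda>t. \<phi> (s, t)) K K" if "s \<in> {0..1}" for s
  proof -
    have "holder_norm 1 (\<lambda>t. \<phi> (s, t)) \<le> ennreal K"
      unfolding K(2)[symmetric] S_def using that by (rule SUP_upper)
    then obtain A H where *: "holder_bounds 1 (\<lambda>t. \<phi> (s, t)) A H" "A + H \<le> K"
      using K(1) by (rule holder_norm_leE)
    show ?thesis using holder_boundsD(1,2)[OF *(1)] *(2) by (intro holder_bounds_mono[OF *(1)]) auto
  qed
  then show thesis by (rule that[OF m K(1) K(1)])
qed

lemma C1_stableI:
  assumes "\<phi> \<in> borel_measurable borel_square"
    "\<And>s. s \<in> {0..1} \<Longrightarrow> holder_bounds 1 (\<lambda>t. \<phi> (s, t)) A H"
  shows "\<phi> \<in> C1_stable"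
proof -
  have "(SUP s\<in>{0..1}. holder_norm 1 (\<lambda>t. \<phi> (s, t))) \<le> ennreal (A + H)"
    by (rule SUP_least) (rule holder_norm_le[OF assms(2)])
  also have "\<dots> < \<infinity>" by simp
  finally show ?thesis using assms(1) unfolding C1_stable_def by simp
qed

lemma C1_unstable_lincomb:
  assumes "f \<in> C1_unstable" "g \<in> C1_unstable"
  shows "(\<lambda>x. a * f x + c * g x) \<in> C1_unstable"
proof -
  obtain K where K: "f \<in> borel_measurable borel_square" "0 \<le> K"
    "\<And>s t. s \<in> {0..1} \<Longrightarrow> t \<in> {0..1} \<Longrightarrow> \<bar>f (s, t)\<bar> \<le> K"
    "\<And>s s' t. s \<in> {0..1} \<Longrightarrow> s' \<in> {0..1} \<Longrightarrow> t \<in> {0..1} \<Longrightarrow> \<bar>f (s, t) - f (s', t)\<bar> \<le> K * \<bar>s - s'\<bar>"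
    using C1_unstableE[OF assms(1)] by blast
  obtain K' where K': "g \<in> borel_measurable borel_square" "0 \<le> K'"
    "\<And>s t. s \<in> {0..1} \<Longrightarrow> t \<in> {0..1} \<Longrightarrow> \<bar>g (s, t)\<bar> \<le> K'"
    "\<And>s s' t. s \<in> {0..1} \<Longrightarrow> s' \<in> {0..1} \<Longrightarrow> t \<in> {0..1} \<Longrightarrow> \<bar>g (s, t) - g (s', t)\<bar> \<le> K' * \<bar>s - s'\<bar>"
    using C1_unstableE[OF assms(2)] by blast
  show ?thesis
  proof (rule C1_unstableI)
    show "(\<lambda>x. a * f x + c * g x) \<in> borel_measurable borel_square"
      using K(1) K'(1) by simp
    show "\<bar>a * f (s, t) + c * g (s, t)\<bar> \<le> \<bar>a\<bar> * K + \<bar>c\<bar> * K'" if "s \<in> {0..1}" "t \<in> {0..1}" for s t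
    proof -
      have "\<bar>a * f (s, t) + c * g (s, t)\<bar> \<le> \<bar>a\<bar> * \<bar>f (s, t)\<bar> + \<bar>c\<bar> * \<bar>g (s, t)\<bar>"
        unfolding abs_mult[symmetric] by (rule abs_triangle_ineq)
      also have "\<dots> \<le> \<bar>a\<bar> * K + \<bar>c\<bar> * K'"
        by (intro add_mono mult_left_mono K(3) K'(3) that) auto
      finally show ?thesis .
    qed
    show "\<bar>a * f (s, t) + c * g (s, t) - (a * f (s', t) + c * g (s', t))\<bar>
        \<le> (\<bar>a\<bar> * K + \<bar>c\<bar> * K') * \<bar>s - s'\<bar>" if "s \<in> {0..1}" "s' \<in> {0..1}" "t \<in> {0..1}" for s s' t
    proof -
      have "\<bar>a * f (s, t) + c * g (s, t) - (a * f (s', t) + c * g (s', t))\<bar>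
          = \<bar>a * (f (s, t) - f (s', t)) + c * (g (s, t) - g (s', t))\<bar>" by (simp add: algebra_simps)
      also have "\<dots> \<le> \<bar>a\<bar> * \<bar>f (s, t) - f (s', t)\<bar> + \<bar>c\<bar> * \<bar>g (s, t) - g (s', t)\<bar>"
        unfolding abs_mult[symmetric] by (rule abs_triangle_ineq)
      also have "\<dots> \<le> \<bar>a\<bar> * (K * \<bar>s - s'\<bar>) + \<bar>c\<bar> * (K' * \<bar>s - s'\<bar>)"
        by (intro add_mono mult_left_mono K(4) K'(4) that) auto
      finally show ?thesis by (simp add: algebra_simps)
    qed
  qed
qed

lemma C1_unstable_diff:
  assumes "f \<in> C1_unstable" "g \<in> C1_unstable"
  shows "(\<lambda>x. f x - g x) \<in> C1_unstable"
  using C1_unstable_lincomb[OF assms, of 1 "-1"] by simp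

lemma C1_unstable_const: "(\<lambda>x. c) \<in> C1_unstable"
  by (rule C1_unstableI[of _ "\<bar>c\<bar>" 0]) auto

lemma C1_stable_const: "(\<lambda>x. c) \<in> C1_stable"
  by (rule C1_stableI[of _ "\<bar>c\<bar>" 0]) (auto intro: holder_bounds_const)

lemma leaf_measurable:
  assumes "f \<in> borel_measurable borel_square" "s \<in> {0..1}"
  shows "(\<lambda>t. f (s, t)) \<in> borel_measurable (restrict_space borel {0..1::real})"
proof -
  have "(\<lambda>t. (s, t)) \<in> measurable (restrict_space borel {0..1::real}) borel_square"
    using assms(2) by (intro measurable_restrict_space2 measurable_restrict_space1
        borel_measurable_continuous_onI continuous_intros) (auto simp: space_restrict_space square_def)
  from measurable_compose[OF this assms(1)] show ?thesis by simp
qed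

lemma set_integrable_bounded_unit:
  fixes f :: "real \<Rightarrow> real"
  assumes "f \<in> borel_measurable (restrict_space borel {0..1})" "\<And>t. t \<in> {0..1} \<Longrightarrow> \<bar>f t\<bar> \<le> K"
  shows "set_integrable lborel {0..1} f"
proof (rule set_integrable_bound[of _ _ "\<lambda>_. K"])
  show "set_integrable lborel {0..1::real} (\<lambda>_. K)" unfolding set_integrable_def by (rule borel_integrable_compact) auto
  show "set_borel_measurable lborel {0..1} f"
    using assms(1) unfolding set_borel_measurable_def
    by (subst (asm) borel_measurable_restrict_space_iff) auto
  show "AE x in lborel. x \<in> {0..1} \<longrightarrow> norm (f x) \<le> norm K"
    using assms(2) by (auto intro!: AE_I2 order_trans[OF _ abs_ge_self])
qed

lemma leaf_integrable_borel:
  assumes "f \<in> C1_unstable" "s \<in> {0..1}" "g \<in> borel_measurable (restrict_space borel {0..1})"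
    "\<And>t. t \<in> {0..1} \<Longrightarrow> \<bar>g t\<bar> \<le> A"
  shows "set_integrable lborel {0..1} (\<lambda>t. f (s, t) * g t)"
proof -
  have m: "f \<in> borel_measurable borel_square" by (rule C1_unstable_measurable[OF assms(1)])
  obtain K where K: "0 \<le> K" "\<And>s t. s \<in> {0..1} \<Longrightarrow> t \<in> {0..1} \<Longrightarrow> \<bar>f (s, t)\<bar> \<le> K"
    using C1_unstable_bounded[OF assms(1)] by blast
  show ?thesis
  proof (rule set_integrable_bounded_unit)
    show "(\<lambda>t. f (s, t) * g t) \<in> borel_measurable (restrict_space borel {0..1})"
      by (rule borel_measurable_times[OF leaf_measurable[OF m assms(2)] assms(3)])
    show "\<bar>f (s, t) * g t\<bar> \<le> K * A" if "t \<in> {0..1}" for t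
      unfolding abs_mult using K assms that by (intro mult_mono) auto
  qed
qed

lemma continuous_on_unit_bounded:
  fixes g :: "real \<Rightarrow> real"
  assumes "continuous_on {0..1} g"
  obtains A where "\<And>t. t \<in> {0..1} \<Longrightarrow> \<bar>g t\<bar> \<le> A" "0 \<le> A"
proof -
  have "bounded (g ` {0..1})" using assms by (intro compact_imp_bounded compact_continuous_image) auto
  then obtain A where "\<forall>x\<in>g ` {0..1}. norm x \<le> A" unfolding bounded_iff by blast
  then have *: "\<And>t. t \<in> {0..1} \<Longrightarrow> \<bar>g t\<bar> \<le> A" by auto
  moreover have "0 \<le> A" using *[of 0] by auto
  ultimately show thesis by (rule that)
qed

lemma leaf_integrable:
  assumes "f \<in> C1_unstable" "s \<in> {0..1}" "continuous_on {0..1} g"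
  shows "set_integrable lborel {0..1} (\<lambda>t. f (s, t) * g t)"
proof -
  obtain A where "\<And>t. t \<in> {0..1} \<Longrightarrow> \<bar>g t\<bar> \<le> A" using continuous_on_unit_bounded[OF assms(3)] by blast
  with assms show ?thesis
    by (intro leaf_integrable_borel borel_measurable_continuous_on_restrict)
qed

lemma leaf_integral_cong:
  assumes "\<And>t. t \<in> {0..1} \<Longrightarrow> f (s, t) * g t = f' (s', t) * g' t"
  shows "leaf_integral s f g = leaf_integral s' f' g'"
  unfolding leaf_integral_def by (rule set_lebesgue_integral_cong) (use assms in auto)

lemma leaf_integral_diff_left:
  assumes "f \<in> C1_unstable" "f' \<in> C1_unstable" "s \<in> {0..1}" "continuous_on {0..1} g"
  shows "leaf_integral s (\<lambda>x. f x - f' x) g = leaf_integral s f g - leaf_integral s f' g"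
  unfolding leaf_integral_def
  by (subst set_integral_diff(2)[symmetric]) (auto simp: left_diff_distrib intro!: leaf_integrable assms)

lemma leaf_integral_lincomb_left:
  assumes "f \<in> C1_unstable" "f' \<in> C1_unstable" "s \<in> {0..1}" "continuous_on {0..1} g"
  shows "leaf_integral s (\<lambda>x. a * f x + c * f' x) g = a * leaf_integral s f g + c * leaf_integral s f' g"
proof -
  have "(LINT t:{0..1}|lborel. a * (f (s, t) * g t) + c * (f' (s, t) * g t))
      = (LINT t:{0..1}|lborel. a * (f (s, t) * g t)) + (LINT t:{0..1}|lborel. c * (f' (s, t) * g t))"
    by (intro set_integral_add(2) set_integrable_mult_right leaf_integrable assms)
  then show ?thesis unfolding leaf_integral_def by (simp add: algebra_simps)
qed

lemma leaf_integral_add_right: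
  assumes "f \<in> C1_unstable" "s \<in> {0..1}" "continuous_on {0..1} g" "continuous_on {0..1} g'"
  shows "leaf_integral s f (\<lambda>t. g t + g' t) = leaf_integral s f g + leaf_integral s f g'"
  unfolding leaf_integral_def
  by (subst set_integral_add(2)[symmetric]) (auto simp: distrib_left intro!: leaf_integrable assms)

lemma leaf_integral_scale_right: "leaf_integral s f (\<lambda>t. c * g t) = c * leaf_integral s f g"
  unfolding leaf_integral_def set_integral_mult_right[symmetric]
  by (rule set_lebesgue_integral_cong) auto

lemma leaf_integral_bound:
  assumes "f \<in> C1_unstable" "s \<in> {0..1}" "continuous_on {0..1} g"
    "\<And>t. t \<in> {0..1} \<Longrightarrow> \<bar>f (s, t) * g t\<bar> \<le> K"
  shows "\<bar>leaf_integral s f g\<bar> \<le> K"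
proof -
  have "norm (leaf_integral s f g) \<le> (LINT t:{0..1}|lborel. norm (f (s, t) * g t))"
    unfolding leaf_integral_def
    by (rule set_integral_norm_bound) (rule leaf_integrable[OF assms(1-3)])
  also have "\<dots> \<le> (LINT t:{0..1::real}|lborel. K)"
  proof (rule set_integral_mono)
    show "set_integrable lborel {0..1} (\<lambda>t. norm (f (s, t) * g t))"
      using set_integrable_abs[OF leaf_integrable[OF assms(1-3)]] by simp
    show "set_integrable lborel {0..1::real} (\<lambda>t. K)" unfolding set_integrable_def by (rule borel_integrable_compact) auto
    show "norm (f (s, t) * g t) \<le> K" if "t \<in> {0..1}" for t using assms(4)[OF that] by simp
  qed
  also have "\<dots> = K" by (subst set_integral_const) auto
  finally show ?thesis by simp
qed

locale holder_exponents =
  fixes \<alpha> \<beta> :: real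
  assumes exponents: "0 < \<alpha>" "\<alpha> < 1" "0 < \<beta>" "\<beta> < 1"
begin

abbreviation stable :: "(point \<Rightarrow> real) \<Rightarrow> real" where "stable \<equiv> stable_norm \<alpha>"
abbreviation unstable :: "(point \<Rightarrow> real) \<Rightarrow> real" where "unstable \<equiv> unstable_norm \<beta>"
abbreviation strong :: "(point \<Rightarrow> real) \<Rightarrow> real" where "strong \<equiv> strong_norm \<alpha> \<beta>"
abbreviation B :: "functional set" where "B \<equiv> banach_B \<alpha> \<beta>"
abbreviation N :: "functional \<Rightarrow> real" where "N \<equiv> B_norm \<alpha> \<beta>"

lemma holder_bounds_continuous1: "holder_bounds 1 g A H \<Longrightarrow> continuous_on {0..1} g"
  by (rule holder_bounds_continuous) auto

lemma holder_leaf_cont: "g \<in> holder_leaf \<alpha> \<Longrightarrow> continuous_on {0..1} g"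
  by (rule holder_leaf_continuous) (use exponents in auto)

section \<open>Rules for bounding the two seminorms and for using them as bounds\<close>

lemma stable_norm_least:
  assumes "\<And>s g A H. s \<in> {0..1} \<Longrightarrow> g \<in> holder_leaf \<alpha> \<Longrightarrow> holder_bounds \<alpha> g A H \<Longrightarrow> A + H \<le> 1 \<Longrightarrow>
    leaf_integral s f g \<le> K"
  shows "stable f \<le> K"
  unfolding stable_norm_def
proof (rule cSup_least)
  show "{leaf_integral s f g |s g. s \<in> {0..1} \<and> g \<in> holder_leaf \<alpha> \<and> holder_norm \<alpha> g \<le> 1} \<noteq> {}"
  proof -
    have "(\<lambda>t. 0) \<in> holder_leaf \<alpha>" using holder_bounds_zero by (rule lipschitz_imp_holder_leaf)
    moreover have "holder_norm \<alpha> (\<lambda>t. 0) \<le> 1" using holder_norm_le[OF holder_bounds_zero, of \<alpha>] by (simp add: order_trans[OF _ zero_le_one])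
    ultimately show ?thesis by (auto intro!: exI[of _ 0])
  qed
  fix x assume "x \<in> {leaf_integral s f g |s g. s \<in> {0..1} \<and> g \<in> holder_leaf \<alpha> \<and> holder_norm \<alpha> g \<le> 1}"
  then obtain s g where x: "x = leaf_integral s f g" "s \<in> {0..1}" "g \<in> holder_leaf \<alpha>" "holder_norm \<alpha> g \<le> ennreal 1"
    by auto
  obtain A H where "holder_bounds \<alpha> g A H" "A + H \<le> 1" using holder_norm_leE[OF x(4)] by auto
  with x assms show "x \<le> K" by blast
qed

text \<open>The seminorm is a real supremum, so its use requires the set to be bounded: leaf
  integrals against functions bounded by 1 are at most the supremum of \<open>f\<close>. The general
  case follows by dividing the test function by \<open>A + H\<close>.\<close>

lemma stable_norm_upper:
  assumes "f \<in> C1_unstable" "s \<in> {0..1}" "g \<in> holder_leaf \<alpha>" "holder_bounds \<alpha> g A H"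
  shows "\<bar>leaf_integral s f g\<bar> \<le> stable f * (A + H)"
proof -
  obtain K where K: "0 \<le> K" "\<And>s t. s \<in> {0..1} \<Longrightarrow> t \<in> {0..1} \<Longrightarrow> \<bar>f (s, t)\<bar> \<le> K"
    using C1_unstable_bounded[OF assms(1)] by blast
  note D = holder_boundsD[OF assms(4)]
  have bdd: "bdd_above {leaf_integral s f g | s g. s \<in> {0..1} \<and> g \<in> holder_leaf \<alpha> \<and> holder_norm \<alpha> g \<le> 1}"
  proof (rule bdd_aboveI, safe)
    fix s :: real and g assume *: "s \<in> {0..1}" "g \<in> holder_leaf \<alpha>" "holder_norm \<alpha> g \<le> 1"
    obtain A H where AH: "holder_bounds \<alpha> g A H" "A + H \<le> 1"
      using holder_norm_leE[of \<alpha> g 1] *(3) by auto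
    have "\<bar>leaf_integral s f g\<bar> \<le> K"
    proof (rule leaf_integral_bound[OF assms(1) *(1) holder_leaf_cont[OF *(2)]])
      fix t :: real assume t: "t \<in> {0..1}"
      have "\<bar>g t\<bar> \<le> 1"
        using holder_boundsD(2)[OF AH(1)] holder_boundsD(3)[OF AH(1) t] AH(2) by linarith
      then have "\<bar>f (s, t)\<bar> * \<bar>g t\<bar> \<le> K * 1"
        by (intro mult_mono K *(1) t) auto
      then show "\<bar>f (s, t) * g t\<bar> \<le> K" by (simp add: abs_mult)
    qed
    then show "leaf_integral s f g \<le> K" by simp
  qed
  show ?thesis
  \<comment> \<open>Rescaling is impossible in this case, but then the test function vanishes on the
    leaf.\<close>
  proof (cases "A + H = 0")
    case True
    then have "A = 0" using D by auto
    then have "leaf_integral s f g = leaf_integral s f (\<lambda>t. 0 * g t)"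
      using D(3) by (intro leaf_integral_cong) auto
    then show ?thesis unfolding leaf_integral_scale_right True by simp
  next
    case False
    then have pos: "0 < A + H" using D by simp
    \<comment> \<open>The supremum runs over signed integrals, so both signs of \<open>c\<close> are
      used to bound the absolute value.\<close>
    have *: "c * leaf_integral s f g \<le> stable f" if "\<bar>c\<bar> = 1 / (A + H)" for c
    proof -
      have "(\<lambda>t. c * g t) \<in> holder_leaf \<alpha>" using holder_leaf_scale_shift[OF assms(3), of c 0] by simp
      moreover have "holder_norm \<alpha> (\<lambda>t. c * g t) \<le> 1"
      proof -
        have "\<bar>c\<bar> * A + \<bar>c\<bar> * H = 1" unfolding distrib_left[symmetric] that using pos by simp
        then show ?thesis using holder_norm_le[OF holder_bounds_scale[OF assms(4), of c]] by simp
      qed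
      ultimately have "leaf_integral s f (\<lambda>t. c * g t) \<le> stable f"
        unfolding stable_norm_def using assms(2) by (intro cSup_upper[OF _ bdd]) blast
      then show ?thesis unfolding leaf_integral_scale_right .
    qed
    have "\<bar>leaf_integral s f g\<bar> / (A + H) \<le> stable f"
      using *[of "1 / (A + H)"] *[of "- 1 / (A + H)"] pos by (cases "leaf_integral s f g \<ge> 0") auto
    then show ?thesis using pos by (simp add: pos_divide_le_eq)
  qed
qed

lemma stable_norm_nonneg:
  assumes "f \<in> C1_unstable" shows "0 \<le> stable f"
proof -
  have "0 \<le> \<bar>leaf_integral 0 f (\<lambda>t. 1)\<bar>" by simp
  also have "\<dots> \<le> stable f * (\<bar>1\<bar> + 0)"
    by (rule stable_norm_upper[OF assms _ lipschitz_imp_holder_leaf[OF holder_bounds_const] holder_bounds_const]) simp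
  finally show ?thesis by simp
qed

lemma stable_norm_lipschitz_upper:
  assumes "f \<in> C1_unstable" "s \<in> {0..1}" "holder_bounds 1 g A H"
  shows "\<bar>leaf_integral s f g\<bar> \<le> stable f * (A + H)"
  by (rule stable_norm_upper[OF assms(1,2) lipschitz_imp_holder_leaf[OF assms(3)]
        holder_bounds_of_lipschitz[OF assms(3)]]) (use exponents in auto)

text \<open>Distance 0 makes the two test functions equal on the parameter interval, so a single
  \<open>g\<close> on both leaves suffices. The pairs with \<open>s = s'\<close> contribute 0, which
  is where \<open>0 \<le> K\<close> enters.\<close>

lemma unstable_norm_least:
  assumes "0 \<le> K" "\<And>s s' g A H. s \<in> {0..1} \<Longrightarrow> s' \<in> {0..1} \<Longrightarrow> s \<noteq> s' \<Longrightarrow> holder_bounds 1 g A H \<Longrightarrow> A + H \<le> 1 \<Longrightarrow>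
    \<bar>leaf_integral s f g - leaf_integral s' f g\<bar> \<le> K * \<bar>s - s'\<bar> powr \<beta>"
  shows "unstable f \<le> K"
  unfolding unstable_norm_def
proof (rule cSup_least)
  have "holder_norm 1 (\<lambda>t. 0) \<le> 1" using holder_norm_le[OF holder_bounds_zero, of 1] by (simp add: order_trans[OF _ zero_le_one])
  then show "{\<bar>s - s'\<bar> powr (- \<beta>) * \<bar>leaf_integral s f g - leaf_integral s' f h\<bar> | s s' g h.
      s \<in> {0..1} \<and> s' \<in> {0..1} \<and> holder_norm 1 g \<le> 1 \<and> holder_norm 1 h \<le> 1 \<and>
      leaf_distance0 g h = 0} \<noteq> {}"
    by (auto intro!: exI[of _ 0] exI[of _ "\<lambda>t. 0"] simp: leaf_distance0_def)
  fix x assume "x \<in> {\<bar>s - s'\<bar> powr (- \<beta>) * \<bar>leaf_integral s f g - leaf_integral s' f h\<bar> | s s' g h.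
      s \<in> {0..1} \<and> s' \<in> {0..1} \<and> holder_norm 1 g \<le> 1 \<and> holder_norm 1 h \<le> 1 \<and>
      leaf_distance0 g h = 0}"
  then obtain s s' g h where x: "x = \<bar>s - s'\<bar> powr (- \<beta>) * \<bar>leaf_integral s f g - leaf_integral s' f h\<bar>"
    "s \<in> {0..1}" "s' \<in> {0..1}" "holder_norm 1 g \<le> ennreal 1" "leaf_distance0 g h = 0" by auto
  obtain A H where AH: "holder_bounds 1 g A H" "A + H \<le> 1" using holder_norm_leE[OF x(4)] by auto
  have "ennreal \<bar>g t - h t\<bar> \<le> 0" if "t \<in> {0..1}" for t
    unfolding x(5)[symmetric] leaf_distance0_def using that by (rule SUP_upper)
  then have gh: "leaf_integral s' f h = leaf_integral s' f g" by (intro leaf_integral_cong) auto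
  show "x \<le> K"
  proof (cases "s = s'")
    case False
    then have "\<bar>s - s'\<bar> powr (- \<beta>) * \<bar>leaf_integral s f g - leaf_integral s' f g\<bar>
        \<le> \<bar>s - s'\<bar> powr (- \<beta>) * (K * \<bar>s - s'\<bar> powr \<beta>)"
      using assms(2)[OF x(2,3) False AH] by (intro mult_left_mono) auto
    also have "\<dots> = K" using False by (simp add: powr_minus field_simps)
    finally show ?thesis unfolding x(1) gh .
  qed (use x(1) assms(1) in simp)
qed

text \<open>Finiteness of the supremum comes from the horizontal Lipschitz bound: \<open>K\<close>
  times the distance of the leaves, divided by the distance to the power \<beta>, stays at most
  \<open>K\<close>, since \<beta> < 1 and the distance is at most 1.\<close>

lemma unstable_norm_upper:
  assumes "f \<in> C1_unstable" "s \<in> {0..1}" "s' \<in> {0..1}" "holder_bounds 1 g A H"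
  shows "\<bar>leaf_integral s f g - leaf_integral s' f g\<bar> \<le> unstable f * (A + H) * \<bar>s - s'\<bar> powr \<beta>"
proof -
  obtain K where K: "0 \<le> K"
    "\<And>s s' t. s \<in> {0..1} \<Longrightarrow> s' \<in> {0..1} \<Longrightarrow> t \<in> {0..1} \<Longrightarrow> \<bar>f (s, t) - f (s', t)\<bar> \<le> K * \<bar>s - s'\<bar>"
    using C1_unstable_lipschitz[OF assms(1)] by blast
  note D = holder_boundsD[OF assms(4)]
  let ?S = "{\<bar>s - s'\<bar> powr (- \<beta>) * \<bar>leaf_integral s f g - leaf_integral s' f h\<bar> | s s' g h.
      s \<in> {0..1} \<and> s' \<in> {0..1} \<and> holder_norm 1 g \<le> 1 \<and> holder_norm 1 h \<le> 1 \<and>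
      leaf_distance0 g h = 0}"
  have bdd: "bdd_above ?S"
  proof (rule bdd_aboveI, safe)
    fix s s' :: real and g h assume *: "s \<in> {0..1}" "s' \<in> {0..1}" "holder_norm 1 g \<le> 1" "leaf_distance0 g h = 0"
    obtain A H where AH: "holder_bounds 1 g A H" "A + H \<le> 1"
      using holder_norm_leE[of 1 g 1] *(3) by auto
    have "ennreal \<bar>g t - h t\<bar> \<le> 0" if "t \<in> {0..1}" for t
      unfolding *(4)[symmetric] leaf_distance0_def using that by (rule SUP_upper)
    then have gh: "leaf_integral s' f h = leaf_integral s' f g" by (intro leaf_integral_cong) auto
    have c: "continuous_on {0..1} g" by (rule holder_bounds_continuous1[OF AH(1)])
    \<comment> \<open>Freezing the abscissae turns the difference over two leaves into one density
      on a single leaf, to which the general bound for leaf integrals applies.\<close>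
    have cs: "(\<lambda>x. f (s, snd x) - f (s', snd x)) \<in> C1_unstable"
    proof -
      have m: "f \<in> borel_measurable borel_square" by (rule C1_unstable_measurable[OF assms(1)])
      obtain K where K: "0 \<le> K" "\<And>s t. s \<in> {0..1} \<Longrightarrow> t \<in> {0..1} \<Longrightarrow> \<bar>f (s, t)\<bar> \<le> K"
        using C1_unstable_bounded[OF assms(1)] by blast
      have "(\<lambda>x. f (r, snd x)) \<in> C1_unstable" if "r \<in> {0..1}" for r
      proof (rule C1_unstableI[of _ K 0])
        have "(\<lambda>x. (r, snd x)) \<in> measurable borel_square borel_square"
          using that by (intro measurable_restrict_space2) (auto simp: space_restrict_space square_def
              borel_prod[symmetric] intro!: measurable_restrict_space1)
        from measurable_compose[OF this m]
        show "(\<lambda>x. f (r, snd x)) \<in> borel_measurable borel_square" .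
      qed (use K that in auto)
      with * show ?thesis by (intro C1_unstable_diff) auto
    qed
    have "leaf_integral s f g - leaf_integral s' f g = leaf_integral s (\<lambda>x. f (s, snd x) - f (s', snd x)) g"
      unfolding leaf_integral_def
      by (subst set_integral_diff(2)[symmetric]) (auto simp: left_diff_distrib intro!: leaf_integrable assms * c)
    also have "\<bar>\<dots>\<bar> \<le> K * \<bar>s - s'\<bar>"
    proof (rule leaf_integral_bound[OF cs *(1) c])
      fix t :: real assume t: "t \<in> {0..1}"
      have "\<bar>g t\<bar> \<le> 1"
        using holder_boundsD(2)[OF AH(1)] holder_boundsD(3)[OF AH(1) t] AH(2) by linarith
      then have "\<bar>f (s, t) - f (s', t)\<bar> * \<bar>g t\<bar> \<le> K * \<bar>s - s'\<bar> * 1"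
        using K(1) by (intro mult_mono K(2) *(1,2) t) auto
      then show "\<bar>(f (s, snd (s, t)) - f (s', snd (s, t))) * g t\<bar> \<le> K * \<bar>s - s'\<bar>" by (simp add: abs_mult)
    qed
    finally have "\<bar>s - s'\<bar> powr (- \<beta>) * \<bar>leaf_integral s f g - leaf_integral s' f g\<bar>
        \<le> \<bar>s - s'\<bar> powr (- \<beta>) * (K * \<bar>s - s'\<bar>)" by (intro mult_left_mono) auto
    also have "\<dots> = K * (\<bar>s - s'\<bar> powr (- \<beta>) * \<bar>s - s'\<bar> powr 1)" by simp
    also have "\<dots> = K * \<bar>s - s'\<bar> powr (1 - \<beta>)" by (simp only: powr_add[symmetric]) simp
    also have "\<dots> \<le> K * 1" using K(1) * exponents by (intro mult_left_mono powr_le1) auto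
    finally show "\<bar>s - s'\<bar> powr (- \<beta>) * \<bar>leaf_integral s f g - leaf_integral s' f h\<bar> \<le> K"
      unfolding gh by simp
  qed
  show ?thesis
  proof (cases "A + H = 0 \<or> s = s'")
    case True
    then consider "s = s'" | "A = 0" "A + H = 0" using D by auto
    then show ?thesis
    proof cases
      case 2
      then have "leaf_integral r f g = leaf_integral r f (\<lambda>t. 0 * g t)" for r
        using D(3) by (intro leaf_integral_cong) auto
      then show ?thesis unfolding leaf_integral_scale_right 2(2) by simp
    qed simp
  next
    case False
    then have pos: "0 < A + H" and ne: "s \<noteq> s'" using D by auto
    define c where "c = 1 / (A + H)"
    have c: "0 < c" using pos by (simp add: c_def)
    have "c * A + c * H = 1" unfolding distrib_left[symmetric] c_def using pos by simp
    then have "holder_norm 1 (\<lambda>t. c * g t) \<le> 1"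
      using holder_norm_le[OF holder_bounds_scale[OF assms(4), of c]] c by simp
    then have "\<bar>s - s'\<bar> powr (- \<beta>) * \<bar>leaf_integral s f (\<lambda>t. c * g t) - leaf_integral s' f (\<lambda>t. c * g t)\<bar> \<in> ?S"
      using assms(2,3)
      by (intro CollectI exI[of _ s] exI[of _ s'] exI[of _ "\<lambda>t. c * g t"] conjI refl)
        (auto simp: leaf_distance0_def)
    then have "\<bar>s - s'\<bar> powr (- \<beta>) * \<bar>leaf_integral s f (\<lambda>t. c * g t) - leaf_integral s' f (\<lambda>t. c * g t)\<bar> \<le> unstable f"
      unfolding unstable_norm_def by (intro cSup_upper[OF _ bdd])
    then have "\<bar>s - s'\<bar> powr (- \<beta>) * (c * \<bar>leaf_integral s f g - leaf_integral s' f g\<bar>) \<le> unstable f"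
      unfolding leaf_integral_scale_right right_diff_distrib[symmetric] abs_mult using c by simp
    note le = this
    define P where "P = \<bar>s - s'\<bar> powr \<beta>"
    have P: "0 < P" using ne by (simp add: P_def)
    have "\<bar>leaf_integral s f g - leaf_integral s' f g\<bar>
        = (A + H) * P * (inverse P * (c * \<bar>leaf_integral s f g - leaf_integral s' f g\<bar>))"
      using P pos by (simp add: c_def)
    also have "\<dots> \<le> (A + H) * P * unstable f"
      using le P pos by (intro mult_left_mono) (simp_all add: powr_minus P_def)
    finally show ?thesis by (simp add: P_def mult_ac)
  qed
qed

lemma unstable_norm_nonneg:
  assumes "f \<in> C1_unstable" shows "0 \<le> unstable f"
proof -
  have "0 \<le> \<bar>leaf_integral 0 f (\<lambda>t. 1) - leaf_integral 1 f (\<lambda>t. 1)\<bar>" by simp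
  also have "\<dots> \<le> unstable f * (\<bar>1\<bar> + 0) * \<bar>0 - 1\<bar> powr \<beta>"
    by (rule unstable_norm_upper[OF assms _ _ holder_bounds_const]) simp_all
  finally show ?thesis by simp
qed

lemma strong_norm_nonneg: "f \<in> C1_unstable \<Longrightarrow> 0 \<le> strong f"
  unfolding strong_norm_def by (simp add: stable_norm_nonneg unstable_norm_nonneg)

lemma stable_le_strong: "f \<in> C1_unstable \<Longrightarrow> stable f \<le> strong f"
  unfolding strong_norm_def by (simp add: unstable_norm_nonneg)

lemma unstable_le_strong: "f \<in> C1_unstable \<Longrightarrow> unstable f \<le> strong f"
  unfolding strong_norm_def by (simp add: stable_norm_nonneg)

text \<open>The one inequality behind the triangle inequality, the symmetry of distances, the value
  at 0 and the reverse triangle inequality, all of which result from choices of the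
  coefficients.\<close>

lemma strong_norm_lincomb:
  assumes f: "f \<in> C1_unstable" and g: "g \<in> C1_unstable"
  shows "strong (\<lambda>x. a * f x + c * g x) \<le> \<bar>a\<bar> * strong f + \<bar>c\<bar> * strong g"
proof -
  have "stable (\<lambda>x. a * f x + c * g x) \<le> \<bar>a\<bar> * stable f + \<bar>c\<bar> * stable g"
  proof (rule stable_norm_least)
    fix s :: real and h A H assume *: "s \<in> {0..1}" "h \<in> holder_leaf \<alpha>" "holder_bounds \<alpha> h A H" "A + H \<le> 1"
    have 1: "\<bar>leaf_integral s k h\<bar> \<le> stable k" if "k \<in> C1_unstable" for k
      using stable_norm_upper[OF that *(1-3)] mult_left_mono[OF *(4) stable_norm_nonneg[OF that]] by simp
    have "leaf_integral s (\<lambda>x. a * f x + c * g x) h = a * leaf_integral s f h + c * leaf_integral s g h"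
      using f g * by (intro leaf_integral_lincomb_left holder_leaf_cont)
    also have "\<dots> \<le> \<bar>a\<bar> * \<bar>leaf_integral s f h\<bar> + \<bar>c\<bar> * \<bar>leaf_integral s g h\<bar>"
      unfolding abs_mult[symmetric] by (intro add_mono abs_ge_self)
    also have "\<dots> \<le> \<bar>a\<bar> * stable f + \<bar>c\<bar> * stable g"
      by (intro add_mono mult_left_mono 1 f g) auto
    finally show "leaf_integral s (\<lambda>x. a * f x + c * g x) h \<le> \<dots>" .
  qed
  moreover have "unstable (\<lambda>x. a * f x + c * g x) \<le> \<bar>a\<bar> * unstable f + \<bar>c\<bar> * unstable g"
  proof (rule unstable_norm_least)
    show "0 \<le> \<bar>a\<bar> * unstable f + \<bar>c\<bar> * unstable g"
      by (simp add: f g unstable_norm_nonneg)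
    fix s s' :: real and h A H
    assume *: "s \<in> {0..1}" "s' \<in> {0..1}" "s \<noteq> s'" "holder_bounds 1 h A H" "A + H \<le> 1"
    have 1: "\<bar>leaf_integral s k h - leaf_integral s' k h\<bar> \<le> unstable k * \<bar>s - s'\<bar> powr \<beta>" if "k \<in> C1_unstable" for k
    proof -
      have "unstable k * (A + H) * \<bar>s - s'\<bar> powr \<beta> \<le> unstable k * 1 * \<bar>s - s'\<bar> powr \<beta>"
        by (intro mult_right_mono mult_left_mono * unstable_norm_nonneg that) auto
      then show ?thesis using unstable_norm_upper[OF that *(1,2,4)] by simp
    qed
    have "leaf_integral r (\<lambda>x. a * f x + c * g x) h = a * leaf_integral r f h + c * leaf_integral r g h"
      if "r \<in> {0..1}" for r
      using f g that * by (intro leaf_integral_lincomb_left holder_bounds_continuous1)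
    then have "leaf_integral s (\<lambda>x. a * f x + c * g x) h - leaf_integral s' (\<lambda>x. a * f x + c * g x) h
        = a * (leaf_integral s f h - leaf_integral s' f h) + c * (leaf_integral s g h - leaf_integral s' g h)"
      using * by (simp add: algebra_simps)
    also have "\<bar>\<dots>\<bar> \<le> \<bar>a\<bar> * \<bar>leaf_integral s f h - leaf_integral s' f h\<bar> + \<bar>c\<bar> * \<bar>leaf_integral s g h - leaf_integral s' g h\<bar>"
      unfolding abs_mult[symmetric] by (rule abs_triangle_ineq)
    also have "\<dots> \<le> \<bar>a\<bar> * (unstable f * \<bar>s - s'\<bar> powr \<beta>) + \<bar>c\<bar> * (unstable g * \<bar>s - s'\<bar> powr \<beta>)"
      by (intro add_mono mult_left_mono 1 f g) auto
    finally show "\<bar>leaf_integral s (\<lambda>x. a * f x + c * g x) h - leaf_integral s' (\<lambda>x. a * f x + c * g x) h\<bar>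
      \<le> (\<bar>a\<bar> * unstable f + \<bar>c\<bar> * unstable g) * \<bar>s - s'\<bar> powr \<beta>"
      by (simp add: algebra_simps)
  qed
  ultimately show ?thesis unfolding strong_norm_def by (simp add: algebra_simps)
qed

lemma strong_norm_triangle:
  assumes "f \<in> C1_unstable" "g \<in> C1_unstable" "h \<in> C1_unstable"
  shows "strong (\<lambda>x. f x - h x) \<le> strong (\<lambda>x. f x - g x) + strong (\<lambda>x. g x - h x)"
  using strong_norm_lincomb[OF C1_unstable_diff[OF assms(1,2)] C1_unstable_diff[OF assms(2,3)], of 1 1] by simp

lemma strong_norm_diff_commute:
  assumes "f \<in> C1_unstable" "g \<in> C1_unstable"
  shows "strong (\<lambda>x. f x - g x) = strong (\<lambda>x. g x - f x)"
  using strong_norm_lincomb[OF C1_unstable_diff[OF assms] C1_unstable_diff[OF assms], of "-1" 0]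
    strong_norm_lincomb[OF C1_unstable_diff[OF assms(2,1)] C1_unstable_diff[OF assms(2,1)], of "-1" 0] by simp

lemma strong_norm_zero: "strong (\<lambda>x. 0) = 0"
  using strong_norm_lincomb[OF C1_unstable_const C1_unstable_const, of 0 0 0 0]
    strong_norm_nonneg[OF C1_unstable_const, of 0] by simp

lemma strong_norm_reverse_triangle:
  assumes "f \<in> C1_unstable" "g \<in> C1_unstable"
  shows "\<bar>strong f - strong g\<bar> \<le> strong (\<lambda>x. f x - g x)"
  using strong_norm_triangle[OF assms(1,2) C1_unstable_const, of 0]
    strong_norm_triangle[OF assms(2,1) C1_unstable_const, of 0] strong_norm_diff_commute[OF assms] by simp

end

section \<open>Pairing densities with test functions\<close>

lemma square_borel [measurable]: "square \<in> sets borel"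
  unfolding square_def by (intro borel_closed closed_Times) auto

lemma emeasure_square: "emeasure lborel square = 1"
proof -
  have "emeasure (lborel \<Otimes>\<^sub>M lborel) ({0..1::real} \<times> {0..1::real}) = 1"
    by (subst lborel.emeasure_pair_measure_Times) auto
  then show ?thesis unfolding lborel_prod square_def .
qed

lemma square_iff: "(s, t) \<in> square \<longleftrightarrow> s \<in> {0..1} \<and> t \<in> {0..1}"
  by (auto simp: square_def)

lemma borel_measurable_square_iff:
  fixes F :: "point \<Rightarrow> real"
  shows "F \<in> borel_measurable borel_square \<longleftrightarrow> (\<lambda>x. indicator square x *\<^sub>R F x) \<in> borel_measurable borel"
  by (subst borel_measurable_restrict_space_iff) auto

lemma indicator_square: "indicator square (s, t) = (indicator {0..1} s * indicator {0..1} t :: real)"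
  by (auto simp: square_def indicator_def)

lemma fubini_square:
  fixes F :: "point \<Rightarrow> real"
  assumes "F \<in> borel_measurable borel_square"
    "\<And>s t. s \<in> {0..1} \<Longrightarrow> t \<in> {0..1} \<Longrightarrow> \<bar>F (s, t)\<bar> \<le> K"
  shows "set_integrable lborel square F"
    and "set_integrable lborel {0..1} (\<lambda>s. LINT t:{0..1}|lborel. F (s, t))"
    and "(LINT x:square|lborel. F x) = (LINT s:{0..1}|lborel. LINT t:{0..1}|lborel. F (s, t))"
proof -
  have m: "(\<lambda>x. indicator square x *\<^sub>R F x) \<in> borel_measurable borel"
    using assms(1) unfolding borel_measurable_square_iff .
  have K: "0 \<le> K" using assms(2)[of 0 0] by simp
  have int: "integrable lborel (\<lambda>x. indicator square x *\<^sub>R F x)"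
  proof (rule Bochner_Integration.integrable_bound)
    show "integrable lborel (\<lambda>x. K * indicator square x :: real)"
      by (intro integrable_mult_right integrable_real_indicator) (simp_all add: emeasure_square)
    show "(\<lambda>x. indicator square x *\<^sub>R F x) \<in> borel_measurable lborel" using m by simp
    show "AE x in lborel. norm (indicator square x *\<^sub>R F x) \<le> norm (K * indicator square x :: real)"
    proof (rule AE_I2)
      fix x :: point
      show "norm (indicator square x *\<^sub>R F x) \<le> norm (K * indicator square x :: real)"
        using assms(2)[of "fst x" "snd x"] K by (cases x) (auto simp: indicator_def square_def)
    qed
  qed
  then show "set_integrable lborel square F" unfolding set_integrable_def .
  have int': "integrable (lborel \<Otimes>\<^sub>M lborel) (\<lambda>(s, t). indicator square (s, t) *\<^sub>R F (s, t))"
    using int unfolding lborel_prod by (simp add: case_prod_beta')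
  have eq: "(\<integral>t. indicator square (s, t) *\<^sub>R F (s, t) \<partial>lborel)
      = indicator {0..1} s *\<^sub>R (LINT t:{0..1}|lborel. F (s, t))" for s
    unfolding set_lebesgue_integral_def
    by (subst integral_scaleR_right[symmetric], rule Bochner_Integration.integral_cong) (simp_all add: indicator_square mult.assoc)
  show "set_integrable lborel {0..1} (\<lambda>s. LINT t:{0..1}|lborel. F (s, t))"
    using lborel_pair.integrable_fst[OF int'] unfolding eq set_integrable_def .
  have "(LINT x:square|lborel. F x) = (\<integral>x. (case x of (s, t) \<Rightarrow> indicator square (s, t) *\<^sub>R F (s, t)) \<partial>(lborel \<Otimes>\<^sub>M lborel))"
    unfolding lborel_prod set_lebesgue_integral_def by (simp add: case_prod_beta)
  also have "\<dots> = (\<integral>s. (\<integral>t. indicator square (s, t) *\<^sub>R F (s, t) \<partial>lborel) \<partial>lborel)"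
    by (rule lborel_pair.integral_fst[OF int', symmetric])
  also have "\<dots> = (LINT s:{0..1}|lborel. LINT t:{0..1}|lborel. F (s, t))"
    unfolding eq set_lebesgue_integral_def[of lborel "{0..1}" "\<lambda>s. LINT t:{0..1}|lborel. F (s, t)"] ..
  finally show "(LINT x:square|lborel. F x) = (LINT s:{0..1}|lborel. LINT t:{0..1}|lborel. F (s, t))" .
qed

lemma set_integral_unit_bound:
  fixes F :: "real \<Rightarrow> real"
  assumes "\<And>s. s \<in> {0..1} \<Longrightarrow> \<bar>F s\<bar> \<le> K"
  shows "\<bar>LINT s:{0..1}|lborel. F s\<bar> \<le> K"
proof (cases "set_integrable lborel {0..1} F")
  case True
  have "norm (LINT s:{0..1}|lborel. F s) \<le> (LINT s:{0..1}|lborel. norm (F s))"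
    by (rule set_integral_norm_bound[OF True])
  also have "\<dots> \<le> (LINT t:{0..1::real}|lborel. K)"
  proof (rule set_integral_mono)
    show "set_integrable lborel {0..1} (\<lambda>t. norm (F t))" using set_integrable_abs[OF True] by simp
    show "set_integrable lborel {0..1::real} (\<lambda>t. K)"
      unfolding set_integrable_def by (rule borel_integrable_compact) auto
    show "norm (F t) \<le> K" if "t \<in> {0..1}" for t using assms(1)[OF that] by simp
  qed
  also have "\<dots> = K" by (subst set_integral_const) auto
  finally show ?thesis by simp
next
  case False
  \<comment> \<open>The integral of a non-integrable function is 0 by convention, and
    \<open>K\<close> is nonnegative as a bound of an absolute value.\<close>
  then have "(LINT s:{0..1}|lborel. F s) = 0"
    unfolding set_integrable_def set_lebesgue_integral_def by (rule not_integrable_integral_eq)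
  then show ?thesis using assms[of 0] by simp
qed

text \<open>The value at \<phi> of the measure with density \<open>f\<close>.\<close>

definition pairing :: "(point \<Rightarrow> real) \<Rightarrow> (point \<Rightarrow> real) \<Rightarrow> real"
  where "pairing f \<phi> = (LINT x:square|lborel. f x * \<phi> x)"

lemma pairing_bounded_integrand:
  assumes "f \<in> C1_unstable" "\<phi> \<in> C1_stable"
  obtains K where "(\<lambda>x. f x * \<phi> x) \<in> borel_measurable borel_square"
    "\<And>s t. s \<in> {0..1} \<Longrightarrow> t \<in> {0..1} \<Longrightarrow> \<bar>f (s, t) * \<phi> (s, t)\<bar> \<le> K"
proof -
  obtain K where K: "0 \<le> K" "\<And>s t. s \<in> {0..1} \<Longrightarrow> t \<in> {0..1} \<Longrightarrow> \<bar>f (s, t)\<bar> \<le> K"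
    using C1_unstable_bounded[OF assms(1)] by blast
  obtain A H where A: "\<phi> \<in> borel_measurable borel_square" "0 \<le> A" "0 \<le> H"
    "\<And>s. s \<in> {0..1} \<Longrightarrow> holder_bounds 1 (\<lambda>t. \<phi> (s, t)) A H"
    using C1_stableE[OF assms(2)] by blast
  show thesis
  proof (rule that)
    show "(\<lambda>x. f x * \<phi> x) \<in> borel_measurable borel_square"
      by (rule borel_measurable_times[OF C1_unstable_measurable[OF assms(1)] A(1)])
    show "\<bar>f (s, t) * \<phi> (s, t)\<bar> \<le> K * A" if "s \<in> {0..1}" "t \<in> {0..1}" for s t
      unfolding abs_mult by (intro mult_mono K that holder_boundsD(3)[OF A(4)]) auto
  qed
qed

lemma pairing_integrable:
  assumes "f \<in> C1_unstable" "\<phi> \<in> C1_stable"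
  shows "set_integrable lborel square (\<lambda>x. f x * \<phi> x)"
  by (rule pairing_bounded_integrand[OF assms]) (rule fubini_square(1))

lemma pairing_leaves:
  assumes "f \<in> C1_unstable" "\<phi> \<in> C1_stable"
  shows "set_integrable lborel {0..1} (\<lambda>s. leaf_integral s f (\<lambda>t. \<phi> (s, t)))"
    and "pairing f \<phi> = (LINT s:{0..1}|lborel. leaf_integral s f (\<lambda>t. \<phi> (s, t)))"
  unfolding pairing_def leaf_integral_def
  by (rule pairing_bounded_integrand[OF assms], rule fubini_square, assumption, assumption)+

lemma pairing_lincomb:
  assumes "f \<in> C1_unstable" "g \<in> C1_unstable" "\<phi> \<in> C1_stable"
  shows "pairing (\<lambda>x. a * f x + c * g x) \<phi> = a * pairing f \<phi> + c * pairing g \<phi>"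
proof -
  have "(LINT x:square|lborel. a * (f x * \<phi> x) + c * (g x * \<phi> x))
      = (LINT x:square|lborel. a * (f x * \<phi> x)) + (LINT x:square|lborel. c * (g x * \<phi> x))"
    by (intro set_integral_add(2) set_integrable_mult_right pairing_integrable assms)
  then show ?thesis unfolding pairing_def by (simp add: algebra_simps)
qed

lemma pairing_diff:
  assumes "f \<in> C1_unstable" "g \<in> C1_unstable" "\<phi> \<in> C1_stable"
  shows "pairing (\<lambda>x. f x - g x) \<phi> = pairing f \<phi> - pairing g \<phi>"
  using pairing_lincomb[OF assms, of 1 "-1"] by simp

text \<open>A continuous function of vanishing L2 norm vanishes at every point, not only almost
  everywhere. This turns an integral over all leaves into a statement about each single
  leaf.\<close>

lemma set_integral_square_zero_imp:
  fixes I :: "real \<Rightarrow> real"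
  assumes "continuous_on {0..1} I" "(LINT s:{0..1}|lborel. I s * I s) = 0" "s \<in> {0..1}"
  shows "I s = 0"
proof -
  have c: "continuous_on {0..1} (\<lambda>s. I s * I s)" using assms(1) by (intro continuous_intros)
  have "set_integrable lborel {0..1} (\<lambda>s. I s * I s)"
    unfolding set_integrable_def using c by (intro borel_integrable_compact) auto
  from set_borel_integral_eq_integral(2)[OF this] have "integral {0..1} (\<lambda>s. I s * I s) = 0"
    using assms(2) by simp
  then have "\<forall>x\<in>{0..1}. I x * I x = 0"
    using integral_eq_0_iff[of 0 1 "\<lambda>s. I s * I s"] c by simp
  then show ?thesis using assms(3) by simp
qed

context holder_exponents
begin

text \<open>The stable norm bounds every leaf integral, and the pairing is their mean over the
  leaves. This estimate embeds the space into the dual of \<open>C1_stable\<close>.\<close>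

lemma pairing_bound:
  assumes "f \<in> C1_unstable" "\<phi> \<in> C1_stable" "\<And>s. s \<in> {0..1} \<Longrightarrow> holder_bounds 1 (\<lambda>t. \<phi> (s, t)) A H"
  shows "\<bar>pairing f \<phi>\<bar> \<le> strong f * (A + H)"
proof -
  have "0 \<le> A + H" using holder_boundsD(1,2)[OF assms(3)[of 0]] by simp
  then have le: "stable f * (A + H) \<le> strong f * (A + H)"
    by (intro mult_right_mono stable_le_strong assms)
  show ?thesis unfolding pairing_leaves(2)[OF assms(1,2)]
    by (rule set_integral_unit_bound, rule order_trans[OF stable_norm_lipschitz_upper[OF assms(1) _ assms(3)] le])
qed

section \<open>Strong Cauchy sequences with vanishing limit functional\<close>

lemma strong_Cauchy_unstable: "strong_Cauchy \<alpha> \<beta> f \<Longrightarrow> f n \<in> C1_unstable"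
  unfolding strong_Cauchy_def by blast

lemma strong_CauchyE:
  assumes "strong_Cauchy \<alpha> \<beta> f" "0 < e"
  obtains K where "\<And>m n. m \<ge> K \<Longrightarrow> n \<ge> K \<Longrightarrow> strong (\<lambda>x. f m x - f n x) < e"
  using assms unfolding strong_Cauchy_def by blast

lemma strong_Cauchy_bounded:
  assumes "strong_Cauchy \<alpha> \<beta> f"
  obtains S where "\<And>n. strong (f n) \<le> S"
proof -
  obtain K where K: "\<And>m n. m \<ge> K \<Longrightarrow> n \<ge> K \<Longrightarrow> strong (\<lambda>x. f m x - f n x) < 1"
    using strong_CauchyE[OF assms zero_less_one] by blast
  note u = strong_Cauchy_unstable[OF assms]
  have "strong (f n) \<le> Max ((\<lambda>n. strong (f n)) ` {..K}) + 1" for n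
  proof (cases "n \<le> K")
    case True
    then have "strong (f n) \<le> Max ((\<lambda>n. strong (f n)) ` {..K})" by (intro Max_ge) auto
    then show ?thesis by simp
  next
    case False
    then have "strong (\<lambda>x. f n x - f K x) < 1" by (intro K) auto
    then have "strong (f n) < strong (f K) + 1"
      using strong_norm_reverse_triangle[OF u u, of n K] by simp
    moreover have "strong (f K) \<le> Max ((\<lambda>n. strong (f n)) ` {..K})" by (intro Max_ge) auto
    ultimately show ?thesis by linarith
  qed
  then show thesis by (rule that)
qed

text \<open>
  A strong Cauchy sequence of densities with trivial limit functional has leaf integrals that
  converge uniformly to a continuous function of the leaf; testing against that function itself
  shows that it vanishes.
\<close>

lemma leaf_integral_null_lipschitz:
  assumes f: "strong_Cauchy \<alpha> \<beta> f" and null: "\<And>\<phi>. \<phi> \<in> C1_stable \<Longrightarrow> (\<lambda>n. pairing (f n) \<phi>) \<longlonglongrightarrow> 0"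
    and g: "holder_bounds 1 g A H" and s: "s \<in> {0..1}"
  shows "(\<lambda>n. leaf_integral s (f n) g) \<longlonglongrightarrow> 0"
proof -
  note u = strong_Cauchy_unstable[OF f]
  note cg = holder_bounds_continuous1[OF g]
  have AH: "0 \<le> A + H" using holder_boundsD(1,2)[OF g] by simp
  have diff: "\<bar>leaf_integral r (f m) g - leaf_integral r (f n) g\<bar> \<le> strong (\<lambda>x. f m x - f n x) * (A + H)"
    if "r \<in> {0..1}" for r m n
  proof -
    have "\<bar>leaf_integral r (f m) g - leaf_integral r (f n) g\<bar> = \<bar>leaf_integral r (\<lambda>x. f m x - f n x) g\<bar>"
      by (subst leaf_integral_diff_left[OF u u that cg]) simp
    also have "\<dots> \<le> stable (\<lambda>x. f m x - f n x) * (A + H)"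
      by (rule stable_norm_lipschitz_upper[OF C1_unstable_diff[OF u u] that g])
    also have "\<dots> \<le> strong (\<lambda>x. f m x - f n x) * (A + H)"
      by (intro mult_right_mono stable_le_strong C1_unstable_diff u AH)
    finally show ?thesis .
  qed
  have "uniformly_convergent_on {0..1} (\<lambda>n r. leaf_integral r (f n) g)"
  proof (rule Cauchy_uniformly_convergent, rule uniformly_Cauchy_onI)
    fix e :: real assume e: "0 < e"
    then have "0 < e / (A + H + 1)" using AH by simp
    then obtain K where K: "\<And>m n. m \<ge> K \<Longrightarrow> n \<ge> K \<Longrightarrow> strong (\<lambda>x. f m x - f n x) < e / (A + H + 1)"
      using strong_CauchyE[OF f] by blast
    show "\<exists>M. \<forall>x\<in>{0..1}. \<forall>m\<ge>M. \<forall>n\<ge>M. dist (leaf_integral x (f m) g) (leaf_integral x (f n) g) < e"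
    proof (intro exI[of _ K] ballI allI impI)
      fix x :: real and m n assume *: "x \<in> {0..1}" "K \<le> m" "K \<le> n"
      have "\<bar>leaf_integral x (f m) g - leaf_integral x (f n) g\<bar> \<le> strong (\<lambda>x. f m x - f n x) * (A + H)"
        by (rule diff[OF *(1)])
      also have "\<dots> \<le> e / (A + H + 1) * (A + H)"
        using K[OF *(2,3)] AH by (intro mult_right_mono) auto
      also have "\<dots> < e" using e AH by (simp add: field_simps)
      finally show "dist (leaf_integral x (f m) g) (leaf_integral x (f n) g) < e" by (simp add: dist_real_def)
    qed
  qed
  then obtain I where I: "uniform_limit {0..1} (\<lambda>n r. leaf_integral r (f n) g) I sequentially"
    unfolding uniformly_convergent_on_def by blast
  \<comment> \<open>The unstable seminorm makes leaf integrals Hoelder continuous of exponent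
    \<beta> in the leaf.\<close>
  have contn: "continuous_on {0..1} (\<lambda>r. leaf_integral r (f n) g)" for n
  proof (rule continuous_on_cong[THEN iffD1, OF refl])
    obtain K where K: "0 \<le> K" "\<And>s t. s \<in> {0..1} \<Longrightarrow> t \<in> {0..1} \<Longrightarrow> \<bar>f n (s, t)\<bar> \<le> K"
      using C1_unstable_bounded[OF u] by blast
    have "holder_bounds \<beta> (\<lambda>r. leaf_integral r (f n) g) (K * A) (unstable (f n) * (A + H))"
    proof (rule holder_boundsI)
      show "0 \<le> K * A" "0 \<le> unstable (f n) * (A + H)"
        using K(1) holder_boundsD(1)[OF g] AH unstable_norm_nonneg[OF u] by simp_all
      show "\<bar>leaf_integral t (f n) g\<bar> \<le> K * A" if "t \<in> {0..1}" for t
        by (rule leaf_integral_bound[OF u that cg], unfold abs_mult)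
          (intro mult_mono K that holder_boundsD(3)[OF g], auto)
      show "\<bar>leaf_integral t (f n) g - leaf_integral r (f n) g\<bar> \<le> unstable (f n) * (A + H) * \<bar>t - r\<bar> powr \<beta>"
        if "t \<in> {0..1}" "r \<in> {0..1}" for t r by (rule unstable_norm_upper[OF u that g])
    qed
    then show "continuous_on {0..1} (\<lambda>r. leaf_integral r (f n) g)"
      by (rule holder_bounds_continuous) (use exponents in simp)
  qed simp
  have contI: "continuous_on {0..1} I"
    by (rule uniform_limit_theorem[OF _ I]) (simp_all add: contn)
  obtain C where C: "\<And>t. t \<in> {0..1} \<Longrightarrow> \<bar>I t\<bar> \<le> C" "0 \<le> C" using continuous_on_unit_bounded[OF contI] by blast
  \<comment> \<open>The limit \<open>I\<close> is only known to be continuous. As a factor in the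
    horizontal coordinate it is admissible, because \<open>C1_stable\<close> asks for regularity
    along vertical leaves only.\<close>
  have phi: "(\<lambda>x. I (fst x) * g (snd x)) \<in> C1_stable"
  proof (rule C1_stableI)
    have "continuous_on square (\<lambda>x. I (fst x) * g (snd x))"
      by (intro continuous_intros continuous_on_compose2[OF contI] continuous_on_compose2[OF cg])
        (auto simp: square_def)
    then show "(\<lambda>x. I (fst x) * g (snd x)) \<in> borel_measurable borel_square"
      by (rule borel_measurable_continuous_on_restrict)
    show "holder_bounds 1 (\<lambda>t. I (fst (r, t)) * g (snd (r, t))) (C * A) (C * H)" if "r \<in> {0..1}" for r
      using holder_bounds_mono[OF holder_bounds_scale[OF g, of "I r"], of "C * A" "C * H"]
        C(1)[OF that] holder_boundsD(1,2)[OF g] by (simp add: mult_right_mono)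
  qed
  have "(\<lambda>n. pairing (f n) (\<lambda>x. I (fst x) * g (snd x))) \<longlonglongrightarrow> 0" by (rule null[OF phi])
  moreover have "pairing (f n) (\<lambda>x. I (fst x) * g (snd x)) = (LINT r:{0..1}|lborel. I r * leaf_integral r (f n) g)" for n
    unfolding pairing_leaves(2)[OF u phi] by (simp add: leaf_integral_scale_right)
  ultimately have lim0: "(\<lambda>n. LINT r:{0..1}|lborel. I r * leaf_integral r (f n) g) \<longlonglongrightarrow> 0" by simp
  have "(\<lambda>n. LINT r:{0..1}|lborel. I r * leaf_integral r (f n) g) \<longlonglongrightarrow> (LINT r:{0..1}|lborel. I r * I r)"
  proof (rule LIMSEQ_I)
    fix e :: real assume e: "0 < e"
    have e': "0 < e / (2 * (C + 1))" using e C(2) by simp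
    obtain N where N: "\<And>n r. n \<ge> N \<Longrightarrow> r \<in> {0..1} \<Longrightarrow> dist (leaf_integral r (f n) g) (I r) < e / (2 * (C + 1))"
      using uniform_limitD[OF I e'] unfolding eventually_sequentially by blast
    show "\<exists>no. \<forall>n\<ge>no. norm ((LINT r:{0..1}|lborel. I r * leaf_integral r (f n) g) - (LINT r:{0..1}|lborel. I r * I r)) < e"
    proof (intro exI[of _ N] allI impI)
      fix n assume n: "N \<le> n"
      have si: "set_integrable lborel {0..1} (\<lambda>r. I r * h r)" if "continuous_on {0..1} h" for h
        unfolding set_integrable_def using contI that by (intro borel_integrable_compact continuous_intros) auto
      have "(LINT r:{0..1}|lborel. I r * leaf_integral r (f n) g) - (LINT r:{0..1}|lborel. I r * I r)
          = (LINT r:{0..1}|lborel. I r * leaf_integral r (f n) g - I r * I r)"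
        by (rule set_integral_diff(2)[symmetric, OF si[OF contn] si[OF contI]])
      also have "\<bar>\<dots>\<bar> \<le> C * (e / (2 * (C + 1)))"
      proof (rule set_integral_unit_bound)
        fix r :: real assume r: "r \<in> {0..1}"
        have "\<bar>I r\<bar> * \<bar>leaf_integral r (f n) g - I r\<bar> \<le> C * (e / (2 * (C + 1)))"
          using N[OF n r] C r e by (intro mult_mono) (auto simp: dist_real_def)
        then show "\<bar>I r * leaf_integral r (f n) g - I r * I r\<bar> \<le> C * (e / (2 * (C + 1)))"
          by (simp add: abs_mult[symmetric] right_diff_distrib)
      qed
      also have "\<dots> \<le> (C + 1) * (e / (2 * (C + 1)))" using e C(2) by (intro mult_right_mono) auto
      also have "\<dots> = e / 2" using C(2) by (simp add: field_simps)
      also have "\<dots> < e" using e by simp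
      finally show "norm ((LINT r:{0..1}|lborel. I r * leaf_integral r (f n) g) - (LINT r:{0..1}|lborel. I r * I r)) < e"
        by simp
    qed
  qed
  from LIMSEQ_unique[OF this lim0] have "I s = 0" by (rule set_integral_square_zero_imp[OF contI _ s])
  moreover have "(\<lambda>n. leaf_integral s (f n) g) \<longlonglongrightarrow> I s" by (rule tendsto_uniform_limitI[OF I s])
  ultimately show ?thesis by simp
qed

text \<open>Test functions are limits of Lipschitz functions and the norms of a Cauchy sequence are
  bounded, so the error of the approximation is small uniformly in \<open>n\<close>.\<close>

lemma leaf_integral_null:
  assumes f: "strong_Cauchy \<alpha> \<beta> f" and null: "\<And>\<phi>. \<phi> \<in> C1_stable \<Longrightarrow> (\<lambda>n. pairing (f n) \<phi>) \<longlonglongrightarrow> 0"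
    and g: "g \<in> holder_leaf \<alpha>" and s: "s \<in> {0..1}"
  shows "(\<lambda>n. leaf_integral s (f n) g) \<longlonglongrightarrow> 0"
proof (rule LIMSEQ_I)
  fix e :: real assume e: "0 < e"
  note u = strong_Cauchy_unstable[OF f]
  obtain S where S: "\<And>n. strong (f n) \<le> S" using strong_Cauchy_bounded[OF f] by blast
  have S0: "0 \<le> S" using S[of 0] strong_norm_nonneg[OF u, of 0] by simp
  \<comment> \<open>With norms at most \<open>S\<close> and an approximation within \<open>d\<close>
    in both components, the error is at most \<open>2 * d * S\<close>, hence at most
    \<open>e / 2\<close>.\<close>
  define d where "d = e / (4 * (S + 1))"
  have d: "0 < d" using e S0 by (simp add: d_def)
  obtain h where h: "h \<in> lipschitz_leaf" "holder_bounds \<alpha> (\<lambda>t. g t - h t) d d"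
    using g d unfolding holder_leaf_iff by blast
  obtain A H where hAH: "holder_bounds 1 h A H" using h(1) unfolding lipschitz_leaf_iff by blast
  note ch = holder_bounds_continuous1[OF hAH]
  have gh: "(\<lambda>t. g t - h t) \<in> holder_leaf \<alpha>" unfolding holder_leaf_iff
  proof (intro allI impI)
    fix e' :: real assume "0 < e'"
    then obtain k where k: "k \<in> lipschitz_leaf" "holder_bounds \<alpha> (\<lambda>t. g t - k t) e' e'"
      using g unfolding holder_leaf_iff by blast
    obtain A' H' where "holder_bounds 1 k A' H'" using k(1) unfolding lipschitz_leaf_iff by blast
    from holder_bounds_diff[OF this hAH] have "(\<lambda>t. k t - h t) \<in> lipschitz_leaf" unfolding lipschitz_leaf_iff by blast
    moreover have "holder_bounds \<alpha> (\<lambda>t. g t - h t - (k t - h t)) e' e'" using k(2) by simp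
    ultimately show "\<exists>k\<in>lipschitz_leaf. holder_bounds \<alpha> (\<lambda>t. g t - h t - k t) e' e'"
      by (intro bexI[of _ "\<lambda>t. k t - h t"])
  qed
  have "(\<lambda>n. leaf_integral s (f n) h) \<longlonglongrightarrow> 0" by (rule leaf_integral_null_lipschitz[OF f null hAH s])
  then obtain N where N: "\<And>n. n \<ge> N \<Longrightarrow> norm (leaf_integral s (f n) h - 0) < e / 2"
    using LIMSEQ_D[of _ 0 "e / 2"] e by (meson half_gt_zero)
  show "\<exists>no. \<forall>n\<ge>no. norm (leaf_integral s (f n) g - 0) < e"
  proof (intro exI[of _ N] allI impI)
    fix n assume n: "N \<le> n"
    have "leaf_integral s (f n) g = leaf_integral s (f n) (\<lambda>t. h t + (g t - h t))" by simp
    also have "\<dots> = leaf_integral s (f n) h + leaf_integral s (f n) (\<lambda>t. g t - h t)"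
      by (rule leaf_integral_add_right[OF u s ch holder_leaf_cont[OF gh]])
    finally have eq: "leaf_integral s (f n) g = leaf_integral s (f n) h + leaf_integral s (f n) (\<lambda>t. g t - h t)" .
    have "\<bar>leaf_integral s (f n) (\<lambda>t. g t - h t)\<bar> \<le> stable (f n) * (d + d)"
      by (rule stable_norm_upper[OF u s gh h(2)])
    also have "\<dots> \<le> S * (d + d)"
      using d order_trans[OF stable_le_strong[OF u] S] by (intro mult_right_mono) auto
    also have "\<dots> \<le> (S + 1) * (d + d)" using d by (intro mult_right_mono) auto
    also have "\<dots> = 4 * (S + 1) * d / 2" by (simp add: algebra_simps)
    also have "4 * (S + 1) * d = e" unfolding d_def using S0 by simp
    finally show "norm (leaf_integral s (f n) g - 0) < e"
      using N[OF n] unfolding eq by simp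
  qed
qed

text \<open>Convergence of the single leaf integrals is a priori not uniform in the test function.
  Fixing \<open>n\<close> and letting \<open>m\<close> tend to infinity in the Cauchy estimate for
  \<open>f n - f m\<close> makes it uniform: the contribution of \<open>f m\<close> disappears and a
  bound for \<open>f n\<close> alone remains.\<close>

lemma strong_norm_null:
  assumes f: "strong_Cauchy \<alpha> \<beta> f" and null: "\<And>\<phi>. \<phi> \<in> C1_stable \<Longrightarrow> (\<lambda>n. pairing (f n) \<phi>) \<longlonglongrightarrow> 0"
  shows "(\<lambda>n. strong (f n)) \<longlonglongrightarrow> 0"
proof (rule LIMSEQ_I)
  fix e :: real assume e: "0 < e"
  note u = strong_Cauchy_unstable[OF f]
  have e4: "0 < e / 4" using e by simp
  obtain K where K: "\<And>m n. m \<ge> K \<Longrightarrow> n \<ge> K \<Longrightarrow> strong (\<lambda>x. f m x - f n x) < e / 4"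
    using strong_CauchyE[OF f e4] by blast
  have *: "strong (f n) \<le> e / 2" if n: "n \<ge> K" for n
  proof -
    have "stable (f n) \<le> e / 4"
    proof (rule stable_norm_least)
      fix s :: real and g A H assume g: "s \<in> {0..1}" "g \<in> holder_leaf \<alpha>" "holder_bounds \<alpha> g A H" "A + H \<le> 1"
      have "leaf_integral s (f n) g - leaf_integral s (f m) g \<le> e / 4" if "m \<ge> K" for m
      proof -
        have "leaf_integral s (f n) g - leaf_integral s (f m) g = leaf_integral s (\<lambda>x. f n x - f m x) g"
          by (rule leaf_integral_diff_left[OF u u g(1) holder_leaf_cont[OF g(2)], symmetric])
        also have "\<dots> \<le> stable (\<lambda>x. f n x - f m x) * (A + H)"
          using stable_norm_upper[OF C1_unstable_diff[OF u u] g(1-3), of n m] by simp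
        also have "\<dots> \<le> strong (\<lambda>x. f n x - f m x) * 1"
          using holder_boundsD(1,2)[OF g(3)]
          by (intro mult_mono stable_le_strong C1_unstable_diff u g(4) strong_norm_nonneg) auto
        also have "\<dots> \<le> e / 4" using K[OF n that] by simp
        finally show ?thesis .
      qed
      moreover have "(\<lambda>m. leaf_integral s (f n) g - leaf_integral s (f m) g) \<longlonglongrightarrow> leaf_integral s (f n) g - 0"
        by (intro tendsto_diff tendsto_const leaf_integral_null[OF f null] g)
      ultimately show "leaf_integral s (f n) g \<le> e / 4"
        using LIMSEQ_le_const2[of "\<lambda>m. leaf_integral s (f n) g - leaf_integral s (f m) g" _ "e / 4"] by auto
    qed
    moreover have "unstable (f n) \<le> e / 4"
    proof (rule unstable_norm_least)
      show "0 \<le> e / 4" using e by simp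
      fix s s' :: real and g A H
      assume g: "s \<in> {0..1}" "s' \<in> {0..1}" "s \<noteq> s'" "holder_bounds 1 g A H" "A + H \<le> 1"
      note cg = holder_bounds_continuous1[OF g(4)]
      let ?D = "\<lambda>m. leaf_integral s (f m) g - leaf_integral s' (f m) g"
      have "\<bar>?D n - ?D m\<bar> \<le> e / 4 * \<bar>s - s'\<bar> powr \<beta>" if "m \<ge> K" for m
      proof -
        have "?D n - ?D m = leaf_integral s (\<lambda>x. f n x - f m x) g - leaf_integral s' (\<lambda>x. f n x - f m x) g"
          unfolding leaf_integral_diff_left[OF u u g(1) cg] leaf_integral_diff_left[OF u u g(2) cg] by simp
        also have "\<bar>\<dots>\<bar> \<le> unstable (\<lambda>x. f n x - f m x) * (A + H) * \<bar>s - s'\<bar> powr \<beta>"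
          by (rule unstable_norm_upper[OF C1_unstable_diff[OF u u] g(1,2,4)])
        also have "\<dots> \<le> (strong (\<lambda>x. f n x - f m x) * 1) * \<bar>s - s'\<bar> powr \<beta>"
          using holder_boundsD(1,2)[OF g(4)]
          by (intro mult_right_mono mult_mono unstable_le_strong C1_unstable_diff u g(5) strong_norm_nonneg) auto
        also have "\<dots> \<le> e / 4 * \<bar>s - s'\<bar> powr \<beta>"
          using K[OF n that] by (intro mult_right_mono) auto
        finally show ?thesis .
      qed
      moreover have "(\<lambda>m. \<bar>?D n - ?D m\<bar>) \<longlonglongrightarrow> \<bar>?D n - (0 - 0)\<bar>"
        by (intro tendsto_intros leaf_integral_null_lipschitz[OF f null g(4)] g)
      ultimately show "\<bar>?D n\<bar> \<le> e / 4 * \<bar>s - s'\<bar> powr \<beta>"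
        using LIMSEQ_le_const2[of "\<lambda>m. \<bar>?D n - ?D m\<bar>" "\<bar>?D n\<bar>" "e / 4 * \<bar>s - s'\<bar> powr \<beta>"] by auto
    qed
    ultimately show ?thesis unfolding strong_norm_def by simp
  qed
  show "\<exists>no. \<forall>n\<ge>no. norm (strong (f n) - 0) < e"
  proof (intro exI[of _ K] allI impI)
    fix n assume n: "K \<le> n"
    show "norm (strong (f n) - 0) < e" using *[OF n] strong_norm_nonneg[OF u, of n] e by simp
  qed
qed

end

section \<open>The Banach space\<close>

definition density_functional :: "(point \<Rightarrow> real) \<Rightarrow> functional"
  where "density_functional f = (\<lambda>\<phi>. if \<phi> \<in> C1_stable then pairing f \<phi> else 0)"

lemma approximates_iff:
  "approximates f F \<longleftrightarrow> (\<forall>\<phi>\<in>C1_stable. (\<lambda>n. pairing (f n) \<phi>) \<longlonglongrightarrow> F \<phi>) \<and> (\<forall>\<phi>. \<phi> \<notin> C1_stable \<longrightarrow> F \<phi> = 0)"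
  unfolding approximates_def pairing_def ..

lemma approximatesD:
  assumes "approximates f F"
  shows "\<phi> \<in> C1_stable \<Longrightarrow> (\<lambda>n. pairing (f n) \<phi>) \<longlonglongrightarrow> F \<phi>" "\<phi> \<notin> C1_stable \<Longrightarrow> F \<phi> = 0"
  using assms unfolding approximates_iff by blast+

lemma approximates_density_functional: "approximates (\<lambda>n. f) (density_functional f)"
  unfolding approximates_iff density_functional_def by simp

context holder_exponents
begin

lemma strong_Cauchy_lincomb:
  assumes f: "strong_Cauchy \<alpha> \<beta> f" and g: "strong_Cauchy \<alpha> \<beta> g"
  shows "strong_Cauchy \<alpha> \<beta> (\<lambda>n x. a * f n x + c * g n x)"
  unfolding strong_Cauchy_def
proof (intro conjI allI impI)
  note uf = strong_Cauchy_unstable[OF f] and ug = strong_Cauchy_unstable[OF g]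
  show "(\<lambda>x. a * f n x + c * g n x) \<in> C1_unstable" for n by (rule C1_unstable_lincomb[OF uf ug])
  fix e :: real assume e: "0 < e"
  define d where "d = e / (\<bar>a\<bar> + \<bar>c\<bar> + 1)"
  have d: "0 < d" using e by (simp add: d_def)
  obtain K where K: "\<And>m n. m \<ge> K \<Longrightarrow> n \<ge> K \<Longrightarrow> strong (\<lambda>x. f m x - f n x) < d"
    using strong_CauchyE[OF f d] by blast
  obtain K' where K': "\<And>m n. m \<ge> K' \<Longrightarrow> n \<ge> K' \<Longrightarrow> strong (\<lambda>x. g m x - g n x) < d"
    using strong_CauchyE[OF g d] by blast
  show "\<exists>K. \<forall>m\<ge>K. \<forall>n\<ge>K. strong (\<lambda>x. (a * f m x + c * g m x) - (a * f n x + c * g n x)) < e"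
  proof (intro exI[of _ "max K K'"] allI impI)
    fix m n assume *: "max K K' \<le> m" "max K K' \<le> n"
    have "strong (\<lambda>x. (a * f m x + c * g m x) - (a * f n x + c * g n x))
        = strong (\<lambda>x. a * (f m x - f n x) + c * (g m x - g n x))" by (simp add: algebra_simps)
    also have "\<dots> \<le> \<bar>a\<bar> * strong (\<lambda>x. f m x - f n x) + \<bar>c\<bar> * strong (\<lambda>x. g m x - g n x)"
      by (intro strong_norm_lincomb C1_unstable_diff uf ug)
    also have "\<dots> \<le> \<bar>a\<bar> * d + \<bar>c\<bar> * d"
      using K[of m n] K'[of m n] * by (intro add_mono mult_left_mono) auto
    also have "\<dots> < (\<bar>a\<bar> + \<bar>c\<bar> + 1) * d" using d by (simp add: algebra_simps)
    also have "\<dots> = e" by (simp add: d_def)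
    finally show "strong (\<lambda>x. (a * f m x + c * g m x) - (a * f n x + c * g n x)) < e" .
  qed
qed

lemma strong_Cauchy_const:
  assumes "f \<in> C1_unstable" shows "strong_Cauchy \<alpha> \<beta> (\<lambda>n. f)"
  unfolding strong_Cauchy_def using assms by (simp add: strong_norm_zero)

lemma approximates_lincomb:
  assumes f: "strong_Cauchy \<alpha> \<beta> f" "approximates f F" and g: "strong_Cauchy \<alpha> \<beta> g" "approximates g G"
  shows "approximates (\<lambda>n x. a * f n x + c * g n x) (\<lambda>\<phi>. a * F \<phi> + c * G \<phi>)"
  unfolding approximates_iff
proof (intro conjI ballI allI impI)
  fix \<phi> assume p: "\<phi> \<in> C1_stable"
  have "(\<lambda>n. a * pairing (f n) \<phi> + c * pairing (g n) \<phi>) \<longlonglongrightarrow> a * F \<phi> + c * G \<phi>"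
    by (intro tendsto_intros approximatesD(1)[OF f(2)] approximatesD(1)[OF g(2)] p)
  then show "(\<lambda>n. pairing (\<lambda>x. a * f n x + c * g n x) \<phi>) \<longlonglongrightarrow> a * F \<phi> + c * G \<phi>"
    unfolding pairing_lincomb[OF strong_Cauchy_unstable[OF f(1)] strong_Cauchy_unstable[OF g(1)] p] .
next
  fix \<phi> :: "point \<Rightarrow> real" assume p: "\<phi> \<notin> C1_stable"
  then show "a * F \<phi> + c * G \<phi> = 0" using approximatesD(2)[OF f(2) p] approximatesD(2)[OF g(2) p] by simp
qed

lemma strong_Cauchy_convergent_norm:
  assumes "strong_Cauchy \<alpha> \<beta> f" shows "convergent (\<lambda>n. strong (f n))"
proof (rule Cauchy_convergent, rule metric_CauchyI)
  fix e :: real assume e: "0 < e"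
  note u = strong_Cauchy_unstable[OF assms]
  obtain K where K: "\<And>m n. m \<ge> K \<Longrightarrow> n \<ge> K \<Longrightarrow> strong (\<lambda>x. f m x - f n x) < e"
    using strong_CauchyE[OF assms e] by blast
  show "\<exists>M. \<forall>m\<ge>M. \<forall>n\<ge>M. dist (strong (f m)) (strong (f n)) < e"
    unfolding dist_real_def
    by (intro exI[of _ K] allI impI, rule le_less_trans[OF strong_norm_reverse_triangle[OF u u] K])
qed

text \<open>Two sequences with the same limit functional differ by a Cauchy sequence with limit
  functional 0, which is null in norm. Hence the description defining the norm has exactly one
  solution, and every representing sequence computes it.\<close>

lemma B_norm_tendsto:
  assumes f: "strong_Cauchy \<alpha> \<beta> f" "approximates f F"
  shows "(\<lambda>n. strong (f n)) \<longlonglongrightarrow> N F"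
proof -
  obtain r where r: "(\<lambda>n. strong (f n)) \<longlonglongrightarrow> r"
    using strong_Cauchy_convergent_norm[OF f(1)] unfolding convergent_def by blast
  have "N F = r" unfolding B_norm_def
  proof (rule the_equality)
    show "\<exists>f. strong_Cauchy \<alpha> \<beta> f \<and> approximates f F \<and> (\<lambda>n. strong (f n)) \<longlonglongrightarrow> r"
      using f r by blast
    fix r' assume "\<exists>g. strong_Cauchy \<alpha> \<beta> g \<and> approximates g F \<and> (\<lambda>n. strong (g n)) \<longlonglongrightarrow> r'"
    then obtain g where g: "strong_Cauchy \<alpha> \<beta> g" "approximates g F" "(\<lambda>n. strong (g n)) \<longlonglongrightarrow> r'" by blast
    note uf = strong_Cauchy_unstable[OF f(1)] and ug = strong_Cauchy_unstable[OF g(1)]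
    have d: "strong_Cauchy \<alpha> \<beta> (\<lambda>n x. f n x - g n x)"
      using strong_Cauchy_lincomb[OF f(1) g(1), of 1 "-1"] by simp
    have "approximates (\<lambda>n x. f n x - g n x) (\<lambda>\<phi>. F \<phi> - F \<phi>)"
      using approximates_lincomb[OF f g(1,2), of 1 "-1"] by simp
    then have "(\<lambda>n. pairing (\<lambda>x. f n x - g n x) \<phi>) \<longlonglongrightarrow> 0" if "\<phi> \<in> C1_stable" for \<phi>
      using approximatesD(1)[OF _ that] by fastforce
    then have null: "(\<lambda>n. strong (\<lambda>x. f n x - g n x)) \<longlonglongrightarrow> 0" by (rule strong_norm_null[OF d])
    have "(\<lambda>n. strong (f n) - strong (g n)) \<longlonglongrightarrow> 0"
    proof (rule Lim_null_comparison[OF always_eventually null], rule allI)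
      fix n show "norm (strong (f n) - strong (g n)) \<le> strong (\<lambda>x. f n x - g n x)"
        unfolding real_norm_def by (rule strong_norm_reverse_triangle[OF uf ug])
    qed
    moreover have "(\<lambda>n. strong (f n) - strong (g n)) \<longlonglongrightarrow> r - r'"
      by (rule tendsto_diff[OF r g(3)])
    ultimately have "r - r' = 0" using LIMSEQ_unique by blast
    then show "r' = r" by simp
  qed
  with r show ?thesis by simp
qed

text \<open>Pairing with a fixed test function is bounded by the strong norm, so the pairings form a
  Cauchy sequence of reals.\<close>

lemma strong_Cauchy_approximates:
  assumes f: "strong_Cauchy \<alpha> \<beta> f"
  obtains F where "approximates f F"
proof -
  note u = strong_Cauchy_unstable[OF f]
  have conv: "convergent (\<lambda>n. pairing (f n) \<phi>)" if p: "\<phi> \<in> C1_stable" for \<phi>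
  proof (rule Cauchy_convergent, rule metric_CauchyI)
    fix e :: real assume e: "0 < e"
    obtain A H where A: "\<phi> \<in> borel_measurable borel_square" "0 \<le> A" "0 \<le> H"
      "\<And>s. s \<in> {0..1} \<Longrightarrow> holder_bounds 1 (\<lambda>t. \<phi> (s, t)) A H" using C1_stableE[OF p] by blast
    have d: "0 < e / (A + H + 1)" using A e by simp
    obtain K where K: "\<And>m n. m \<ge> K \<Longrightarrow> n \<ge> K \<Longrightarrow> strong (\<lambda>x. f m x - f n x) < e / (A + H + 1)"
      using strong_CauchyE[OF f d] by blast
    show "\<exists>M. \<forall>m\<ge>M. \<forall>n\<ge>M. dist (pairing (f m) \<phi>) (pairing (f n) \<phi>) < e"
    proof (intro exI[of _ K] allI impI)
      fix m n assume mn: "K \<le> m" "K \<le> n"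
      have "dist (pairing (f m) \<phi>) (pairing (f n) \<phi>) = \<bar>pairing (\<lambda>x. f m x - f n x) \<phi>\<bar>"
        unfolding pairing_diff[OF u u p] dist_real_def ..
      also have "\<dots> \<le> strong (\<lambda>x. f m x - f n x) * (A + H)"
        by (rule pairing_bound[OF C1_unstable_diff[OF u u] p A(4)])
      also have "\<dots> \<le> e / (A + H + 1) * (A + H)"
        using K[OF mn] A by (intro mult_right_mono) auto
      also have "\<dots> < e / (A + H + 1) * (A + H + 1)" using d by (intro mult_strict_left_mono) auto
      also have "\<dots> = e" using A by simp
      finally show "dist (pairing (f m) \<phi>) (pairing (f n) \<phi>) < e" .
    qed
  qed
  have "approximates f (\<lambda>\<phi>. if \<phi> \<in> C1_stable then lim (\<lambda>n. pairing (f n) \<phi>) else 0)"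
    unfolding approximates_iff using conv by (simp add: convergent_LIMSEQ_iff)
  then show thesis by (rule that)
qed

lemma banach_BI: "strong_Cauchy \<alpha> \<beta> f \<Longrightarrow> approximates f F \<Longrightarrow> F \<in> B"
  unfolding banach_B_def by blast

lemma banach_BE:
  assumes "F \<in> B"
  obtains f where "strong_Cauchy \<alpha> \<beta> f" "approximates f F"
  using assms unfolding banach_B_def by blast

lemma density_functional_in_B: "f \<in> C1_unstable \<Longrightarrow> density_functional f \<in> B"
  by (rule banach_BI[OF strong_Cauchy_const approximates_density_functional])

lemma B_norm_density_functional:
  assumes "f \<in> C1_unstable" shows "N (density_functional f) = strong f"
  using B_norm_tendsto[OF strong_Cauchy_const[OF assms] approximates_density_functional]
  by (simp add: LIMSEQ_const_iff)

text \<open>Inherited from the densities through representing sequences. As for densities, the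
  triangle inequality and symmetry follow by choosing coefficients.\<close>

lemma banach_B_lincomb:
  assumes "F \<in> B" "G \<in> B"
  shows "(\<lambda>\<phi>. a * F \<phi> + c * G \<phi>) \<in> B"
    and "N (\<lambda>\<phi>. a * F \<phi> + c * G \<phi>) \<le> \<bar>a\<bar> * N F + \<bar>c\<bar> * N G"
proof -
  obtain f where f: "strong_Cauchy \<alpha> \<beta> f" "approximates f F" using banach_BE[OF assms(1)] by blast
  obtain g where g: "strong_Cauchy \<alpha> \<beta> g" "approximates g G" using banach_BE[OF assms(2)] by blast
  note l = strong_Cauchy_lincomb[OF f(1) g(1)] approximates_lincomb[OF f g]
  show "(\<lambda>\<phi>. a * F \<phi> + c * G \<phi>) \<in> B" by (rule banach_BI[OF l])
  show "N (\<lambda>\<phi>. a * F \<phi> + c * G \<phi>) \<le> \<bar>a\<bar> * N F + \<bar>c\<bar> * N G"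
  proof (rule LIMSEQ_le[OF B_norm_tendsto[OF l]])
    show "(\<lambda>n. \<bar>a\<bar> * strong (f n) + \<bar>c\<bar> * strong (g n))
        \<longlonglongrightarrow> \<bar>a\<bar> * N F + \<bar>c\<bar> * N G"
      by (intro tendsto_intros B_norm_tendsto f g)
    show "\<exists>N. \<forall>n\<ge>N. strong (\<lambda>x. a * f n x + c * g n x) \<le> \<bar>a\<bar> * strong (f n) + \<bar>c\<bar> * strong (g n)"
      by (intro exI[of _ 0] allI impI strong_norm_lincomb strong_Cauchy_unstable[OF f(1)] strong_Cauchy_unstable[OF g(1)])
  qed
qed

lemma banach_B_zero: "(\<lambda>\<phi>. 0) \<in> B"
  using density_functional_in_B[OF C1_unstable_const, of 0]
    banach_B_lincomb(1)[of "density_functional (\<lambda>x. 0)" "density_functional (\<lambda>x. 0)" 0 0] by simp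

lemma banach_B_diff:
  assumes "F \<in> B" "G \<in> B"
  shows "(\<lambda>\<phi>. F \<phi> - G \<phi>) \<in> B"
  using banach_B_lincomb(1)[OF assms, of 1 "-1"] by simp

lemma B_norm_nonneg:
  assumes "F \<in> B" shows "0 \<le> N F"
proof -
  obtain f where f: "strong_Cauchy \<alpha> \<beta> f" "approximates f F" using banach_BE[OF assms(1)] by blast
  show ?thesis
    by (rule LIMSEQ_le_const[OF B_norm_tendsto[OF f]])
      (intro exI[of _ 0] allI impI strong_norm_nonneg strong_Cauchy_unstable[OF f(1)])
qed

lemma B_norm_diff_le:
  assumes "F \<in> B" "G \<in> B"
  shows "N (\<lambda>\<phi>. F \<phi> - G \<phi>) \<le> N F + N G"
  using banach_B_lincomb(2)[OF assms, of 1 "-1"] by simp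

lemma B_norm_triangle:
  assumes "F \<in> B" "G \<in> B" "H \<in> B"
  shows "N (\<lambda>\<phi>. F \<phi> - H \<phi>) \<le> N (\<lambda>\<phi>. F \<phi> - G \<phi>) + N (\<lambda>\<phi>. G \<phi> - H \<phi>)"
  using banach_B_lincomb(2)[OF banach_B_diff[OF assms(1,2)] banach_B_diff[OF assms(2,3)], of 1 1] by simp

lemma B_norm_diff_commute:
  assumes "F \<in> B" "G \<in> B"
  shows "N (\<lambda>\<phi>. F \<phi> - G \<phi>) = N (\<lambda>\<phi>. G \<phi> - F \<phi>)"
  using banach_B_lincomb(2)[OF banach_B_diff[OF assms] banach_B_zero, of "-1" 0]
    banach_B_lincomb(2)[OF banach_B_diff[OF assms(2,1)] banach_B_zero, of "-1" 0] by simp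

text \<open>Evaluation at a fixed test function is continuous on the space; at the constant 1 this
  is continuity of the total mass.\<close>

lemma banach_B_eval_bound:
  assumes "F \<in> B" "\<phi> \<in> C1_stable" "\<And>s. s \<in> {0..1} \<Longrightarrow> holder_bounds 1 (\<lambda>t. \<phi> (s, t)) A H"
  shows "\<bar>F \<phi>\<bar> \<le> N F * (A + H)"
proof -
  obtain f where f: "strong_Cauchy \<alpha> \<beta> f" "approximates f F" using banach_BE[OF assms(1)] by blast
  show ?thesis
  proof (rule LIMSEQ_le)
    show "(\<lambda>n. \<bar>pairing (f n) \<phi>\<bar>) \<longlonglongrightarrow> \<bar>F \<phi>\<bar>" by (intro tendsto_rabs approximatesD(1)[OF f(2)] assms)
    show "(\<lambda>n. strong (f n) * (A + H)) \<longlonglongrightarrow> N F * (A + H)"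
      by (intro tendsto_intros B_norm_tendsto f)
    show "\<exists>N. \<forall>n\<ge>N. \<bar>pairing (f n) \<phi>\<bar> \<le> strong (f n) * (A + H)"
      by (intro exI[of _ 0] allI impI pairing_bound strong_Cauchy_unstable[OF f(1)] assms)
  qed
qed

lemma banach_B_eval_one:
  assumes "F \<in> B" shows "\<bar>F (\<lambda>_. 1)\<bar> \<le> N F"
  using banach_B_eval_bound[OF assms C1_stable_const holder_bounds_const, of 1] by simp

lemma B_norm_zero_imp:
  assumes "F \<in> B" "N F = 0" shows "F = (\<lambda>\<phi>. 0)"
proof
  fix \<phi>
  show "F \<phi> = 0"
  proof (cases "\<phi> \<in> C1_stable")
    case True
    obtain A H where A: "\<phi> \<in> borel_measurable borel_square" "0 \<le> A" "0 \<le> H"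
      "\<And>s. s \<in> {0..1} \<Longrightarrow> holder_bounds 1 (\<lambda>t. \<phi> (s, t)) A H" using C1_stableE[OF True] by blast
    show ?thesis using banach_B_eval_bound[OF assms(1) True A(4)] assms(2) by simp
  next
    case False
    then show ?thesis using banach_BE[OF assms(1)] approximatesD(2) by metis
  qed
qed

text \<open>For fixed \<open>k\<close> the sequence \<open>f n - f k\<close> represents the
  difference, so the Cauchy estimate passes to its norm in the limit.\<close>

lemma density_functional_dense:
  assumes f: "strong_Cauchy \<alpha> \<beta> f" "approximates f F" and e: "0 < e"
  shows "\<exists>n0. \<forall>k\<ge>n0. N (\<lambda>\<phi>. F \<phi> - density_functional (f k) \<phi>) < e"
proof -
  note u = strong_Cauchy_unstable[OF f(1)]
  have e2: "0 < e / 2" using e by simp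
  obtain K where K: "\<And>m n. m \<ge> K \<Longrightarrow> n \<ge> K \<Longrightarrow> strong (\<lambda>x. f m x - f n x) < e / 2"
    using strong_CauchyE[OF f(1) e2] by blast
  show ?thesis
  proof (intro exI[of _ K] allI impI)
    fix k assume k: "K \<le> k"
    have "strong_Cauchy \<alpha> \<beta> (\<lambda>n x. f n x - f k x)"
      using strong_Cauchy_lincomb[OF f(1) strong_Cauchy_const[OF u], of 1 "-1"] by simp
    moreover have "approximates (\<lambda>n x. f n x - f k x) (\<lambda>\<phi>. F \<phi> - density_functional (f k) \<phi>)"
      using approximates_lincomb[OF f strong_Cauchy_const[OF u] approximates_density_functional, of 1 "-1"] by simp
    ultimately have "(\<lambda>n. strong (\<lambda>x. f n x - f k x)) \<longlonglongrightarrow> N (\<lambda>\<phi>. F \<phi> - density_functional (f k) \<phi>)"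
      by (rule B_norm_tendsto)
    then have "N (\<lambda>\<phi>. F \<phi> - density_functional (f k) \<phi>) \<le> e / 2"
      by (rule LIMSEQ_le_const2) (intro exI[of _ K] allI impI less_imp_le[OF K] k)
    then show "N (\<lambda>\<phi>. F \<phi> - density_functional (f k) \<phi>) < e" using e by simp
  qed
qed

text \<open>Each \<open>F k\<close> is replaced by a density within \<open>1 / Suc k\<close>. The
  chosen densities form a strong Cauchy sequence, hence have a limit functional, and it is the limit
  of the \<open>F k\<close> as well. Convergence of the Neumann series depends on this.\<close>

theorem banach_B_complete:
  assumes F: "\<And>k. F k \<in> B"
    and C: "\<And>e. 0 < e \<Longrightarrow> \<exists>K. \<forall>m\<ge>K. \<forall>n\<ge>K. N (\<lambda>\<phi>. F m \<phi> - F n \<phi>) < e"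
  obtains G where "G \<in> B" "(\<lambda>k. N (\<lambda>\<phi>. F k \<phi> - G \<phi>)) \<longlonglongrightarrow> 0"
proof -
  have "\<exists>f. f \<in> C1_unstable \<and> N (\<lambda>\<phi>. F k \<phi> - density_functional f \<phi>) < 1 / Suc k" for k
  proof -
    obtain f where f: "strong_Cauchy \<alpha> \<beta> f" "approximates f (F k)" using banach_BE[OF F] by blast
    have "0 < 1 / real (Suc k)" by simp
    from density_functional_dense[OF f this] strong_Cauchy_unstable[OF f(1)] show ?thesis by blast
  qed
  then obtain f where u: "\<And>k. f k \<in> C1_unstable"
    and f: "\<And>k. N (\<lambda>\<phi>. F k \<phi> - density_functional (f k) \<phi>) < 1 / Suc k" by metis
  note d = density_functional_in_B[OF u]
  have fC: "strong_Cauchy \<alpha> \<beta> f" unfolding strong_Cauchy_def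
  proof (intro conjI allI impI u)
    fix e :: real assume e: "0 < e"
    then have e3: "0 < e / 3" by simp
    obtain K where K: "\<And>m n. m \<ge> K \<Longrightarrow> n \<ge> K \<Longrightarrow> N (\<lambda>\<phi>. F m \<phi> - F n \<phi>) < e / 3"
      using C[OF e3] by blast
    obtain K' :: nat where K': "1 / Suc K' < e / 3" using reals_Archimedean[OF e3] by (auto simp: inverse_eq_divide)
    have small: "1 / Suc m < e / 3" if "K' \<le> m" for m
      by (rule le_less_trans[OF _ K']) (use that in \<open>simp add: field_simps\<close>)
    show "\<exists>K. \<forall>m\<ge>K. \<forall>n\<ge>K. strong (\<lambda>x. f m x - f n x) < e"
    proof (intro exI[of _ "max K K'"] allI impI)
      fix m n assume *: "max K K' \<le> m" "max K K' \<le> n"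
      have df: "density_functional (\<lambda>x. f m x - f n x) = (\<lambda>\<phi>. density_functional (f m) \<phi> - density_functional (f n) \<phi>)"
        unfolding density_functional_def by (auto simp: pairing_diff[OF u u])
      have "strong (\<lambda>x. f m x - f n x) = N (\<lambda>\<phi>. density_functional (f m) \<phi> - density_functional (f n) \<phi>)"
        unfolding df[symmetric] by (rule B_norm_density_functional[OF C1_unstable_diff[OF u u], symmetric])
      also have "\<dots> \<le> N (\<lambda>\<phi>. density_functional (f m) \<phi> - F m \<phi>) + N (\<lambda>\<phi>. F m \<phi> - density_functional (f n) \<phi>)"
        by (rule B_norm_triangle[OF d F d])
      also have "N (\<lambda>\<phi>. F m \<phi> - density_functional (f n) \<phi>)
          \<le> N (\<lambda>\<phi>. F m \<phi> - F n \<phi>) + N (\<lambda>\<phi>. F n \<phi> - density_functional (f n) \<phi>)"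
        by (rule B_norm_triangle[OF F F d])
      also have "N (\<lambda>\<phi>. density_functional (f m) \<phi> - F m \<phi>) = N (\<lambda>\<phi>. F m \<phi> - density_functional (f m) \<phi>)"
        by (rule B_norm_diff_commute[OF d F])
      finally show "strong (\<lambda>x. f m x - f n x) < e"
        using f[of m] f[of n] K[of m n] small[of m] small[of n] * by simp
    qed
  qed
  obtain G where G: "approximates f G" using strong_Cauchy_approximates[OF fC] by blast
  have GB: "G \<in> B" by (rule banach_BI[OF fC G])
  have "(\<lambda>k. N (\<lambda>\<phi>. F k \<phi> - G \<phi>)) \<longlonglongrightarrow> 0"
  proof (rule LIMSEQ_I)
    fix e :: real assume e: "0 < e"
    then have e2: "0 < e / 2" by simp
    obtain K where K: "\<And>k. k \<ge> K \<Longrightarrow> N (\<lambda>\<phi>. G \<phi> - density_functional (f k) \<phi>) < e / 2"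
      using density_functional_dense[OF fC G e2] by blast
    obtain K' :: nat where K': "1 / Suc K' < e / 2" using reals_Archimedean[OF e2] by (auto simp: inverse_eq_divide)
    show "\<exists>no. \<forall>n\<ge>no. norm (N (\<lambda>\<phi>. F n \<phi> - G \<phi>) - 0) < e"
    proof (intro exI[of _ "max K K'"] allI impI)
      fix n assume n: "max K K' \<le> n"
      have small: "1 / Suc n < e / 2"
        by (rule le_less_trans[OF _ K']) (use n in \<open>simp add: field_simps\<close>)
      have "N (\<lambda>\<phi>. F n \<phi> - G \<phi>) \<le> N (\<lambda>\<phi>. F n \<phi> - density_functional (f n) \<phi>)
          + N (\<lambda>\<phi>. density_functional (f n) \<phi> - G \<phi>)" by (rule B_norm_triangle[OF F d GB])
      also have "N (\<lambda>\<phi>. density_functional (f n) \<phi> - G \<phi>) = N (\<lambda>\<phi>. G \<phi> - density_functional (f n) \<phi>)"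
        by (rule B_norm_diff_commute[OF d GB])
      finally show "norm (N (\<lambda>\<phi>. F n \<phi> - G \<phi>) - 0) < e"
        using f[of n] K[of n] small n B_norm_nonneg[OF banach_B_diff[OF F GB], of n] by simp
    qed
  qed
  with GB show thesis by (rule that)
qed

end

section \<open>The transfer operator on densities\<close>

text \<open>Only the affine branches occur here, because the operator is built from them; the map
  \<open>T\<close> itself enters in \<open>baker_system\<close>. The signs \<open>e\<close> and
  \<open>d\<close> are the horizontal and vertical orientations of the branches.\<close>

locale baker_data = holder_exponents \<alpha> \<beta> for \<alpha> \<beta> :: real +
  fixes \<kappa> :: nat and l :: real and p q e d :: "nat \<Rightarrow> real" and b :: "nat \<Rightarrow> point \<Rightarrow> point"
  assumes kappa: "2 \<le> \<kappa>" and l_pos: "0 < l" and l_le: "l \<le> 1 / real \<kappa>"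
    and orient: "\<And>i. i < \<kappa> \<Longrightarrow> e i \<in> {1, -1}" "\<And>i. i < \<kappa> \<Longrightarrow> d i \<in> {1, -1}"
    and branch: "\<And>i x y. i < \<kappa> \<Longrightarrow> b i (x, y) = (p i + e i * real \<kappa> * x, q i + d i * l * y)"
    and branch_into: "\<And>i. i < \<kappa> \<Longrightarrow> b i ` rectangle \<kappa> i \<subseteq> square"
begin

section \<open>Branches, their inverses and the change of variables\<close>

abbreviation \<Lambda> :: "point \<Rightarrow> point" where "\<Lambda> \<equiv> leafwise \<kappa> b"

text \<open>\<open>X i s\<close> is the abscissa of the leaf that branch \<open>i\<close> maps into
  the leaf at \<open>s\<close>, \<open>V i\<close> is the map between their ordinates and
  \<open>W i\<close> its inverse on the whole line. So \<open>W i y\<close> lies in the unit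
  interval exactly if \<open>y\<close> lies in the image strip of branch \<open>i\<close>. Writing
  \<open>X\<close> as a constant plus a multiple of \<open>s\<close> matches the rule for affine
  substitutions.\<close>

definition X :: "nat \<Rightarrow> real \<Rightarrow> real" where "X i s = - p i / (e i * \<kappa>) + 1 / (e i * \<kappa>) * s"
definition V :: "nat \<Rightarrow> real \<Rightarrow> real" where "V i t = q i + d i * l * t"
definition W :: "nat \<Rightarrow> real \<Rightarrow> real" where "W i y = (y - q i) / (d i * l)"

lemma kappa_pos: "0 < real \<kappa>" using kappa by simp

lemma l_less_1: "l < 1"
proof -
  have "1 / real \<kappa> < 1" using kappa by simp
  then show ?thesis using l_le by simp
qed

lemma abs_orient: "i < \<kappa> \<Longrightarrow> \<bar>e i\<bar> = 1" "i < \<kappa> \<Longrightarrow> \<bar>d i\<bar> = 1"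
  using orient by fastforce+

lemma branch_range:
  assumes "i < \<kappa>" "x \<in> {real i / \<kappa> .. real (Suc i) / \<kappa>}" "y \<in> {0..1}"
  shows "p i + e i * \<kappa> * x \<in> {0..1}" "V i y \<in> {0..1}"
proof -
  have "(x, y) \<in> rectangle \<kappa> i" using assms by (auto simp: rectangle_def)
  then have "b i (x, y) \<in> square" using branch_into[OF assms(1)] by blast
  then show "p i + e i * \<kappa> * x \<in> {0..1}" "V i y \<in> {0..1}"
    unfolding branch[OF assms(1)] V_def square_iff by blast+
qed

lemma V_unit: "i < \<kappa> \<Longrightarrow> y \<in> {0..1} \<Longrightarrow> V i y \<in> {0..1}"
  by (rule branch_range(2)[of i "real i / \<kappa>"]) (auto intro: divide_right_mono)

text \<open>
  A branch maps an interval of length \<open>1 / \<kappa>\<close> into the unit interval with slope \<open>\<plusminus>\<kappa>\<close>, so it is onto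
  and its offset is forced.
\<close>

lemma offset:
  assumes "i < \<kappa>"
  shows "e i = 1 \<and> p i = - real i \<or> e i = -1 \<and> p i = real i + 1"
proof -
  have 1: "p i + e i * \<kappa> * (real i / \<kappa>) \<in> {0..1}"
    by (rule branch_range(1)[OF assms, of _ 0]) (auto intro: divide_right_mono)
  have 2: "p i + e i * \<kappa> * (real (Suc i) / \<kappa>) \<in> {0..1}"
    by (rule branch_range(1)[OF assms, of _ 0]) (auto intro: divide_right_mono)
  have "p i + e i * real i \<in> {0..1}" "p i + e i * (real i + 1) \<in> {0..1}"
    using 1 2 kappa_pos by (simp_all add: add.commute)
  then show ?thesis using orient(1)[OF assms] by auto
qed

lemma X_inverse: "i < \<kappa> \<Longrightarrow> p i + e i * \<kappa> * X i s = s"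
  using kappa_pos orient(1)[of i] by (auto simp: X_def field_simps)

lemma X_iff:
  assumes "i < \<kappa>"
  shows "X i s \<in> {real i / \<kappa> .. real (Suc i) / \<kappa>} \<longleftrightarrow> s \<in> {0..1}"
    and "X i s \<in> {real i / \<kappa> <..< real (Suc i) / \<kappa>} \<longleftrightarrow> s \<in> {0<..<1}"
  using offset[OF assms] kappa_pos by (auto simp: X_def field_simps)

lemma X_unit:
  assumes "i < \<kappa>" "s \<in> {0..1}" shows "X i s \<in> {0..1}"
proof -
  have "X i s \<in> {real i / \<kappa> .. real (Suc i) / \<kappa>}" using X_iff(1)[OF assms(1)] assms(2) by blast
  moreover have "real (Suc i) / \<kappa> \<le> 1" using assms(1) kappa_pos by (simp add: divide_le_eq)
  moreover have "0 \<le> real i / \<kappa>" by simp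
  ultimately show ?thesis by (meson atLeastAtMost_iff order_trans)
qed

lemma X_dist:
  assumes "i < \<kappa>" shows "\<bar>X i s - X i s'\<bar> = \<bar>s - s'\<bar> / \<kappa>"
proof -
  have "X i s - X i s' = 1 / (e i * \<kappa>) * (s - s')" by (simp add: X_def diff_divide_distrib)
  then show ?thesis using abs_orient(1)[OF assms] kappa_pos by (simp add: abs_mult)
qed

lemma W_V: "i < \<kappa> \<Longrightarrow> W i (V i t) = t"
  using l_pos abs_orient(2)[of i] by (auto simp: W_def V_def)

lemma holder_bounds_V:
  assumes "i < \<kappa>" "holder_bounds a g A H"
  shows "holder_bounds a (\<lambda>t. g (V i t)) A (H * l powr a)"
proof -
  have "\<bar>d i * l\<bar> = l" using abs_orient(2)[OF assms(1)] l_pos by (simp add: abs_mult)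
  then show ?thesis
    using holder_bounds_affine[OF assms(2), of "q i" "d i * l"] V_unit[OF assms(1)] unfolding V_def by simp
qed

lemma holder_bounds_V_le:
  assumes "i < \<kappa>" "holder_bounds a g A H" "0 \<le> a"
  shows "holder_bounds a (\<lambda>t. g (V i t)) A H"
proof (rule holder_bounds_mono[OF holder_bounds_V[OF assms(1,2)] order_refl])
  have "l powr a \<le> 1" using l_pos l_less_1 assms(3) by (intro powr_le1) auto
  then show "H * l powr a \<le> H" using holder_boundsD(2)[OF assms(2)] by (intro mult_left_le)
qed

lemma holder_leaf_V:
  assumes "i < \<kappa>" "g \<in> holder_leaf a" "0 \<le> a"
  shows "(\<lambda>t. g (V i t)) \<in> holder_leaf a"
proof -
  have "\<bar>d i * l\<bar> \<le> 1" using abs_orient(2)[OF assms(1)] l_pos l_less_1 by (simp add: abs_mult)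
  then show ?thesis
    using holder_leaf_affine[OF assms(2), of "q i" "d i * l"] V_unit[OF assms(1)] assms(3) unfolding V_def by simp
qed

lemma continuous_V:
  assumes "i < \<kappa>" "continuous_on {0..1} g" shows "continuous_on {0..1} (\<lambda>t. g (V i t))"
proof (rule continuous_on_compose2[OF assms(2)])
  show "continuous_on {0..1} (V i)" unfolding V_def by (intro continuous_intros)
  show "V i ` {0..1} \<subseteq> {0..1}" using V_unit[OF assms(1)] by blast
qed

text \<open>Neighbouring closed intervals share an endpoint, which the sum counts twice. The
  identity holds off the finite grid, and that is enough under an integral.\<close>

lemma sum_grid_indicator:
  fixes G :: "real \<Rightarrow> real"
  assumes "x \<notin> (\<lambda>i::nat. real i / \<kappa>) ` {..\<kappa>}"
  shows "(\<Sum>i<\<kappa>. indicator {real i / \<kappa> .. real (Suc i) / \<kappa>} x *\<^sub>R G x) = indicator {0..1} x *\<^sub>R G x"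
proof (cases "x \<in> {0..1}")
  case False
  have "x \<notin> {real i / \<kappa> .. real (Suc i) / \<kappa>}" if "i < \<kappa>" for i
  proof
    assume *: "x \<in> {real i / \<kappa> .. real (Suc i) / \<kappa>}"
    have "real (Suc i) / \<kappa> \<le> 1" using that kappa_pos by (simp add: divide_le_eq)
    moreover have "0 \<le> real i / \<kappa>" by simp
    ultimately have "x \<in> {0..1}" using * by (meson atLeastAtMost_iff order_trans)
    with False show False by simp
  qed
  with False show ?thesis by simp
next
  case True
  define j where "j = nat \<lfloor>\<kappa> * x\<rfloor>"
  have "x \<noteq> real \<kappa> / \<kappa>" using assms by blast
  then have x1: "0 \<le> x" "x < 1" using True kappa_pos by auto
  have j: "real j \<le> \<kappa> * x" "\<kappa> * x < real j + 1"
    using x1 unfolding j_def by (auto simp: nat_0_le)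
  have "\<kappa> * x < \<kappa>" using x1 kappa_pos by simp
  then have jk: "j < \<kappa>" using j by linarith
  have "indicator {real i / \<kappa> .. real (Suc i) / \<kappa>} x = (if i = j then 1 else 0 :: real)" if "i < \<kappa>" for i
  proof (cases "i = j")
    case True
    then show ?thesis using j kappa_pos by (auto simp: indicator_def divide_le_eq le_divide_eq mult.commute)
  next
    case False
    have "x \<notin> {real i / \<kappa> .. real (Suc i) / \<kappa>}"
    proof
      assume *: "x \<in> {real i / \<kappa> .. real (Suc i) / \<kappa>}"
      have "x \<noteq> real (Suc i) / \<kappa>" using assms that by (auto simp del: of_nat_Suc)
      then have "x < real (Suc i) / \<kappa>" using * by simp
      then have "real i \<le> \<kappa> * x" "\<kappa> * x < real (Suc i)"
        using * kappa_pos by (auto simp: divide_le_eq less_divide_eq mult.commute simp del: of_nat_Suc)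
      then have "i = j" using j by linarith
      with False show False by simp
    qed
    with False show ?thesis by simp
  qed
  then have "(\<Sum>i<\<kappa>. indicator {real i / \<kappa> .. real (Suc i) / \<kappa>} x *\<^sub>R G x) = (\<Sum>i<\<kappa>. if i = j then G x else 0)"
    by (intro sum.cong) auto
  then show ?thesis using jk True by simp
qed

text \<open>The unit interval is cut at the grid and each piece is stretched to full length by its
  branch, with Jacobian \<open>1 / \<kappa>\<close>.\<close>

lemma change_of_variables:
  fixes G :: "real \<Rightarrow> real"
  assumes G: "set_integrable lborel {0..1} G"
  shows "i < \<kappa> \<Longrightarrow> set_integrable lborel {0..1} (\<lambda>u. G (X i u))"
    and "(LINT x:{0..1}|lborel. G x) = (\<Sum>i<\<kappa>. LINT u:{0..1}|lborel. G (X i u)) / \<kappa>"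
proof -
  let ?K = "\<lambda>i x. indicator {real i / \<kappa> .. real (Suc i) / \<kappa>} x *\<^sub>R G x"
  have sub: "{real i / \<kappa> .. real (Suc i) / \<kappa>} \<subseteq> {0..1}" if "i < \<kappa>" for i
  proof -
    have "real (Suc i) / \<kappa> \<le> 1" using that kappa_pos by (simp add: divide_le_eq)
    moreover have "0 \<le> real i / \<kappa>" by simp
    ultimately show ?thesis by (meson atLeastatMost_subset_iff)
  qed
  have K: "integrable lborel (?K i)" if "i < \<kappa>" for i
    using set_integrable_subset[OF G _ sub[OF that]] unfolding set_integrable_def by simp
  have KX: "?K i (- p i / (e i * \<kappa>) + 1 / (e i * \<kappa>) * u) = indicator {0..1} u *\<^sub>R G (X i u)" if "i < \<kappa>" for i u
    using X_iff(1)[OF that, of u] unfolding X_def[symmetric] by (simp add: indicator_def)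
  have c: "1 / (e i * \<kappa>) \<noteq> 0" "\<bar>1 / (e i * \<kappa>)\<bar> = 1 / \<kappa>" if "i < \<kappa>" for i
    using abs_orient(1)[OF that] kappa_pos by (auto simp: abs_mult)
  show "set_integrable lborel {0..1} (\<lambda>u. G (X i u))" if "i < \<kappa>" for i
    using lborel_integrable_real_affine_iff[OF c(1)[OF that], of "?K i" "- p i / (e i * \<kappa>)"] K[OF that]
    unfolding set_integrable_def KX[OF that] by blast
  have "(LINT x:{0..1}|lborel. G x) = (\<integral>x. (\<Sum>i<\<kappa>. ?K i x) \<partial>lborel)"
    unfolding set_lebesgue_integral_def
  proof (rule integral_discrete_difference[of "(\<lambda>i::nat. real i / \<kappa>) ` {..\<kappa>}"])
    show "indicator {0..1} x *\<^sub>R G x = (\<Sum>i<\<kappa>. ?K i x)" if "x \<notin> (\<lambda>i::nat. real i / \<kappa>) ` {..\<kappa>}" for x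
      by (rule sum_grid_indicator[OF that, symmetric])
  qed (simp_all add: countable_finite)
  also have "\<dots> = (\<Sum>i<\<kappa>. \<integral>x. ?K i x \<partial>lborel)" by (rule Bochner_Integration.integral_sum) (use K in auto)
  also have "\<dots> = (\<Sum>i<\<kappa>. (LINT u:{0..1}|lborel. G (X i u)) / \<kappa>)"
  proof (rule sum.cong[OF refl])
    fix i assume "i \<in> {..<\<kappa>}"
    then have i: "i < \<kappa>" by simp
    show "(\<integral>x. ?K i x \<partial>lborel) = (LINT u:{0..1}|lborel. G (X i u)) / \<kappa>"
      using lborel_integral_real_affine[OF c(1)[OF i], of "?K i" "- p i / (e i * \<kappa>)"]
      unfolding KX[OF i] c(2)[OF i] set_lebesgue_integral_def by simp
  qed
  finally show "(LINT x:{0..1}|lborel. G x) = (\<Sum>i<\<kappa>. LINT u:{0..1}|lborel. G (X i u)) / \<kappa>"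
    by (simp add: sum_divide_distrib)
qed

text \<open>This is \<open>f\<close> composed with the inverse of the map and divided by the
  Jacobian \<open>\<kappa> * l\<close> on the image strips, and 0 off them. As a sum over the
  branches it makes the formula for leaf integrals exact on every vertical leaf, also where two
  strips touch.\<close>

definition transfer_density :: "(point \<Rightarrow> real) \<Rightarrow> point \<Rightarrow> real"
  where "transfer_density f z = (\<Sum>i<\<kappa>. if W i (snd z) \<in> {0..1} then f (X i (fst z), W i (snd z)) else 0) / (\<kappa> * l)"

text \<open>The strips have full horizontal length, so the cut-off depends on the ordinate alone and
  horizontal Lipschitz bounds survive. The jumps at the edges of the strips are vertical, and in
  that direction only measurability is asked.\<close>

lemma transfer_density_C1:
  assumes "f \<in> C1_unstable" shows "transfer_density f \<in> C1_unstable"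
proof -
  obtain K where K: "0 \<le> K" "\<And>s t. s \<in> {0..1} \<Longrightarrow> t \<in> {0..1} \<Longrightarrow> \<bar>f (s, t)\<bar> \<le> K"
    using C1_unstable_bounded[OF assms(1)] by blast
  obtain K' where K': "0 \<le> K'"
    "\<And>s s' t. s \<in> {0..1} \<Longrightarrow> s' \<in> {0..1} \<Longrightarrow> t \<in> {0..1} \<Longrightarrow> \<bar>f (s, t) - f (s', t)\<bar> \<le> K' * \<bar>s - s'\<bar>"
    using C1_unstable_lipschitz[OF assms(1)] by blast
  have kl: "0 < \<kappa> * l" using kappa_pos l_pos by simp
  \<comment> \<open>The extension by 0 is measurable on the whole plane. For points of the square
    \<open>X i\<close> stays in the unit interval, so the indicator tests precisely the condition on
    \<open>W i\<close>.\<close>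
  let ?F = "\<lambda>x. indicator square x *\<^sub>R f x"
  have F: "?F \<in> borel_measurable borel"
    using C1_unstable_measurable[OF assms] unfolding borel_measurable_square_iff .
  show ?thesis
  proof (rule C1_unstableI)
    have "(\<lambda>z. ?F (X i (fst z), W i (snd z))) \<in> borel_measurable borel" for i
      by (rule measurable_compose[OF _ F]) (simp add: X_def W_def borel_prod[symmetric])
    then have "(\<lambda>z. (\<Sum>i<\<kappa>. ?F (X i (fst z), W i (snd z))) / (\<kappa> * l)) \<in> borel_measurable borel_square"
      by (intro borel_measurable_divide borel_measurable_sum borel_measurable_const measurable_restrict_space1)
    moreover have "(\<Sum>i<\<kappa>. ?F (X i (fst z), W i (snd z))) / (\<kappa> * l) = transfer_density f z"
      if "z \<in> space borel_square" for z
      unfolding transfer_density_def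
      using that X_unit by (intro arg_cong2[of _ _ _ _ "(/)"] sum.cong) (auto simp: space_restrict_space square_def indicator_def)
    ultimately show "transfer_density f \<in> borel_measurable borel_square"
      by (subst measurable_cong[symmetric]) auto
    show "\<bar>transfer_density f (s, t)\<bar> \<le> (\<Sum>i<\<kappa>. K) / (\<kappa> * l)" if "s \<in> {0..1}" "t \<in> {0..1}" for s t
    proof -
      have "\<bar>\<Sum>i<\<kappa>. if W i t \<in> {0..1} then f (X i s, W i t) else 0\<bar> \<le> (\<Sum>i<\<kappa>. K)"
        using K X_unit that(1) by (intro order_trans[OF sum_abs] sum_mono) auto
      from divide_right_mono[OF this less_imp_le[OF kl]] show ?thesis
        unfolding transfer_density_def fst_conv snd_conv abs_divide abs_of_pos[OF kl] .
    qed
    show "\<bar>transfer_density f (s, t) - transfer_density f (s', t)\<bar> \<le> ((\<Sum>i<\<kappa>. K') / (\<kappa> * l)) * \<bar>s - s'\<bar>"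
      if s: "s \<in> {0..1}" "s' \<in> {0..1}" "t \<in> {0..1}" for s s' t
    proof -
      have "\<bar>(if W i t \<in> {0..1} then f (X i s, W i t) else 0) - (if W i t \<in> {0..1} then f (X i s', W i t) else 0)\<bar> \<le> K' * \<bar>s - s'\<bar>"
        if "i < \<kappa>" for i
      proof (cases "W i t \<in> {0..1}")
        case True
        have "\<bar>f (X i s, W i t) - f (X i s', W i t)\<bar> \<le> K' * \<bar>X i s - X i s'\<bar>"
          by (rule K'(2)[OF X_unit[OF that s(1)] X_unit[OF that s(2)] True])
        also have "\<dots> \<le> K' * \<bar>s - s'\<bar>"
          unfolding X_dist[OF that] using kappa K'(1) by (intro mult_left_mono) (auto simp: divide_le_eq mult_le_cancel_left1)
        finally show ?thesis using True by simp
      next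
        case False
        then show ?thesis unfolding if_not_P[OF False] using K'(1) by simp
      qed
      then have "\<bar>(\<Sum>i<\<kappa>. if W i t \<in> {0..1} then f (X i s, W i t) else 0) - (\<Sum>i<\<kappa>. if W i t \<in> {0..1} then f (X i s', W i t) else 0)\<bar> \<le> (\<Sum>i<\<kappa>. K' * \<bar>s - s'\<bar>)"
        unfolding sum_subtractf[symmetric] by (intro order_trans[OF sum_abs] sum_mono) auto
      from divide_right_mono[OF this less_imp_le[OF kl]] show ?thesis
        unfolding transfer_density_def fst_conv snd_conv diff_divide_distrib[symmetric] abs_divide
          abs_of_pos[OF kl] times_divide_eq_left sum_distrib_right .
    qed
  qed
qed

lemma transfer_density_pow_C1: "f \<in> C1_unstable \<Longrightarrow> (transfer_density ^^ n) f \<in> C1_unstable"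
  by (induction n) (auto intro: transfer_density_C1)

lemma transfer_density_lincomb:
  "transfer_density (\<lambda>x. a * f x + c * g x) = (\<lambda>x. a * transfer_density f x + c * transfer_density g x)"
proof
  fix z
  have "(\<Sum>i<\<kappa>. if W i (snd z) \<in> {0..1} then a * f (X i (fst z), W i (snd z)) + c * g (X i (fst z), W i (snd z)) else 0)
    = (\<Sum>i<\<kappa>. a * (if W i (snd z) \<in> {0..1} then f (X i (fst z), W i (snd z)) else 0)
        + c * (if W i (snd z) \<in> {0..1} then g (X i (fst z), W i (snd z)) else 0))"
    by (rule sum.cong) auto
  then show "transfer_density (\<lambda>x. a * f x + c * g x) z = a * transfer_density f z + c * transfer_density g z"
    unfolding transfer_density_def by (simp add: sum.distrib sum_distrib_left add_divide_distrib)
qed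

lemma transfer_density_pow_lincomb:
  "(transfer_density ^^ n) (\<lambda>x. a * f x + c * g x) = (\<lambda>x. a * (transfer_density ^^ n) f x + c * (transfer_density ^^ n) g x)"
  by (induction n) (simp_all add: transfer_density_lincomb)

text \<open>The substitution \<open>t = V i u\<close> in the strip of branch \<open>i\<close>
  produces a factor \<open>l\<close>, which cancels the \<open>l\<close> in the density and leaves
  the mean over the branches.\<close>

lemma leaf_integral_transfer_density:
  assumes f: "f \<in> C1_unstable" and s: "s \<in> {0..1}" and g: "continuous_on {0..1} g"
  shows "leaf_integral s (transfer_density f) g = (\<Sum>i<\<kappa>. leaf_integral (X i s) f (\<lambda>t. g (V i t))) / \<kappa>"
proof -
  let ?k = "\<lambda>i t. indicator {0..1} t * ((if W i t \<in> {0..1} then f (X i s, W i t) else 0) * g t)"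
  have kV: "?k i (q i + d i * l * u) = indicator {0..1} u * (f (X i s, u) * g (V i u))" if "i < \<kappa>" for i u
    unfolding V_def[symmetric] W_V[OF that] using V_unit[OF that, of u] by (auto simp: indicator_def)
  have c: "d i * l \<noteq> 0" "\<bar>d i * l\<bar> = l" if "i < \<kappa>" for i
    using abs_orient(2)[OF that] l_pos by (auto simp: abs_mult)
  have int: "integrable lborel (?k i)" if "i < \<kappa>" for i
    using leaf_integrable[OF f X_unit[OF that s] continuous_V[OF that g]]
      lborel_integrable_real_affine_iff[OF c(1)[OF that], of "?k i" "q i"]
    unfolding kV[OF that] set_integrable_def by simp
  have "leaf_integral s (transfer_density f) g = (\<integral>t. (\<Sum>i<\<kappa>. ?k i t) / (\<kappa> * l) \<partial>lborel)"
    unfolding leaf_integral_def set_lebesgue_integral_def transfer_density_def fst_conv snd_conv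
    by (rule Bochner_Integration.integral_cong) (simp_all add: sum_distrib_left sum_distrib_right)
  also have "\<dots> = (\<Sum>i<\<kappa>. \<integral>t. ?k i t \<partial>lborel) / (\<kappa> * l)"
    using int by (subst integral_divide_zero, subst Bochner_Integration.integral_sum) auto
  also have "(\<Sum>i<\<kappa>. \<integral>t. ?k i t \<partial>lborel) = (\<Sum>i<\<kappa>. l * leaf_integral (X i s) f (\<lambda>t. g (V i t)))"
  proof (rule sum.cong[OF refl])
    fix i assume "i \<in> {..<\<kappa>}"
    then have i: "i < \<kappa>" by simp
    show "(\<integral>t. ?k i t \<partial>lborel) = l * leaf_integral (X i s) f (\<lambda>t. g (V i t))"
      using lborel_integral_real_affine[OF c(1)[OF i], of "?k i" "q i"]
      unfolding kV[OF i] c(2)[OF i] leaf_integral_def set_lebesgue_integral_def by simp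
  qed
  finally show ?thesis using l_pos by (simp add: sum_distrib_left[symmetric])
qed

text \<open>The number of the branch that \<open>leafwise\<close> applies at abscissa
  \<open>s\<close>; the minimum sends \<open>s = 1\<close> to the last rectangle.\<close>

definition idx :: "real \<Rightarrow> nat" where "idx s = min (nat \<lfloor>real \<kappa> * s\<rfloor>) (\<kappa> - 1)"

lemma idx_less: "idx s < \<kappa>" using kappa by (simp add: idx_def)

lemma idx_range:
  assumes "s \<in> {0..1}" shows "s \<in> {real (idx s) / \<kappa> .. real (Suc (idx s)) / \<kappa>}"
proof -
  have "0 \<le> \<kappa> * s" "\<kappa> * s \<le> \<kappa>" using assms kappa_pos by (auto simp: mult_left_le)
  moreover have "real (\<kappa> - 1) = \<kappa> - 1" using kappa by simp
  ultimately have "real (idx s) \<le> \<kappa> * s" "\<kappa> * s \<le> real (Suc (idx s))"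
    unfolding idx_def by (auto simp: min_def) linarith+
  then show ?thesis using kappa_pos by (simp add: divide_le_eq le_divide_eq mult.commute)
qed

text \<open>The endpoints are excluded because there \<open>X i s\<close> lies on a side of
  rectangle \<open>i\<close>, which may be assigned to the right neighbour.\<close>

lemma idx_X:
  assumes "i < \<kappa>" "s \<in> {0<..<1}" shows "idx (X i s) = i"
proof -
  have "X i s \<in> {real i / \<kappa> <..< real (Suc i) / \<kappa>}" using X_iff(2)[OF assms(1)] assms(2) by blast
  then have "real i < \<kappa> * X i s" "\<kappa> * X i s < real i + 1"
    using kappa_pos by (auto simp: divide_less_eq less_divide_eq mult.commute)
  then have "\<lfloor>\<kappa> * X i s\<rfloor> = int i" by linarith
  then show ?thesis using assms(1) unfolding idx_def by simp
qed

lemma leafwise_eq: "\<Lambda> (s, t) = (p (idx s) + e (idx s) * \<kappa> * s, V (idx s) t)"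
  unfolding leafwise_def fst_conv idx_def[symmetric] branch[OF idx_less] V_def ..

lemma leafwise_unit:
  assumes "s \<in> {0..1}" shows "p (idx s) + e (idx s) * \<kappa> * s \<in> {0..1}"
  by (rule branch_range(1)[OF idx_less idx_range[OF assms], of 0]) simp

lemma leafwise_square: "z \<in> square \<Longrightarrow> \<Lambda> z \<in> square"
  by (cases z) (simp only: leafwise_eq square_iff leafwise_unit V_unit[OF idx_less] simp_thms)

lemma leafwise_X:
  assumes "i < \<kappa>" "s \<in> {0<..<1}" shows "\<Lambda> (X i s, t) = (s, V i t)"
  unfolding leafwise_eq idx_X[OF assms] X_inverse[OF assms(1)] ..

lemma leafwise_measurable:
  "\<Lambda> \<in> measurable borel_square borel_square"
proof (rule measurable_restrict_space2)
  have *: "(\<lambda>z. (p i + e i * \<kappa> * fst z, V i (snd z))) \<in> measurable (borel :: point measure) borel" for i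
    unfolding V_def by (intro borel_measurable_continuous_onI continuous_intros)
  have "(\<lambda>z::point. real \<kappa> * fst z) \<in> borel_measurable borel"
    by (intro borel_measurable_continuous_onI continuous_intros)
  then have "(\<lambda>z::point. \<lfloor>real \<kappa> * fst z\<rfloor>) \<in> measurable borel (count_space UNIV)" by measurable
  then have "(\<lambda>z::point. idx (fst z)) \<in> measurable borel (count_space UNIV)"
    unfolding idx_def by (rule measurable_compose) simp
  from measurable_compose_countable[OF * this]
  have "(\<lambda>z. (p (idx (fst z)) + e (idx (fst z)) * \<kappa> * fst z, V (idx (fst z)) (snd z))) \<in> measurable borel borel" .
  moreover have "(\<lambda>z. (p (idx (fst z)) + e (idx (fst z)) * \<kappa> * fst z, V (idx (fst z)) (snd z))) = \<Lambda>"
    by (rule ext, rename_tac z, case_tac z) (simp add: leafwise_eq)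
  ultimately show "\<Lambda> \<in> measurable borel_square borel"
    by (simp add: measurable_restrict_space1)
  show "\<Lambda> \<in> space borel_square \<rightarrow> square"
    using leafwise_square by (auto simp: space_restrict_space)
qed

lemma leafwise_holder_bounds:
  assumes "\<And>s. s \<in> {0..1} \<Longrightarrow> holder_bounds 1 (\<lambda>t. \<phi> (s, t)) A H" "s \<in> {0..1}"
  shows "holder_bounds 1 (\<lambda>t. (\<phi> \<circ> \<Lambda>) (s, t)) A H"
  unfolding o_def leafwise_eq
  by (rule holder_bounds_V_le[OF idx_less assms(1)[OF leafwise_unit[OF assms(2)]]]) simp

lemma leafwise_C1_stable:
  assumes "\<phi> \<in> C1_stable" shows "\<phi> \<circ> \<Lambda> \<in> C1_stable"
proof -
  obtain A H where A: "\<phi> \<in> borel_measurable borel_square" "0 \<le> A" "0 \<le> H"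
    "\<And>s. s \<in> {0..1} \<Longrightarrow> holder_bounds 1 (\<lambda>t. \<phi> (s, t)) A H" using C1_stableE[OF assms] by blast
  show ?thesis
    by (rule C1_stableI[OF measurable_comp[OF leafwise_measurable A(1)] leafwise_holder_bounds[OF A(4)]])
qed

text \<open>The mean over preimage leaves meets the change of variables in the horizontal direction:
  on the leaf at \<open>X i s\<close>, the function \<open>\<phi> \<circ> \<Lambda>\<close> is
  \<phi> on the leaf at \<open>s\<close> composed with \<open>V i\<close>. This identifies the
  density formula with the operator defined by duality.\<close>

lemma pairing_transfer_density:
  assumes f: "f \<in> C1_unstable" and \<phi>: "\<phi> \<in> C1_stable"
  shows "pairing (transfer_density f) \<phi> = pairing f (\<phi> \<circ> \<Lambda>)"
proof -
  obtain A H where A: "\<phi> \<in> borel_measurable borel_square" "0 \<le> A" "0 \<le> H"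
    "\<And>s. s \<in> {0..1} \<Longrightarrow> holder_bounds 1 (\<lambda>t. \<phi> (s, t)) A H" using C1_stableE[OF \<phi>] by blast
  note pl = pairing_leaves[OF f leafwise_C1_stable[OF \<phi>]]
  let ?R = "\<lambda>i u. leaf_integral (X i u) f (\<lambda>t. (\<phi> \<circ> \<Lambda>) (X i u, t))"
  let ?L = "\<lambda>i s. leaf_integral (X i s) f (\<lambda>t. \<phi> (s, V i t))"
  \<comment> \<open>For \<open>s = 0\<close> and \<open>s = 1\<close> the preimage leaf may be a
    common side, on which \<open>leafwise\<close> applies another branch; two values of
    \<open>s\<close> are negligible.\<close>
  have eq: "indicator {0..1} s *\<^sub>R ?L i s = indicator {0..1} s *\<^sub>R ?R i s" if "i < \<kappa>" "s \<notin> {0, 1}" for i s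
    using that leafwise_X[OF that(1), of s] by (cases "s \<in> {0<..<1}") (auto simp: indicator_def)
  have Lint: "set_integrable lborel {0..1} (?L i)" if i: "i < \<kappa>" for i
    using change_of_variables(1)[OF pl(1) i] unfolding set_integrable_def
    by (subst integrable_discrete_difference[of "{0, 1}" _ _ "\<lambda>s. indicator {0..1} s *\<^sub>R ?R i s"]) (use eq[OF i] in auto)
  have L: "(LINT s:{0..1}|lborel. ?L i s) = (LINT s:{0..1}|lborel. ?R i s)" if i: "i < \<kappa>" for i
    unfolding set_lebesgue_integral_def
    by (rule integral_discrete_difference[of "{0, 1}"]) (use eq[OF i] in auto)
  have "pairing (transfer_density f) \<phi> = (LINT s:{0..1}|lborel. leaf_integral s (transfer_density f) (\<lambda>t. \<phi> (s, t)))"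
    by (rule pairing_leaves(2)[OF transfer_density_C1[OF f] \<phi>])
  also have "\<dots> = (LINT s:{0..1}|lborel. (\<Sum>i<\<kappa>. ?L i s) / \<kappa>)"
    by (rule set_lebesgue_integral_cong)
      (auto simp: leaf_integral_transfer_density[OF f] holder_bounds_continuous1[OF A(4)])
  also have "\<dots> = (\<Sum>i<\<kappa>. LINT s:{0..1}|lborel. ?L i s) / \<kappa>"
  proof -
    have "(LINT s:{0..1}|lborel. (\<Sum>i<\<kappa>. ?L i s)) = (\<Sum>i<\<kappa>. LINT s:{0..1}|lborel. ?L i s)"
      unfolding set_lebesgue_integral_def scaleR_sum_right
      by (rule Bochner_Integration.integral_sum) (use Lint in \<open>auto simp: set_integrable_def\<close>)
    then show ?thesis by simp
  qed
  also have "\<dots> = (\<Sum>i<\<kappa>. LINT s:{0..1}|lborel. ?R i s) / \<kappa>" using L by simp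
  also have "\<dots> = pairing f (\<phi> \<circ> \<Lambda>)"
    unfolding pl(2) by (rule change_of_variables(2)[OF pl(1), symmetric])
  finally show ?thesis .
qed

end

section \<open>Exponential decay on densities of zero mass\<close>

context baker_data
begin

lemma average_le:
  fixes f :: "nat \<Rightarrow> real"
  assumes "\<And>i. i < \<kappa> \<Longrightarrow> \<bar>f i\<bar> \<le> C"
  shows "\<bar>(\<Sum>i<\<kappa>. f i) / \<kappa>\<bar> \<le> C"
proof -
  have "\<bar>\<Sum>i<\<kappa>. f i\<bar> \<le> (\<Sum>i<\<kappa>. C)" using assms by (intro order_trans[OF sum_abs] sum_mono) auto
  then have "\<bar>\<Sum>i<\<kappa>. f i\<bar> / \<kappa> \<le> \<kappa> * C / \<kappa>" by (intro divide_right_mono) auto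
  then show ?thesis using kappa_pos by simp
qed

text \<open>Composition with \<open>V i\<close> enlarges neither Hoelder bound. A factor below 1
  cannot be expected, because constants are test functions as well.\<close>

lemma stable_norm_transfer_density:
  assumes f: "f \<in> C1_unstable"
  shows "stable (transfer_density f) \<le> stable f"
proof (rule stable_norm_least)
  fix s :: real and g A H
  assume g: "s \<in> {0..1}" "g \<in> holder_leaf \<alpha>" "holder_bounds \<alpha> g A H" "A + H \<le> 1"
  have "\<bar>leaf_integral s (transfer_density f) g\<bar> \<le> stable f"
    unfolding leaf_integral_transfer_density[OF f g(1) holder_leaf_cont[OF g(2)]]
  proof (rule average_le)
    fix i assume i: "i < \<kappa>"
    have "\<bar>leaf_integral (X i s) f (\<lambda>t. g (V i t))\<bar> \<le> stable f * (A + H)"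
      using exponents
      by (intro stable_norm_upper[OF f X_unit[OF i g(1)]] holder_leaf_V[OF i g(2)] holder_bounds_V_le[OF i g(3)]) auto
    also have "\<dots> \<le> stable f" using stable_norm_nonneg[OF f] g(4) by (intro mult_left_le)
    finally show "\<bar>leaf_integral (X i s) f (\<lambda>t. g (V i t))\<bar> \<le> stable f" .
  qed
  then show "leaf_integral s (transfer_density f) g \<le> stable f" by simp
qed

text \<open>
  The preimages of two leaves are matched in pairs at distance \<open>\<kappa>\<close> times smaller, with the same
  test functions.
\<close>

lemma unstable_norm_transfer_density:
  assumes f: "f \<in> C1_unstable"
  shows "unstable (transfer_density f) \<le> \<kappa> powr (- \<beta>) * unstable f"
proof (rule unstable_norm_least)
  show "0 \<le> \<kappa> powr (- \<beta>) * unstable f" using unstable_norm_nonneg[OF f] by simp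
  fix s s' :: real and g A H
  assume g: "s \<in> {0..1}" "s' \<in> {0..1}" "s \<noteq> s'" "holder_bounds 1 g A H" "A + H \<le> 1"
  note cg = holder_bounds_continuous1[OF g(4)]
  have "leaf_integral s (transfer_density f) g - leaf_integral s' (transfer_density f) g
      = (\<Sum>i<\<kappa>. leaf_integral (X i s) f (\<lambda>t. g (V i t)) - leaf_integral (X i s') f (\<lambda>t. g (V i t))) / \<kappa>"
    unfolding leaf_integral_transfer_density[OF f g(1) cg] leaf_integral_transfer_density[OF f g(2) cg]
    by (simp add: sum_subtractf diff_divide_distrib)
  also have "\<bar>\<dots>\<bar> \<le> \<kappa> powr (- \<beta>) * unstable f * \<bar>s - s'\<bar> powr \<beta>"
  proof (rule average_le)
    fix i assume i: "i < \<kappa>"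
    have "\<bar>leaf_integral (X i s) f (\<lambda>t. g (V i t)) - leaf_integral (X i s') f (\<lambda>t. g (V i t))\<bar>
        \<le> unstable f * (A + H) * \<bar>X i s - X i s'\<bar> powr \<beta>"
      by (rule unstable_norm_upper[OF f X_unit[OF i g(1)] X_unit[OF i g(2)] holder_bounds_V_le[OF i g(4)]]) simp
    also have "\<dots> \<le> unstable f * \<bar>X i s - X i s'\<bar> powr \<beta>"
      using unstable_norm_nonneg[OF f] g(5) by (intro mult_right_mono mult_left_le) auto
    also have "\<bar>X i s - X i s'\<bar> powr \<beta> = \<kappa> powr (- \<beta>) * \<bar>s - s'\<bar> powr \<beta>"
      unfolding X_dist[OF i] powr_divide powr_minus by (simp add: divide_inverse)
    finally show "\<bar>leaf_integral (X i s) f (\<lambda>t. g (V i t)) - leaf_integral (X i s') f (\<lambda>t. g (V i t))\<bar>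
        \<le> \<kappa> powr (- \<beta>) * unstable f * \<bar>s - s'\<bar> powr \<beta>" by (simp add: mult_ac)
  qed
  finally show "\<bar>leaf_integral s (transfer_density f) g - leaf_integral s' (transfer_density f) g\<bar>
      \<le> \<kappa> powr (- \<beta>) * unstable f * \<bar>s - s'\<bar> powr \<beta>" .
qed

definition \<rho> :: real where "\<rho> = max (l powr \<alpha>) (\<kappa> powr (- \<beta>))"

lemma rho: "0 < \<rho>" "\<rho> < 1" "l powr \<alpha> \<le> \<rho>" "\<kappa> powr (- \<beta>) \<le> \<rho>"
proof -
  show "0 < \<rho>" unfolding \<rho>_def using l_pos by (simp add: less_max_iff_disj)
  have "l powr \<alpha> < 1" using powr_less_mono2[of \<alpha> l 1] l_pos l_less_1 exponents by simp
  moreover have "1 < \<kappa> powr \<beta>" using powr_less_mono2[of \<beta> 1 \<kappa>] kappa exponents by simp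
  then have "\<kappa> powr (- \<beta>) < 1" by (simp add: powr_minus inverse_less_1_iff)
  ultimately show "\<rho> < 1" unfolding \<rho>_def by simp
qed (simp_all add: \<rho>_def)

lemma unstable_norm_transfer_density_rho:
  assumes f: "f \<in> C1_unstable"
  shows "unstable ((transfer_density ^^ n) f) \<le> \<rho> ^ n * unstable f"
proof (induction n)
  case (Suc n)
  have u: "(transfer_density ^^ n) f \<in> C1_unstable" by (rule transfer_density_pow_C1[OF f])
  have "unstable ((transfer_density ^^ Suc n) f) \<le> \<kappa> powr (- \<beta>) * unstable ((transfer_density ^^ n) f)"
    using unstable_norm_transfer_density[OF u] by simp
  also have "\<dots> \<le> \<rho> * (\<rho> ^ n * unstable f)"
    using rho by (intro mult_mono Suc.IH unstable_norm_nonneg u) auto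
  finally show ?case by simp
qed simp

lemma strong_norm_transfer_density:
  assumes f: "f \<in> C1_unstable"
  shows "strong (transfer_density f) \<le> strong f"
proof -
  have "unstable (transfer_density f) \<le> \<rho> * unstable f"
    using unstable_norm_transfer_density_rho[OF f, of 1] by simp
  also have "\<dots> \<le> 1 * unstable f"
    using rho by (intro mult_right_mono unstable_norm_nonneg f) auto
  finally show ?thesis using stable_norm_transfer_density[OF f] unfolding strong_norm_def by simp
qed

text \<open>The constant 1 is unchanged by composition with the map, so the condition of zero mass
  passes to all iterates.\<close>

lemma pairing_transfer_density_one:
  assumes "f \<in> C1_unstable"
  shows "pairing ((transfer_density ^^ n) f) (\<lambda>_. 1) = pairing f (\<lambda>_. 1)"
proof (induction n)
  case (Suc n)
  have "pairing ((transfer_density ^^ Suc n) f) (\<lambda>_. 1) = pairing ((transfer_density ^^ n) f) ((\<lambda>_. 1) \<circ> \<Lambda>)"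
    using pairing_transfer_density[OF transfer_density_pow_C1[OF assms] C1_stable_const] by simp
  with Suc show ?case by (simp add: o_def)
qed simp

text \<open>
  The leaf averages of a density of zero mass are Hoelder continuous in the leaf and have mean
  zero, so they are controlled by the unstable norm.
\<close>

lemma leaf_average_le:
  assumes f: "f \<in> C1_unstable" and zero: "pairing f (\<lambda>_. 1) = 0" and s: "s \<in> {0..1}"
  shows "\<bar>leaf_integral s f (\<lambda>t. c)\<bar> \<le> \<bar>c\<bar> * unstable f"
proof -
  let ?r = "\<lambda>s. leaf_integral s f (\<lambda>t. 1)"
  note pl = pairing_leaves[OF f C1_stable_const[of 1]]
  have const: "set_integrable lborel {0..1::real} (\<lambda>r. ?r s)"
    unfolding set_integrable_def by (rule borel_integrable_compact) auto
  \<comment> \<open>The mean of \<open>?r\<close> over the leaves is the mass, which is 0, so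
    \<open>?r s\<close> equals the mean of its differences to the other leaves.\<close>
  have "(LINT r:{0..1}|lborel. ?r s - ?r r) = (LINT r:{0..1::real}|lborel. ?r s) - (LINT r:{0..1}|lborel. ?r r)"
    by (rule set_integral_diff(2)[OF const pl(1)])
  also have "\<dots> = ?r s" using zero pl(2) by (simp add: set_integral_const)
  finally have eq: "(LINT r:{0..1}|lborel. ?r s - ?r r) = ?r s" .
  have "\<bar>LINT r:{0..1}|lborel. ?r s - ?r r\<bar> \<le> unstable f"
  proof (rule set_integral_unit_bound)
    fix r :: real assume r: "r \<in> {0..1}"
    have "\<bar>?r s - ?r r\<bar> \<le> unstable f * (\<bar>1\<bar> + 0) * \<bar>s - r\<bar> powr \<beta>"
      by (rule unstable_norm_upper[OF f s r holder_bounds_const])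
    also have "\<dots> \<le> unstable f"
      using r s exponents unstable_norm_nonneg[OF f] by (simp, intro mult_left_le powr_le1) auto
    finally show "\<bar>?r s - ?r r\<bar> \<le> unstable f" .
  qed
  then have "\<bar>?r s\<bar> \<le> unstable f" unfolding eq .
  then have "\<bar>c\<bar> * \<bar>?r s\<bar> \<le> \<bar>c\<bar> * unstable f" by (intro mult_left_mono) auto
  then show ?thesis using leaf_integral_scale_right[of s f c "\<lambda>t. 1"] by (simp add: abs_mult)
qed

text \<open>
  Test functions are normalised to vanish at 0 and measured by their Hoelder constant only: composing
  with a branch and renormalising then gains the full factor \<open>l powr \<alpha>\<close>, with no constant that would
  be compounded under iteration.
\<close>

definition based_bound :: "(point \<Rightarrow> real) \<Rightarrow> real \<Rightarrow> bool"
  where "based_bound f K \<longleftrightarrow> (\<forall>s g A H. s \<in> {0..1} \<longrightarrow> g \<in> holder_leaf \<alpha> \<longrightarrow> holder_bounds \<alpha> g A H \<longrightarrow>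
    g 0 = 0 \<longrightarrow> \<bar>leaf_integral s f g\<bar> \<le> K * H)"

lemma holder_bounds_base:
  assumes "holder_bounds \<alpha> g A H" "t \<in> {0..1}"
  shows "\<bar>g t - g 0\<bar> \<le> H"
proof -
  have "\<bar>g t - g 0\<bar> \<le> H * \<bar>t - 0\<bar> powr \<alpha>" using assms by (intro holder_boundsD(4)) auto
  also have "\<dots> \<le> H" using assms exponents holder_boundsD(2)[OF assms(1)] by (intro mult_left_le powr_le1) auto
  finally show ?thesis .
qed

text \<open>A test function vanishing at 0 has supremum at most its Hoelder constant, which accounts
  for the factor 2.\<close>

lemma based_bound_stable:
  assumes f: "f \<in> C1_unstable" shows "based_bound f (2 * stable f)"
  unfolding based_bound_def
proof (intro allI impI)
  fix s :: real and g A H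
  assume g: "s \<in> {0..1}" "g \<in> holder_leaf \<alpha>" "holder_bounds \<alpha> g A H" "g 0 = 0"
  have "holder_bounds \<alpha> g H H"
    using holder_boundsD(2,4)[OF g(3)] holder_bounds_base[OF g(3)] g(4) by (intro holder_boundsI) auto
  from stable_norm_upper[OF f g(1,2) this]
  show "\<bar>leaf_integral s f g\<bar> \<le> 2 * stable f * H" by simp
qed

lemma leaf_integral_split:
  assumes f: "f \<in> C1_unstable" and s: "s \<in> {0..1}" and g: "continuous_on {0..1} g"
  shows "leaf_integral s f g = leaf_integral s f (\<lambda>t. g t - c) + leaf_integral s f (\<lambda>t. c)"
  using leaf_integral_add_right[OF f s continuous_on_diff[OF g continuous_on_const] continuous_on_const, of c c] by simp

text \<open>The composition \<open>g (V i t)\<close> no longer vanishes at 0. Its value there is at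
  most \<open>H\<close>, since \<open>g\<close> does vanish at 0, and it pairs with a leaf average,
  which gives the term \<open>unstable f\<close>. What is left vanishes at 0 and has Hoelder
  constant \<open>H * l powr \<alpha>\<close>.\<close>

lemma based_bound_transfer_density:
  assumes f: "f \<in> C1_unstable" and zero: "pairing f (\<lambda>_. 1) = 0" and K: "based_bound f K" "0 \<le> K"
  shows "based_bound (transfer_density f) (\<rho> * K + unstable f)"
  unfolding based_bound_def
proof (intro allI impI)
  fix s :: real and g A H
  assume g: "s \<in> {0..1}" "g \<in> holder_leaf \<alpha>" "holder_bounds \<alpha> g A H" "g 0 = 0"
  note cg = holder_leaf_cont[OF g(2)]
  show "\<bar>leaf_integral s (transfer_density f) g\<bar> \<le> (\<rho> * K + unstable f) * H"
    unfolding leaf_integral_transfer_density[OF f g(1) cg]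
  proof (rule average_le)
    fix i assume i: "i < \<kappa>"
    let ?c = "g (V i 0)"
    have c: "\<bar>?c\<bar> \<le> H" using holder_bounds_base[OF g(3) V_unit[OF i, of 0]] g(4) by simp
    have "(\<lambda>t. g (V i t)) \<in> holder_leaf \<alpha>" using exponents by (intro holder_leaf_V[OF i g(2)]) auto
    from holder_leaf_scale_shift[OF this, of 1 "- ?c"] have h1: "(\<lambda>t. g (V i t) - ?c) \<in> holder_leaf \<alpha>" by simp
    have h2: "holder_bounds \<alpha> (\<lambda>t. g (V i t) - ?c) (A + \<bar>?c\<bar>) (H * l powr \<alpha> + 0)"
      by (rule holder_bounds_diff[OF holder_bounds_V[OF i g(3)] holder_bounds_const])
    have "\<bar>leaf_integral (X i s) f (\<lambda>t. g (V i t) - ?c)\<bar> \<le> K * (H * l powr \<alpha> + 0)"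
      using K(1) X_unit[OF i g(1)] h1 h2 unfolding based_bound_def by fastforce
    also have "\<dots> \<le> K * (H * \<rho>)"
      using K(2) holder_boundsD(2)[OF g(3)] rho by (intro mult_left_mono) (auto intro: mult_left_mono)
    finally have 1: "\<bar>leaf_integral (X i s) f (\<lambda>t. g (V i t) - ?c)\<bar> \<le> K * (H * \<rho>)" .
    have "\<bar>leaf_integral (X i s) f (\<lambda>t. ?c)\<bar> \<le> \<bar>?c\<bar> * unstable f"
      by (rule leaf_average_le[OF f zero X_unit[OF i g(1)]])
    also have "\<dots> \<le> H * unstable f" using c by (intro mult_right_mono unstable_norm_nonneg f)
    finally have 2: "\<bar>leaf_integral (X i s) f (\<lambda>t. ?c)\<bar> \<le> H * unstable f" .
    have "\<bar>leaf_integral (X i s) f (\<lambda>t. g (V i t))\<bar> \<le> K * (H * \<rho>) + H * unstable f"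
      using 1 2 leaf_integral_split[OF f X_unit[OF i g(1)] continuous_V[OF i cg], of ?c] by simp
    then show "\<bar>leaf_integral (X i s) f (\<lambda>t. g (V i t))\<bar> \<le> (\<rho> * K + unstable f) * H"
      by (simp add: algebra_simps)
  qed
qed

text \<open>For a general test function the constant \<open>g 0\<close> is at most 1 in absolute
  value and is again absorbed by the leaf averages.\<close>

lemma stable_norm_le_based_bound:
  assumes f: "f \<in> C1_unstable" and zero: "pairing f (\<lambda>_. 1) = 0" and K: "based_bound f K" "0 \<le> K"
  shows "stable f \<le> K + unstable f"
proof (rule stable_norm_least)
  fix s :: real and g A H
  assume g: "s \<in> {0..1}" "g \<in> holder_leaf \<alpha>" "holder_bounds \<alpha> g A H" "A + H \<le> 1"
  note D = holder_boundsD[OF g(3)]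
  have h1: "(\<lambda>t. g t - g 0) \<in> holder_leaf \<alpha>" using holder_leaf_scale_shift[OF g(2), of 1 "- g 0"] by simp
  have h2: "holder_bounds \<alpha> (\<lambda>t. g t - g 0) (A + \<bar>g 0\<bar>) (H + 0)"
    by (rule holder_bounds_diff[OF g(3) holder_bounds_const])
  have "\<bar>leaf_integral s f (\<lambda>t. g t - g 0)\<bar> \<le> K * (H + 0)"
    using K(1) g(1) h1 h2 unfolding based_bound_def by fastforce
  also have "\<dots> \<le> K" using K(2) D(1,2) g(4) by (intro mult_left_le) auto
  finally have 1: "\<bar>leaf_integral s f (\<lambda>t. g t - g 0)\<bar> \<le> K" .
  have "\<bar>leaf_integral s f (\<lambda>t. g 0)\<bar> \<le> \<bar>g 0\<bar> * unstable f" by (rule leaf_average_le[OF f zero g(1)])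
  also have "\<dots> \<le> 1 * unstable f"
    using D(2) D(3)[of 0] g(4) by (intro mult_right_mono unstable_norm_nonneg f) auto
  finally have 2: "\<bar>leaf_integral s f (\<lambda>t. g 0)\<bar> \<le> unstable f" by simp
  show "leaf_integral s f g \<le> K + unstable f"
    using 1 2 leaf_integral_split[OF f g(1) holder_leaf_cont[OF g(2)], of "g 0"] by simp
qed

text \<open>The bounds obey \<open>K (n + 1) = \<rho> * K n + \<rho> ^ n * unstable f\<close> with
  twice the stable norm as initial value; the expression is the solution of this recursion.\<close>

lemma based_bound_pow:
  assumes f: "f \<in> C1_unstable" and zero: "pairing f (\<lambda>_. 1) = 0"
  shows "based_bound ((transfer_density ^^ n) f) (\<rho> ^ n * (2 * stable f + real n * unstable f / \<rho>))"
proof (induction n)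
  case 0
  then show ?case using based_bound_stable[OF f] by simp
next
  case (Suc n)
  let ?f = "(transfer_density ^^ n) f"
  let ?K = "\<rho> ^ n * (2 * stable f + real n * unstable f / \<rho>)"
  have u: "?f \<in> C1_unstable" by (rule transfer_density_pow_C1[OF f])
  have z: "pairing ?f (\<lambda>_. 1) = 0" using pairing_transfer_density_one[OF f] zero by simp
  have "0 \<le> ?K" using rho stable_norm_nonneg[OF f] unstable_norm_nonneg[OF f] by simp
  from based_bound_transfer_density[OF u z Suc this]
  have *: "based_bound ((transfer_density ^^ Suc n) f) (\<rho> * ?K + unstable ?f)" by simp
  have "\<rho> * ?K + unstable ?f \<le> \<rho> * ?K + \<rho> ^ n * unstable f"
    using unstable_norm_transfer_density_rho[OF f, of n] by simp
  also have "\<dots> = \<rho> ^ Suc n * (2 * stable f + real (Suc n) * unstable f / \<rho>)"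
    using rho by (simp add: field_simps)
  finally have le: "\<rho> * ?K + unstable ?f \<le> \<rho> ^ Suc n * (2 * stable f + real (Suc n) * unstable f / \<rho>)" .
  show ?case unfolding based_bound_def
  proof (intro allI impI)
    fix s :: real and g A H
    assume g: "s \<in> {0..1}" "g \<in> holder_leaf \<alpha>" "holder_bounds \<alpha> g A H" "g 0 = 0"
    then have "\<bar>leaf_integral s ((transfer_density ^^ Suc n) f) g\<bar> \<le> (\<rho> * ?K + unstable ?f) * H"
      using * unfolding based_bound_def by blast
    also have "\<dots> \<le> \<rho> ^ Suc n * (2 * stable f + real (Suc n) * unstable f / \<rho>) * H"
      by (rule mult_right_mono[OF le holder_boundsD(2)[OF g(3)]])
    finally show "\<bar>leaf_integral s ((transfer_density ^^ Suc n) f) g\<bar>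
      \<le> \<rho> ^ Suc n * (2 * stable f + real (Suc n) * unstable f / \<rho>) * H" .
  qed
qed

text \<open>The summand 2 covers the initial value and the two unstable terms at the end,
  \<open>2 / \<rho>\<close> covers the terms that accumulate during the iteration.\<close>

definition decay_const :: real where "decay_const = 2 / \<rho> + 2"

lemma decay_const_pos: "0 < decay_const" unfolding decay_const_def using rho by (simp add: add_pos_pos)

text \<open>The bound for based test functions yields the stable norm up to one unstable term, the
  strong norm adds another one, and the unstable seminorm decays like \<open>\<rho> ^ n\<close> by
  itself.\<close>

theorem strong_norm_decay:
  assumes f: "f \<in> C1_unstable" and zero: "pairing f (\<lambda>_. 1) = 0"
  shows "strong ((transfer_density ^^ n) f) \<le> decay_const * (real n + 1) * \<rho> ^ n * strong f"
proof -
  let ?f = "(transfer_density ^^ n) f"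
  let ?S = "stable f" and ?U = "unstable f"
  have u: "?f \<in> C1_unstable" by (rule transfer_density_pow_C1[OF f])
  have z: "pairing ?f (\<lambda>_. 1) = 0" using pairing_transfer_density_one[OF f] zero by simp
  have S: "0 \<le> ?S" "0 \<le> ?U" using stable_norm_nonneg[OF f] unstable_norm_nonneg[OF f] by auto
  have "0 \<le> \<rho> ^ n * (2 * ?S + real n * ?U / \<rho>)" using rho S by simp
  from stable_norm_le_based_bound[OF u z based_bound_pow[OF f zero] this]
  have "strong ?f \<le> \<rho> ^ n * (2 * ?S + real n * ?U / \<rho>) + 2 * unstable ?f"
    unfolding strong_norm_def by simp
  also have "\<dots> \<le> \<rho> ^ n * (2 * ?S + real n * ?U / \<rho>) + 2 * (\<rho> ^ n * ?U)"
    using unstable_norm_transfer_density_rho[OF f, of n] by simp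
  also have "\<dots> = \<rho> ^ n * (2 * ?S + real n * ?U / \<rho> + 2 * ?U)" by (simp add: algebra_simps)
  also have "\<dots> \<le> \<rho> ^ n * (decay_const * (real n + 1) * (?S + ?U))"
  proof (rule mult_left_mono)
    have "?U / \<rho> * real n \<le> (?S + ?U) * (2 / \<rho>) * real n"
      using S rho by (intro mult_right_mono) (auto simp: field_simps)
    moreover have "0 \<le> (?S + ?U) * (2 / \<rho>)" "0 \<le> 2 * (?S + ?U) * real n" using S rho by auto
    moreover have "decay_const * (real n + 1) * (?S + ?U)
        = (?S + ?U) * (2 / \<rho>) * real n + (?S + ?U) * (2 / \<rho>) + 2 * (?S + ?U) * real n + 2 * ?S + 2 * ?U"
      unfolding decay_const_def by (simp add: algebra_simps add_divide_distrib)
    ultimately show "2 * ?S + real n * ?U / \<rho> + 2 * ?U \<le> decay_const * (real n + 1) * (?S + ?U)"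
      by (simp add: mult.commute)
  qed (use rho in simp)
  finally show ?thesis unfolding strong_norm_def by (simp add: mult_ac)
qed

section \<open>The operator on the completion and its fixed point\<close>

abbreviation L :: "functional \<Rightarrow> functional" where "L \<equiv> transfer_op \<kappa> b"

text \<open>The density operator does not increase the strong norm, so it preserves Cauchy
  sequences, and duality identifies the limit with \<open>L F\<close>. Statements on densities
  extend to the whole space in this way.\<close>

lemma transfer_op_approximates:
  assumes f: "strong_Cauchy \<alpha> \<beta> f" "approximates f F"
  shows "strong_Cauchy \<alpha> \<beta> (\<lambda>n. transfer_density (f n))" "approximates (\<lambda>n. transfer_density (f n)) (L F)"
proof -
  note u = strong_Cauchy_unstable[OF f(1)]
  show "strong_Cauchy \<alpha> \<beta> (\<lambda>n. transfer_density (f n))" unfolding strong_Cauchy_def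
  proof (intro conjI allI impI)
    show "transfer_density (f n) \<in> C1_unstable" for n by (rule transfer_density_C1[OF u])
    fix r :: real assume "0 < r"
    then obtain K where K: "\<And>m n. m \<ge> K \<Longrightarrow> n \<ge> K \<Longrightarrow> strong (\<lambda>x. f m x - f n x) < r"
      using strong_CauchyE[OF f(1)] by blast
    show "\<exists>K. \<forall>m\<ge>K. \<forall>n\<ge>K. strong (\<lambda>x. transfer_density (f m) x - transfer_density (f n) x) < r"
    proof (intro exI[of _ K] allI impI)
      fix m n assume mn: "K \<le> m" "K \<le> n"
      have "(\<lambda>x. transfer_density (f m) x - transfer_density (f n) x) = transfer_density (\<lambda>x. f m x - f n x)"
        using transfer_density_lincomb[of 1 "f m" "-1" "f n"] by simp
      then show "strong (\<lambda>x. transfer_density (f m) x - transfer_density (f n) x) < r"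
        using strong_norm_transfer_density[OF C1_unstable_diff[OF u u], of m n] K[OF mn] by simp
    qed
  qed
  show "approximates (\<lambda>n. transfer_density (f n)) (L F)" unfolding approximates_iff transfer_op_def
    using approximatesD(1)[OF f(2) leafwise_C1_stable] by (simp add: pairing_transfer_density[OF u])
qed

lemma transfer_op_pow_approximates:
  assumes f: "strong_Cauchy \<alpha> \<beta> f" "approximates f F"
  shows "strong_Cauchy \<alpha> \<beta> (\<lambda>n. (transfer_density ^^ k) (f n))"
    "approximates (\<lambda>n. (transfer_density ^^ k) (f n)) ((L ^^ k) F)"
  using f by (induction k) (simp_all add: transfer_op_approximates)

lemma transfer_op_B: "F \<in> B \<Longrightarrow> L F \<in> B"
  by (erule banach_BE) (rule banach_BI[OF transfer_op_approximates])

lemma transfer_op_pow_B: "F \<in> B \<Longrightarrow> (L ^^ n) F \<in> B"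
  by (induction n) (auto intro: transfer_op_B)

lemma transfer_op_lincomb: "L (\<lambda>\<phi>. a * F \<phi> + c * G \<phi>) = (\<lambda>\<phi>. a * L F \<phi> + c * L G \<phi>)"
  unfolding transfer_op_def by auto

lemma transfer_op_pow_lincomb:
  "(L ^^ n) (\<lambda>\<phi>. a * F \<phi> + c * G \<phi>) = (\<lambda>\<phi>. a * (L ^^ n) F \<phi> + c * (L ^^ n) G \<phi>)"
  by (induction n) (simp_all add: transfer_op_lincomb)

lemma transfer_op_one: "L F (\<lambda>_. 1) = F (\<lambda>_. 1)"
  unfolding transfer_op_def using C1_stable_const[of 1] by (simp add: o_def)

lemma B_norm_transfer_op:
  assumes "F \<in> B" shows "N (L F) \<le> N F"
proof -
  obtain f where f: "strong_Cauchy \<alpha> \<beta> f" "approximates f F" using banach_BE[OF assms] by blast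
  show ?thesis
    by (rule LIMSEQ_le[OF B_norm_tendsto[OF transfer_op_approximates[OF f]] B_norm_tendsto[OF f]])
      (intro exI[of _ 0] allI impI strong_norm_transfer_density strong_Cauchy_unstable[OF f(1)])
qed

lemma pairing_one_one: "pairing (\<lambda>_. 1) (\<lambda>_. 1) = 1"
  unfolding pairing_def by (simp add: set_integral_const emeasure_square measure_def)

text \<open>Densities approximating a functional of zero mass need not have zero mass themselves.
  Their masses \<open>c n\<close> tend to 0, so the constant \<open>c n\<close> is subtracted before
  the decay is applied, and its contribution vanishes in the limit.\<close>

theorem B_norm_decay:
  assumes "F \<in> B" "F (\<lambda>_. 1) = 0"
  shows "N ((L ^^ k) F) \<le> decay_const * (real k + 1) * \<rho> ^ k * N F"
proof -
  obtain f where f: "strong_Cauchy \<alpha> \<beta> f" "approximates f F" using banach_BE[OF assms(1)] by blast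
  note u = strong_Cauchy_unstable[OF f(1)]
  define c where "c n = pairing (f n) (\<lambda>_. 1)" for n
  define h where "h n x = f n x - c n" for n x
  have hu: "h n \<in> C1_unstable" for n
    unfolding h_def using C1_unstable_diff[OF u C1_unstable_const] by blast
  have h0: "pairing (h n) (\<lambda>_. 1) = 0" for n
    unfolding h_def using pairing_lincomb[OF u C1_unstable_const[of 1] C1_stable_const[of 1], of 1 n "- c n"] pairing_one_one
    by (simp add: c_def)
  have c0: "c \<longlonglongrightarrow> 0" using approximatesD(1)[OF f(2) C1_stable_const[of 1]] assms(2) unfolding c_def by simp
  have sc: "strong (\<lambda>x. r) \<le> \<bar>r\<bar> * strong (\<lambda>x. 1)" for r
    using strong_norm_lincomb[OF C1_unstable_const[of 1] C1_unstable_const[of 1], of r 0] by simp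
  have nh: "strong (h n) \<le> strong (f n) + \<bar>c n\<bar> * strong (\<lambda>x. 1)" for n
    unfolding h_def using strong_norm_lincomb[OF u C1_unstable_const[of 1], of 1 n "- c n"] by simp
  have le: "strong ((transfer_density ^^ k) (f n))
      \<le> decay_const * (real k + 1) * \<rho> ^ k * (strong (f n) + \<bar>c n\<bar> * strong (\<lambda>x. 1))
        + \<bar>c n\<bar> * strong ((transfer_density ^^ k) (\<lambda>x. 1))" for n
  proof -
    have "f n = (\<lambda>x. 1 * h n x + c n * 1)" unfolding h_def by simp
    then have eq: "(transfer_density ^^ k) (f n) = (\<lambda>x. 1 * (transfer_density ^^ k) (h n) x + c n * (transfer_density ^^ k) (\<lambda>x. 1) x)"
      using transfer_density_pow_lincomb[of k 1 "h n" "c n" "\<lambda>x. 1"] by simp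
    have "strong ((transfer_density ^^ k) (f n))
        \<le> \<bar>1\<bar> * strong ((transfer_density ^^ k) (h n)) + \<bar>c n\<bar> * strong ((transfer_density ^^ k) (\<lambda>x. 1))"
      unfolding eq by (rule strong_norm_lincomb[OF transfer_density_pow_C1[OF hu] transfer_density_pow_C1[OF C1_unstable_const]])
    moreover have "strong ((transfer_density ^^ k) (h n)) \<le> decay_const * (real k + 1) * \<rho> ^ k * strong (h n)"
      by (rule strong_norm_decay[OF hu h0])
    moreover have "decay_const * (real k + 1) * \<rho> ^ k * strong (h n)
        \<le> decay_const * (real k + 1) * \<rho> ^ k * (strong (f n) + \<bar>c n\<bar> * strong (\<lambda>x. 1))"
      using decay_const_pos rho by (intro mult_left_mono nh) auto
    ultimately show ?thesis by simp
  qed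
  have "(\<lambda>n. decay_const * (real k + 1) * \<rho> ^ k * (strong (f n) + \<bar>c n\<bar> * strong (\<lambda>x. 1))
        + \<bar>c n\<bar> * strong ((transfer_density ^^ k) (\<lambda>x. 1)))
      \<longlonglongrightarrow> decay_const * (real k + 1) * \<rho> ^ k * (N F + \<bar>0\<bar> * strong (\<lambda>x. 1))
        + \<bar>0\<bar> * strong ((transfer_density ^^ k) (\<lambda>x. 1))"
    by (intro tendsto_intros B_norm_tendsto f c0)
  from LIMSEQ_le[OF B_norm_tendsto[OF transfer_op_pow_approximates[OF f]] this] le show ?thesis by auto
qed

lemma decay_tendsto: "(\<lambda>n. (real n + 1) * \<rho> ^ n) \<longlonglongrightarrow> 0"
proof -
  have "norm \<rho> < 1" using rho by simp
  from tendsto_add[OF powser_times_n_limit_0[OF this] LIMSEQ_power_zero[OF this]]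
  show ?thesis by (simp add: distrib_right)
qed

text \<open>The densities at times \<open>n\<close> and \<open>n + k\<close> differ by the n-th
  iterate of 1 minus the density at time \<open>k\<close>. This function has zero mass and a norm
  bounded independently of \<open>k\<close>.\<close>

lemma strong_Cauchy_pow_one: "strong_Cauchy \<alpha> \<beta> (\<lambda>n. (transfer_density ^^ n) (\<lambda>_. 1))"
  unfolding strong_Cauchy_def
proof (intro conjI allI impI)
  let ?h = "\<lambda>n. (transfer_density ^^ n) (\<lambda>_. 1 :: real)"
  have u: "?h n \<in> C1_unstable" for n by (rule transfer_density_pow_C1[OF C1_unstable_const])
  show "?h n \<in> C1_unstable" for n by (rule u)
  let ?S = "strong (\<lambda>_. 1)"
  have S0: "0 \<le> ?S" by (rule strong_norm_nonneg[OF C1_unstable_const])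
  have hS: "strong (?h n) \<le> ?S" for n
  proof (induction n)
    case (Suc n)
    then show ?case using strong_norm_transfer_density[OF u, of n] by simp
  qed simp
  have step: "strong (\<lambda>x. ?h n x - ?h (n + k) x) \<le> decay_const * ((real n + 1) * \<rho> ^ n) * (2 * ?S)" for n k
  proof -
    define w where "w = (\<lambda>x. 1 - ?h k x)"
    have w: "w \<in> C1_unstable" unfolding w_def by (rule C1_unstable_diff[OF C1_unstable_const u])
    have "pairing w (\<lambda>_. 1) = pairing (\<lambda>_. 1) (\<lambda>_. 1) - pairing (?h k) (\<lambda>_. 1)"
      unfolding w_def by (rule pairing_diff[OF C1_unstable_const u C1_stable_const])
    then have w0: "pairing w (\<lambda>_. 1) = 0"
      using pairing_transfer_density_one[OF C1_unstable_const[of 1], of k] by linarith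
    have "strong (\<lambda>x. 1 * 1 + (-1) * ?h k x) \<le> \<bar>1\<bar> * ?S + \<bar>- 1\<bar> * strong (?h k)"
      by (rule strong_norm_lincomb[OF C1_unstable_const u])
    moreover have "(\<lambda>x. 1 * 1 + (-1) * ?h k x) = w" unfolding w_def by simp
    ultimately have wS: "strong w \<le> 2 * ?S" using hS[of k] by simp
    have "(transfer_density ^^ n) (\<lambda>x. 1 * 1 + (-1) * ?h k x) = (\<lambda>x. 1 * ?h n x + (-1) * (transfer_density ^^ n) (?h k) x)"
      by (rule transfer_density_pow_lincomb)
    then have "(transfer_density ^^ n) w = (\<lambda>x. ?h n x - ?h (n + k) x)"
      unfolding w_def by (simp add: funpow_add)
    then have "strong (\<lambda>x. ?h n x - ?h (n + k) x) \<le> decay_const * (real n + 1) * \<rho> ^ n * strong w"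
      using strong_norm_decay[OF w w0, of n] by simp
    also have "\<dots> \<le> decay_const * (real n + 1) * \<rho> ^ n * (2 * ?S)"
      using decay_const_pos rho by (intro mult_left_mono wS) simp
    finally show ?thesis by (simp add: mult_ac)
  qed
  fix r :: real assume r: "0 < r"
  have "(\<lambda>n. decay_const * ((real n + 1) * \<rho> ^ n) * (2 * ?S)) \<longlonglongrightarrow> decay_const * 0 * (2 * ?S)"
    by (intro tendsto_intros decay_tendsto)
  then have "\<forall>\<^sub>F n in sequentially. decay_const * ((real n + 1) * \<rho> ^ n) * (2 * ?S) < r"
    using r by (intro order_tendstoD(2)) auto
  then obtain K where K: "\<And>n. n \<ge> K \<Longrightarrow> decay_const * ((real n + 1) * \<rho> ^ n) * (2 * ?S) < r"
    unfolding eventually_sequentially by blast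
  show "\<exists>K. \<forall>m\<ge>K. \<forall>n\<ge>K. strong (\<lambda>x. ?h m x - ?h n x) < r"
  proof (intro exI[of _ K] allI impI)
    fix m n assume mn: "K \<le> m" "K \<le> n"
    show "strong (\<lambda>x. ?h m x - ?h n x) < r"
    proof (cases "m \<le> n")
      case True
      then show ?thesis using step[of m "n - m"] K[OF mn(1)] by simp
    next
      case False
      then show ?thesis using step[of n "m - n"] K[OF mn(2)] strong_norm_diff_commute[OF u u, of m n] by simp
    qed
  qed
qed

text \<open>The limit of Lebesgue measure on the square under iteration. The sequence determines the
  functional, so \<open>SOME\<close> merely names it.\<close>

definition \<mu>\<^sub>0 :: functional where "\<mu>\<^sub>0 = (SOME F. approximates (\<lambda>n. (transfer_density ^^ n) (\<lambda>_. 1)) F)"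

lemma mu0_approximates: "approximates (\<lambda>n. (transfer_density ^^ n) (\<lambda>_. 1)) \<mu>\<^sub>0"
proof -
  obtain F where "approximates (\<lambda>n. (transfer_density ^^ n) (\<lambda>_. 1)) F"
    using strong_Cauchy_approximates[OF strong_Cauchy_pow_one] by blast
  then show ?thesis unfolding \<mu>\<^sub>0_def
    by (rule someI[of "approximates (\<lambda>n. (transfer_density ^^ n) (\<lambda>_. 1))"])
qed

lemma mu0_B: "\<mu>\<^sub>0 \<in> B"
  by (rule banach_BI[OF strong_Cauchy_pow_one mu0_approximates])

text \<open>Applying \<open>L\<close> shifts the approximating sequence by one index, which leaves
  the limit unchanged.\<close>

lemma mu0_invariant: "L \<mu>\<^sub>0 = \<mu>\<^sub>0"
proof
  fix \<phi>
  show "L \<mu>\<^sub>0 \<phi> = \<mu>\<^sub>0 \<phi>"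
  proof (cases "\<phi> \<in> C1_stable")
    case True
    have "(\<lambda>n. pairing ((transfer_density ^^ Suc n) (\<lambda>_. 1)) \<phi>) \<longlonglongrightarrow> L \<mu>\<^sub>0 \<phi>"
      using approximatesD(1)[OF transfer_op_approximates(2)[OF strong_Cauchy_pow_one mu0_approximates] True] by simp
    moreover have "(\<lambda>n. pairing ((transfer_density ^^ Suc n) (\<lambda>_. 1)) \<phi>) \<longlonglongrightarrow> \<mu>\<^sub>0 \<phi>"
      by (rule LIMSEQ_Suc[OF approximatesD(1)[OF mu0_approximates True]])
    ultimately show ?thesis by (rule LIMSEQ_unique)
  next
    case False
    then show ?thesis using approximatesD(2)[OF mu0_approximates False] by (simp add: transfer_op_def)
  qed
qed

lemma mu0_one: "\<mu>\<^sub>0 (\<lambda>_. 1) = 1"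
proof -
  have "pairing ((transfer_density ^^ n) (\<lambda>_. 1)) (\<lambda>_. 1) = 1" for n
    using pairing_transfer_density_one[OF C1_unstable_const] pairing_one_one by simp
  with approximatesD(1)[OF mu0_approximates C1_stable_const[of 1]] show ?thesis
    by (simp add: LIMSEQ_const_iff)
qed

end

section \<open>Neumann series and rank one limits\<close>

lemma bounded_operator_lincomb:
  assumes "bounded_operator V N A" "\<And>c v. v \<in> V \<Longrightarrow> (\<lambda>a. c * v a) \<in> V" "u \<in> V" "v \<in> V"
  shows "A (\<lambda>a. x * u a + y * v a) = (\<lambda>a. x * A u a + y * A v a)"
proof -
  have add: "\<And>u v. u \<in> V \<Longrightarrow> v \<in> V \<Longrightarrow> A (\<lambda>a. u a + v a) = (\<lambda>a. A u a + A v a)"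
    and scale: "\<And>c v. v \<in> V \<Longrightarrow> A (\<lambda>a. c * v a) = (\<lambda>a. c * A v a)"
    using assms(1) unfolding bounded_operator_def by blast+
  have "A (\<lambda>a. x * u a + y * v a) = (\<lambda>a. A (\<lambda>a. x * u a) a + A (\<lambda>a. y * v a) a)"
    by (rule add[OF assms(2)[OF assms(3)] assms(2)[OF assms(4)]])
  then show ?thesis unfolding scale[OF assms(3)] scale[OF assms(4)] .
qed

text \<open>This abstract setting is used twice, for the complexified space and for its subspace of
  zero mass. The inequality \<open>N_lincomb\<close> combines the triangle inequality and
  homogeneity.\<close>

locale function_banach =
  fixes V :: "('a \<Rightarrow> complex) set" and N :: "('a \<Rightarrow> complex) \<Rightarrow> real"
  assumes zero_in: "(\<lambda>_. 0) \<in> V"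
    and lincomb_in: "\<And>u v x y. u \<in> V \<Longrightarrow> v \<in> V \<Longrightarrow> (\<lambda>a. x * u a + y * v a) \<in> V"
    and N_nonneg: "\<And>v. v \<in> V \<Longrightarrow> 0 \<le> N v"
    and N_lincomb: "\<And>u v x y. u \<in> V \<Longrightarrow> v \<in> V \<Longrightarrow> N (\<lambda>a. x * u a + y * v a) \<le> cmod x * N u + cmod y * N v"
    and N_definite: "\<And>v. v \<in> V \<Longrightarrow> N v = 0 \<Longrightarrow> v = (\<lambda>_. 0)"
    and complete: "\<And>F. (\<And>k::nat. F k \<in> V) \<Longrightarrow>
      (\<And>e. 0 < e \<Longrightarrow> \<exists>K. \<forall>m\<ge>K. \<forall>n\<ge>K. N (\<lambda>a. F m a - F n a) < e) \<Longrightarrow>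
      \<exists>G\<in>V. (\<lambda>k. N (\<lambda>a. F k a - G a)) \<longlonglongrightarrow> 0"
begin

lemma scale_in: "v \<in> V \<Longrightarrow> (\<lambda>a. c * v a) \<in> V"
  using lincomb_in[of v v c 0] by simp

lemma diff_in: "u \<in> V \<Longrightarrow> v \<in> V \<Longrightarrow> (\<lambda>a. u a - v a) \<in> V"
  using lincomb_in[of u v 1 "-1"] by simp

lemma N_zero: "N (\<lambda>_. 0) = 0"
  using N_lincomb[OF zero_in zero_in, of 0 0] N_nonneg[OF zero_in] by simp

lemma N_diff: "u \<in> V \<Longrightarrow> v \<in> V \<Longrightarrow> N (\<lambda>a. u a - v a) \<le> N u + N v"
  using N_lincomb[of u v 1 "-1"] by simp

lemma N_scale: "v \<in> V \<Longrightarrow> N (\<lambda>a. c * v a) \<le> cmod c * N v"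
  using N_lincomb[of v v c 0] by simp

lemma limit_unique:
  assumes "\<And>k. F k \<in> V" "G \<in> V" "G' \<in> V" "(\<lambda>k. N (\<lambda>a. F k a - G a)) \<longlonglongrightarrow> 0" "(\<lambda>k. N (\<lambda>a. F k a - G' a)) \<longlonglongrightarrow> 0"
  shows "G = G'"
proof -
  have "(\<lambda>k. N (\<lambda>a. F k a - G' a) + N (\<lambda>a. F k a - G a)) \<longlonglongrightarrow> 0 + 0" by (rule tendsto_add[OF assms(5,4)])
  moreover have "N (\<lambda>a. G a - G' a) \<le> N (\<lambda>a. F k a - G' a) + N (\<lambda>a. F k a - G a)" for k
    using N_diff[OF diff_in[OF assms(1,3)] diff_in[OF assms(1,2)], of k k] by simp
  ultimately have "N (\<lambda>a. G a - G' a) \<le> 0" using LIMSEQ_le_const by fastforce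
  then have "(\<lambda>a. G a - G' a) = (\<lambda>_. 0)"
    using N_definite[OF diff_in[OF assms(2,3)]] N_nonneg[OF diff_in[OF assms(2,3)]] by simp
  then show ?thesis by (metis eq_iff_diff_eq_0 ext)
qed

lemma bounded_operator_in: "bounded_operator V N A \<Longrightarrow> v \<in> V \<Longrightarrow> A v \<in> V"
  unfolding bounded_operator_def by blast

lemma bounded_operatorI:
  assumes "\<And>v. v \<in> V \<Longrightarrow> A v \<in> V"
    "\<And>u v x y. u \<in> V \<Longrightarrow> v \<in> V \<Longrightarrow> A (\<lambda>a. x * u a + y * v a) = (\<lambda>a. x * A u a + y * A v a)"
    "\<And>v. v \<in> V \<Longrightarrow> N (A v) \<le> C * N v"
  shows "bounded_operator V N A"
  unfolding bounded_operator_def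
proof (intro conjI ballI allI exI[of _ C] assms)
  fix u v assume "u \<in> V" "v \<in> V"
  then show "A (\<lambda>a. u a + v a) = (\<lambda>a. A u a + A v a)" using assms(2)[of u v 1 1] by simp
next
  fix c v assume "v \<in> V"
  then show "A (\<lambda>a. c * v a) = (\<lambda>a. c * A v a)" using assms(2)[of v v c 0] by simp
qed

lemma shifted_in: "bounded_operator V N A \<Longrightarrow> v \<in> V \<Longrightarrow> shifted z A v \<in> V"
  unfolding shifted_def using lincomb_in[of v "A v" z "-1"] bounded_operator_in[of A v] by simp

lemma shifted_lincomb:
  assumes "bounded_operator V N A" "u \<in> V" "v \<in> V"
  shows "shifted z A (\<lambda>a. x * u a + y * v a) = (\<lambda>a. x * shifted z A u a + y * shifted z A v a)"
proof -
  have "A (\<lambda>a. x * u a + y * v a) = (\<lambda>a. x * A u a + y * A v a)"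
    by (rule bounded_operator_lincomb[OF assms(1) scale_in assms(2,3)])
  then show ?thesis unfolding shifted_def by (simp add: algebra_simps)
qed

section \<open>The Neumann series of the resolvent\<close>

context
  fixes A :: "('a \<Rightarrow> complex) \<Rightarrow> 'a \<Rightarrow> complex" and c :: "nat \<Rightarrow> real" and z :: complex
  assumes A: "bounded_operator V N A" and z0: "z \<noteq> 0"
    and c: "\<And>n v. v \<in> V \<Longrightarrow> N ((A ^^ n) v) \<le> c n * N v"
    and c_nonneg: "\<And>n. 0 \<le> c n" and summable_c: "summable (\<lambda>n. c n / cmod z ^ Suc n)"
begin

text \<open>Partial sums of the series of \<open>A ^^ k\<close> divided by
  \<open>z ^ (k + 1)\<close>. Bounds \<open>c n\<close> on all powers take the place of the norm of
  \<open>A\<close>, so that the series reaches every \<open>z\<close> beyond the growth rate of the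
  powers.\<close>

definition neumann_sum :: "nat \<Rightarrow> ('a \<Rightarrow> complex) \<Rightarrow> 'a \<Rightarrow> complex"
  where "neumann_sum n v = (\<lambda>a. \<Sum>k<n. inverse z ^ Suc k * (A ^^ k) v a)"

lemma pow_in: "v \<in> V \<Longrightarrow> (A ^^ n) v \<in> V"
  by (induction n) (auto intro: bounded_operator_in[OF A])

lemma A_lincomb: "u \<in> V \<Longrightarrow> v \<in> V \<Longrightarrow> A (\<lambda>a. x * u a + y * v a) = (\<lambda>a. x * A u a + y * A v a)"
  by (rule bounded_operator_lincomb[OF A scale_in])

lemma pow_lincomb: "u \<in> V \<Longrightarrow> v \<in> V \<Longrightarrow> (A ^^ n) (\<lambda>a. x * u a + y * v a) = (\<lambda>a. x * (A ^^ n) u a + y * (A ^^ n) v a)"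
  by (induction n) (simp_all add: A_lincomb pow_in)

lemma neumann_sum_Suc: "neumann_sum (Suc n) v = (\<lambda>a. 1 * neumann_sum n v a + inverse z ^ Suc n * (A ^^ n) v a)"
  unfolding neumann_sum_def by simp

lemma neumann_sum_in: "v \<in> V \<Longrightarrow> neumann_sum n v \<in> V"
proof (induction n)
  case 0 then show ?case using zero_in by (simp add: neumann_sum_def)
next
  case (Suc n) then show ?case unfolding neumann_sum_Suc by (intro lincomb_in pow_in)
qed

lemma neumann_sum_lincomb:
  "u \<in> V \<Longrightarrow> v \<in> V \<Longrightarrow> neumann_sum n (\<lambda>a. x * u a + y * v a) = (\<lambda>a. x * neumann_sum n u a + y * neumann_sum n v a)"
  unfolding neumann_sum_def by (auto simp: pow_lincomb sum.distrib sum_distrib_left algebra_simps)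

lemma N_term: "v \<in> V \<Longrightarrow> cmod (inverse z ^ Suc n) * N ((A ^^ n) v) \<le> c n / cmod z ^ Suc n * N v"
proof -
  assume v: "v \<in> V"
  have eq: "cmod (inverse z ^ Suc n) = 1 / cmod z ^ Suc n"
    by (simp add: norm_power norm_inverse power_inverse divide_inverse del: power_Suc)
  show ?thesis unfolding eq using mult_left_mono[OF c[OF v], of "1 / cmod z ^ Suc n" n]
    by (simp del: power_Suc)
qed

lemma N_neumann_diff:
  assumes "v \<in> V" "n \<le> m"
  shows "N (\<lambda>a. neumann_sum m v a - neumann_sum n v a) \<le> (\<Sum>k=n..<m. c k / cmod z ^ Suc k) * N v"
  using assms(2)
proof (induction m rule: dec_induct)
  case base then show ?case using N_zero by simp
next
  case (step m)
  have "N (\<lambda>a. neumann_sum (Suc m) v a - neumann_sum n v a)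
      = N (\<lambda>a. 1 * (neumann_sum m v a - neumann_sum n v a) + inverse z ^ Suc m * (A ^^ m) v a)"
    unfolding neumann_sum_Suc by (simp add: algebra_simps)
  also have "\<dots> \<le> cmod 1 * N (\<lambda>a. neumann_sum m v a - neumann_sum n v a) + cmod (inverse z ^ Suc m) * N ((A ^^ m) v)"
    by (rule N_lincomb[OF diff_in[OF neumann_sum_in[OF assms(1)] neumann_sum_in[OF assms(1)]] pow_in[OF assms(1)]])
  also have "\<dots> \<le> (\<Sum>k=n..<m. c k / cmod z ^ Suc k) * N v + c m / cmod z ^ Suc m * N v"
    using step.IH N_term[OF assms(1), of m] by simp
  also have "\<dots> = (\<Sum>k=n..<Suc m. c k / cmod z ^ Suc k) * N v"
    using step.hyps by (simp add: distrib_right)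
  finally show ?case .
qed

lemma neumann_limit:
  assumes v: "v \<in> V"
  shows "\<exists>G\<in>V. (\<lambda>k. N (\<lambda>a. neumann_sum k v a - G a)) \<longlonglongrightarrow> 0"
proof (rule complete[OF neumann_sum_in[OF v]])
  fix e :: real assume e: "0 < e"
  let ?t = "\<lambda>k. c k / cmod z ^ Suc k"
  have "0 < e / (N v + 1)" using e N_nonneg[OF v] by simp
  with summable_c obtain K where K: "\<And>m n. m \<ge> K \<Longrightarrow> norm (sum ?t {m..<n}) < e / (N v + 1)"
    unfolding summable_Cauchy by blast
  have t: "0 \<le> ?t k" for k using c_nonneg by simp
  have main: "N (\<lambda>a. neumann_sum m v a - neumann_sum n v a) < e" if "K \<le> n" "n \<le> m" for m n
  proof -
    have "N (\<lambda>a. neumann_sum m v a - neumann_sum n v a) \<le> sum ?t {n..<m} * N v"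
      by (rule N_neumann_diff[OF v that(2)])
    also have "\<dots> \<le> e / (N v + 1) * N v"
      using K[OF that(1), of m] N_nonneg[OF v] by (intro mult_right_mono) auto
    also have "\<dots> < e / (N v + 1) * (N v + 1)" using e N_nonneg[OF v] by (intro mult_strict_left_mono) auto
    also have "\<dots> = e" using N_nonneg[OF v] by simp
    finally show ?thesis .
  qed
  have sym: "N (\<lambda>a. u a - w a) \<le> N (\<lambda>a. w a - u a)" if "u \<in> V" "w \<in> V" for u w
    using N_scale[OF diff_in[OF that(2,1)], of "-1"] by simp
  show "\<exists>K. \<forall>m\<ge>K. \<forall>n\<ge>K. N (\<lambda>a. neumann_sum m v a - neumann_sum n v a) < e"
  proof (intro exI[of _ K] allI impI)
    fix m n assume mn: "K \<le> m" "K \<le> n"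
    show "N (\<lambda>a. neumann_sum m v a - neumann_sum n v a) < e"
    proof (cases "n \<le> m")
      case True then show ?thesis using main mn by blast
    next
      case False
      then have "N (\<lambda>a. neumann_sum n v a - neumann_sum m v a) < e" using main mn by simp
      then show ?thesis using sym[OF neumann_sum_in[OF v] neumann_sum_in[OF v], of m n] by simp
    qed
  qed
qed

text \<open>The series converges in the norm \<open>N\<close>, which is not assumed to control
  values at points, so its sum is chosen as a norm limit instead of being defined pointwise.\<close>

definition neumann :: "('a \<Rightarrow> complex) \<Rightarrow> 'a \<Rightarrow> complex"
  where "neumann v = (SOME G. G \<in> V \<and> (\<lambda>k. N (\<lambda>a. neumann_sum k v a - G a)) \<longlonglongrightarrow> 0)"

lemma neumann:
  assumes "v \<in> V"
  shows "neumann v \<in> V" "(\<lambda>k. N (\<lambda>a. neumann_sum k v a - neumann v a)) \<longlonglongrightarrow> 0"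
proof -
  have "\<exists>G. G \<in> V \<and> (\<lambda>k. N (\<lambda>a. neumann_sum k v a - G a)) \<longlonglongrightarrow> 0" using neumann_limit[OF assms] by blast
  from someI_ex[OF this] show "neumann v \<in> V" "(\<lambda>k. N (\<lambda>a. neumann_sum k v a - neumann v a)) \<longlonglongrightarrow> 0"
    unfolding neumann_def by blast+
qed

lemma neumann_eqI:
  assumes "v \<in> V" "G \<in> V" "(\<lambda>k. N (\<lambda>a. neumann_sum k v a - G a)) \<longlonglongrightarrow> 0"
  shows "neumann v = G"
  by (rule limit_unique[OF neumann_sum_in[OF assms(1)] neumann(1)[OF assms(1)] assms(2) neumann(2)[OF assms(1)] assms(3)])

lemma neumann_lincomb:
  assumes "u \<in> V" "v \<in> V"
  shows "neumann (\<lambda>a. x * u a + y * v a) = (\<lambda>a. x * neumann u a + y * neumann v a)"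
proof (rule neumann_eqI)
  show "(\<lambda>a. x * u a + y * v a) \<in> V" by (rule lincomb_in[OF assms])
  show "(\<lambda>a. x * neumann u a + y * neumann v a) \<in> V" by (intro lincomb_in neumann assms)
  have eq: "(\<lambda>a. neumann_sum k (\<lambda>a. x * u a + y * v a) a - (x * neumann u a + y * neumann v a))
    = (\<lambda>a. x * (neumann_sum k u a - neumann u a) + y * (neumann_sum k v a - neumann v a))" for k
    unfolding neumann_sum_lincomb[OF assms] by (simp add: algebra_simps)
  note d = diff_in[OF neumann_sum_in neumann(1)]
  show "(\<lambda>k. N (\<lambda>a. neumann_sum k (\<lambda>a. x * u a + y * v a) a - (x * neumann u a + y * neumann v a))) \<longlonglongrightarrow> 0"
    unfolding eq
  proof (rule tendsto_sandwich[OF always_eventually always_eventually tendsto_const])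
    show "\<forall>k. 0 \<le> N (\<lambda>a. x * (neumann_sum k u a - neumann u a) + y * (neumann_sum k v a - neumann v a))"
      by (intro allI N_nonneg lincomb_in d assms)
    show "\<forall>k. N (\<lambda>a. x * (neumann_sum k u a - neumann u a) + y * (neumann_sum k v a - neumann v a))
        \<le> cmod x * N (\<lambda>a. neumann_sum k u a - neumann u a) + cmod y * N (\<lambda>a. neumann_sum k v a - neumann v a)"
      by (intro allI N_lincomb d assms)
    have "(\<lambda>k. cmod x * N (\<lambda>a. neumann_sum k u a - neumann u a) + cmod y * N (\<lambda>a. neumann_sum k v a - neumann v a))
        \<longlonglongrightarrow> cmod x * 0 + cmod y * 0" by (intro tendsto_intros neumann(2) assms)
    then show "(\<lambda>k. cmod x * N (\<lambda>a. neumann_sum k u a - neumann u a) + cmod y * N (\<lambda>a. neumann_sum k v a - neumann v a))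
        \<longlonglongrightarrow> 0" by simp
  qed
qed

text \<open>The empty partial sum vanishes, so the Cauchy estimate starting at 0 bounds all partial
  sums, and then the limit.\<close>

lemma neumann_bound:
  assumes v: "v \<in> V" shows "N (neumann v) \<le> suminf (\<lambda>k. c k / cmod z ^ Suc k) * N v"
proof -
  let ?M = "suminf (\<lambda>k. c k / cmod z ^ Suc k) * N v"
  note d = diff_in[OF neumann_sum_in[OF v] neumann(1)[OF v]]
  have "N (neumann v) \<le> ?M + N (\<lambda>a. neumann_sum k v a - neumann v a)" for k
  proof -
    have "N (\<lambda>a. neumann_sum k v a - neumann_sum 0 v a) \<le> (\<Sum>k=0..<k. c k / cmod z ^ Suc k) * N v"
      by (rule N_neumann_diff[OF v]) simp
    also have "\<dots> \<le> ?M"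
      using c_nonneg N_nonneg[OF v] by (intro mult_right_mono sum_le_suminf summable_c) auto
    finally have "N (neumann_sum k v) \<le> ?M" by (simp add: neumann_sum_def)
    then show ?thesis using N_diff[OF neumann_sum_in[OF v] d, of k k] by simp
  qed
  moreover have "(\<lambda>k. ?M + N (\<lambda>a. neumann_sum k v a - neumann v a)) \<longlonglongrightarrow> ?M + 0"
    by (intro tendsto_intros neumann(2)[OF v])
  ultimately show ?thesis using LIMSEQ_le_const by fastforce
qed

text \<open>Up to the factor |z| the remainders are dominated by the terms of a convergent
  series.\<close>

lemma remainder_tendsto: "v \<in> V \<Longrightarrow> (\<lambda>n. N (\<lambda>a. inverse z ^ n * (A ^^ n) v a)) \<longlonglongrightarrow> 0"
proof (rule tendsto_sandwich[OF always_eventually always_eventually tendsto_const])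
  assume v: "v \<in> V"
  show "\<forall>n. 0 \<le> N (\<lambda>a. inverse z ^ n * (A ^^ n) v a)" by (intro allI N_nonneg scale_in pow_in v)
  show "\<forall>n. N (\<lambda>a. inverse z ^ n * (A ^^ n) v a) \<le> cmod z * (c n / cmod z ^ Suc n) * N v"
  proof
    fix n
    have "N (\<lambda>a. inverse z ^ n * (A ^^ n) v a) \<le> cmod (inverse z ^ n) * N ((A ^^ n) v)" by (rule N_scale[OF pow_in[OF v]])
    also have "\<dots> = cmod z * (cmod (inverse z ^ Suc n) * N ((A ^^ n) v))"
      using z0 by (simp add: norm_mult norm_inverse)
    also have "\<dots> \<le> cmod z * (c n / cmod z ^ Suc n * N v)" by (rule mult_left_mono[OF N_term[OF v]]) simp
    finally show "N (\<lambda>a. inverse z ^ n * (A ^^ n) v a) \<le> cmod z * (c n / cmod z ^ Suc n) * N v" by (simp only: mult.assoc)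
  qed
  have "(\<lambda>n. cmod z * (c n / cmod z ^ Suc n) * N v) \<longlonglongrightarrow> cmod z * 0 * N v"
    by (intro tendsto_intros summable_LIMSEQ_zero[OF summable_c])
  then show "(\<lambda>n. cmod z * (c n / cmod z ^ Suc n) * N v) \<longlonglongrightarrow> 0" by simp
qed

text \<open>Multiplying a partial sum by \<open>z - A\<close> telescopes on either side; both orders
  are required for a two-sided inverse.\<close>

lemma neumann_sum_telescope:
  assumes v: "v \<in> V"
  shows "neumann_sum n (shifted z A v) = (\<lambda>a. v a - inverse z ^ n * (A ^^ n) v a)"
    and "shifted z A (neumann_sum n v) = (\<lambda>a. v a - inverse z ^ n * (A ^^ n) v a)"
proof -
  have Av: "A v \<in> V" by (rule bounded_operator_in[OF A v])
  have zi: "z * (inverse z * w) = w" for w using z0 by simp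
  have sh: "shifted z A v = (\<lambda>a. z * v a + (-1) * A v a)" unfolding shifted_def by simp
  have 1: "(A ^^ n) (shifted z A v) = (\<lambda>a. z * (A ^^ n) v a - (A ^^ Suc n) v a)" for n
    unfolding sh pow_lincomb[OF v Av] by (simp add: funpow_swap1)
  show "neumann_sum n (shifted z A v) = (\<lambda>a. v a - inverse z ^ n * (A ^^ n) v a)"
  proof (induction n)
    case 0 then show ?case by (simp add: neumann_sum_def)
  next
    case (Suc n)
    show ?case unfolding neumann_sum_Suc Suc 1 by (simp add: algebra_simps zi)
  qed
  show "shifted z A (neumann_sum n v) = (\<lambda>a. v a - inverse z ^ n * (A ^^ n) v a)"
  proof (induction n)
    case 0
    have "shifted z A (\<lambda>a. 0 * v a + 0 * v a) = (\<lambda>a. 0)" unfolding shifted_lincomb[OF A v v] by simp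
    then show ?case by (simp add: neumann_sum_def)
  next
    case (Suc n)
    have "shifted z A (neumann_sum (Suc n) v) = (\<lambda>a. 1 * shifted z A (neumann_sum n v) a + inverse z ^ Suc n * shifted z A ((A ^^ n) v) a)"
      unfolding neumann_sum_Suc by (rule shifted_lincomb[OF A neumann_sum_in[OF v] pow_in[OF v]])
    then show ?case unfolding Suc unfolding shifted_def by (simp add: algebra_simps zi)
  qed
qed

text \<open>The remainder in the telescoped identities vanishes in the limit. For the left inverse
  this is the defining property of \<open>neumann\<close>; for the right inverse, boundedness of
  \<open>z - A\<close> lets it pass through the limit.\<close>

theorem neumann_resolvent: "z \<in> resolvent_set V N A"
  unfolding resolvent_set_def
proof (intro CollectI exI[of _ neumann] conjI ballI)
  show "bounded_operator V N neumann"
    by (rule bounded_operatorI[OF neumann(1) neumann_lincomb neumann_bound])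
  fix v assume v: "v \<in> V"
  have lim: "(\<lambda>k. N (\<lambda>a. (v a - inverse z ^ k * (A ^^ k) v a) - v a)) \<longlonglongrightarrow> 0"
  proof (rule tendsto_sandwich[OF always_eventually always_eventually tendsto_const remainder_tendsto[OF v]])
    have eq: "(\<lambda>a. (v a - inverse z ^ k * (A ^^ k) v a) - v a) = (\<lambda>a. (-1) * (inverse z ^ k * (A ^^ k) v a))" for k
      by simp
    show "\<forall>k. 0 \<le> N (\<lambda>a. (v a - inverse z ^ k * (A ^^ k) v a) - v a)"
      unfolding eq by (intro allI N_nonneg scale_in pow_in v)
    show "\<forall>k. N (\<lambda>a. (v a - inverse z ^ k * (A ^^ k) v a) - v a) \<le> N (\<lambda>a. inverse z ^ k * (A ^^ k) v a)"
      unfolding eq using N_scale[OF scale_in[OF pow_in[OF v]], of "-1"] by simp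
  qed
  show "neumann (shifted z A v) = v"
    by (rule neumann_eqI[OF shifted_in[OF A v] v], unfold neumann_sum_telescope(1)[OF v], rule lim)
  obtain C where C: "\<And>v. v \<in> V \<Longrightarrow> N (A v) \<le> C * N v" using A unfolding bounded_operator_def by blast
  note nv = neumann(1)[OF v]
  show "shifted z A (neumann v) = v"
  proof (rule limit_unique[of "\<lambda>k. shifted z A (neumann_sum k v)", symmetric])
    show "shifted z A (neumann_sum k v) \<in> V" for k by (rule shifted_in[OF A neumann_sum_in[OF v]])
    show "v \<in> V" by (rule v)
    show "shifted z A (neumann v) \<in> V" by (rule shifted_in[OF A nv])
    show "(\<lambda>k. N (\<lambda>a. shifted z A (neumann_sum k v) a - v a)) \<longlonglongrightarrow> 0"
      unfolding neumann_sum_telescope(2)[OF v] by (rule lim)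
    show "(\<lambda>k. N (\<lambda>a. shifted z A (neumann_sum k v) a - shifted z A (neumann v) a)) \<longlonglongrightarrow> 0"
    proof (rule tendsto_sandwich[OF always_eventually always_eventually tendsto_const])
      show "\<forall>k. 0 \<le> N (\<lambda>a. shifted z A (neumann_sum k v) a - shifted z A (neumann v) a)"
        by (intro allI N_nonneg diff_in shifted_in[OF A] neumann_sum_in v nv)
      show "\<forall>k. N (\<lambda>a. shifted z A (neumann_sum k v) a - shifted z A (neumann v) a)
          \<le> (cmod z + C) * N (\<lambda>a. neumann_sum k v a - neumann v a)"
      proof
        fix k
        let ?w = "\<lambda>a. neumann_sum k v a - neumann v a"
        have w: "?w \<in> V" by (rule diff_in[OF neumann_sum_in[OF v] nv])
        have "(\<lambda>a. shifted z A (neumann_sum k v) a - shifted z A (neumann v) a) = shifted z A (\<lambda>a. 1 * neumann_sum k v a + (-1) * neumann v a)"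
          unfolding shifted_lincomb[OF A neumann_sum_in[OF v] nv] by simp
        also have "\<dots> = (\<lambda>a. z * ?w a + (-1) * A ?w a)" unfolding shifted_def by simp
        finally have eq: "(\<lambda>a. shifted z A (neumann_sum k v) a - shifted z A (neumann v) a) = (\<lambda>a. z * ?w a + (-1) * A ?w a)" .
        have "N (\<lambda>a. z * ?w a + (-1) * A ?w a) \<le> cmod z * N ?w + cmod (-1) * N (A ?w)"
          by (rule N_lincomb[OF w bounded_operator_in[OF A w]])
        moreover have "cmod z * N ?w + cmod (-1) * N (A ?w) \<le> (cmod z + C) * N ?w" using C[OF w] by (simp add: distrib_right)
        ultimately show "N (\<lambda>a. shifted z A (neumann_sum k v) a - shifted z A (neumann v) a) \<le> (cmod z + C) * N ?w"
          unfolding eq by (rule order_trans)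
      qed
      have "(\<lambda>k. (cmod z + C) * N (\<lambda>a. neumann_sum k v a - neumann v a)) \<longlonglongrightarrow> (cmod z + C) * 0"
        by (intro tendsto_intros neumann(2)[OF v])
      then show "(\<lambda>k. (cmod z + C) * N (\<lambda>a. neumann_sum k v a - neumann v a)) \<longlonglongrightarrow> 0" by simp
    qed
  qed
qed

end

end

text \<open>The space is the sum of the line through \<mu>, on which \<open>A\<close> is the
  identity, and the kernel of \<tau>, on which the powers of \<open>A\<close> decay; both are
  invariant. Linearity of \<tau> is stated for all functions, as \<tau> will be an
  evaluation.\<close>

locale rank_one_decay = function_banach V N for V :: "('a \<Rightarrow> complex) set" and N +
  fixes A :: "('a \<Rightarrow> complex) \<Rightarrow> 'a \<Rightarrow> complex" and \<mu> :: "'a \<Rightarrow> complex" and \<tau> :: "('a \<Rightarrow> complex) \<Rightarrow> complex"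
    and D \<rho> M :: real
  assumes A: "bounded_operator V N A" and mu_in: "\<mu> \<in> V" and A_mu: "A \<mu> = \<mu>" and l_mu: "\<tau> \<mu> = 1"
    and l_lincomb: "\<And>u v x y. \<tau> (\<lambda>a. x * u a + y * v a) = x * \<tau> u + y * \<tau> v"
    and l_bound: "\<And>v. v \<in> V \<Longrightarrow> cmod (\<tau> v) \<le> M * N v"
    and l_A: "\<And>v. v \<in> V \<Longrightarrow> \<tau> (A v) = \<tau> v"
    and D: "0 \<le> D" and rho: "0 < \<rho>" "\<rho> < 1"
    and decay: "\<And>n v. v \<in> V \<Longrightarrow> \<tau> v = 0 \<Longrightarrow> N ((A ^^ n) v) \<le> D * (real n + 1) * \<rho> ^ n * N v"
begin

section \<open>Spectrum of an operator that fixes a line and decays on a complement\<close>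

definition K :: "('a \<Rightarrow> complex) set" where "K = {v \<in> V. \<tau> v = 0}"

lemma l_diff: "\<tau> (\<lambda>a. u a - v a) = \<tau> u - \<tau> v"
  using l_lincomb[of 1 u "-1" v] by simp

lemma l_scale: "\<tau> (\<lambda>a. x * v a) = x * \<tau> v"
  using l_lincomb[of x v 0 v] by simp

lemma l_zero: "\<tau> (\<lambda>_. 0) = 0"
  using l_scale[of 0 "\<lambda>_. 0"] by simp

lemma mu_nonzero: "\<mu> \<noteq> (\<lambda>_. 0)"
  using l_mu l_zero by auto

text \<open>Boundedness of \<tau> makes its kernel closed, so completeness is inherited.\<close>

lemma K_function_banach: "function_banach K N"
proof
  show "(\<lambda>_. 0) \<in> K" using zero_in l_zero by (simp add: K_def)
  show "(\<lambda>a. x * u a + y * v a) \<in> K" if "u \<in> K" "v \<in> K" for u v x y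
    using that lincomb_in by (simp add: K_def l_lincomb)
  show "0 \<le> N v" if "v \<in> K" for v using that N_nonneg by (simp add: K_def)
  show "N (\<lambda>a. x * u a + y * v a) \<le> cmod x * N u + cmod y * N v" if "u \<in> K" "v \<in> K" for u v x y
    using that N_lincomb by (simp add: K_def)
  show "v = (\<lambda>_. 0)" if "v \<in> K" "N v = 0" for v using that N_definite by (simp add: K_def)
  fix F :: "nat \<Rightarrow> 'a \<Rightarrow> complex"
  assume F: "\<And>k. F k \<in> K" and C: "\<And>e. 0 < e \<Longrightarrow> \<exists>K. \<forall>m\<ge>K. \<forall>n\<ge>K. N (\<lambda>a. F m a - F n a) < e"
  have FV: "F k \<in> V" "\<tau> (F k) = 0" for k using F[of k] by (auto simp: K_def)
  obtain G where G: "G \<in> V" "(\<lambda>k. N (\<lambda>a. F k a - G a)) \<longlonglongrightarrow> 0" using complete[OF FV(1) C] by blast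
  have "cmod (\<tau> G) \<le> M * N (\<lambda>a. F k a - G a)" for k
    using l_bound[OF diff_in[OF FV(1) G(1)], of k] by (simp add: l_diff FV(2))
  moreover have "(\<lambda>k. M * N (\<lambda>a. F k a - G a)) \<longlonglongrightarrow> M * 0" by (intro tendsto_intros G(2))
  ultimately have "cmod (\<tau> G) \<le> 0" using LIMSEQ_le_const by fastforce
  then have "G \<in> K" using G(1) by (simp add: K_def)
  with G(2) show "\<exists>G\<in>K. (\<lambda>k. N (\<lambda>a. F k a - G a)) \<longlonglongrightarrow> 0" by blast
qed

lemma K_bounded: "bounded_operator K N A"
proof -
  obtain C where C: "\<And>v. v \<in> V \<Longrightarrow> N (A v) \<le> C * N v" using A unfolding bounded_operator_def by blast
  show ?thesis
  proof (rule function_banach.bounded_operatorI[OF K_function_banach])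
  show "A v \<in> K" if "v \<in> K" for v using that bounded_operator_in[OF A] l_A by (simp add: K_def)
  show "A (\<lambda>a. x * u a + y * v a) = (\<lambda>a. x * A u a + y * A v a)" if "u \<in> K" "v \<in> K" for u v x y
    using that by (intro bounded_operator_lincomb[OF A scale_in]) (auto simp: K_def)
  show "N (A v) \<le> C * N v" if "v \<in> K" for v using that C by (simp add: K_def)
  qed
qed

text \<open>Up to a constant, the terms of the Neumann series are bounded by those of the derivative
  of a geometric series with ratio \<open>\<rho> / cmod z\<close>.\<close>

lemma K_resolvent:
  assumes "\<rho> < cmod z" shows "z \<in> resolvent_set K N A"
proof (rule function_banach.neumann_resolvent[OF K_function_banach K_bounded, of _ "\<lambda>n. D * (real n + 1) * \<rho> ^ n"])
  show "z \<noteq> 0" using assms rho by auto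
  show "N ((A ^^ n) v) \<le> D * (real n + 1) * \<rho> ^ n * N v" if "v \<in> K" for n v
    using decay that by (simp add: K_def)
  show "0 \<le> D * (real n + 1) * \<rho> ^ n" for n using D rho by simp
  have "0 < cmod z" using assms rho by linarith
  then have "norm (\<rho> / cmod z) < 1" using assms rho by (simp add: divide_less_eq)
  from sums_summable[OF geometric_deriv_sums[OF this]]
  have "summable (\<lambda>n. D / cmod z * (real (Suc n) * (\<rho> / cmod z) ^ n))" by (intro summable_mult)
  then show "summable (\<lambda>n. D * (real n + 1) * \<rho> ^ n / cmod z ^ Suc n)"
    by (simp add: power_divide mult_ac add.commute)
qed

definition proj :: "('a \<Rightarrow> complex) \<Rightarrow> 'a \<Rightarrow> complex" where "proj v = (\<lambda>a. v a - \<tau> v * \<mu> a)"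

lemma proj_in: "v \<in> V \<Longrightarrow> proj v \<in> K"
  unfolding proj_def K_def by (simp add: l_diff l_scale l_mu diff_in[OF _ scale_in[OF mu_in]])

lemma proj_lincomb: "proj (\<lambda>a. x * u a + y * v a) = (\<lambda>a. x * proj u a + y * proj v a)"
  unfolding proj_def l_lincomb by (auto simp: algebra_simps)

lemma shifted_mu: "shifted z A (\<lambda>a. c * \<mu> a) = (\<lambda>a. c * (z - 1) * \<mu> a)"
  using bounded_operator_lincomb[OF A scale_in mu_in mu_in, of c 0]
  unfolding shifted_def by (auto simp: A_mu algebra_simps)

lemma shifted_decomp:
  assumes "v \<in> V"
  shows "shifted z A v = (\<lambda>a. \<tau> v * (z - 1) * \<mu> a + shifted z A (proj v) a)"
proof -
  have p: "proj v \<in> V" using proj_in[OF assms] by (simp add: K_def)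
  have "v = (\<lambda>a. 1 * (\<tau> v * \<mu> a) + 1 * proj v a)" by (simp add: proj_def)
  then have "shifted z A v = shifted z A (\<lambda>a. 1 * (\<tau> v * \<mu> a) + 1 * proj v a)" by simp
  also have "\<dots> = (\<lambda>a. 1 * shifted z A (\<lambda>a. \<tau> v * \<mu> a) a + 1 * shifted z A (proj v) a)"
    by (rule shifted_lincomb[OF A scale_in[OF mu_in] p])
  finally show ?thesis unfolding shifted_mu by simp
qed

text \<open>The operator \<open>z - A\<close> acts as the number \<open>z - 1\<close> on the line of
  \<mu> and is inverted by \<open>R\<close> on the kernel of \<tau>. The two inverses are added
  along the decomposition of \<open>v\<close> into \<open>\<tau> v * \<mu>\<close> and
  \<open>proj v\<close>.\<close>

lemma resolvent:
  assumes z: "\<rho> < cmod z" "z \<noteq> 1" shows "z \<in> resolvent_set V N A"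
proof -
  obtain R where R: "bounded_operator K N R" "\<And>v. v \<in> K \<Longrightarrow> R (shifted z A v) = v" "\<And>v. v \<in> K \<Longrightarrow> shifted z A (R v) = v"
    using K_resolvent[OF z(1)] unfolding resolvent_set_def by blast
  interpret K: function_banach K N by (rule K_function_banach)
  have RK: "R v \<in> K" if "v \<in> K" for v by (rule K.bounded_operator_in[OF R(1) that])
  have KV: "v \<in> V" if "v \<in> K" for v using that by (simp add: K_def)
  obtain C where C: "\<And>v. v \<in> K \<Longrightarrow> N (R v) \<le> C * N v" using R(1) unfolding bounded_operator_def by blast
  \<comment> \<open>The constant in \<open>bounded_operator\<close> carries no sign
    condition.\<close>
  have C': "N (R v) \<le> \<bar>C\<bar> * N v" if "v \<in> K" for v
    using C[OF that] mult_right_mono[OF abs_ge_self[of C] K.N_nonneg[OF that]] by simp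
  define Q where "Q v = (\<lambda>a. \<tau> v / (z - 1) * \<mu> a + 1 * R (proj v) a)" for v
  have z1: "z - 1 \<noteq> 0" using z by simp
  show ?thesis unfolding resolvent_set_def
  proof (intro CollectI exI[of _ Q] conjI ballI)
    show "bounded_operator V N Q"
    proof (rule bounded_operatorI)
      show "Q v \<in> V" if "v \<in> V" for v
        unfolding Q_def by (rule lincomb_in[OF mu_in KV[OF RK[OF proj_in[OF that]]]])
      show "Q (\<lambda>a. x * u a + y * v a) = (\<lambda>a. x * Q u a + y * Q v a)" if "u \<in> V" "v \<in> V" for u v x y
      proof -
        have "R (\<lambda>a. x * proj u a + y * proj v a) = (\<lambda>a. x * R (proj u) a + y * R (proj v) a)"
          by (rule bounded_operator_lincomb[OF R(1) K.scale_in proj_in[OF that(1)] proj_in[OF that(2)]])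
        then show ?thesis
          unfolding Q_def proj_lincomb l_lincomb by (simp add: algebra_simps add_divide_distrib)
      qed
      show "N (Q v) \<le> (M / cmod (z - 1) * N \<mu> + \<bar>C\<bar> * (1 + M * N \<mu>)) * N v" if v: "v \<in> V" for v
      proof -
        have "N (proj v) \<le> N v + cmod (\<tau> v) * N \<mu>"
          unfolding proj_def using N_diff[OF v scale_in[OF mu_in]] N_scale[OF mu_in, of "\<tau> v"] by (meson add_left_mono order_trans)
        also have "\<dots> \<le> N v + M * N v * N \<mu>"
          by (intro add_left_mono mult_right_mono l_bound v N_nonneg mu_in)
        finally have p: "N (proj v) \<le> (1 + M * N \<mu>) * N v" by (simp add: algebra_simps)
        have "N (Q v) \<le> cmod (\<tau> v / (z - 1)) * N \<mu> + cmod 1 * N (R (proj v))"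
          unfolding Q_def by (rule N_lincomb[OF mu_in KV[OF RK[OF proj_in[OF v]]]])
        also have "\<dots> \<le> (M * N v) / cmod (z - 1) * N \<mu> + cmod 1 * (\<bar>C\<bar> * ((1 + M * N \<mu>) * N v))"
          unfolding norm_divide
          by (intro add_mono mult_right_mono mult_left_mono divide_right_mono l_bound v N_nonneg mu_in
              order_trans[OF C'[OF proj_in[OF v]]] p) auto
        finally show ?thesis by (simp add: algebra_simps)
      qed
    qed
    fix v assume v: "v \<in> V"
    have l: "\<tau> (shifted z A v) = (z - 1) * \<tau> v"
      unfolding shifted_def using l_lincomb[of z v "-1" "A v"] l_A[OF v] by (simp add: algebra_simps)
    have p: "proj (shifted z A v) = shifted z A (proj v)"
    proof -
      have "proj (shifted z A v) = (\<lambda>a. shifted z A v a - (z - 1) * \<tau> v * \<mu> a)" unfolding proj_def l ..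
      then show ?thesis unfolding shifted_decomp[OF v] by (simp add: mult_ac)
    qed
    show "Q (shifted z A v) = v"
      unfolding Q_def p l R(2)[OF proj_in[OF v]] using z1 by (simp add: proj_def)
    have "shifted z A (Q v) = (\<lambda>a. \<tau> v / (z - 1) * shifted z A \<mu> a + 1 * shifted z A (R (proj v)) a)"
      unfolding Q_def by (rule shifted_lincomb[OF A mu_in KV[OF RK[OF proj_in[OF v]]]])
    then show "shifted z A (Q v) = v"
      unfolding R(3)[OF proj_in[OF v]] using shifted_mu[of z 1] z1 by (simp add: proj_def)
  qed
qed

text \<open>A left inverse of \<open>1 - A\<close> would have to send 0 to \<mu>.\<close>

lemma one_in_spectrum: "1 \<in> spectrum_on V N A"
proof -
  have False if R: "bounded_operator V N R" "\<forall>v\<in>V. R (shifted 1 A v) = v" for R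
  proof -
    have "shifted 1 A \<mu> = (\<lambda>_. 0)" using shifted_mu[of 1 1] by simp
    then have "R (\<lambda>_. 0) = \<mu>" using R(2) mu_in by metis
    moreover have "R (\<lambda>_. 0) = (\<lambda>_. 0)"
      using bounded_operator_lincomb[OF R(1) scale_in zero_in zero_in, of 0 0] by simp
    ultimately show False using mu_nonzero by simp
  qed
  then show ?thesis unfolding spectrum_on_def resolvent_set_def by blast
qed

lemma spectrum_cases: "z \<in> spectrum_on V N A \<Longrightarrow> z = 1 \<or> cmod z \<le> \<rho>"
  using resolvent[of z] unfolding spectrum_on_def by fastforce

lemma spectral_radius: "spectral_radius_on V N A = 1"
  unfolding spectral_radius_on_def
proof (rule cSup_eq_maximum)
  show "1 \<in> cmod ` spectrum_on V N A" using one_in_spectrum by (force intro: rev_image_eqI)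
  show "x \<le> 1" if "x \<in> cmod ` spectrum_on V N A" for x using that spectrum_cases rho by fastforce
qed

lemma proj_zero_iff: "{v \<in> V. (\<lambda>a. \<tau> v * \<mu> a) = (\<lambda>_. 0)} = K"
proof -
  have "(\<lambda>a. \<tau> v * \<mu> a) = (\<lambda>_. 0) \<longleftrightarrow> \<tau> v = 0" for v using mu_nonzero by (auto simp: fun_eq_iff)
  then show ?thesis by (simp add: K_def)
qed

text \<open>The Riesz projection at 1 is the rank one operator \<open>\<tau> v * \<mu>\<close>. Its
  kernel is \<open>K\<close>, on which 1 lies in the resolvent set. The rest of the spectrum stays
  in the disc of radius \<rho>, hence outside the ball of radius \<open>1 - \<rho>\<close> about
  1.\<close>

lemma discrete_one: "discrete_eigenvalue V N A 1"
  unfolding discrete_eigenvalue_def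
proof (intro conjI exI[of _ "\<lambda>v a. \<tau> v * \<mu> a"] ballI)
  show "1 isolated_in spectrum_on V N A" unfolding isolated_in_def
  proof (intro conjI exI[of _ "ball 1 (1 - \<rho>)"] one_in_spectrum open_ball)
    show "ball 1 (1 - \<rho>) \<inter> spectrum_on V N A = {1}"
    proof (intro equalityI subsetI)
      fix z assume z: "z \<in> ball 1 (1 - \<rho>) \<inter> spectrum_on V N A"
      then have "cmod (1 - z) < 1 - \<rho>" by (simp add: dist_norm)
      moreover have "1 \<le> cmod (1 - z) + cmod z" using norm_triangle_ineq[of "1 - z" z] by simp
      ultimately show "z \<in> {1}" using spectrum_cases[of z] z by auto
    qed (use one_in_spectrum rho in auto)
  qed
  show "eigenvalue_on V A 1"
    unfolding eigenvalue_on_def using mu_in mu_nonzero A_mu by (intro bexI[of _ \<mu>]) auto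
  show "bounded_operator V N (\<lambda>v a. \<tau> v * \<mu> a)"
  proof (rule bounded_operatorI)
    show "(\<lambda>a. \<tau> v * \<mu> a) \<in> V" for v by (rule scale_in[OF mu_in])
    show "(\<lambda>a. \<tau> (\<lambda>a. x * u a + y * v a) * \<mu> a) = (\<lambda>a. x * (\<tau> u * \<mu> a) + y * (\<tau> v * \<mu> a))" for u v x y
      unfolding l_lincomb by (simp add: algebra_simps)
    show "N (\<lambda>a. \<tau> v * \<mu> a) \<le> M * N \<mu> * N v" if "v \<in> V" for v
      using N_scale[OF mu_in, of "\<tau> v"] mult_right_mono[OF l_bound[OF that] N_nonneg[OF mu_in]] by (simp add: mult_ac)
  qed
  show "(\<lambda>a. \<tau> (\<lambda>a. \<tau> v * \<mu> a) * \<mu> a) = (\<lambda>a. \<tau> v * \<mu> a)" for v unfolding l_scale l_mu by simp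
  show "(\<lambda>a. \<tau> (A v) * \<mu> a) = A (\<lambda>a. \<tau> v * \<mu> a)" if "v \<in> V" for v
    using bounded_operator_lincomb[OF A scale_in mu_in mu_in, of "\<tau> v" 0] by (simp add: l_A[OF that] A_mu)
  show "finite_dimensional ((\<lambda>v a. \<tau> v * \<mu> a) ` V)" unfolding finite_dimensional_def
  proof (intro exI[of _ "{\<mu>}"] conjI ballI)
    have "\<mu> = (\<lambda>a. \<tau> \<mu> * \<mu> a)" by (simp add: l_mu)
    with mu_in show "{\<mu>} \<subseteq> (\<lambda>v a. \<tau> v * \<mu> a) ` V" by blast
    show "\<exists>c. u = (\<lambda>a. \<Sum>s\<in>{\<mu>}. c s * s a)" if "u \<in> (\<lambda>v a. \<tau> v * \<mu> a) ` V" for u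
    proof -
      obtain v where "u = (\<lambda>a. \<tau> v * \<mu> a)" using \<open>u \<in> _\<close> by blast
      then show ?thesis by (intro exI[of _ "\<lambda>_. \<tau> v"]) simp
    qed
  qed simp
  show "\<exists>k. \<forall>v\<in>(\<lambda>v a. \<tau> v * \<mu> a) ` V. (shifted 1 A ^^ k) v = (\<lambda>_. 0)"
    by (intro exI[of _ 1]) (auto simp: shifted_mu)
  show "1 \<in> resolvent_set {v \<in> V. (\<lambda>a. \<tau> v * \<mu> a) = (\<lambda>_. 0)} N A"
    unfolding proj_zero_iff by (rule K_resolvent) (use rho in simp)
qed

text \<open>Outside the closed disc of radius \<rho> the spectrum consists of 1 alone, so \<rho> is
  admissible in the infimum.\<close>

lemma essential_radius: "essential_spectral_radius V N A \<le> \<rho>"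
  unfolding essential_spectral_radius_def
proof (rule cInf_lower)
  show "\<rho> \<in> {r. 0 \<le> r \<and> (\<forall>z\<in>spectrum_on V N A. r < cmod z \<longrightarrow> discrete_eigenvalue V N A z)}"
    using rho spectrum_cases discrete_one by fastforce
  show "bdd_below {r. 0 \<le> r \<and> (\<forall>z\<in>spectrum_on V N A. r < cmod z \<longrightarrow> discrete_eigenvalue V N A z)}"
    by (rule bdd_belowI[of _ 0]) simp
qed

lemma quasi_compact: "quasi_compact V N A"
  unfolding quasi_compact_def spectral_radius using A essential_radius rho by simp

text \<open>On \<open>K\<close> the operator \<open>1 - A\<close> is invertible, so a generalized
  eigenvector for 1 has no component there and lies on the line of \<mu>.\<close>

lemma simple_one: "simple_eigenvalue_on V A 1"
  unfolding simple_eigenvalue_on_def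
proof (intro bexI[OF _ mu_in] conjI mu_nonzero)
  obtain R where R: "bounded_operator K N R" "\<And>v. v \<in> K \<Longrightarrow> R (shifted 1 A v) = v"
    using K_resolvent[of 1] rho unfolding resolvent_set_def by auto
  interpret K: function_banach K N by (rule K_function_banach)
  have inj: "(shifted 1 A ^^ k) w = (\<lambda>_. 0) \<Longrightarrow> w = (\<lambda>_. 0)" if "w \<in> K" for k w
    using that
  proof (induction k arbitrary: w)
    case (Suc k)
    have "(shifted 1 A ^^ k) (shifted 1 A w) = (\<lambda>_. 0)" using Suc.prems(1) by (simp add: funpow_swap1)
    then have "shifted 1 A w = (\<lambda>_. 0)" by (rule Suc.IH[OF _ K.shifted_in[OF K_bounded Suc.prems(2)]])
    then have "w = R (\<lambda>_. 0)" using R(2)[OF Suc.prems(2)] by simp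
    also have "\<dots> = (\<lambda>_. 0)" using bounded_operator_lincomb[OF R(1) K.scale_in K.zero_in K.zero_in, of 0 0] by simp
    finally show ?case .
  qed simp
  show "{u \<in> V. \<exists>k. (shifted 1 A ^^ k) u = (\<lambda>_. 0)} = range (\<lambda>c a. c * \<mu> a)"
  proof (intro equalityI subsetI)
    fix u assume "u \<in> {u \<in> V. \<exists>k. (shifted 1 A ^^ k) u = (\<lambda>_. 0)}"
    then obtain k where u: "u \<in> V" "(shifted 1 A ^^ k) u = (\<lambda>_. 0)" by blast
    have "shifted 1 A (\<lambda>_. 0) = (\<lambda>_. 0)" using shifted_mu[of 1 0] by simp
    \<comment> \<open>One more power guarantees that at least one factor acts, and a single factor
      removes the component along \<mu>.\<close>
    then have "(shifted 1 A ^^ Suc k) u = (\<lambda>_. 0)" using u(2) by simp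
    then have "(shifted 1 A ^^ k) (shifted 1 A u) = (\<lambda>_. 0)" by (simp add: funpow_swap1)
    moreover have "shifted 1 A u = shifted 1 A (proj u)" using shifted_decomp[OF u(1), of 1] by simp
    ultimately have "(shifted 1 A ^^ Suc k) (proj u) = (\<lambda>_. 0)" by (simp add: funpow_swap1)
    then have "proj u = (\<lambda>_. 0)" by (rule inj[OF proj_in[OF u(1)]])
    then have "u = (\<lambda>a. \<tau> u * \<mu> a)" unfolding proj_def by (simp add: fun_eq_iff)
    then show "u \<in> range (\<lambda>c a. c * \<mu> a)" by blast
  next
    fix u assume "u \<in> range (\<lambda>c a. c * \<mu> a)"
    then obtain c where u: "u = (\<lambda>a. c * \<mu> a)" by blast
    have "(shifted 1 A ^^ 1) u = (\<lambda>_. 0)" unfolding u by (simp add: shifted_mu)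
    then show "u \<in> {u \<in> V. \<exists>k. (shifted 1 A ^^ k) u = (\<lambda>_. 0)}" using scale_in[OF mu_in] u by blast
  qed
qed

lemma eigenvalue_less_one:
  assumes "eigenvalue_on V A z" "z \<noteq> 1" shows "cmod z < 1"
proof (rule ccontr)
  assume "\<not> cmod z < 1"
  then have "\<rho> < cmod z" using rho by simp
  then obtain R where R: "bounded_operator V N R" "\<And>v. v \<in> V \<Longrightarrow> R (shifted z A v) = v"
    using resolvent[OF _ assms(2)] unfolding resolvent_set_def by blast
  obtain v where v: "v \<in> V" "v \<noteq> (\<lambda>_. 0)" "A v = (\<lambda>a. z * v a)" using assms(1) unfolding eigenvalue_on_def by blast
  have "shifted z A v = (\<lambda>_. 0)" unfolding shifted_def v(3) by simp
  then have "v = R (\<lambda>_. 0)" using R(2)[OF v(1)] by simp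
  also have "\<dots> = (\<lambda>_. 0)" using bounded_operator_lincomb[OF R(1) scale_in zero_in zero_in, of 0 0] by simp
  finally show False using v(2) by simp
qed

end

section \<open>Complexification\<close>

context holder_exponents
begin

abbreviation "BC \<equiv> complexify_space B"
abbreviation "NC \<equiv> complexify_norm N"

lemma BC_iff: "G \<in> BC \<longleftrightarrow> (\<lambda>a. Re (G a)) \<in> B \<and> (\<lambda>a. Im (G a)) \<in> B"
  unfolding complexify_space_def by simp

text \<open>A rotation mixes real and imaginary part with coefficients of absolute value at most 1.
  In particular the supremum in the complexified norm is taken over a bounded set.\<close>

lemma rotated:
  assumes "G \<in> BC"
  shows "(\<lambda>a. Re (cis t * G a)) \<in> B"
    and "N (\<lambda>a. Re (cis t * G a)) \<le> N (\<lambda>a. Re (G a)) + N (\<lambda>a. Im (G a))"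
proof -
  have G: "(\<lambda>a. Re (G a)) \<in> B" "(\<lambda>a. Im (G a)) \<in> B" using assms BC_iff by blast+
  have eq: "(\<lambda>a. Re (cis t * G a)) = (\<lambda>a. cos t * Re (G a) + (- sin t) * Im (G a))" by simp
  show "(\<lambda>a. Re (cis t * G a)) \<in> B" unfolding eq by (rule banach_B_lincomb(1)[OF G])
  have "N (\<lambda>a. Re (cis t * G a)) \<le> \<bar>cos t\<bar> * N (\<lambda>a. Re (G a)) + \<bar>- sin t\<bar> * N (\<lambda>a. Im (G a))"
    unfolding eq by (rule banach_B_lincomb(2)[OF G])
  also have "\<dots> \<le> 1 * N (\<lambda>a. Re (G a)) + 1 * N (\<lambda>a. Im (G a))"
    by (intro add_mono mult_right_mono B_norm_nonneg G) auto
  finally show "N (\<lambda>a. Re (cis t * G a)) \<le> N (\<lambda>a. Re (G a)) + N (\<lambda>a. Im (G a))" by simp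
qed

lemma NC_upper:
  assumes "G \<in> BC" shows "N (\<lambda>a. Re (cis t * G a)) \<le> NC G"
  unfolding complexify_norm_def
  by (rule cSUP_upper, simp, rule bdd_aboveI2, rule rotated(2)[OF assms])

lemma NC_least: "(\<And>t. N (\<lambda>a. Re (cis t * G a)) \<le> K) \<Longrightarrow> NC G \<le> K"
  unfolding complexify_norm_def by (rule cSUP_least) auto

lemma NC_le: "G \<in> BC \<Longrightarrow> NC G \<le> N (\<lambda>a. Re (G a)) + N (\<lambda>a. Im (G a))"
  by (rule NC_least, rule rotated(2))

lemma NC_Re: "G \<in> BC \<Longrightarrow> N (\<lambda>a. Re (G a)) \<le> NC G"
  using NC_upper[of G 0] by simp

text \<open>A clockwise quarter turn carries the imaginary part to the real part.\<close>

lemma NC_Im: "G \<in> BC \<Longrightarrow> N (\<lambda>a. Im (G a)) \<le> NC G"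
  using NC_upper[of G "- (pi / 2)"] by simp

lemma BC_lincomb:
  assumes "G \<in> BC" "H \<in> BC" shows "(\<lambda>a. x * G a + y * H a) \<in> BC"
proof -
  have G: "(\<lambda>a. Re (G a)) \<in> B" "(\<lambda>a. Im (G a)) \<in> B" using assms BC_iff by blast+
  have H: "(\<lambda>a. Re (H a)) \<in> B" "(\<lambda>a. Im (H a)) \<in> B" using assms BC_iff by blast+
  have 1: "(\<lambda>a. Re (x * G a + y * H a)) = (\<lambda>a. 1 * (Re x * Re (G a) + (- Im x) * Im (G a)) + 1 * (Re y * Re (H a) + (- Im y) * Im (H a)))"
    and 2: "(\<lambda>a. Im (x * G a + y * H a)) = (\<lambda>a. 1 * (Re x * Im (G a) + Im x * Re (G a)) + 1 * (Re y * Im (H a) + Im y * Re (H a)))"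
    by auto
  show ?thesis unfolding BC_iff 1 2 by (intro conjI banach_B_lincomb(1) G H)
qed

text \<open>A complex factor is its modulus times a rotation, and rotations are absorbed by the
  supremum over all angles. This homogeneity is the reason for Taylor's norm; the sum of the norms
  of both parts would not have it.\<close>

lemma NC_lincomb:
  assumes "G \<in> BC" "H \<in> BC" shows "NC (\<lambda>a. x * G a + y * H a) \<le> cmod x * NC G + cmod y * NC H"
proof (rule NC_least)
  fix t
  have r: "cis t * (w * g) = of_real (cmod w) * (cis (t + Arg w) * g)" for w g :: complex
    using rcis_cmod_Arg[of w] unfolding rcis_def by (metis cis_mult mult.assoc mult.left_commute)
  have "Re (cis t * (x * G a + y * H a)) = cmod x * Re (cis (t + Arg x) * G a) + cmod y * Re (cis (t + Arg y) * H a)" for a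
    unfolding distrib_left r by simp
  then have eq: "(\<lambda>a. Re (cis t * (x * G a + y * H a)))
      = (\<lambda>a. cmod x * Re (cis (t + Arg x) * G a) + cmod y * Re (cis (t + Arg y) * H a))" by (rule ext)
  have "N (\<lambda>a. Re (cis t * (x * G a + y * H a)))
      \<le> \<bar>cmod x\<bar> * N (\<lambda>a. Re (cis (t + Arg x) * G a)) + \<bar>cmod y\<bar> * N (\<lambda>a. Re (cis (t + Arg y) * H a))"
    unfolding eq by (rule banach_B_lincomb(2)[OF rotated(1)[OF assms(1)] rotated(1)[OF assms(2)]])
  also have "\<dots> \<le> cmod x * NC G + cmod y * NC H"
    unfolding abs_norm_cancel by (intro add_mono mult_left_mono NC_upper assms norm_ge_zero)
  finally show "N (\<lambda>a. Re (cis t * (x * G a + y * H a))) \<le> cmod x * NC G + cmod y * NC H" .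
qed

text \<open>The complexified norm lies between the norm of either part and the sum of both, so
  definiteness and completeness can be checked on real and imaginary parts.\<close>

lemma BC_function_banach: "function_banach BC NC"
proof
  show "(\<lambda>_. 0) \<in> BC" using banach_B_zero by (simp add: BC_iff)
  show "(\<lambda>a. x * u a + y * v a) \<in> BC" if "u \<in> BC" "v \<in> BC" for u v x y by (rule BC_lincomb[OF that])
  show "0 \<le> NC v" if "v \<in> BC" for v
    using NC_Re[OF that] B_norm_nonneg[of "\<lambda>a. Re (v a)"] that BC_iff by (meson order_trans)
  show "NC (\<lambda>a. x * u a + y * v a) \<le> cmod x * NC u + cmod y * NC v" if "u \<in> BC" "v \<in> BC" for u v x y
    by (rule NC_lincomb[OF that])
  show "v = (\<lambda>_. 0)" if v: "v \<in> BC" "NC v = 0" for v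
  proof -
    have B: "(\<lambda>a. Re (v a)) \<in> B" "(\<lambda>a. Im (v a)) \<in> B" using v BC_iff by blast+
    have "(\<lambda>a. Re (v a)) = (\<lambda>_. 0)" by (rule B_norm_zero_imp[OF B(1)]) (use NC_Re[OF v(1)] B_norm_nonneg[OF B(1)] v(2) in simp)
    moreover have "(\<lambda>a. Im (v a)) = (\<lambda>_. 0)" by (rule B_norm_zero_imp[OF B(2)]) (use NC_Im[OF v(1)] B_norm_nonneg[OF B(2)] v(2) in simp)
    ultimately show ?thesis by (simp add: fun_eq_iff complex_eq_iff)
  qed
  fix F :: "nat \<Rightarrow> (point \<Rightarrow> real) \<Rightarrow> complex"
  assume F: "\<And>k. F k \<in> BC" and C: "\<And>e. 0 < e \<Longrightarrow> \<exists>K. \<forall>m\<ge>K. \<forall>n\<ge>K. NC (\<lambda>a. F m a - F n a) < e"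
  have d: "(\<lambda>a. F m a - F n a) \<in> BC" for m n using BC_lincomb[OF F F, of 1 m "-1" n] by simp
  have FB: "(\<lambda>a. Re (F k a)) \<in> B" "(\<lambda>a. Im (F k a)) \<in> B" for k using F[of k] BC_iff by blast+
  have "\<exists>K. \<forall>m\<ge>K. \<forall>n\<ge>K. N (\<lambda>a. Re (F m a) - Re (F n a)) < e" if "0 < e" for e
    using C[OF that] NC_Re[OF d] by (simp, meson le_less_trans)
  then obtain G1 where G1: "G1 \<in> B" "(\<lambda>k. N (\<lambda>a. Re (F k a) - G1 a)) \<longlonglongrightarrow> 0"
    using banach_B_complete[of "\<lambda>k a. Re (F k a)"] FB(1) by blast
  have "\<exists>K. \<forall>m\<ge>K. \<forall>n\<ge>K. N (\<lambda>a. Im (F m a) - Im (F n a)) < e" if "0 < e" for e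
    using C[OF that] NC_Im[OF d] by (simp, meson le_less_trans)
  then obtain G2 where G2: "G2 \<in> B" "(\<lambda>k. N (\<lambda>a. Im (F k a) - G2 a)) \<longlonglongrightarrow> 0"
    using banach_B_complete[of "\<lambda>k a. Im (F k a)"] FB(2) by blast
  define G where "G a = Complex (G1 a) (G2 a)" for a
  have GB: "G \<in> BC" using G1 G2 by (simp add: BC_iff G_def)
  have dG: "(\<lambda>a. F k a - G a) \<in> BC" for k using BC_lincomb[OF F GB, of 1 k "-1"] by simp
  have "(\<lambda>k. NC (\<lambda>a. F k a - G a)) \<longlonglongrightarrow> 0"
  proof (rule tendsto_sandwich[OF always_eventually always_eventually tendsto_const])
    show "\<forall>k. 0 \<le> NC (\<lambda>a. F k a - G a)"
      using NC_Re[OF dG] B_norm_nonneg dG BC_iff by (meson order_trans)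
    show "\<forall>k. NC (\<lambda>a. F k a - G a) \<le> N (\<lambda>a. Re (F k a) - G1 a) + N (\<lambda>a. Im (F k a) - G2 a)"
      using NC_le[OF dG] by (simp add: G_def)
    have "(\<lambda>k. N (\<lambda>a. Re (F k a) - G1 a) + N (\<lambda>a. Im (F k a) - G2 a)) \<longlonglongrightarrow> 0 + 0"
      by (rule tendsto_add[OF G1(2) G2(2)])
    then show "(\<lambda>k. N (\<lambda>a. Re (F k a) - G1 a) + N (\<lambda>a. Im (F k a) - G2 a)) \<longlonglongrightarrow> 0" by simp
  qed
  with GB show "\<exists>G\<in>BC. (\<lambda>k. NC (\<lambda>a. F k a - G a)) \<longlonglongrightarrow> 0" by blast
qed

end

context baker_data
begin

abbreviation "LC \<equiv> complexify_op L"

lemma LC_pow: "(LC ^^ n) G = (\<lambda>a. Complex ((L ^^ n) (\<lambda>a. Re (G a)) a) ((L ^^ n) (\<lambda>a. Im (G a)) a))"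
  by (induction n) (simp_all add: complexify_op_def)

lemma LC_pow_in: "G \<in> BC \<Longrightarrow> (LC ^^ n) G \<in> BC"
  unfolding LC_pow BC_iff by (simp add: transfer_op_pow_B)

text \<open>The functional \<tau> is the total mass, that is, evaluation at the constant 1. The
  factors 2 come from estimating real and imaginary part separately.\<close>

sublocale spectral: rank_one_decay BC NC LC "\<lambda>a. complex_of_real (\<mu>\<^sub>0 a)" "\<lambda>G. G (\<lambda>_. 1)" "2 * decay_const" \<rho> 2
proof (rule rank_one_decay.intro[OF BC_function_banach], unfold_locales)
  have Re1: "\<bar>Re (v (\<lambda>_. 1))\<bar> \<le> NC v" and Im1: "\<bar>Im (v (\<lambda>_. 1))\<bar> \<le> NC v" if "v \<in> BC" for v
  proof -
    have B: "(\<lambda>a. Re (v a)) \<in> B" "(\<lambda>a. Im (v a)) \<in> B" using that BC_iff by blast+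
    show "\<bar>Re (v (\<lambda>_. 1))\<bar> \<le> NC v" using banach_B_eval_one[OF B(1)] NC_Re[OF that] by simp
    show "\<bar>Im (v (\<lambda>_. 1))\<bar> \<le> NC v" using banach_B_eval_one[OF B(2)] NC_Im[OF that] by simp
  qed
  show "bounded_operator BC NC LC"
  proof (rule function_banach.bounded_operatorI[OF BC_function_banach])
    show "LC v \<in> BC" if "v \<in> BC" for v using LC_pow_in[OF that, of 1] by simp
    show "LC (\<lambda>a. x * u a + y * v a) = (\<lambda>a. x * LC u a + y * LC v a)" if "u \<in> BC" "v \<in> BC" for u v x y
    proof
      fix \<phi>
      show "LC (\<lambda>a. x * u a + y * v a) \<phi> = x * LC u \<phi> + y * LC v \<phi>"
        unfolding complexify_op_def transfer_op_def by (simp add: complex_eq_iff)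
    qed
    show "NC (LC v) \<le> 2 * NC v" if v: "v \<in> BC" for v
    proof -
      have B: "(\<lambda>a. Re (v a)) \<in> B" "(\<lambda>a. Im (v a)) \<in> B" using v BC_iff by blast+
      have "NC (LC v) \<le> N (L (\<lambda>a. Re (v a))) + N (L (\<lambda>a. Im (v a)))"
        using NC_le[OF LC_pow_in[OF v, of 1]] by (simp add: complexify_op_def)
      also have "\<dots> \<le> NC v + NC v"
        by (intro add_mono order_trans[OF B_norm_transfer_op] B NC_Re NC_Im v)
      finally show ?thesis by simp
    qed
  qed
  show "(\<lambda>a. complex_of_real (\<mu>\<^sub>0 a)) \<in> BC" using mu0_B banach_B_zero by (simp add: BC_iff)
  have "L (\<lambda>a. 0) = (\<lambda>a. 0)" by (auto simp: transfer_op_def)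
  then show "LC (\<lambda>a. complex_of_real (\<mu>\<^sub>0 a)) = (\<lambda>a. complex_of_real (\<mu>\<^sub>0 a))"
    by (simp add: complexify_op_def mu0_invariant complex_eq_iff fun_eq_iff)
  show "complex_of_real (\<mu>\<^sub>0 (\<lambda>_. 1)) = 1" by (simp add: mu0_one)
  show "cmod (v (\<lambda>_. 1)) \<le> 2 * NC v" if "v \<in> BC" for v
    using cmod_le[of "v (\<lambda>_. 1)"] Re1[OF that] Im1[OF that] by linarith
  show "LC v (\<lambda>_. 1) = v (\<lambda>_. 1)" for v
    by (simp add: complexify_op_def transfer_op_one)
  show "0 \<le> 2 * decay_const" "0 < \<rho>" "\<rho> < 1" using decay_const_pos rho by auto
  show "NC ((LC ^^ n) v) \<le> 2 * decay_const * (real n + 1) * \<rho> ^ n * NC v" if v: "v \<in> BC" "v (\<lambda>_. 1) = 0" for n v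
  proof -
    have B: "(\<lambda>a. Re (v a)) \<in> B" "(\<lambda>a. Im (v a)) \<in> B" using v BC_iff by blast+
    have "NC ((LC ^^ n) v) \<le> N ((L ^^ n) (\<lambda>a. Re (v a))) + N ((L ^^ n) (\<lambda>a. Im (v a)))"
      using NC_le[OF LC_pow_in[OF v(1), of n]] by (simp add: LC_pow)
    also have "\<dots> \<le> decay_const * (real n + 1) * \<rho> ^ n * N (\<lambda>a. Re (v a)) + decay_const * (real n + 1) * \<rho> ^ n * N (\<lambda>a. Im (v a))"
      by (intro add_mono B_norm_decay B) (simp_all add: v(2))
    also have "\<dots> \<le> decay_const * (real n + 1) * \<rho> ^ n * NC v + decay_const * (real n + 1) * \<rho> ^ n * NC v"
      using decay_const_pos rho by (intro add_mono mult_left_mono NC_Re NC_Im v) auto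
    finally show ?thesis by (simp add: mult_ac)
  qed
qed simp_all

text \<open>The difference to \<open>\<mu>\<^sub>0\<close> has mass 0 and is fixed by
  \<open>L\<close>, so the decay forces its norm to vanish.\<close>

lemma mu0_unique:
  assumes "\<mu> \<in> B" "L \<mu> = \<mu>" "\<mu> (\<lambda>_. 1) = 1"
  shows "\<mu> = \<mu>\<^sub>0"
proof -
  have d: "(\<lambda>\<phi>. \<mu> \<phi> - \<mu>\<^sub>0 \<phi>) \<in> B" by (rule banach_B_diff[OF assms(1) mu0_B])
  have inv: "(L ^^ n) (\<lambda>\<phi>. \<mu> \<phi> - \<mu>\<^sub>0 \<phi>) = (\<lambda>\<phi>. \<mu> \<phi> - \<mu>\<^sub>0 \<phi>)" for n
  proof (induction n)
    case (Suc n)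
    then show ?case using transfer_op_lincomb[of 1 \<mu> "-1" \<mu>\<^sub>0] assms(2) mu0_invariant by simp
  qed simp
  have "N (\<lambda>\<phi>. \<mu> \<phi> - \<mu>\<^sub>0 \<phi>) \<le> decay_const * ((real n + 1) * \<rho> ^ n) * N (\<lambda>\<phi>. \<mu> \<phi> - \<mu>\<^sub>0 \<phi>)" for n
    using B_norm_decay[OF d, of n] assms(3) mu0_one unfolding inv by (simp add: mult.assoc)
  moreover have "(\<lambda>n. decay_const * ((real n + 1) * \<rho> ^ n) * N (\<lambda>\<phi>. \<mu> \<phi> - \<mu>\<^sub>0 \<phi>)) \<longlonglongrightarrow> decay_const * 0 * N (\<lambda>\<phi>. \<mu> \<phi> - \<mu>\<^sub>0 \<phi>)"
    by (intro tendsto_intros decay_tendsto)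
  ultimately have "N (\<lambda>\<phi>. \<mu> \<phi> - \<mu>\<^sub>0 \<phi>) \<le> 0" using LIMSEQ_le_const by fastforce
  then have "(\<lambda>\<phi>. \<mu> \<phi> - \<mu>\<^sub>0 \<phi>) = (\<lambda>\<phi>. 0)" using B_norm_zero_imp[OF d] B_norm_nonneg[OF d] by simp
  then show ?thesis by (simp add: fun_eq_iff)
qed

text \<open>With \<sigma> the square root of \<rho>, one factor \<open>\<sigma> ^ n\<close> is spent
  on \<open>n + 1\<close> and the other remains. The bound contains the norm of \<open>f\<close>
  alone: unit mass gives \<open>1 \<le> N f\<close>, which absorbs the norm of
  \<open>\<mu>\<^sub>0\<close>.\<close>

theorem exponential_convergence:
  obtains \<sigma> C where "\<sigma> < 1" "0 < C"
    "\<And>f n. f \<in> B \<Longrightarrow> f (\<lambda>_. 1) = 1 \<Longrightarrow> N (\<lambda>\<phi>. (L ^^ n) f \<phi> - \<mu>\<^sub>0 \<phi>) \<le> C * \<sigma> ^ n * N f"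
proof -
  define \<sigma> where "\<sigma> = sqrt \<rho>"
  have s: "0 < \<sigma>" "\<sigma> < 1" "\<sigma> * \<sigma> = \<rho>" using rho by (simp_all add: \<sigma>_def)
  have "norm \<sigma> < 1" using s by simp
  from tendsto_add[OF powser_times_n_limit_0[OF this] LIMSEQ_power_zero[OF this]]
  have "convergent (\<lambda>n. (real n + 1) * \<sigma> ^ n)" by (auto simp: distrib_right convergent_def)
  then obtain M where M: "0 < M" "\<And>n. norm ((real n + 1) * \<sigma> ^ n) \<le> M" using BseqE[OF convergent_imp_Bseq] by blast
  show thesis
  proof (rule that)
    show "\<sigma> < 1" by (rule s)
    show "0 < decay_const * M * (1 + N \<mu>\<^sub>0)"
      using decay_const_pos M(1) B_norm_nonneg[OF mu0_B] by (simp add: add_pos_nonneg)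
    fix f n assume f: "f \<in> B" "f (\<lambda>_. 1) = 1"
    have d: "(\<lambda>\<phi>. f \<phi> - \<mu>\<^sub>0 \<phi>) \<in> B" by (rule banach_B_diff[OF f(1) mu0_B])
    have inv: "(L ^^ n) \<mu>\<^sub>0 = \<mu>\<^sub>0" by (induction n) (simp_all add: mu0_invariant)
    have "(\<lambda>\<phi>. (L ^^ n) f \<phi> - \<mu>\<^sub>0 \<phi>) = (L ^^ n) (\<lambda>\<phi>. f \<phi> - \<mu>\<^sub>0 \<phi>)"
      using transfer_op_pow_lincomb[of n 1 f "-1" \<mu>\<^sub>0] inv by simp
    then have "N (\<lambda>\<phi>. (L ^^ n) f \<phi> - \<mu>\<^sub>0 \<phi>) \<le> decay_const * (real n + 1) * \<rho> ^ n * N (\<lambda>\<phi>. f \<phi> - \<mu>\<^sub>0 \<phi>)"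
      using B_norm_decay[OF d, of n] f(2) mu0_one by simp
    also have "\<dots> = decay_const * ((real n + 1) * \<sigma> ^ n) * \<sigma> ^ n * N (\<lambda>\<phi>. f \<phi> - \<mu>\<^sub>0 \<phi>)"
      unfolding s(3)[symmetric] power_mult_distrib by (simp add: mult_ac)
    also have "\<dots> \<le> decay_const * M * \<sigma> ^ n * ((1 + N \<mu>\<^sub>0) * N f)"
    proof (intro mult_mono mult_right_mono mult_left_mono)
      show "(real n + 1) * \<sigma> ^ n \<le> M" using M(2)[of n] by simp
      have "1 \<le> N f" using banach_B_eval_one[OF f(1)] f(2) by simp
      then have "N \<mu>\<^sub>0 * 1 \<le> N \<mu>\<^sub>0 * N f" by (intro mult_left_mono B_norm_nonneg mu0_B)
      then show "N (\<lambda>\<phi>. f \<phi> - \<mu>\<^sub>0 \<phi>) \<le> (1 + N \<mu>\<^sub>0) * N f"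
        using B_norm_diff_le[OF f(1) mu0_B] by (simp add: distrib_right)
    qed (use s decay_const_pos M(1) B_norm_nonneg[OF d] in auto)
    finally show "N (\<lambda>\<phi>. (L ^^ n) f \<phi> - \<mu>\<^sub>0 \<phi>) \<le> decay_const * M * (1 + N \<mu>\<^sub>0) * \<sigma> ^ n * N f"
      by (simp add: mult_ac)
  qed
qed

end

section \<open>The invariant measure\<close>

lemma space_square: "measure_on_square \<nu> \<Longrightarrow> space \<nu> = square"
  unfolding measure_on_square_def using sets_eq_imp_space_eq[of \<nu> "borel_square"]
  by (auto simp: space_restrict_space)

lemma measurable_on_square:
  "measure_on_square \<nu> \<Longrightarrow> borel_measurable \<nu> = borel_measurable borel_square"
  unfolding measure_on_square_def by (auto intro!: measurable_cong_sets)

lemma sets_square_iff: "A \<in> sets borel_square \<longleftrightarrow> A \<in> sets borel \<and> A \<subseteq> square"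
  by (subst sets_restrict_space_iff) auto

section \<open>Lipschitz functions determine measures on the square\<close>

lemma lipschitz_indicator_approx:
  fixes C :: "point set"
  shows "(real n)-lipschitz_on UNIV (\<lambda>x. max 0 (1 - real n * infdist x C))"
proof (rule lipschitz_onI)
  fix x y :: point
  have "\<bar>real n * infdist x C - real n * infdist y C\<bar> \<le> real n * dist x y"
    unfolding right_diff_distrib[symmetric] abs_mult
    using infdist_triangle_abs[of x C y] by (simp add: mult_left_mono)
  then show "dist (max 0 (1 - real n * infdist x C)) (max 0 (1 - real n * infdist y C)) \<le> real n * dist x y"
    unfolding dist_real_def by linarith
qed simp

lemma indicator_approx_tendsto:
  assumes "closed C" "C \<noteq> {}"
  shows "(\<lambda>n. max 0 (1 - real n * infdist x C)) \<longlonglongrightarrow> (indicator C x :: real)"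
proof (cases "x \<in> C")
  case False
  then have d: "0 < infdist x C" using infdist_pos_not_in_closed[OF assms(1,2)] by blast
  obtain n0 :: nat where n0: "1 < real n0 * infdist x C" using reals_Archimedean3[OF d] by blast
  have "max 0 (1 - real n * infdist x C) = 0" if "n0 \<le> n" for n
  proof -
    have "real n0 * infdist x C \<le> real n * infdist x C" using that d by (intro mult_right_mono) auto
    with n0 show ?thesis by simp
  qed
  then have "\<forall>\<^sub>F n in sequentially. max 0 (1 - real n * infdist x C) = indicator C x"
    using False unfolding eventually_sequentially by auto
  then show ?thesis by (rule tendsto_eventually)
qed simp

text \<open>Indicators of closed sets are pointwise limits of Lipschitz functions, and the closed
  sets form an intersection stable generator. Lipschitz functions are the right class because they
  are both continuous and test functions of the space.\<close>

lemma measure_on_square_eqI: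
  assumes \<nu>: "measure_on_square \<nu>" and \<nu>': "measure_on_square \<nu>'"
    and eq: "\<And>(\<psi> :: point \<Rightarrow> real) K. K-lipschitz_on UNIV \<psi> \<Longrightarrow> (\<integral>x. \<psi> x \<partial>\<nu>) = (\<integral>x. \<psi> x \<partial>\<nu>')"
  shows "\<nu> = \<nu>'"
proof -
  have id: "(\<lambda>x. x) \<in> measurable m borel" if "measure_on_square m" for m :: "point measure"
    unfolding measurable_on_square[OF that] by (rule measurable_restrict_space1) simp
  have lim: "(\<lambda>n. \<integral>x. max 0 (1 - real n * infdist x C) \<partial>m) \<longlonglongrightarrow> measure m (C \<inter> square)"
    if m: "measure_on_square m" and C: "closed C" "C \<noteq> {}" for m :: "point measure" and C
  proof -
    interpret finite_measure m using m by (simp add: measure_on_square_def)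
    have "(\<lambda>n. \<integral>x. max 0 (1 - real n * infdist x C) \<partial>m) \<longlonglongrightarrow> (\<integral>x. indicator C x \<partial>m)"
    proof (rule integral_dominated_convergence[where w = "\<lambda>_. 1"])
      show "(\<lambda>x. max 0 (1 - real n * infdist x C)) \<in> borel_measurable m" for n
        by (rule measurable_compose[OF id[OF m]]) (intro borel_measurable_continuous_onI continuous_intros)
      show "(indicator C :: point \<Rightarrow> real) \<in> borel_measurable m"
        by (rule measurable_compose[OF id[OF m]]) (use C in simp)
      show "AE x in m. norm (max 0 (1 - real n * infdist x C)) \<le> 1" for n
        by (rule AE_I2) (simp add: infdist_nonneg max_def)
    qed (use indicator_approx_tendsto[OF C] in auto)
    then show ?thesis by (simp add: space_square[OF m])
  qed
  \<comment> \<open>Both measures are moved to the Borel sets of the whole plane, where the closed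
    sets generate.\<close>
  have "distr \<nu> borel (\<lambda>x. x) = distr \<nu>' borel (\<lambda>x. x)"
  proof (rule measure_eqI_generator_eq[where E = "Collect closed" and \<Omega> = UNIV and A = "\<lambda>_. UNIV"])
    show "Int_stable (Collect closed :: point set set)" by (auto simp: Int_stable_def)
    have "sets (borel :: point measure) = sigma_sets UNIV (Collect closed)"
      unfolding borel_eq_closed by simp
    then show "sets (distr \<nu> borel (\<lambda>x. x)) = sigma_sets UNIV (Collect closed)"
      "sets (distr \<nu>' borel (\<lambda>x. x)) = sigma_sets UNIV (Collect closed)" by simp_all
    interpret n: finite_measure \<nu> using \<nu> by (simp add: measure_on_square_def)
    interpret n': finite_measure \<nu>' using \<nu>' by (simp add: measure_on_square_def)
    show "emeasure (distr \<nu> borel (\<lambda>x. x)) UNIV \<noteq> \<infinity>" using id[OF \<nu>] by (subst emeasure_distr) auto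
    fix C :: "point set" assume "C \<in> Collect closed"
    then have C: "closed C" by simp
    have e: "emeasure (distr m borel (\<lambda>x. x)) C = emeasure m (C \<inter> square)" if "measure_on_square m" for m :: "point measure"
      using id[OF that] C by (subst emeasure_distr) (auto simp: space_square[OF that])
    show "emeasure (distr \<nu> borel (\<lambda>x. x)) C = emeasure (distr \<nu>' borel (\<lambda>x. x)) C"
    proof (cases "C = {}")
      case False
      have "measure \<nu> (C \<inter> square) = measure \<nu>' (C \<inter> square)"
        using LIMSEQ_unique[OF lim[OF \<nu> C False]] lim[OF \<nu>' C False] eq[OF lipschitz_indicator_approx] by simp
      then show ?thesis unfolding e[OF \<nu>] e[OF \<nu>'] by (simp add: n.emeasure_eq_measure n'.emeasure_eq_measure)
    qed simp
  qed (auto)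
  then have eqd: "emeasure (distr \<nu> borel (\<lambda>x. x)) A = emeasure (distr \<nu>' borel (\<lambda>x. x)) A" for A by simp
  show ?thesis
  proof (rule measure_eqI)
    show "sets \<nu> = sets \<nu>'" using \<nu> \<nu>' by (simp add: measure_on_square_def)
    fix A assume "A \<in> sets \<nu>"
    then have A: "A \<in> sets borel" "A \<subseteq> square" using \<nu> sets_square_iff by (auto simp: measure_on_square_def)
    have e: "emeasure (distr m borel (\<lambda>x. x)) A = emeasure m A" if "measure_on_square m" for m :: "point measure"
      using id[OF that] A by (subst emeasure_distr) (auto simp: space_square[OF that] Int_absorb2)
    show "emeasure \<nu> A = emeasure \<nu>' A" using eqd[of A] e[OF \<nu>] e[OF \<nu>'] by simp
  qed
qed

lemma lipschitz_C1_stable: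
  fixes \<psi> :: "point \<Rightarrow> real"
  assumes "K-lipschitz_on square \<psi>" shows "\<psi> \<in> C1_stable"
proof -
  have c: "continuous_on square \<psi>" by (rule lipschitz_on_continuous_on[OF assms])
  have "compact square" unfolding square_def by (intro compact_Times compact_Icc)
  then have "bounded (\<psi> ` square)" using c by (intro compact_imp_bounded compact_continuous_image)
  then obtain A where A: "\<And>x. x \<in> square \<Longrightarrow> norm (\<psi> x) \<le> A" unfolding bounded_iff by blast
  show ?thesis
  proof (rule C1_stableI)
    show "\<psi> \<in> borel_measurable borel_square" by (rule borel_measurable_continuous_on_restrict[OF c])
    fix s :: real assume s: "s \<in> {0..1}"
    show "holder_bounds 1 (\<lambda>t. \<psi> (s, t)) \<bar>A\<bar> K"
    proof (rule holder_boundsI)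
      show "0 \<le> K" using assms by (rule lipschitz_on_nonneg)
      show "\<bar>\<psi> (s, t)\<bar> \<le> \<bar>A\<bar>" if "t \<in> {0..1}" for t using A[of "(s, t)"] s that by (simp add: square_iff)
      show "\<bar>\<psi> (s, t) - \<psi> (s, u)\<bar> \<le> K * \<bar>t - u\<bar> powr 1" if "t \<in> {0..1}" "u \<in> {0..1}" for t u
        using lipschitz_onD[OF assms, of "(s, t)" "(s, u)"] s that by (simp add: square_iff dist_Pair_Pair dist_real_def)
    qed simp
  qed
qed

text \<open>A retraction of the line onto the unit interval. It extends functions on leaves to the
  line, where weak convergence is formulated, and lets maps take values in the square everywhere
  instead of almost everywhere.\<close>

definition unit_clamp :: "real \<Rightarrow> real" where "unit_clamp y = max 0 (min 1 y)"

lemma unit_clamp_range: "unit_clamp y \<in> {0..1}" by (simp add: unit_clamp_def)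

lemma unit_clamp_id: "y \<in> {0..1} \<Longrightarrow> unit_clamp y = y" by (simp add: unit_clamp_def)

lemma continuous_unit_clamp: "continuous_on UNIV unit_clamp" unfolding unit_clamp_def[abs_def] by (intro continuous_intros)

lemma continuous_comp_clamp:
  assumes "continuous_on {0..1} g" shows "continuous_on UNIV (\<lambda>t. g (unit_clamp t))"
  by (rule continuous_on_compose2[OF assms continuous_unit_clamp]) (use unit_clamp_range in auto)

context baker_data
begin

section \<open>Lebesgue measure under iteration and its limit on leaves\<close>

definition h :: "nat \<Rightarrow> point \<Rightarrow> real" where "h n = (transfer_density ^^ n) (\<lambda>_. 1)"

lemma h_C1: "h n \<in> C1_unstable"
  unfolding h_def by (rule transfer_density_pow_C1[OF C1_unstable_const])

lemma h_Suc: "h (Suc n) = transfer_density (h n)" by (simp add: h_def)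

lemma h_nonneg: "0 \<le> h n z"
proof (induction n arbitrary: z)
  case (Suc n)
  then show ?case unfolding h_Suc transfer_density_def using l_pos
    by (intro divide_nonneg_nonneg sum_nonneg) auto
qed (simp add: h_def)

text \<open>The cut-off and the second argument in \<open>transfer_density\<close> depend on the
  ordinate alone, so a density constant in the horizontal direction stays so. All vertical leaves
  therefore carry the same measure.\<close>

lemma h_const: "h n (s, t) = h n (s', t)"
proof (induction n arbitrary: s s' t)
  case (Suc n)
  have "(\<Sum>i<\<kappa>. if W i t \<in> {0..1} then h n (X i s, W i t) else 0) = (\<Sum>i<\<kappa>. if W i t \<in> {0..1} then h n (X i s', W i t) else 0)"
    by (intro sum.cong if_cong refl Suc)
  then show ?case unfolding h_Suc transfer_density_def fst_conv snd_conv by simp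
qed (simp add: h_def)

lemma leaf_integral_h_const: "leaf_integral s (h n) g = leaf_integral s' (h n) g"
  by (rule leaf_integral_cong) (simp add: h_const[of n s _ s'])

text \<open>Means over preimage leaves preserve the value 1; each \<open>h n\<close> thus restricts
  to a probability density on every leaf.\<close>

lemma leaf_integral_h_one: "s \<in> {0..1} \<Longrightarrow> leaf_integral s (h n) (\<lambda>_. 1) = 1"
proof (induction n arbitrary: s)
  case 0
  then show ?case by (simp add: h_def leaf_integral_def set_integral_const)
next
  case (Suc n)
  have "leaf_integral s (h (Suc n)) (\<lambda>_. 1) = (\<Sum>i<\<kappa>. leaf_integral (X i s) (h n) (\<lambda>_. 1)) / \<kappa>"
    unfolding h_Suc by (rule leaf_integral_transfer_density[OF h_C1 Suc.prems]) simp
  also have "(\<Sum>i<\<kappa>. leaf_integral (X i s) (h n) (\<lambda>_. 1)) = (\<Sum>i<\<kappa>. 1)"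
    by (rule sum.cong[OF refl]) (use Suc X_unit in auto)
  finally show ?case using kappa_pos by simp
qed

lemma leaf_integral_h_bound:
  assumes "s \<in> {0..1}" "continuous_on {0..1} g" "\<And>t. t \<in> {0..1} \<Longrightarrow> \<bar>g t\<bar> \<le> A"
  shows "\<bar>leaf_integral s (h n) g\<bar> \<le> A"
proof -
  have ci: "set_integrable lborel {0..1} (\<lambda>t. h n (s, t) * A)" by (rule leaf_integrable[OF h_C1 assms(1)]) simp
  have "norm (leaf_integral s (h n) g) \<le> (LINT t:{0..1}|lborel. norm (h n (s, t) * g t))"
    unfolding leaf_integral_def by (rule set_integral_norm_bound) (rule leaf_integrable[OF h_C1 assms(1,2)])
  also have "\<dots> \<le> (LINT t:{0..1}|lborel. h n (s, t) * A)"
  proof (rule set_integral_mono[OF _ ci])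
    show "set_integrable lborel {0..1} (\<lambda>t. norm (h n (s, t) * g t))"
      using set_integrable_abs[OF leaf_integrable[OF h_C1 assms(1,2)]] by simp
    show "norm (h n (s, t) * g t) \<le> h n (s, t) * A" if "t \<in> {0..1}" for t
      using assms(3)[OF that] h_nonneg[of n "(s, t)"] by (simp add: abs_mult mult_left_mono)
  qed
  also have "\<dots> = A"
    using leaf_integral_scale_right[of s "h n" A "\<lambda>_. 1"] leaf_integral_h_one[OF assms(1), of n]
    by (simp add: leaf_integral_def)
  finally show ?thesis by simp
qed

text \<open>The common law of \<open>h n\<close> on the leaves, read off at abscissa 0 and regarded
  as a measure on the line.\<close>

definition leaf_measure :: "nat \<Rightarrow> real measure"
  where "leaf_measure n = density lborel (\<lambda>t. ennreal (indicator {0..1} t * h n (0, t)))"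

lemma leaf_density_measurable: "(\<lambda>t. indicator {0..1} t * h n (0, t)) \<in> borel_measurable borel"
  using leaf_measurable[OF C1_unstable_measurable[OF h_C1], of 0 n]
  by (simp add: borel_measurable_restrict_space_iff)

lemma integral_leaf_measure:
  assumes "g \<in> borel_measurable borel"
  shows "(\<integral>t. g t \<partial>leaf_measure n) = leaf_integral 0 (h n) g"
  unfolding leaf_measure_def
  by (subst integral_density)
    (use assms leaf_density_measurable h_nonneg in \<open>auto simp: leaf_integral_def set_lebesgue_integral_def mult.assoc\<close>)

lemma real_distribution_leaf_measure: "real_distribution (leaf_measure n)"
proof -
  have "(\<integral>\<^sup>+t. ennreal (indicator {0..1} t * h n (0, t)) \<partial>lborel) = ennreal (\<integral>t. indicator {0..1} t * h n (0, t) \<partial>lborel)"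
    using leaf_integrable[OF h_C1, of 0 "\<lambda>_. 1" n] h_nonneg
    by (intro nn_integral_eq_integral) (auto simp: set_integrable_def)
  also have "(\<integral>t. indicator {0..1} t * h n (0, t) \<partial>lborel) = 1"
    using leaf_integral_h_one[of 0 n] by (simp add: leaf_integral_def set_lebesgue_integral_def)
  finally have "prob_space (leaf_measure n)"
    unfolding leaf_measure_def using leaf_density_measurable by (intro prob_spaceI) (simp add: emeasure_density)
  then show ?thesis
    unfolding real_distribution_def real_distribution_axioms_def by (simp add: leaf_measure_def)
qed

lemma tight_leaf_measure: "tight leaf_measure"
  unfolding tight_def
proof (intro conjI allI impI real_distribution_leaf_measure)
  fix r :: real assume r: "0 < r"
  \<comment> \<open>The intervals in the definition of tightness are open on the left, so the
    interval starts below 0.\<close>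
  have "measure (leaf_measure n) {-1<..1} = 1" for n
  proof -
    interpret real_distribution "leaf_measure n" by (rule real_distribution_leaf_measure)
    have "measure (leaf_measure n) {-1<..1} = (\<integral>t. indicator {-1<..1} t \<partial>leaf_measure n)" by simp
    also have "\<dots> = leaf_integral 0 (h n) (indicator {-1<..1})" by (rule integral_leaf_measure) simp
    also have "\<dots> = leaf_integral 0 (h n) (\<lambda>_. 1)" by (rule leaf_integral_cong) (auto simp: indicator_def)
    finally show ?thesis by (simp add: leaf_integral_h_one)
  qed
  then show "\<exists>a b. a < b \<and> (\<forall>n. 1 - r < measure (leaf_measure n) {a<..b})"
    using r by (intro exI[of _ "-1"] exI[of _ 1]) simp
qed

text \<open>A tight sequence of laws on the line has a weakly convergent subsequence. A subsequence
  is enough, as \<open>\<mu>\<^sub>0\<close> is already known to be the limit of the full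
  sequence.\<close>

lemma leaf_limit:
  obtains r \<eta> where "strict_mono r" "prob_space \<eta>" "sets \<eta> = sets borel" "AE t in \<eta>. t \<in> {0..1}"
    "\<And>g s. s \<in> {0..1} \<Longrightarrow> continuous_on {0..1} g \<Longrightarrow>
      (\<lambda>n. leaf_integral s (h (r n)) g) \<longlonglongrightarrow> (\<integral>t. g (unit_clamp t) \<partial>\<eta>)"
proof -
  obtain r \<eta> where r: "strict_mono r" and \<eta>: "real_distribution \<eta>" and w: "weak_conv_m (leaf_measure \<circ> id \<circ> r) \<eta>"
    using tight_imp_convergent_subsubsequence[OF tight_leaf_measure, of id] by (auto simp: strict_mono_id)
  interpret \<eta>: real_distribution \<eta> by (rule \<eta>)
  have conv: "(\<lambda>n. leaf_integral s (h (r n)) g) \<longlonglongrightarrow> (\<integral>t. g t \<partial>\<eta>)"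
    if g: "continuous_on UNIV g" "\<And>t. \<bar>g t\<bar> \<le> A" for g :: "real \<Rightarrow> real" and A s
  proof -
    have "(\<lambda>n. \<integral>t. g t \<partial>(leaf_measure \<circ> id \<circ> r) n) \<longlonglongrightarrow> (\<integral>t. g t \<partial>\<eta>)"
      using g real_distribution_leaf_measure
      by (intro weak_conv_imp_integral_bdd_continuous_conv[OF _ \<eta> w, of _ A])
        (auto simp: continuous_on_eq_continuous_at)
    moreover have "(\<integral>t. g t \<partial>leaf_measure k) = leaf_integral s (h k) g" for k
      using integral_leaf_measure[of g k] g(1) leaf_integral_h_const[of 0 k g s] borel_measurable_continuous_onI by auto
    ultimately show ?thesis by simp
  qed
  show thesis
  proof (rule that)
    show "strict_mono r" by (rule r)
    show "prob_space \<eta>" by unfold_locales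
    show "sets \<eta> = sets borel" by simp
    \<comment> \<open>This bounded continuous function vanishes exactly on the unit interval. Its
      integrals are 0 along the sequence, hence also in the limit, so \<eta> lives on the unit
      interval.\<close>
    have c: "continuous_on UNIV (\<lambda>t. min 1 \<bar>t - unit_clamp t\<bar>)"
      using continuous_unit_clamp by (intro continuous_intros)
    have b: "\<bar>min 1 \<bar>t - unit_clamp t\<bar>\<bar> \<le> 1" for t by simp
    have "leaf_integral 0 (h n) (\<lambda>t. min 1 \<bar>t - unit_clamp t\<bar>) = leaf_integral 0 (h n) (\<lambda>t. 0 * 1)" for n
      by (rule leaf_integral_cong) (simp add: unit_clamp_id)
    then have "leaf_integral 0 (h n) (\<lambda>t. min 1 \<bar>t - unit_clamp t\<bar>) = 0" for n
      unfolding leaf_integral_scale_right by simp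
    with conv[OF c b, of 0] have "(\<integral>t. min 1 \<bar>t - unit_clamp t\<bar> \<partial>\<eta>) = 0" by (simp add: LIMSEQ_const_iff)
    moreover have "integrable \<eta> (\<lambda>t. min 1 \<bar>t - unit_clamp t\<bar>)"
    proof (rule \<eta>.integrable_const_bound[of _ 1])
      show "(\<lambda>t. min 1 \<bar>t - unit_clamp t\<bar>) \<in> borel_measurable \<eta>"
        by (subst measurable_cong_sets[OF \<eta>.events_eq_borel refl]) (rule borel_measurable_continuous_onI[OF c])
    qed simp
    ultimately have "AE t in \<eta>. min 1 \<bar>t - unit_clamp t\<bar> = 0"
      by (subst (asm) integral_nonneg_eq_0_iff_AE) auto
    then show "AE t in \<eta>. t \<in> {0..1}"
    proof (rule AE_mp, intro AE_I2 impI)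
      fix t assume "min 1 \<bar>t - unit_clamp t\<bar> = 0"
      then have "t = unit_clamp t" by (simp add: min_def split: if_splits)
      then show "t \<in> {0..1}" using unit_clamp_range by metis
    qed
    fix g :: "real \<Rightarrow> real" and s :: real assume s: "s \<in> {0..1}" and g: "continuous_on {0..1} g"
    obtain A where A: "\<And>t. t \<in> {0..1} \<Longrightarrow> \<bar>g t\<bar> \<le> A" using continuous_on_unit_bounded[OF g] by blast
    have "(\<lambda>n. leaf_integral s (h (r n)) (\<lambda>t. g (unit_clamp t))) \<longlonglongrightarrow> (\<integral>t. g (unit_clamp t) \<partial>\<eta>)"
      by (rule conv[OF continuous_comp_clamp[OF g] A[OF unit_clamp_range]])
    moreover have "leaf_integral s (h k) (\<lambda>t. g (unit_clamp t)) = leaf_integral s (h k) g" for k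
      by (rule leaf_integral_cong) (simp add: unit_clamp_id)
    ultimately show "(\<lambda>n. leaf_integral s (h (r n)) g) \<longlonglongrightarrow> (\<integral>t. g (unit_clamp t) \<partial>\<eta>)" by simp
  qed
qed

end

text \<open>The measure is Lebesgue times \<eta>, carried to the square. Integrating over the
  horizontal coordinate first exhibits it as a mixture of arclength measures, which is the
  disintegration; integrating over the vertical one first gives the form that arises as a limit of
  leaf integrals.\<close>

lemma conditional_fubini:
  assumes \<eta>: "prob_space \<eta>" "sets \<eta> = sets borel"
  defines "P \<equiv> restrict_space lborel {0..1::real} \<Otimes>\<^sub>M \<eta>"
  defines "\<nu> \<equiv> distr P borel_square (\<lambda>z. (fst z, unit_clamp (snd z)))"
  shows "measure_on_square \<nu>" "prob_space \<nu>"
    and "\<And>(\<phi> :: point \<Rightarrow> real) K. \<phi> \<in> borel_measurable borel_square \<Longrightarrow> (\<And>z. z \<in> square \<Longrightarrow> \<bar>\<phi> z\<bar> \<le> K) \<Longrightarrow>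
      set_integrable lborel {0..1} (\<lambda>s. \<integral>y. \<phi> (s, unit_clamp y) \<partial>\<eta>) \<and>
      (\<integral>x. \<phi> x \<partial>\<nu>) = (LINT s:{0..1}|lborel. \<integral>y. \<phi> (s, unit_clamp y) \<partial>\<eta>)"
    and "conditional_measures_unstable \<nu> arclength_unstable"
    and "\<And>A. A \<in> sets borel_square \<Longrightarrow>
      emeasure \<nu> A = (\<integral>\<^sup>+y. emeasure (arclength_unstable (unit_clamp y)) A \<partial>\<eta>)"
proof -
  interpret \<eta>: prob_space \<eta> by (rule \<eta>)
  interpret U: prob_space "restrict_space lborel {0..1::real}"
    by (rule prob_spaceI) (simp add: space_restrict_space emeasure_restrict_space)
  interpret PP: pair_prob_space "restrict_space lborel {0..1::real}" \<eta> ..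
  interpret P: prob_space P unfolding P_def by unfold_locales
  have fstm: "fst \<in> measurable P (restrict_space lborel {0..1})" unfolding P_def by simp
  have fstb: "fst \<in> borel_measurable P"
    using measurable_compose[OF fstm measurable_restrict_space1[of "\<lambda>x. x" lborel borel]] by simp
  have "snd \<in> measurable P \<eta>" unfolding P_def by simp
  then have sndm: "snd \<in> borel_measurable P" using \<eta>(2) by (simp cong: measurable_cong_sets)
  have clampm: "unit_clamp \<in> borel_measurable borel"
    by (rule borel_measurable_continuous_onI[OF continuous_unit_clamp])
  have spP: "fst z \<in> {0..1}" if "z \<in> space P" for z
    using that by (auto simp: P_def space_pair_measure space_restrict_space)
  have cm: "(\<lambda>z. (fst z, unit_clamp (snd z))) \<in> measurable P borel_square"
  proof (rule measurable_restrict_space2)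
    show "(\<lambda>z. (fst z, unit_clamp (snd z))) \<in> borel_measurable P"
      unfolding borel_prod[symmetric] by (rule measurable_Pair[OF fstb measurable_compose[OF sndm clampm]])
    show "(\<lambda>z. (fst z, unit_clamp (snd z))) \<in> space P \<rightarrow> square"
      using spP unit_clamp_range by (auto simp: square_def)
  qed
  show pn: "prob_space \<nu>" unfolding \<nu>_def by (rule P.prob_space_distr[OF cm])
  show ms: "measure_on_square \<nu>" unfolding measure_on_square_def
    using prob_space.finite_measure[OF pn] by (simp add: \<nu>_def)
  have iff: "set_integrable lborel {0..1} F \<longleftrightarrow> integrable (restrict_space lborel {0..1::real}) F" for F :: "real \<Rightarrow> real"
    by (simp add: set_integrable_def integrable_restrict_space)
  show "set_integrable lborel {0..1} (\<lambda>s. \<integral>y. \<phi> (s, unit_clamp y) \<partial>\<eta>) \<and>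
      (\<integral>x. \<phi> x \<partial>\<nu>) = (LINT s:{0..1}|lborel. \<integral>y. \<phi> (s, unit_clamp y) \<partial>\<eta>)"
    if \<phi>: "\<phi> \<in> borel_measurable borel_square" "\<And>z. z \<in> square \<Longrightarrow> \<bar>\<phi> z\<bar> \<le> K" for \<phi> :: "point \<Rightarrow> real" and K
  proof -
    have int: "integrable P (\<lambda>(s, y). \<phi> (s, unit_clamp y))"
    proof (rule P.integrable_const_bound[of _ K])
      show "(\<lambda>(s, y). \<phi> (s, unit_clamp y)) \<in> borel_measurable P"
        using measurable_compose[OF cm \<phi>(1)] by (simp add: case_prod_beta')
      show "AE z in P. norm (case z of (s, y) \<Rightarrow> \<phi> (s, unit_clamp y)) \<le> K"
      proof (rule AE_I2)
        fix z assume "z \<in> space P"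
        then have "(fst z, unit_clamp (snd z)) \<in> square" using spP unit_clamp_range by (simp add: square_iff)
        from \<phi>(2)[OF this] show "norm (case z of (s, y) \<Rightarrow> \<phi> (s, unit_clamp y)) \<le> K" by (simp add: case_prod_beta)
      qed
    qed
    have "(\<integral>x. \<phi> x \<partial>\<nu>) = (\<integral>z. (case z of (s, y) \<Rightarrow> \<phi> (s, unit_clamp y)) \<partial>P)"
      unfolding \<nu>_def by (subst integral_distr[OF cm \<phi>(1)]) (simp add: case_prod_beta')
    also have "\<dots> = (\<integral>s. (\<integral>y. \<phi> (s, unit_clamp y) \<partial>\<eta>) \<partial>restrict_space lborel {0..1})"
      unfolding P_def by (rule PP.integral_fst[symmetric]) (use int in \<open>simp add: P_def\<close>)
    also have "\<dots> = (LINT s:{0..1}|lborel. \<integral>y. \<phi> (s, unit_clamp y) \<partial>\<eta>)"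
      by (simp add: set_lebesgue_integral_def integral_restrict_space)
    finally show ?thesis unfolding iff using PP.integrable_fst[OF int[unfolded P_def]] by simp
  qed
  have arc: "(\<lambda>x. (x, y)) \<in> measurable (restrict_space lborel {0..1}) borel_square" if "y \<in> {0..1}" for y :: real
    using that by (intro measurable_restrict_space2 measurable_restrict_space1)
      (auto simp: space_restrict_space square_def borel_prod[symmetric])
  have arcA: "emeasure (arclength_unstable y) A = (\<integral>\<^sup>+x. indicator A (x, y) \<partial>restrict_space lborel {0..1})"
    if "y \<in> {0..1}" "A \<in> sets borel_square" for y A
  proof -
    have "emeasure (arclength_unstable y) A = (\<integral>\<^sup>+z. indicator A z \<partial>arclength_unstable y)"
      using that(2) by (subst nn_integral_indicator) (auto simp: arclength_unstable_def)
    also have "\<dots> = (\<integral>\<^sup>+x. indicator A (x, y) \<partial>restrict_space lborel {0..1})"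
      unfolding arclength_unstable_def by (rule nn_integral_distr[OF arc[OF that(1)]]) (use that(2) in simp)
    finally show ?thesis .
  qed
  show emA: "emeasure \<nu> A = (\<integral>\<^sup>+y. emeasure (arclength_unstable (unit_clamp y)) A \<partial>\<eta>)"
    if A: "A \<in> sets borel_square" for A
  proof -
    have ind: "(indicator A :: point \<Rightarrow> ennreal) \<in> borel_measurable borel_square" using A by simp
    have "emeasure \<nu> A = (\<integral>\<^sup>+z. indicator A z \<partial>\<nu>)" using A by (subst nn_integral_indicator) (auto simp: \<nu>_def)
    also have "\<dots> = (\<integral>\<^sup>+z. indicator A (fst z, unit_clamp (snd z)) \<partial>P)"
      unfolding \<nu>_def by (rule nn_integral_distr[OF cm]) (use A in simp)
    also have "\<dots> = (\<integral>\<^sup>+y. \<integral>\<^sup>+x. indicator A (x, unit_clamp y) \<partial>restrict_space lborel {0..1} \<partial>\<eta>)"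
      using PP.nn_integral_snd[of "\<lambda>z. indicator A (fst z, unit_clamp (snd z))"] measurable_compose[OF cm ind]
      unfolding P_def by simp
    also have "\<dots> = (\<integral>\<^sup>+y. emeasure (arclength_unstable (unit_clamp y)) A \<partial>\<eta>)"
      by (intro nn_integral_cong arcA[symmetric] unit_clamp_range A)
    finally show ?thesis .
  qed
  \<comment> \<open>The measure on the labels of the leaves; it is the law of the clamped ordinate
    under \<eta>.\<close>
  define \<eta>' where "\<eta>' = distr \<nu> (restrict_space borel {0..1}) snd"
  have sndm': "snd \<in> measurable borel_square (restrict_space borel {0..1::real})"
    by (intro measurable_restrict_space2 measurable_restrict_space1)
      (auto simp: space_restrict_space square_def borel_prod[symmetric])
  then have sndn: "snd \<in> measurable \<nu> (restrict_space borel {0..1::real})"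
    unfolding \<nu>_def by simp
  have sp: "space \<eta>' = {0..1}" by (simp add: \<eta>'_def space_restrict_space)
  have Fm: "(\<lambda>y. emeasure (arclength_unstable y) A) \<in> borel_measurable (restrict_space borel {0..1})"
    if A: "A \<in> sets borel_square" for A
  proof -
    have ind: "(indicator A :: point \<Rightarrow> ennreal) \<in> borel_measurable borel_square" using A by simp
    have sw: "(\<lambda>z. (snd z, fst z)) \<in> measurable (restrict_space borel {0..1} \<Otimes>\<^sub>M restrict_space lborel {0..1}) borel_square"
    proof (rule measurable_restrict_space2)
      have 1: "fst \<in> borel_measurable (restrict_space borel {0..1::real} \<Otimes>\<^sub>M restrict_space lborel {0..1::real})"
        by (rule measurable_compose[OF measurable_fst measurable_restrict_space1]) simp
      have 2: "snd \<in> borel_measurable (restrict_space borel {0..1::real} \<Otimes>\<^sub>M restrict_space lborel {0..1::real})"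
        by (rule measurable_compose[OF measurable_snd measurable_restrict_space1]) simp
      show "(\<lambda>z. (snd z, fst z)) \<in> borel_measurable (restrict_space borel {0..1::real} \<Otimes>\<^sub>M restrict_space lborel {0..1::real})"
        unfolding borel_prod[symmetric] by (rule measurable_Pair[OF 2 1])
    qed (auto simp: square_def space_pair_measure space_restrict_space)
    have "(\<lambda>y. \<integral>\<^sup>+x. indicator A (x, y) \<partial>restrict_space lborel {0..1}) \<in> borel_measurable (restrict_space borel {0..1})"
      using U.borel_measurable_nn_integral_fst[OF measurable_compose[OF sw ind]] by simp
    then show ?thesis
      by (subst measurable_cong[OF arcA]) (auto simp: space_restrict_space A)
  qed
  show "conditional_measures_unstable \<nu> arclength_unstable"
    unfolding conditional_measures_unstable_def Let_def \<eta>'_def[symmetric]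
  proof (intro conjI ballI)
    show "AE y in \<eta>'. prob_space (arclength_unstable y) \<and> sets (arclength_unstable y) = sets borel_square \<and>
        emeasure (arclength_unstable y) (square - unstable_leaf y) = 0"
    proof (rule AE_I2)
      fix y assume "y \<in> space \<eta>'"
      then have y: "y \<in> {0..1}" using sp by simp
      have "prob_space (arclength_unstable y)" unfolding arclength_unstable_def by (rule U.prob_space_distr[OF arc[OF y]])
      moreover have "sets (arclength_unstable y) = sets borel_square" by (simp add: arclength_unstable_def)
      moreover have "emeasure (arclength_unstable y) (square - unstable_leaf y) = 0"
      proof -
        have "closed (unstable_leaf y)" unfolding unstable_leaf_def by (intro closed_Times) auto
        then have "square - unstable_leaf y \<in> sets borel_square"
          unfolding sets_square_iff by auto
        from arcA[OF y this] have "emeasure (arclength_unstable y) (square - unstable_leaf y)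
            = (\<integral>\<^sup>+x. indicator (square - unstable_leaf y) (x, y) \<partial>restrict_space lborel {0..1})" .
        also have "\<dots> = (\<integral>\<^sup>+x. 0 \<partial>restrict_space lborel {0..1::real})"
          by (rule nn_integral_cong) (auto simp: unstable_leaf_def space_restrict_space)
        finally show ?thesis by simp
      qed
      ultimately show "prob_space (arclength_unstable y) \<and> sets (arclength_unstable y) = sets borel_square \<and>
        emeasure (arclength_unstable y) (square - unstable_leaf y) = 0" by blast
    qed
    fix A assume "A \<in> sets \<nu>"
    then have A: "A \<in> sets borel_square" by (simp add: \<nu>_def)
    show "(\<lambda>y. emeasure (arclength_unstable y) A) \<in> borel_measurable \<eta>'"
      using Fm[OF A] by (simp add: \<eta>'_def)
    have "(\<integral>\<^sup>+y. emeasure (arclength_unstable y) A \<partial>\<eta>') = (\<integral>\<^sup>+z. emeasure (arclength_unstable (snd z)) A \<partial>\<nu>)"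
      unfolding \<eta>'_def by (rule nn_integral_distr[OF sndn]) (use Fm[OF A] in simp)
    also have "\<dots> = (\<integral>\<^sup>+z. emeasure (arclength_unstable (unit_clamp (snd z))) A \<partial>P)"
    proof -
      have "(\<lambda>z. emeasure (arclength_unstable (snd z)) A) \<in> borel_measurable borel_square"
        by (rule measurable_compose[OF sndm' Fm[OF A]])
      then show ?thesis unfolding \<nu>_def by (subst nn_integral_distr[OF cm]) auto
    qed
    also have "\<dots> = (\<integral>\<^sup>+y. \<integral>\<^sup>+x. emeasure (arclength_unstable (unit_clamp y)) A \<partial>restrict_space lborel {0..1::real} \<partial>\<eta>)"
    proof -
      have "(\<lambda>z. emeasure (arclength_unstable (unit_clamp (snd z))) A) \<in> borel_measurable P"
        using measurable_compose[OF measurable_compose[OF cm sndm'] Fm[OF A]] by simp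
      then show ?thesis
        using PP.nn_integral_snd[of "\<lambda>z. emeasure (arclength_unstable (unit_clamp (snd z))) A"] unfolding P_def by simp
    qed
    also have "\<dots> = (\<integral>\<^sup>+y. emeasure (arclength_unstable (unit_clamp y)) A \<partial>\<eta>)"
      by (intro nn_integral_cong) (simp add: space_restrict_space emeasure_restrict_space)
    also have "\<dots> = emeasure \<nu> A" by (rule emA[OF A, symmetric])
    finally show "emeasure \<nu> A = (\<integral>\<^sup>+y. emeasure (arclength_unstable y) A \<partial>\<eta>')" ..
  qed
qed

lemma C1_stable_bounded:
  assumes "\<phi> \<in> C1_stable" obtains A where "\<And>z. z \<in> square \<Longrightarrow> \<bar>\<phi> z\<bar> \<le> A"
proof -
  obtain A H where A: "\<phi> \<in> borel_measurable borel_square" "0 \<le> A" "0 \<le> H"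
    "\<And>s. s \<in> {0..1} \<Longrightarrow> holder_bounds 1 (\<lambda>t. \<phi> (s, t)) A H" using C1_stableE[OF assms] by blast
  have "\<bar>\<phi> z\<bar> \<le> A" if "z \<in> square" for z
    using holder_boundsD(3)[OF A(4)] that by (cases z) (auto simp: square_iff)
  then show thesis by (rule that)
qed

context baker_data
begin

text \<open>Leaf integrals of a test function against \<open>h (r n)\<close> converge on every leaf
  and are bounded by its supremum, so they may be integrated over the leaves. The horizontal
  marginal is Lebesgue measure, hence vertical lines over a countable set are null; this is what
  later allows \<open>T\<close> to be replaced by \<open>leafwise\<close>.\<close>

theorem mu0_measure:
  obtains \<nu> where "measure_on_square \<nu>" "prob_space \<nu>" "\<mu>\<^sub>0 = functional_of_measure \<nu>"
    "conditional_measures_unstable \<nu> arclength_unstable"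
    "\<And>S. countable S \<Longrightarrow> AE z in \<nu>. fst z \<notin> S"
proof -
  obtain r \<eta> where r: "strict_mono r" and \<eta>: "prob_space \<eta>" "sets \<eta> = sets borel" "AE t in \<eta>. t \<in> {0..1}"
    and lim: "\<And>g s. s \<in> {0..1} \<Longrightarrow> continuous_on {0..1} g \<Longrightarrow>
      (\<lambda>n. leaf_integral s (h (r n)) g) \<longlonglongrightarrow> (\<integral>t. g (unit_clamp t) \<partial>\<eta>)"
    using leaf_limit by blast
  define \<nu> where "\<nu> = distr (restrict_space lborel {0..1::real} \<Otimes>\<^sub>M \<eta>) borel_square (\<lambda>z. (fst z, unit_clamp (snd z)))"
  note cf = conditional_fubini[OF \<eta>(1,2), folded \<nu>_def]
  have mu: "\<mu>\<^sub>0 \<phi> = (\<integral>x. \<phi> x \<partial>\<nu>)" if \<phi>: "\<phi> \<in> C1_stable" for \<phi>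
  proof -
    obtain A H where A: "\<phi> \<in> borel_measurable borel_square" "0 \<le> A" "0 \<le> H"
      "\<And>s. s \<in> {0..1} \<Longrightarrow> holder_bounds 1 (\<lambda>t. \<phi> (s, t)) A H" using C1_stableE[OF \<phi>] by blast
    obtain A' where A': "\<And>z. z \<in> square \<Longrightarrow> \<bar>\<phi> z\<bar> \<le> A'" using C1_stable_bounded[OF \<phi>] by blast
    note f = cf(3)[OF A(1) A']
    have c: "continuous_on {0..1} (\<lambda>t. \<phi> (s, t))" if "s \<in> {0..1}" for s
      by (rule holder_bounds_continuous1[OF A(4)[OF that]])
    have "(\<lambda>n. pairing (h (r n)) \<phi>) \<longlonglongrightarrow> (LINT s:{0..1}|lborel. \<integral>y. \<phi> (s, unit_clamp y) \<partial>\<eta>)"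
      unfolding pairing_leaves(2)[OF h_C1 \<phi>] set_lebesgue_integral_def
    proof (rule integral_dominated_convergence[where w = "\<lambda>s. A * indicator {0..1} s"])
      show "(\<lambda>s. indicator {0..1} s *\<^sub>R (\<integral>y. \<phi> (s, unit_clamp y) \<partial>\<eta>)) \<in> borel_measurable lborel"
        using f unfolding set_integrable_def by (auto intro: borel_measurable_integrable)
      show "(\<lambda>s. indicator {0..1} s *\<^sub>R leaf_integral s (h (r n)) (\<lambda>t. \<phi> (s, t))) \<in> borel_measurable lborel" for n
        using pairing_leaves(1)[OF h_C1 \<phi>, of "r n"] unfolding set_integrable_def by (rule borel_measurable_integrable)
      show "integrable lborel (\<lambda>s. A * indicator {0..1::real} s)"
        by (intro integrable_mult_right integrable_real_indicator) auto
      show "AE s in lborel. (\<lambda>n. indicator {0..1} s *\<^sub>R leaf_integral s (h (r n)) (\<lambda>t. \<phi> (s, t)))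
          \<longlonglongrightarrow> indicator {0..1} s *\<^sub>R (\<integral>y. \<phi> (s, unit_clamp y) \<partial>\<eta>)"
      proof (rule AE_I2)
        fix s :: real
        show "(\<lambda>n. indicator {0..1} s *\<^sub>R leaf_integral s (h (r n)) (\<lambda>t. \<phi> (s, t)))
          \<longlonglongrightarrow> indicator {0..1} s *\<^sub>R (\<integral>y. \<phi> (s, unit_clamp y) \<partial>\<eta>)"
          using lim[of s, OF _ c[of s]] by (cases "s \<in> {0..1}") auto
      qed
      show "AE s in lborel. norm (indicator {0..1} s *\<^sub>R leaf_integral s (h (r n)) (\<lambda>t. \<phi> (s, t))) \<le> A * indicator {0..1} s" for n
      proof (rule AE_I2)
        fix s :: real
        show "norm (indicator {0..1} s *\<^sub>R leaf_integral s (h (r n)) (\<lambda>t. \<phi> (s, t))) \<le> A * indicator {0..1} s"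
          using leaf_integral_h_bound[of s, OF _ c[of s] holder_boundsD(3)[OF A(4)[of s]]]
          by (cases "s \<in> {0..1}") auto
      qed
    qed
    moreover have "(\<lambda>n. pairing (h (r n)) \<phi>) \<longlonglongrightarrow> \<mu>\<^sub>0 \<phi>"
      using LIMSEQ_subseq_LIMSEQ[OF approximatesD(1)[OF mu0_approximates \<phi>] r] by (simp add: o_def h_def)
    ultimately have "\<mu>\<^sub>0 \<phi> = (LINT s:{0..1}|lborel. \<integral>y. \<phi> (s, unit_clamp y) \<partial>\<eta>)" by (rule LIMSEQ_unique[rotated])
    with f show ?thesis by simp
  qed
  show thesis
  proof (rule that)
    show "measure_on_square \<nu>" "prob_space \<nu>" "conditional_measures_unstable \<nu> arclength_unstable"
      by (fact cf)+
    show "\<mu>\<^sub>0 = functional_of_measure \<nu>"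
    proof
      fix \<phi>
      show "\<mu>\<^sub>0 \<phi> = functional_of_measure \<nu> \<phi>"
        using mu[of \<phi>] approximatesD(2)[OF mu0_approximates, of \<phi>] by (simp add: functional_of_measure_def)
    qed
    fix S :: "real set" assume S: "countable S"
    have "{z \<in> square. fst z \<in> S} = square \<inter> (S \<times> UNIV)" by auto
    moreover have "S \<times> (UNIV :: real set) \<in> sets (borel \<Otimes>\<^sub>M borel)"
    proof (rule pair_measureI)
      show "S \<in> sets borel" by (rule sets.countable[OF _ S]) simp
    qed simp
    ultimately have A: "{z \<in> square. fst z \<in> S} \<in> sets borel_square"
      unfolding sets_square_iff borel_prod by auto
    have "emeasure (arclength_unstable y) {z \<in> square. fst z \<in> S} = 0" if y: "y \<in> {0..1}" for y
    proof -
      have arc: "(\<lambda>x. (x, y)) \<in> measurable (restrict_space lborel {0..1}) borel_square"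
        using y by (intro measurable_restrict_space2 measurable_restrict_space1)
          (auto simp: space_restrict_space square_def borel_prod[symmetric])
      have "emeasure (arclength_unstable y) {z \<in> square. fst z \<in> S}
          = emeasure (restrict_space lborel {0..1}) ((\<lambda>x. (x, y)) -` {z \<in> square. fst z \<in> S} \<inter> space (restrict_space lborel {0..1}))"
        unfolding arclength_unstable_def by (rule emeasure_distr[OF arc A])
      also have "(\<lambda>x. (x, y)) -` {z \<in> square. fst z \<in> S} \<inter> space (restrict_space lborel {0..1}) = S \<inter> {0..1}"
        using y by (auto simp: space_restrict_space square_def)
      also have "emeasure (restrict_space lborel {0..1}) (S \<inter> {0..1}) = emeasure lborel (S \<inter> {0..1})"
        by (rule emeasure_restrict_space) auto
      also have "\<dots> = 0" by (rule emeasure_lborel_countable) (use S in auto)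
      finally show ?thesis .
    qed
    then have "emeasure \<nu> {z \<in> square. fst z \<in> S} = 0"
      unfolding cf(5)[OF A] using unit_clamp_range by simp
    moreover have "{z \<in> square. fst z \<in> S} \<in> sets \<nu>" using A by (simp add: \<nu>_def)
    ultimately show "AE z in \<nu>. fst z \<notin> S"
      using space_square[OF cf(1)] by (intro AE_I[of _ _ "{z \<in> square. fst z \<in> S}"]) auto
  qed
qed

end

section \<open>The physical measure\<close>

text \<open>From one square to the next there are at most \<open>2 * m\<close> further terms, each
  bounded by \<open>K\<close>, and they change an average over at least \<open>m ^ 2\<close> terms
  by at most \<open>2 * K / m\<close>.\<close>

lemma average_tendsto_of_squares:
  fixes a :: "nat \<Rightarrow> real"
  assumes K: "\<And>k. \<bar>a k\<bar> \<le> K"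
    and sq: "(\<lambda>m. (\<Sum>k<(Suc m)\<^sup>2. a k) / real ((Suc m)\<^sup>2)) \<longlonglongrightarrow> 0"
  shows "(\<lambda>n. (\<Sum>k<n. a k) / real n) \<longlonglongrightarrow> 0"
proof -
  have K0: "0 \<le> K" using K[of 0] by simp
  define S where "S n = (\<Sum>k<n. a k)" for n
  define g where "g m = \<bar>S (m\<^sup>2) / real (m\<^sup>2)\<bar> + 2 * K / real m" for m
  define m where "m n = nat \<lfloor>sqrt (real n)\<rfloor>" for n
  have "(\<lambda>m. S ((Suc m)\<^sup>2) / real ((Suc m)\<^sup>2)) \<longlonglongrightarrow> 0" using sq unfolding S_def .
  then have 1: "(\<lambda>m. S (m\<^sup>2) / real (m\<^sup>2)) \<longlonglongrightarrow> 0"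
    by (rule LIMSEQ_imp_Suc[of "\<lambda>m. S (m\<^sup>2) / real (m\<^sup>2)"])
  have "(\<lambda>m. 2 * K / real m) \<longlonglongrightarrow> 0" by (rule lim_const_over_n)
  with tendsto_rabs[OF 1] have g: "g \<longlonglongrightarrow> 0" unfolding g_def[abs_def] using tendsto_add by fastforce
  have m: "filterlim m at_top sequentially"
    unfolding m_def by (intro filterlim_compose[OF filterlim_nat_sequentially]
        filterlim_compose[OF filterlim_floor_sequentially] filterlim_compose[OF sqrt_at_top] filterlim_real_sequentially)
  have bound: "norm (S n / real n) \<le> g (m n)" if n: "1 \<le> n" for n
  proof -
    have s1: "1 \<le> sqrt (real n)" using n by simp
    have mm: "real (m n) \<le> sqrt (real n)" "sqrt (real n) < real (m n) + 1" using s1 unfolding m_def by linarith+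
    have m1: "1 \<le> m n" using mm s1 by linarith
    have "(real (m n))\<^sup>2 \<le> (sqrt (real n))\<^sup>2" by (rule power_mono[OF mm(1)]) simp
    then have lo: "real ((m n)\<^sup>2) \<le> real n" by simp
    have "(sqrt (real n))\<^sup>2 < (real (m n) + 1)\<^sup>2" by (rule power_strict_mono[OF mm(2)]) auto
    then have "real n < real ((m n)\<^sup>2 + 2 * m n + 1)" by (simp add: power2_eq_square algebra_simps)
    then have hi: "n \<le> (m n)\<^sup>2 + 2 * m n" by linarith
    have lo': "(m n)\<^sup>2 \<le> n" using lo by linarith
    have "S n = S ((m n)\<^sup>2) + (\<Sum>k\<in>{(m n)\<^sup>2..<n}. a k)"
      unfolding S_def using sum.atLeastLessThan_concat[of 0 "(m n)\<^sup>2" n a] lo' by (simp add: lessThan_atLeast0)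
    moreover have "\<bar>\<Sum>k\<in>{(m n)\<^sup>2..<n}. a k\<bar> \<le> (\<Sum>k\<in>{(m n)\<^sup>2..<n}. K)"
      by (rule order_trans[OF sum_abs sum_mono[OF K]])
    moreover have "(\<Sum>k\<in>{(m n)\<^sup>2..<n}. K) \<le> 2 * real (m n) * K"
      using hi K0 by (simp, intro mult_right_mono) linarith+
    ultimately have "\<bar>S n\<bar> \<le> \<bar>S ((m n)\<^sup>2)\<bar> + 2 * real (m n) * K" by linarith
    then have "\<bar>S n\<bar> / real n \<le> (\<bar>S ((m n)\<^sup>2)\<bar> + 2 * real (m n) * K) / real n" by (rule divide_right_mono) simp
    also have "\<dots> \<le> (\<bar>S ((m n)\<^sup>2)\<bar> + 2 * real (m n) * K) / real ((m n)\<^sup>2)"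
      using lo m1 K0 n by (intro divide_left_mono) auto
    also have "\<dots> = g (m n)" unfolding g_def using m1 by (simp add: add_divide_distrib power2_eq_square)
    finally show ?thesis by simp
  qed
  have "(\<lambda>n. S n / real n) \<longlonglongrightarrow> 0"
  proof (rule Lim_null_comparison)
    show "\<forall>\<^sub>F n in sequentially. norm (S n / real n) \<le> g (m n)"
      using bound unfolding eventually_sequentially by blast
    show "(\<lambda>n. g (m n)) \<longlonglongrightarrow> 0" by (rule filterlim_compose[OF g m])
  qed
  then show ?thesis unfolding S_def .
qed

text \<open>
  The second moments of the sums grow linearly, so the averages along squares converge by a
  Borel--Cantelli argument.
\<close>

lemma (in prob_space) averages_AE_null:
  fixes a :: "nat \<Rightarrow> 'a \<Rightarrow> real"
  assumes m: "\<And>k. a k \<in> borel_measurable M" and K: "\<And>k x. x \<in> space M \<Longrightarrow> \<bar>a k x\<bar> \<le> K"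
    and corr: "\<And>j n. \<bar>\<integral>x. a j x * a (j + n) x \<partial>M\<bar> \<le> c n" and c: "summable c"
  shows "AE x in M. (\<lambda>n. (\<Sum>k<n. a k x) / real n) \<longlonglongrightarrow> 0"
proof -
  have c0: "0 \<le> c n" for n using corr[of 0 n] by linarith
  define S where "S n x = (\<Sum>k<n. a k x)" for n x
  define C where "C = suminf c"
  have Sm: "S n \<in> borel_measurable M" for n unfolding S_def[abs_def] using m by simp
  have SK: "\<bar>S n x\<bar> \<le> real n * K" if "x \<in> space M" for n x
  proof -
    have "\<bar>S n x\<bar> \<le> (\<Sum>k<n. K)" unfolding S_def by (rule order_trans[OF sum_abs sum_mono[OF K[OF that]]])
    then show ?thesis by simp
  qed
  have intp: "integrable M (\<lambda>x. u x * v x)"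
    if "u \<in> borel_measurable M" "v \<in> borel_measurable M" "\<And>x. x \<in> space M \<Longrightarrow> \<bar>u x\<bar> \<le> A" "\<And>x. x \<in> space M \<Longrightarrow> \<bar>v x\<bar> \<le> B"
    for u v :: "'a \<Rightarrow> real" and A B
  proof (rule integrable_const_bound[of _ "A * B"])
    show "AE x in M. norm (u x * v x) \<le> A * B"
      using that(3,4) by (intro AE_I2) (auto simp: abs_mult intro!: mult_mono intro: order_trans[OF abs_ge_zero])
  qed (use that in simp)
  note iSS = intp[OF Sm Sm SK SK] and iSa = intp[OF Sm m SK K] and iaa = intp[OF m m K K]
  \<comment> \<open>Pairing the sum up to \<open>n\<close> with the next term costs only the total
    of the correlation bounds, independently of \<open>n\<close>.\<close>
  have cross: "\<bar>\<integral>x. S n x * a n x \<partial>M\<bar> \<le> C" for n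
  proof -
    have "(\<integral>x. S n x * a n x \<partial>M) = (\<Sum>k<n. \<integral>x. a k x * a n x \<partial>M)"
      unfolding S_def sum_distrib_right by (rule Bochner_Integration.integral_sum) (rule iaa)
    also have "\<bar>\<dots>\<bar> \<le> (\<Sum>k<n. c (n - k))"
    proof (rule order_trans[OF sum_abs sum_mono])
      fix k assume "k \<in> {..<n}"
      then show "\<bar>\<integral>x. a k x * a n x \<partial>M\<bar> \<le> c (n - k)" using corr[of k "n - k"] by simp
    qed
    also have "\<dots> = (\<Sum>k\<in>{1..n}. c k)"
      by (rule sum.reindex_bij_witness[of _ "\<lambda>k. n - k" "\<lambda>k. n - k"]) auto
    also have "\<dots> \<le> C" unfolding C_def by (rule sum_le_suminf[OF c]) (use c0 in auto)
    finally show ?thesis .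
  qed
  have diag: "(\<integral>x. a n x * a n x \<partial>M) \<le> C" for n
  proof -
    have "(\<integral>x. a n x * a n x \<partial>M) \<le> c 0" using corr[of n 0] by simp
    also have "\<dots> \<le> C" unfolding C_def using sum_le_suminf[OF c, of "{0}"] c0 by simp
    finally show ?thesis .
  qed
  \<comment> \<open>Each new term adds two cross terms and one diagonal term, each at most
    \<open>C\<close>.\<close>
  have second: "(\<integral>x. S n x * S n x \<partial>M) \<le> 3 * C * real n" for n
  proof (induction n)
    case (Suc n)
    have "(\<integral>x. S (Suc n) x * S (Suc n) x \<partial>M) = (\<integral>x. S n x * S n x + (2 * (S n x * a n x) + a n x * a n x) \<partial>M)"
      by (rule Bochner_Integration.integral_cong) (simp_all add: S_def algebra_simps)
    also have "\<dots> = (\<integral>x. S n x * S n x \<partial>M) + (2 * (\<integral>x. S n x * a n x \<partial>M) + (\<integral>x. a n x * a n x \<partial>M))"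
      using iSS[of n n] iSa[of n n] iaa[of n n] by simp
    also have "\<dots> \<le> 3 * C * real n + (2 * C + C)" using Suc cross[of n] diag[of n] by linarith
    finally show ?case by (simp add: algebra_simps)
  qed (simp add: S_def)
  \<comment> \<open>The squared averages along squares have expectations of order
    \<open>1 / (i + 1) ^ 2\<close>, so their sum has finite expectation and is finite almost
    everywhere.\<close>
  define f where "f i x = (S ((Suc i)\<^sup>2) x / real ((Suc i)\<^sup>2))\<^sup>2" for i x
  have fm: "f i \<in> borel_measurable M" for i unfolding f_def[abs_def] using Sm by simp
  have fint: "integrable M (f i)" for i
  proof -
    have "integrable M (\<lambda>x. S ((Suc i)\<^sup>2) x * S ((Suc i)\<^sup>2) x / (real ((Suc i)\<^sup>2))\<^sup>2)"
      by (intro integrable_divide iSS)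
    then show ?thesis unfolding f_def[abs_def] by (simp add: power_divide power2_eq_square)
  qed
  have fE: "(\<integral>x. f i x \<partial>M) \<le> 3 * C * (1 / real ((Suc i)\<^sup>2))" for i
  proof -
    define q where "q = (Suc i)\<^sup>2"
    have q: "0 < real q" by (simp add: q_def)
    have "(\<integral>x. f i x \<partial>M) = (\<integral>x. S q x * S q x / (real q)\<^sup>2 \<partial>M)"
      unfolding f_def q_def[symmetric] by (simp add: power_divide power2_eq_square)
    also have "\<dots> = (\<integral>x. S q x * S q x \<partial>M) / (real q)\<^sup>2" by simp
    also have "\<dots> \<le> 3 * C * real q / (real q)\<^sup>2" by (intro divide_right_mono second) simp
    also have "\<dots> = 3 * C * (1 / real q)" using q by (simp add: power2_eq_square)
    finally show ?thesis unfolding q_def .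
  qed
  have sums: "summable (\<lambda>i. 3 * C * (1 / real ((Suc i)\<^sup>2)))"
  proof -
    have "summable (\<lambda>i. inverse ((real i)\<^sup>2))" by (rule inverse_power_summable) simp
    then have "summable (\<lambda>i. inverse ((real (Suc i))\<^sup>2))" by (subst summable_Suc_iff)
    then have "summable (\<lambda>i. 1 / real ((Suc i)\<^sup>2))" by (simp add: inverse_eq_divide)
    then show ?thesis by (rule summable_mult)
  qed
  have C0: "0 \<le> C" unfolding C_def by (rule suminf_nonneg[OF c c0])
  have f0: "0 \<le> f i x" for i x by (simp add: f_def)
  have "(\<integral>\<^sup>+x. (\<Sum>i. ennreal (f i x)) \<partial>M) = (\<Sum>i. \<integral>\<^sup>+x. ennreal (f i x) \<partial>M)"
    by (rule nn_integral_suminf) (use fm in simp)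
  also have "\<dots> \<le> (\<Sum>i. ennreal (3 * C * (1 / real ((Suc i)\<^sup>2))))"
  proof (rule suminf_le)
    fix i
    have "(\<integral>\<^sup>+x. ennreal (f i x) \<partial>M) = ennreal (\<integral>x. f i x \<partial>M)"
      by (rule nn_integral_eq_integral[OF fint]) (simp add: f0)
    also have "\<dots> \<le> ennreal (3 * C * (1 / real ((Suc i)\<^sup>2)))" by (rule ennreal_leI[OF fE])
    finally show "(\<integral>\<^sup>+x. ennreal (f i x) \<partial>M) \<le> ennreal (3 * C * (1 / real ((Suc i)\<^sup>2)))" .
  qed simp_all
  also have "\<dots> = ennreal (\<Sum>i. 3 * C * (1 / real ((Suc i)\<^sup>2)))"
    by (rule suminf_ennreal2[OF _ sums]) (use C0 in simp)
  finally have "(\<integral>\<^sup>+x. (\<Sum>i. ennreal (f i x)) \<partial>M) \<noteq> \<infinity>" by (auto simp: top_unique)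
  then have "AE x in M. (\<Sum>i. ennreal (f i x)) \<noteq> \<infinity>"
    by (rule nn_integral_PInf_AE[rotated]) (use fm in simp)
  then show ?thesis
  proof (rule AE_mp, intro AE_I2 impI)
    fix x assume x: "x \<in> space M" and "(\<Sum>i. ennreal (f i x)) \<noteq> \<infinity>"
    then have "summable (\<lambda>i. f i x)" by (intro summable_suminf_not_top) (auto simp: f0)
    then have "(\<lambda>i. f i x) \<longlonglongrightarrow> 0" by (rule summable_LIMSEQ_zero)
    from tendsto_real_sqrt[OF this] have "(\<lambda>i. \<bar>S ((Suc i)\<^sup>2) x / real ((Suc i)\<^sup>2)\<bar>) \<longlonglongrightarrow> 0"
      unfolding f_def by (simp only: real_sqrt_abs real_sqrt_zero)
    then have "(\<lambda>i. S ((Suc i)\<^sup>2) x / real ((Suc i)\<^sup>2)) \<longlonglongrightarrow> 0" by (rule tendsto_rabs_zero_cancel)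
    then show "(\<lambda>n. (\<Sum>k<n. a k x) / real n) \<longlonglongrightarrow> 0"
      unfolding S_def by (intro average_tendsto_of_squares[OF K[OF x]])
  qed
qed

section \<open>Lipschitz observables and polynomials on the square\<close>

lemma lipschitz_on_mult_bounded:
  fixes f g :: "'a::metric_space \<Rightarrow> real"
  assumes "K-lipschitz_on S f" "K'-lipschitz_on S g" "\<And>x. x \<in> S \<Longrightarrow> \<bar>f x\<bar> \<le> A" "\<And>x. x \<in> S \<Longrightarrow> \<bar>g x\<bar> \<le> A'"
    "0 \<le> A" "0 \<le> A'"
  shows "(A * K' + A' * K)-lipschitz_on S (\<lambda>x. f x * g x)"
proof (rule lipschitz_onI)
  have K: "0 \<le> K" "0 \<le> K'" using assms(1,2) lipschitz_on_nonneg by blast+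
  show "0 \<le> A * K' + A' * K" using assms K by simp
  fix x y assume xy: "x \<in> S" "y \<in> S"
  have "f x * g x - f y * g y = f x * (g x - g y) + g y * (f x - f y)" by (simp add: algebra_simps)
  then have "\<bar>f x * g x - f y * g y\<bar> \<le> \<bar>f x\<bar> * \<bar>g x - g y\<bar> + \<bar>g y\<bar> * \<bar>f x - f y\<bar>"
    unfolding abs_mult[symmetric] by (simp only: abs_triangle_ineq)
  also have "\<dots> \<le> A * (K' * dist x y) + A' * (K * dist x y)"
    using lipschitz_onD[OF assms(1) xy] lipschitz_onD[OF assms(2) xy] assms xy K
    by (intro add_mono mult_mono) (auto simp: dist_real_def)
  finally show "dist (f x * g x) (f y * g y) \<le> (A * K' + A' * K) * dist x y"
    by (simp add: dist_real_def algebra_simps)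
qed

definition monomial2 :: "nat \<Rightarrow> nat \<Rightarrow> point \<Rightarrow> real" where "monomial2 i j z = fst z ^ i * snd z ^ j"

lemma square_coord: "z \<in> square \<Longrightarrow> fst z \<in> {0..1} \<and> snd z \<in> {0..1}"
  by (auto simp: square_def)

lemma lipschitz_power:
  assumes "1-lipschitz_on square u" "\<And>z. z \<in> square \<Longrightarrow> u z \<in> {0..1::real}"
  shows "\<exists>K. K-lipschitz_on square (\<lambda>z. u z ^ n)"
proof (induction n)
  case 0
  then show ?case by (auto intro: lipschitz_on_constant)
next
  case (Suc n)
  then obtain K where K: "K-lipschitz_on square (\<lambda>z. u z ^ n)" by blast
  have "(1 * K + 1 * 1)-lipschitz_on square (\<lambda>z. u z * u z ^ n)"
    by (rule lipschitz_on_mult_bounded[OF assms(1) K]) (use assms(2) in \<open>auto simp: power_abs power_le_one\<close>)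
  then show ?case by auto
qed

lemma lipschitz_monomial2:
  shows "\<exists>K. K-lipschitz_on square (monomial2 i j)"
proof -
  have fs: "1-lipschitz_on square (fst :: point \<Rightarrow> real)" "1-lipschitz_on square (snd :: point \<Rightarrow> real)"
    by (rule lipschitz_onI, simp_all only: mult_1 dist_fst_le dist_snd_le zero_le_one)+
  obtain K where K: "K-lipschitz_on square (\<lambda>z. fst z ^ i)"
    using lipschitz_power[OF fs(1), of i] square_coord by blast
  obtain K' where K': "K'-lipschitz_on square (\<lambda>z. snd z ^ j)"
    using lipschitz_power[OF fs(2), of j] square_coord by blast
  have "(1 * K' + 1 * K)-lipschitz_on square (\<lambda>z. fst z ^ i * snd z ^ j)"
    by (rule lipschitz_on_mult_bounded[OF K K']) (auto dest: square_coord simp: power_abs power_le_one)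
  then show ?thesis unfolding monomial2_def[abs_def] by blast
qed

text \<open>Finite sums of monomials as an inductive predicate. Convergence of time averages is
  known for the countably many monomials off a common null set and extends to polynomials by this
  induction.\<close>

inductive polynomial2 :: "(point \<Rightarrow> real) \<Rightarrow> bool" where
  monomial: "polynomial2 (\<lambda>z. c * monomial2 i j z)"
| sum: "polynomial2 f \<Longrightarrow> polynomial2 g \<Longrightarrow> polynomial2 (\<lambda>z. f z + g z)"

lemma polynomial2_mult_monomial: "polynomial2 g \<Longrightarrow> polynomial2 (\<lambda>z. c * monomial2 i j z * g z)"
proof (induction rule: polynomial2.induct)
  case (monomial c' i' j')
  have "(\<lambda>z. c * monomial2 i j z * (c' * monomial2 i' j' z)) = (\<lambda>z. (c * c') * monomial2 (i + i') (j + j') z)"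
    by (auto simp: monomial2_def power_add)
  then show ?case using polynomial2.monomial by metis
next
  case (sum f g)
  from polynomial2.sum[OF sum.IH] show ?case by (simp add: distrib_left)
qed

lemma polynomial2_mult: "polynomial2 f \<Longrightarrow> polynomial2 g \<Longrightarrow> polynomial2 (\<lambda>z. f z * g z)"
proof (induction rule: polynomial2.induct)
  case (monomial c i j)
  then show ?case by (rule polynomial2_mult_monomial)
next
  case (sum f f')
  from polynomial2.sum[OF sum.IH(1)[OF sum.prems] sum.IH(2)[OF sum.prems]] show ?case by (simp add: distrib_right)
qed

text \<open>A linear form on the plane is a combination of the two coordinates, and the class is
  closed under sums and products.\<close>

lemma real_polynomial_function_polynomial2:
  "real_polynomial_function f \<Longrightarrow> polynomial2 f"
proof (induction rule: real_polynomial_function.induct)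
  case (linear f)
  interpret bounded_linear f by fact
  have "f z = f (1, 0) * monomial2 1 0 z + f (0, 1) * monomial2 0 1 z" for z
  proof -
    have "f z = f (fst z *\<^sub>R (1, 0) + snd z *\<^sub>R (0, 1))" by (cases z) simp
    also have "\<dots> = fst z *\<^sub>R f (1, 0) + snd z *\<^sub>R f (0, 1)" by (simp only: add scaleR)
    finally show ?thesis by (simp add: monomial2_def)
  qed
  then have "f = (\<lambda>z. f (1, 0) * monomial2 1 0 z + f (0, 1) * monomial2 0 1 z)" by (rule ext)
  moreover have "polynomial2 (\<lambda>z. f (1, 0) * monomial2 1 0 z + f (0, 1) * monomial2 0 1 z)"
    by (intro polynomial2.intros)
  ultimately show ?case by simp
next
  case (const c)
  then show ?case using polynomial2.monomial[of c 0 0] by (simp add: monomial2_def)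
qed (auto intro: polynomial2.sum polynomial2_mult)

text \<open>Correlations test against products of an observable with its image under
  iteration.\<close>

lemma C1_stable_mult:
  assumes "\<phi> \<in> C1_stable" "\<psi> \<in> C1_stable" shows "(\<lambda>z. \<phi> z * \<psi> z) \<in> C1_stable"
proof -
  obtain A H where A: "\<phi> \<in> borel_measurable borel_square" "0 \<le> A" "0 \<le> H"
    "\<And>s. s \<in> {0..1} \<Longrightarrow> holder_bounds 1 (\<lambda>t. \<phi> (s, t)) A H" using C1_stableE[OF assms(1)] by blast
  obtain A' H' where A': "\<psi> \<in> borel_measurable borel_square" "0 \<le> A'" "0 \<le> H'"
    "\<And>s. s \<in> {0..1} \<Longrightarrow> holder_bounds 1 (\<lambda>t. \<psi> (s, t)) A' H'" using C1_stableE[OF assms(2)] by blast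
  show ?thesis
  proof (rule C1_stableI)
    show "(\<lambda>z. \<phi> z * \<psi> z) \<in> borel_measurable borel_square" using A A' by simp
    fix s :: real assume s: "s \<in> {0..1}"
    have l: "H-lipschitz_on {0..1} (\<lambda>t. \<phi> (s, t))" "H'-lipschitz_on {0..1} (\<lambda>t. \<psi> (s, t))"
      using holder_boundsD[OF A(4)[OF s]] holder_boundsD[OF A'(4)[OF s]]
      by (auto intro!: lipschitz_onI simp: dist_real_def)
    have m: "(A * H' + A' * H)-lipschitz_on {0..1} (\<lambda>t. \<phi> (s, t) * \<psi> (s, t))"
      by (rule lipschitz_on_mult_bounded[OF l holder_boundsD(3)[OF A(4)[OF s]] holder_boundsD(3)[OF A'(4)[OF s]] A(2) A'(2)])
    show "holder_bounds 1 (\<lambda>t. \<phi> (s, t) * \<psi> (s, t)) (A * A') (A * H' + A' * H)"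
    proof (rule holder_boundsI)
      show "\<bar>\<phi> (s, t) * \<psi> (s, t)\<bar> \<le> A * A'" if "t \<in> {0..1}" for t
        unfolding abs_mult
        by (intro mult_mono holder_boundsD(3)[OF A(4)[OF s] that] holder_boundsD(3)[OF A'(4)[OF s] that] A) auto
      show "\<bar>\<phi> (s, t) * \<psi> (s, t) - \<phi> (s, u) * \<psi> (s, u)\<bar> \<le> (A * H' + A' * H) * \<bar>t - u\<bar> powr 1"
        if "t \<in> {0..1}" "u \<in> {0..1}" for t u
        using lipschitz_onD[OF m that] by (simp add: dist_real_def)
    qed (use A A' in auto)
  qed
qed

context baker_data
begin

section \<open>Decay of correlations along Lebesgue typical orbits\<close>

lemma leafwise_pow_C1_stable: "\<phi> \<in> C1_stable \<Longrightarrow> \<phi> \<circ> (\<Lambda> ^^ n) \<in> C1_stable"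
proof (induction n arbitrary: \<phi>)
  case (Suc n)
  have "\<phi> \<circ> (\<Lambda> ^^ Suc n) = (\<phi> \<circ> \<Lambda>) \<circ> (\<Lambda> ^^ n)" by auto
  then show ?case using Suc.IH[OF leafwise_C1_stable[OF Suc.prems]] by simp
qed (simp add: o_def)

lemma transfer_op_apply: "\<phi> \<in> C1_stable \<Longrightarrow> L F \<phi> = F (\<phi> \<circ> \<Lambda>)"
  by (simp add: transfer_op_def)

lemma comp_leafwise_pow:
  "\<phi> \<circ> (\<Lambda> ^^ Suc n) = (\<phi> \<circ> \<Lambda>) \<circ> (\<Lambda> ^^ n)"
  by auto

lemma transfer_op_pow_apply: "\<phi> \<in> C1_stable \<Longrightarrow> (L ^^ n) F \<phi> = F (\<phi> \<circ> (\<Lambda> ^^ n))"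
proof (induction n arbitrary: \<phi>)
  case (Suc n)
  have "(L ^^ Suc n) F \<phi> = L ((L ^^ n) F) \<phi>" by simp
  also have "\<dots> = (L ^^ n) F (\<phi> \<circ> \<Lambda>)" by (rule transfer_op_apply[OF Suc.prems])
  also have "\<dots> = F ((\<phi> \<circ> \<Lambda>) \<circ> (\<Lambda> ^^ n))" by (rule Suc.IH[OF leafwise_C1_stable[OF Suc.prems]])
  finally show ?case unfolding comp_leafwise_pow .
qed (simp add: o_def)

lemma pairing_transfer_density_pow:
  assumes "f \<in> C1_unstable" "\<phi> \<in> C1_stable"
  shows "pairing ((transfer_density ^^ n) f) \<phi> = pairing f (\<phi> \<circ> (\<Lambda> ^^ n))"
  using assms(2)
proof (induction n arbitrary: \<phi>)
  case (Suc n)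
  have "pairing ((transfer_density ^^ Suc n) f) \<phi> = pairing ((transfer_density ^^ n) f) (\<phi> \<circ> \<Lambda>)"
    using pairing_transfer_density[OF transfer_density_pow_C1[OF assms(1)] Suc.prems, of n] by simp
  also have "\<dots> = pairing f ((\<phi> \<circ> \<Lambda>) \<circ> (\<Lambda> ^^ n))" by (rule Suc.IH[OF leafwise_C1_stable[OF Suc.prems]])
  finally show ?case unfolding comp_leafwise_pow .
qed (simp add: o_def)

text \<open>The point is that the bound does not depend on \<open>j\<close>. On each leaf
  \<open>h j\<close> is a probability density, the same one on all leaves, so passing to another
  leaf only changes \<psi>, and its Lipschitz constant bounds the unstable seminorm.\<close>

lemma weighted_density:
  assumes \<psi>: "K-lipschitz_on square \<psi>" and A: "\<And>z. z \<in> square \<Longrightarrow> \<bar>\<psi> z\<bar> \<le> A"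
  shows "(\<lambda>z. h j z * \<psi> z) \<in> C1_unstable" "strong (\<lambda>z. h j z * \<psi> z) \<le> A + K"
proof -
  have A0: "0 \<le> A" using A[of "(0, 0)"] by (simp add: square_iff)
  have K0: "0 \<le> K" using \<psi> by (rule lipschitz_on_nonneg)
  have c: "continuous_on {0..1} (\<lambda>t. \<psi> (s, t))" if "s \<in> {0..1}" for s
    by (rule continuous_on_compose2[OF lipschitz_on_continuous_on[OF \<psi>]]) (use that in \<open>auto intro!: continuous_intros simp: square_def\<close>)
  have dx: "\<bar>\<psi> (s, t) - \<psi> (s', t)\<bar> \<le> K * \<bar>s - s'\<bar>" if "s \<in> {0..1}" "s' \<in> {0..1}" "t \<in> {0..1}" for s s' t
    using lipschitz_onD[OF \<psi>, of "(s, t)" "(s', t)"] that by (simp add: square_iff dist_Pair_Pair dist_real_def)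
  obtain B where B: "0 \<le> B" "\<And>s t. s \<in> {0..1} \<Longrightarrow> t \<in> {0..1} \<Longrightarrow> \<bar>h j (s, t)\<bar> \<le> B"
    using C1_unstable_bounded[OF h_C1] by blast
  show u: "(\<lambda>z. h j z * \<psi> z) \<in> C1_unstable"
  proof (rule C1_unstableI)
    show "(\<lambda>z. h j z * \<psi> z) \<in> borel_measurable borel_square"
      by (rule borel_measurable_times[OF C1_unstable_measurable[OF h_C1]
            borel_measurable_continuous_on_restrict[OF lipschitz_on_continuous_on[OF \<psi>]]])
    show "\<bar>h j (s, t) * \<psi> (s, t)\<bar> \<le> B * A" if "s \<in> {0..1}" "t \<in> {0..1}" for s t
      unfolding abs_mult using that by (intro mult_mono B A) (auto simp: square_iff)
    show "\<bar>h j (s, t) * \<psi> (s, t) - h j (s', t) * \<psi> (s', t)\<bar> \<le> B * K * \<bar>s - s'\<bar>"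
      if s: "s \<in> {0..1}" "s' \<in> {0..1}" "t \<in> {0..1}" for s s' t
    proof -
      have "h j (s, t) * \<psi> (s, t) - h j (s', t) * \<psi> (s', t) = h j (s, t) * (\<psi> (s, t) - \<psi> (s', t))"
        using h_const[of j s' t s] by (simp add: right_diff_distrib)
      then have "\<bar>h j (s, t) * \<psi> (s, t) - h j (s', t) * \<psi> (s', t)\<bar> = \<bar>h j (s, t)\<bar> * \<bar>\<psi> (s, t) - \<psi> (s', t)\<bar>"
        by (simp add: abs_mult)
      also have "\<dots> \<le> B * (K * \<bar>s - s'\<bar>)" by (intro mult_mono B dx s) auto
      finally show ?thesis by simp
    qed
  qed
  have J: "leaf_integral s (\<lambda>z. h j z * \<psi> z) g = leaf_integral s (h j) (\<lambda>t. \<psi> (s, t) * g t)" for s g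
    by (rule leaf_integral_cong) simp
  have "stable (\<lambda>z. h j z * \<psi> z) \<le> A"
  proof (rule stable_norm_least)
    fix s :: real and g A' H assume g: "s \<in> {0..1}" "g \<in> holder_leaf \<alpha>" "holder_bounds \<alpha> g A' H" "A' + H \<le> 1"
    have g1: "\<bar>g t\<bar> \<le> 1" if "t \<in> {0..1}" for t
      using holder_boundsD(3)[OF g(3) that] holder_boundsD(2)[OF g(3)] g(4) by linarith
    have "\<bar>leaf_integral s (h j) (\<lambda>t. \<psi> (s, t) * g t)\<bar> \<le> A"
    proof (rule leaf_integral_h_bound[OF g(1) continuous_on_mult[OF c[OF g(1)] holder_leaf_cont[OF g(2)]]])
      fix t :: real assume t: "t \<in> {0..1}"
      have "\<bar>\<psi> (s, t)\<bar> * \<bar>g t\<bar> \<le> A * 1" using A0 g(1) t by (intro mult_mono A g1) (auto simp: square_iff)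
      then show "\<bar>\<psi> (s, t) * g t\<bar> \<le> A" by (simp add: abs_mult)
    qed
    then show "leaf_integral s (\<lambda>z. h j z * \<psi> z) g \<le> A" unfolding J by simp
  qed
  moreover have "unstable (\<lambda>z. h j z * \<psi> z) \<le> K"
  proof (rule unstable_norm_least[OF K0])
    fix s s' :: real and g A' H
    assume g: "s \<in> {0..1}" "s' \<in> {0..1}" "s \<noteq> s'" "holder_bounds 1 g A' H" "A' + H \<le> 1"
    note cg = holder_bounds_continuous1[OF g(4)]
    have g1: "\<bar>g t\<bar> \<le> 1" if "t \<in> {0..1}" for t
      using holder_boundsD(3)[OF g(4) that] holder_boundsD(2)[OF g(4)] g(5) by linarith
    have c1: "continuous_on {0..1} (\<lambda>t. \<psi> (s, t) * g t)" and c2: "continuous_on {0..1} (\<lambda>t. (-1) * (\<psi> (s', t) * g t))"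
      by (intro continuous_intros c g cg)+
    have "leaf_integral s (h j) (\<lambda>t. \<psi> (s, t) * g t) - leaf_integral s' (h j) (\<lambda>t. \<psi> (s', t) * g t)
        = leaf_integral s (h j) (\<lambda>t. \<psi> (s, t) * g t) + leaf_integral s (h j) (\<lambda>t. (-1) * (\<psi> (s', t) * g t))"
      using leaf_integral_h_const[of s' j "\<lambda>t. \<psi> (s', t) * g t" s] unfolding leaf_integral_scale_right by simp
    also have "\<dots> = leaf_integral s (h j) (\<lambda>t. \<psi> (s, t) * g t + (-1) * (\<psi> (s', t) * g t))"
      by (rule leaf_integral_add_right[OF h_C1 g(1) c1 c2, symmetric])
    also have "\<bar>\<dots>\<bar> \<le> K * \<bar>s - s'\<bar>"
    proof (rule leaf_integral_h_bound[OF g(1) continuous_on_add[OF c1 c2]])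
      fix t :: real assume t: "t \<in> {0..1}"
      have "\<bar>\<psi> (s, t) - \<psi> (s', t)\<bar> * \<bar>g t\<bar> \<le> K * \<bar>s - s'\<bar> * 1" using K0 by (intro mult_mono dx g1 g t) auto
      moreover have "\<psi> (s, t) * g t + (-1) * (\<psi> (s', t) * g t) = (\<psi> (s, t) - \<psi> (s', t)) * g t" by (simp add: algebra_simps)
      ultimately show "\<bar>\<psi> (s, t) * g t + (-1) * (\<psi> (s', t) * g t)\<bar> \<le> K * \<bar>s - s'\<bar>" by (simp only: abs_mult mult_1_right)
    qed
    also have "\<dots> \<le> K * \<bar>s - s'\<bar> powr \<beta>"
    proof (rule mult_left_mono[OF _ K0])
      have "\<bar>s - s'\<bar> powr 1 \<le> \<bar>s - s'\<bar> powr \<beta>" using g exponents by (intro powr_mono') auto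
      then show "\<bar>s - s'\<bar> \<le> \<bar>s - s'\<bar> powr \<beta>" by simp
    qed
    finally show "\<bar>leaf_integral s (\<lambda>z. h j z * \<psi> z) g - leaf_integral s' (\<lambda>z. h j z * \<psi> z) g\<bar> \<le> K * \<bar>s - s'\<bar> powr \<beta>"
      unfolding J .
  qed
  ultimately show "strong (\<lambda>z. h j z * \<psi> z) \<le> A + K" unfolding strong_norm_def by simp
qed

text \<open>The correlation of the times \<open>j\<close> and \<open>j + n\<close> under Lebesgue
  measure is the n-th iterate of the density \<open>h j * \<psi>\<close>, evaluated at \<psi>.
  Subtracting its mass times \<open>\<mu>\<^sub>0\<close> makes the decay applicable and does not
  change the value, because \<open>\<mu>\<^sub>0\<close> annihilates \<psi> at all times.\<close>

lemma correlation_decay: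
  assumes \<psi>: "K-lipschitz_on square \<psi>" and A: "\<And>z. z \<in> square \<Longrightarrow> \<bar>\<psi> z\<bar> \<le> A" and zero: "\<mu>\<^sub>0 \<psi> = 0"
  shows "\<bar>LINT z:square|lborel. \<psi> ((\<Lambda> ^^ j) z) * \<psi> ((\<Lambda> ^^ (j + n)) z)\<bar>
    \<le> decay_const * (A + K) * (1 + N \<mu>\<^sub>0) * (A + K) * ((real n + 1) * \<rho> ^ n)"
proof -
  have pC: "\<psi> \<in> C1_stable" by (rule lipschitz_C1_stable[OF \<psi>])
  have A0: "0 \<le> A" using A[of "(0, 0)"] by (simp add: square_iff)
  have K0: "0 \<le> K" using \<psi> by (rule lipschitz_on_nonneg)
  have hb: "holder_bounds 1 (\<lambda>t. \<psi> (s, t)) A K" if "s \<in> {0..1}" for s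
  proof (rule holder_boundsI[OF A0 K0])
    show "\<bar>\<psi> (s, t)\<bar> \<le> A" if "t \<in> {0..1}" for t using A \<open>s \<in> {0..1}\<close> that by (simp add: square_iff)
    show "\<bar>\<psi> (s, t) - \<psi> (s, u)\<bar> \<le> K * \<bar>t - u\<bar> powr 1" if "t \<in> {0..1}" "u \<in> {0..1}" for t u
      using lipschitz_onD[OF \<psi>, of "(s, t)" "(s, u)"] \<open>s \<in> {0..1}\<close> that by (simp add: square_iff dist_Pair_Pair dist_real_def)
  qed
  let ?f = "\<lambda>z. h j z * \<psi> z"
  note w = weighted_density[OF \<psi> A]
  define F where "F = density_functional ?f"
  have FB: "F \<in> B" unfolding F_def by (rule density_functional_in_B[OF w(1)])
  have NF: "N F \<le> A + K" unfolding F_def using B_norm_density_functional[OF w(1)] w(2) by simp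
  let ?c = "F (\<lambda>_. 1)"
  define G where "G = (\<lambda>\<phi>. 1 * F \<phi> + (- ?c) * \<mu>\<^sub>0 \<phi>)"
  have GB: "G \<in> B" unfolding G_def by (rule banach_B_lincomb(1)[OF FB mu0_B])
  have "N G \<le> \<bar>1\<bar> * N F + \<bar>- ?c\<bar> * N \<mu>\<^sub>0" unfolding G_def by (rule banach_B_lincomb(2)[OF FB mu0_B])
  also have "\<dots> \<le> N F + N F * N \<mu>\<^sub>0"
    using banach_B_eval_one[OF FB] B_norm_nonneg[OF mu0_B] by (simp add: mult_right_mono)
  also have "\<dots> = (1 + N \<mu>\<^sub>0) * N F" by (simp add: algebra_simps)
  also have "\<dots> \<le> (1 + N \<mu>\<^sub>0) * (A + K)" using NF B_norm_nonneg[OF mu0_B] by (intro mult_left_mono) auto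
  finally have NG: "N G \<le> (1 + N \<mu>\<^sub>0) * (A + K)" .
  have "\<mu>\<^sub>0 (\<psi> \<circ> (\<Lambda> ^^ n)) = (L ^^ n) \<mu>\<^sub>0 \<psi>" by (rule transfer_op_pow_apply[OF pC, symmetric])
  also have "(L ^^ n) \<mu>\<^sub>0 = \<mu>\<^sub>0" by (induction n) (simp_all add: mu0_invariant)
  finally have zero': "\<mu>\<^sub>0 (\<psi> \<circ> (\<Lambda> ^^ n)) = 0" unfolding zero .
  have "(L ^^ n) G \<psi> = F (\<psi> \<circ> (\<Lambda> ^^ n))"
    unfolding transfer_op_pow_apply[OF pC] G_def zero' by simp
  also have "\<dots> = pairing (h j) (\<lambda>z. \<psi> z * (\<psi> \<circ> (\<Lambda> ^^ n)) z)"
    unfolding F_def density_functional_def using leafwise_pow_C1_stable[OF pC, of n]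
    by (simp add: pairing_def mult.assoc)
  also have "\<dots> = pairing (\<lambda>_. 1) ((\<lambda>z. \<psi> z * (\<psi> \<circ> (\<Lambda> ^^ n)) z) \<circ> (\<Lambda> ^^ j))"
    unfolding h_def by (rule pairing_transfer_density_pow[OF C1_unstable_const C1_stable_mult[OF pC leafwise_pow_C1_stable[OF pC]]])
  also have "\<dots> = (LINT z:square|lborel. \<psi> ((\<Lambda> ^^ j) z) * \<psi> ((\<Lambda> ^^ (j + n)) z))"
    unfolding pairing_def by (simp add: funpow_add add.commute[of j n])
  finally have eq: "(L ^^ n) G \<psi> = (LINT z:square|lborel. \<psi> ((\<Lambda> ^^ j) z) * \<psi> ((\<Lambda> ^^ (j + n)) z))" .
  have "\<bar>(L ^^ n) G \<psi>\<bar> \<le> N ((L ^^ n) G) * (A + K)"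
    by (rule banach_B_eval_bound[OF transfer_op_pow_B[OF GB] pC hb])
  also have "\<dots> \<le> decay_const * (real n + 1) * \<rho> ^ n * N G * (A + K)"
    using A0 K0 mu0_one by (intro mult_right_mono B_norm_decay GB) (auto simp: G_def)
  also have "\<dots> \<le> decay_const * (real n + 1) * \<rho> ^ n * ((1 + N \<mu>\<^sub>0) * (A + K)) * (A + K)"
    using A0 K0 decay_const_pos rho by (intro mult_right_mono mult_left_mono NG) auto
  finally show ?thesis unfolding eq by (simp add: mult_ac)
qed

lemma leafwise_pow_measurable:
  "(\<Lambda> ^^ n) \<in> measurable borel_square borel_square"
proof (induction n)
  case (Suc n)
  show ?case unfolding funpow.simps(2) by (rule measurable_comp[OF Suc leafwise_measurable])
qed (simp add: id_def)

lemma leafwise_pow_square: "z \<in> square \<Longrightarrow> (\<Lambda> ^^ n) z \<in> square"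
  by (induction n) (auto intro: leafwise_square)

lemma prob_space_square: "prob_space (restrict_space lborel square)"
  by (rule prob_spaceI) (simp add: space_restrict_space emeasure_restrict_space emeasure_square)

text \<open>After centring at \<open>\<mu>\<^sub>0 \<psi>\<close> the correlation bounds are
  summable in the time difference and uniform in the first time, so the strong law applies under
  Lebesgue measure, which need not be invariant.\<close>

lemma averages_AE_lipschitz:
  assumes \<psi>: "K-lipschitz_on square \<psi>"
  shows "AE z in restrict_space lborel square. (\<lambda>n. (\<Sum>k<n. \<psi> ((\<Lambda> ^^ k) z)) / real n) \<longlonglongrightarrow> \<mu>\<^sub>0 \<psi>"
proof -
  interpret U: prob_space "restrict_space lborel square" by (rule prob_space_square)
  obtain \<nu> where \<nu>: "measure_on_square \<nu>" "prob_space \<nu>" "\<mu>\<^sub>0 = functional_of_measure \<nu>" using mu0_measure by blast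
  interpret n: prob_space \<nu> by (rule \<nu>)
  have pC: "\<psi> \<in> C1_stable" by (rule lipschitz_C1_stable[OF \<psi>])
  define \<phi> where "\<phi> z = \<psi> z - \<mu>\<^sub>0 \<psi>" for z
  have lip: "K-lipschitz_on square \<phi>"
    using \<psi> unfolding \<phi>_def[abs_def] lipschitz_on_def by (simp add: dist_real_def)
  have \<phi>C: "\<phi> \<in> C1_stable" by (rule lipschitz_C1_stable[OF lip])
  obtain A where A: "\<And>z. z \<in> square \<Longrightarrow> \<bar>\<phi> z\<bar> \<le> A" using C1_stable_bounded[OF \<phi>C] by blast
  obtain A' where A': "\<And>z. z \<in> square \<Longrightarrow> \<bar>\<psi> z\<bar> \<le> A'" using C1_stable_bounded[OF pC] by blast
  have "integrable \<nu> \<psi>"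
    by (rule n.integrable_const_bound[of _ A'])
      (use A' space_square[OF \<nu>(1)] C1_stable_measurable[OF pC] measurable_on_square[OF \<nu>(1)] in auto)
  then have "(\<integral>z. \<psi> z - \<mu>\<^sub>0 \<psi> \<partial>\<nu>) = (\<integral>z. \<psi> z \<partial>\<nu>) - \<mu>\<^sub>0 \<psi>" by (simp add: n.prob_space)
  moreover have "\<mu>\<^sub>0 u = (\<integral>z. u z \<partial>\<nu>)" if "u \<in> C1_stable" for u
    unfolding \<nu>(3) functional_of_measure_def using that by simp
  ultimately have zero: "\<mu>\<^sub>0 \<phi> = 0" using \<phi>C pC by (simp add: \<phi>_def)
  let ?a = "\<lambda>k z. \<phi> ((\<Lambda> ^^ k) z)"
  have "AE z in restrict_space lborel square. (\<lambda>n. (\<Sum>k<n. ?a k z) / real n) \<longlonglongrightarrow> 0"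
  proof (rule U.averages_AE_null)
    have s: "sets (restrict_space lborel square) = sets borel_square" by (simp add: sets_restrict_space)
    show "?a k \<in> borel_measurable (restrict_space lborel square)" for k
      unfolding measurable_cong_sets[OF s refl]
      by (rule measurable_compose[OF leafwise_pow_measurable C1_stable_measurable[OF \<phi>C]])
    show "\<bar>?a k z\<bar> \<le> A" if "z \<in> space (restrict_space lborel square)" for k z
      using that A[OF leafwise_pow_square] by (simp add: space_restrict_space)
    show "\<bar>\<integral>z. ?a j z * ?a (j + n) z \<partial>restrict_space lborel square\<bar>
        \<le> decay_const * (A + K) * (1 + N \<mu>\<^sub>0) * (A + K) * ((real n + 1) * \<rho> ^ n)" for j n
      using correlation_decay[OF lip A zero, of j n]
      by (simp add: integral_restrict_space set_lebesgue_integral_def)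
    have "norm \<rho> < 1" using rho by simp
    from sums_summable[OF geometric_deriv_sums[OF this]]
    show "summable (\<lambda>n. decay_const * (A + K) * (1 + N \<mu>\<^sub>0) * (A + K) * ((real n + 1) * \<rho> ^ n))"
      by (intro summable_mult) (simp add: add.commute)
  qed
  then show ?thesis
  proof (rule AE_mp, intro AE_I2 impI)
    fix z assume l: "(\<lambda>n. (\<Sum>k<n. ?a k z) / real n) \<longlonglongrightarrow> 0"
    have "(\<lambda>n. (\<Sum>k<n. ?a k z) / real n + \<mu>\<^sub>0 \<psi>) \<longlonglongrightarrow> 0 + \<mu>\<^sub>0 \<psi>" by (intro tendsto_intros l)
    moreover have "\<forall>\<^sub>F n in sequentially. (\<Sum>k<n. ?a k z) / real n + \<mu>\<^sub>0 \<psi> = (\<Sum>k<n. \<psi> ((\<Lambda> ^^ k) z)) / real n"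
      using eventually_gt_at_top[of 0]
      by eventually_elim (simp add: \<phi>_def sum_subtractf diff_divide_distrib)
    ultimately show "(\<lambda>n. (\<Sum>k<n. \<psi> ((\<Lambda> ^^ k) z)) / real n) \<longlonglongrightarrow> \<mu>\<^sub>0 \<psi>"
      by (simp add: tendsto_cong)
  qed
qed

end

section \<open>From the leafwise version to the map itself\<close>

locale baker_system = baker_data +
  fixes T :: "point \<Rightarrow> point"
  assumes T_branch: "\<And>i z. i < \<kappa> \<Longrightarrow> z \<in> rectangle \<kappa> i - (\<Union>j\<in>{..<\<kappa>} - {i}. rectangle \<kappa> j) \<Longrightarrow> T z = b i z"
    and T_measurable: "T \<in> measurable borel_square borel_square"
begin

definition grid :: "real set" where "grid = (\<lambda>i::nat. real i / \<kappa>) ` {..\<kappa>}"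

lemma idx_eqI:
  assumes "j < \<kappa>" "s \<in> {real j / \<kappa> .. real (Suc j) / \<kappa>}" "s \<notin> grid"
  shows "idx s = j"
proof -
  have "s \<noteq> real j / \<kappa>" "s \<noteq> real (Suc j) / \<kappa>" using assms(1,3) unfolding grid_def by (auto simp del: of_nat_Suc)
  then have "real j / \<kappa> < s" "s < real (Suc j) / \<kappa>" using assms(2) by auto
  then have "real j < \<kappa> * s" "\<kappa> * s < real j + 1"
    using kappa_pos by (auto simp: divide_less_eq less_divide_eq mult.commute)
  then have "\<lfloor>\<kappa> * s\<rfloor> = int j" by linarith
  then show ?thesis using assms(1) unfolding idx_def by simp
qed

lemma T_eq_leafwise:
  assumes "z \<in> square" "fst z \<notin> grid" shows "T z = \<Lambda> z"
proof -
  have r: "z \<in> rectangle \<kappa> j \<longleftrightarrow> fst z \<in> {real j / \<kappa> .. real (Suc j) / \<kappa>}" for j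
    using assms(1) by (cases z) (auto simp: rectangle_def square_def)
  have "z \<in> rectangle \<kappa> (idx (fst z))" unfolding r using idx_range[of "fst z"] square_coord[OF assms(1)] by blast
  moreover have "z \<notin> rectangle \<kappa> j" if "j \<in> {..<\<kappa>} - {idx (fst z)}" for j
    using idx_eqI[of j "fst z"] that assms(2) unfolding r by auto
  ultimately have "T z = b (idx (fst z)) z" by (intro T_branch[OF idx_less]) blast
  then show ?thesis unfolding leafwise_def idx_def .
qed

text \<open>The horizontal factor of \<open>leafwise\<close>. Abscissae evolve on their own, so the
  points whose orbit meets a vertical side of a rectangle form a union of vertical lines.\<close>

definition base_map :: "real \<Rightarrow> real" where "base_map s = p (idx s) + e (idx s) * \<kappa> * s"

lemma fst_leafwise_pow: "fst ((\<Lambda> ^^ n) z) = (base_map ^^ n) (fst z)"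
proof (induction n)
  case (Suc n)
  have "fst (\<Lambda> w) = base_map (fst w)" for w by (cases w) (simp add: leafwise_eq base_map_def)
  with Suc show ?case by simp
qed simp

lemma X_left_inverse: "i < \<kappa> \<Longrightarrow> X i (p i + e i * \<kappa> * s) = s"
  using kappa_pos orient(1)[of i] by (auto simp: X_def field_simps)

definition exceptional :: "real set" where "exceptional = (\<Union>n. (base_map ^^ n) -` grid)"

text \<open>A point has at most one preimage under each of the \<kappa> branches of
  \<open>base_map\<close>, so all iterated preimages of the finite grid are countable.\<close>

lemma countable_exceptional: "countable exceptional"
proof -
  have "countable ((base_map ^^ n) -` grid)" for n
  proof (induction n)
    case 0
    then show ?case by (simp add: grid_def countable_finite)
  next
    case (Suc n)
    have "(base_map ^^ Suc n) -` grid \<subseteq> (\<Union>i<\<kappa>. X i ` ((base_map ^^ n) -` grid))"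
    proof
      fix s assume "s \<in> (base_map ^^ Suc n) -` grid"
      then have "base_map s \<in> (base_map ^^ n) -` grid" by (simp add: funpow_swap1)
      moreover have "s = X (idx s) (base_map s)" unfolding base_map_def X_left_inverse[OF idx_less] ..
      ultimately show "s \<in> (\<Union>i<\<kappa>. X i ` ((base_map ^^ n) -` grid))" using idx_less[of s] by blast
    qed
    then show ?case by (rule countable_subset) (intro countable_UN countable_image Suc, simp)
  qed
  then show ?thesis unfolding exceptional_def by (intro countable_UN) auto
qed

lemma T_pow_eq_leafwise_pow:
  assumes "z \<in> square" "fst z \<notin> exceptional" shows "(T ^^ n) z = (\<Lambda> ^^ n) z"
proof (induction n)
  case (Suc n)
  have "fst ((\<Lambda> ^^ n) z) \<notin> grid" using assms(2) unfolding fst_leafwise_pow exceptional_def by blast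
  then show ?case using Suc T_eq_leafwise[OF leafwise_pow_square[OF assms(1)]] by simp
qed simp

text \<open>On the square \<open>T\<close> and its leafwise version differ only over the finite grid
  of abscissae, which is null. Invariance under the leafwise version is the equation
  \<open>L \<mu>\<^sub>0 = \<mu>\<^sub>0\<close> read on Lipschitz functions.\<close>

lemma invariant_measure:
  assumes \<nu>: "measure_on_square \<nu>" "prob_space \<nu>" "\<mu>\<^sub>0 = functional_of_measure \<nu>"
    and S: "\<And>S. countable S \<Longrightarrow> AE z in \<nu>. fst z \<notin> S"
  shows "T \<in> measurable \<nu> \<nu>" "distr \<nu> \<nu> T = \<nu>"
proof -
  have s: "sets \<nu> = sets borel_square" using \<nu>(1) by (simp add: measure_on_square_def)
  show Tm: "T \<in> measurable \<nu> \<nu>" unfolding measurable_cong_sets[OF s s] by (rule T_measurable)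
  have Lm: "\<Lambda> \<in> measurable \<nu> \<nu>" unfolding measurable_cong_sets[OF s s] by (rule leafwise_measurable)
  have "countable grid" by (simp add: grid_def countable_finite)
  from S[OF this] have "AE z in \<nu>. T z = \<Lambda> z"
    by (rule AE_mp) (intro AE_I2 impI T_eq_leafwise, auto simp: space_square[OF \<nu>(1)])
  then have "distr \<nu> \<nu> T = distr \<nu> \<nu> (\<Lambda>)" by (intro distr_cong_AE) (simp_all add: Tm Lm)
  also have "\<dots> = \<nu>"
  proof (rule measure_on_square_eqI[OF _ \<nu>(1)])
    show "measure_on_square (distr \<nu> \<nu> (\<Lambda>))"
      unfolding measure_on_square_def
      using prob_space.prob_space_distr[OF \<nu>(2) Lm] prob_space.finite_measure s by auto
    fix \<psi> :: "point \<Rightarrow> real" and K assume "K-lipschitz_on UNIV \<psi>"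
    then have "\<psi> \<in> C1_stable" by (intro lipschitz_C1_stable) (auto intro: lipschitz_on_subset)
    note C = this leafwise_C1_stable[OF this]
    have mu: "\<mu>\<^sub>0 u = (\<integral>x. u x \<partial>\<nu>)" if "u \<in> C1_stable" for u
      unfolding \<nu>(3) functional_of_measure_def using that by simp
    have "\<psi> \<in> borel_measurable \<nu>"
      using C1_stable_measurable[OF C(1)] unfolding measurable_on_square[OF \<nu>(1)] .
    then have "(\<integral>x. \<psi> x \<partial>distr \<nu> \<nu> (\<Lambda>)) = (\<integral>x. \<psi> (\<Lambda> x) \<partial>\<nu>)"
      by (rule integral_distr[OF Lm])
    also have "\<dots> = (\<integral>x. (\<psi> \<circ> \<Lambda>) x \<partial>\<nu>)" unfolding o_apply ..
    also have "\<dots> = \<mu>\<^sub>0 (\<psi> \<circ> \<Lambda>)" by (rule mu[OF C(2), symmetric])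
    also have "\<dots> = \<mu>\<^sub>0 \<psi>" using transfer_op_apply[OF C(1), of \<mu>\<^sub>0] mu0_invariant by simp
    also have "\<dots> = (\<integral>x. \<psi> x \<partial>\<nu>)" by (rule mu[OF C(1)])
    finally show "(\<integral>x. \<psi> x \<partial>distr \<nu> \<nu> (\<Lambda>)) = (\<integral>x. \<psi> x \<partial>\<nu>)" .
  qed
  finally show "distr \<nu> \<nu> T = \<nu>" .
qed

text \<open>Uniform approximation by a polynomial on the square changes every time average and the
  integral by at most the uniform error.\<close>

lemma averages_continuous:
  assumes \<nu>: "measure_on_square \<nu>" "prob_space \<nu>" "\<mu>\<^sub>0 = functional_of_measure \<nu>"
    and mono: "\<And>i j. (\<lambda>n. (\<Sum>k<n. monomial2 i j (x k)) / real n) \<longlonglongrightarrow> \<mu>\<^sub>0 (monomial2 i j)"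
    and x: "\<And>k. x k \<in> square" and \<psi>: "continuous_on square \<psi>"
  shows "(\<lambda>n. (\<Sum>k<n. \<psi> (x k)) / real n) \<longlonglongrightarrow> (\<integral>z. \<psi> z \<partial>\<nu>)"
proof -
  interpret n: prob_space \<nu> by (rule \<nu>)
  have sq: "compact square" unfolding square_def by (intro compact_Times compact_Icc)
  have cint: "integrable \<nu> g" if g: "continuous_on square g" for g :: "point \<Rightarrow> real"
  proof -
    have "bounded (g ` square)" by (intro compact_imp_bounded compact_continuous_image g sq)
    then obtain A where A: "\<And>z. z \<in> square \<Longrightarrow> norm (g z) \<le> A" unfolding bounded_iff by blast
    show ?thesis
      by (rule n.integrable_const_bound[of _ A])
        (use A space_square[OF \<nu>(1)] borel_measurable_continuous_on_restrict[OF g] measurable_on_square[OF \<nu>(1)] in auto)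
  qed
  have mon: "continuous_on square (monomial2 i j)" for i j
    unfolding monomial2_def[abs_def] by (intro continuous_intros)
  have poly: "continuous_on square f \<and> (\<lambda>n. (\<Sum>k<n. f (x k)) / real n) \<longlonglongrightarrow> (\<integral>z. f z \<partial>\<nu>)" if "polynomial2 f" for f
    using that
  proof (induction rule: polynomial2.induct)
    case (monomial c i j)
    have "monomial2 i j \<in> C1_stable" using lipschitz_monomial2[of i j] lipschitz_C1_stable by blast
    then have "\<mu>\<^sub>0 (monomial2 i j) = (\<integral>z. monomial2 i j z \<partial>\<nu>)" unfolding \<nu>(3) functional_of_measure_def by simp
    moreover have "(\<lambda>n. c * ((\<Sum>k<n. monomial2 i j (x k)) / real n)) \<longlonglongrightarrow> c * \<mu>\<^sub>0 (monomial2 i j)"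
      by (intro tendsto_intros mono)
    ultimately show ?case using mon[of i j] by (auto simp: sum_distrib_left intro!: continuous_intros)
  next
    case (sum f g)
    have "(\<lambda>n. (\<Sum>k<n. f (x k)) / real n + (\<Sum>k<n. g (x k)) / real n) \<longlonglongrightarrow> (\<integral>z. f z \<partial>\<nu>) + (\<integral>z. g z \<partial>\<nu>)"
      using sum.IH by (intro tendsto_intros) auto
    then show ?case using sum.IH cint by (auto simp: sum.distrib add_divide_distrib intro!: continuous_intros)
  qed
  show ?thesis
  proof (rule LIMSEQ_I)
    fix r :: real assume r: "0 < r"
    then have r3: "0 < r / 3" by simp
    obtain g where "real_polynomial_function g" and g: "\<And>z. z \<in> square \<Longrightarrow> \<bar>\<psi> z - g z\<bar> < r / 3"
      using Stone_Weierstrass_real_polynomial_function[OF sq \<psi> r3] by blast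
    then have pg: "continuous_on square g" "(\<lambda>n. (\<Sum>k<n. g (x k)) / real n) \<longlonglongrightarrow> (\<integral>z. g z \<partial>\<nu>)"
      using poly[OF real_polynomial_function_polynomial2] by blast+
    have ints: "\<bar>(\<integral>z. \<psi> z \<partial>\<nu>) - (\<integral>z. g z \<partial>\<nu>)\<bar> \<le> r / 3"
    proof -
      have "(\<integral>z. \<psi> z \<partial>\<nu>) - (\<integral>z. g z \<partial>\<nu>) = (\<integral>z. \<psi> z - g z \<partial>\<nu>)"
        by (rule Bochner_Integration.integral_diff[OF cint[OF \<psi>] cint[OF pg(1)], symmetric])
      also have "norm \<dots> \<le> (\<integral>z. norm (\<psi> z - g z) \<partial>\<nu>)" by (rule integral_norm_bound)
      also have "\<dots> \<le> (\<integral>z. r / 3 \<partial>\<nu>)"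
      proof (rule integral_mono)
        show "integrable \<nu> (\<lambda>z. norm (\<psi> z - g z))"
          by (intro integrable_norm Bochner_Integration.integrable_diff cint \<psi> pg)
        show "norm (\<psi> z - g z) \<le> r / 3" if "z \<in> space \<nu>" for z
          using g[of z] that space_square[OF \<nu>(1)] by simp
      qed simp
      also have "\<dots> = r / 3" by (simp add: n.prob_space)
      finally show ?thesis by simp
    qed
    obtain n0 where n0: "\<And>n. n0 \<le> n \<Longrightarrow> norm ((\<Sum>k<n. g (x k)) / real n - (\<integral>z. g z \<partial>\<nu>)) < r / 3"
      using LIMSEQ_D[OF pg(2) r3] by blast
    have avg: "\<bar>(\<Sum>k<n. \<psi> (x k)) / real n - (\<Sum>k<n. g (x k)) / real n\<bar> \<le> r / 3" for n
    proof (cases "n = 0")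
      case False
      have "\<bar>\<Sum>k<n. \<psi> (x k) - g (x k)\<bar> \<le> (\<Sum>k<n. r / 3)"
        by (rule order_trans[OF sum_abs sum_mono]) (use g[OF x] in \<open>simp add: less_imp_le\<close>)
      then have "\<bar>\<Sum>k<n. \<psi> (x k) - g (x k)\<bar> / real n \<le> (real n * (r / 3)) / real n" by (intro divide_right_mono) auto
      then show ?thesis using False by (simp add: sum_subtractf diff_divide_distrib[symmetric])
    qed (use r in simp)
    show "\<exists>no. \<forall>n\<ge>no. norm ((\<Sum>k<n. \<psi> (x k)) / real n - (\<integral>z. \<psi> z \<partial>\<nu>)) < r"
    proof (intro exI[of _ n0] allI impI)
      fix n assume "n0 \<le> n"
      from n0[OF this] avg[of n] ints show "norm ((\<Sum>k<n. \<psi> (x k)) / real n - (\<integral>z. \<psi> z \<partial>\<nu>)) < r"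
        unfolding real_norm_def by arith
    qed
  qed
qed

text \<open>For uniqueness a single point suffices: a basin of positive Lebesgue measure contains a
  typical point, and there the integrals against both measures are limits of the same
  averages.\<close>

theorem physical_measure_unique:
  assumes \<nu>: "measure_on_square \<nu>" "prob_space \<nu>" "\<mu>\<^sub>0 = functional_of_measure \<nu>"
    and S: "\<And>S. countable S \<Longrightarrow> AE z in \<nu>. fst z \<notin> S"
  shows "physical_measure T \<nu>' \<longleftrightarrow> \<nu>' = \<nu>"
proof -
  have "AE z in restrict_space lborel square. \<forall>i j. (\<lambda>n. (\<Sum>k<n. monomial2 i j ((\<Lambda> ^^ k) z)) / real n) \<longlonglongrightarrow> \<mu>\<^sub>0 (monomial2 i j)"
    unfolding AE_all_countable
  proof (intro allI)
    fix i j
    obtain K where "K-lipschitz_on square (monomial2 i j)" using lipschitz_monomial2 by blast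
    then show "AE z in restrict_space lborel square. (\<lambda>n. (\<Sum>k<n. monomial2 i j ((\<Lambda> ^^ k) z)) / real n) \<longlonglongrightarrow> \<mu>\<^sub>0 (monomial2 i j)"
      by (rule averages_AE_lipschitz)
  qed
  then have ae1: "AE z in lborel. z \<in> square \<longrightarrow>
      (\<forall>i j. (\<lambda>n. (\<Sum>k<n. monomial2 i j ((\<Lambda> ^^ k) z)) / real n) \<longlonglongrightarrow> \<mu>\<^sub>0 (monomial2 i j))"
    by (subst (asm) AE_restrict_space_iff) simp_all
  have ae2: "AE z in (lborel :: point measure). fst z \<notin> exceptional"
  proof -
    have b: "exceptional \<in> sets borel" by (rule sets.countable[OF _ countable_exceptional]) simp
    have "emeasure (lborel \<Otimes>\<^sub>M lborel) (exceptional \<times> (UNIV :: real set)) = emeasure lborel exceptional * emeasure lborel (UNIV :: real set)"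
      by (rule lborel.emeasure_pair_measure_Times) (use b in auto)
    \<comment> \<open>The second factor is infinite; the product with 0 is 0 in
      \<open>ennreal\<close>.\<close>
    also have "\<dots> = 0" by (simp add: emeasure_lborel_countable[OF countable_exceptional])
    finally have "exceptional \<times> (UNIV :: real set) \<in> null_sets lborel"
      using b unfolding lborel_prod[symmetric] by (auto intro!: null_setsI pair_measureI)
    then show ?thesis by (rule AE_I') auto
  qed
  define generic where "generic z \<longleftrightarrow> (\<forall>i j. (\<lambda>n. (\<Sum>k<n. monomial2 i j ((\<Lambda> ^^ k) z)) / real n) \<longlonglongrightarrow> \<mu>\<^sub>0 (monomial2 i j))" for z
  from ae1 ae2 have "AE z in lborel. z \<in> square \<longrightarrow> fst z \<notin> exceptional \<and> generic z"
    unfolding generic_def by eventually_elim blast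
  then obtain Z where "\<And>z. z \<in> space lborel - Z \<Longrightarrow> z \<in> square \<longrightarrow> fst z \<notin> exceptional \<and> generic z" and Z: "Z \<in> null_sets lborel"
    by (rule AE_E3) blast
  then have good: "fst z \<notin> exceptional" "generic z" if "z \<in> square" "z \<notin> Z" for z using that by auto
  have typical: "(\<lambda>n. (\<Sum>k<n. \<psi> ((T ^^ k) z)) / real n) \<longlonglongrightarrow> (\<integral>x. \<psi> x \<partial>\<nu>)"
    if z: "z \<in> square" "z \<notin> Z" and \<psi>: "continuous_on square \<psi>" for z \<psi>
    unfolding T_pow_eq_leafwise_pow[OF z(1) good(1)[OF z]]
  proof (rule averages_continuous[OF \<nu>, of "\<lambda>k. (\<Lambda> ^^ k) z"])
    show "(\<lambda>n. (\<Sum>k<n. monomial2 i j ((\<Lambda> ^^ k) z)) / real n) \<longlonglongrightarrow> \<mu>\<^sub>0 (monomial2 i j)" for i j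
      using good(2)[OF z] unfolding generic_def by blast
    show "(\<Lambda> ^^ k) z \<in> square" for k by (rule leafwise_pow_square[OF z(1)])
    show "continuous_on square \<psi>" by (rule \<psi>)
  qed
  \<comment> \<open>A basin is only Lebesgue measurable, so the null set is compared with it in the
    completion.\<close>
  have Zl: "Z \<in> null_sets lebesgue" using Z by (rule null_sets_completionI)
  show ?thesis
  proof
    assume "\<nu>' = \<nu>"
    have "square - Z \<in> sets lborel" using Z by (intro sets.Diff) auto
    moreover have "emeasure lborel (square - Z) = 1"
      using emeasure_Diff_null_set[OF Z, of square] emeasure_square by simp
    ultimately have "square - Z \<in> sets lebesgue" "0 < emeasure lebesgue (square - Z)" by auto
    then show "physical_measure T \<nu>'"
      unfolding physical_measure_def \<open>\<nu>' = \<nu>\<close>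
      using \<nu>(1) invariant_measure[OF \<nu> S] typical by (intro conjI exI[of _ "square - Z"]) auto
  next
    assume "physical_measure T \<nu>'"
    then obtain D where m: "measure_on_square \<nu>'" and D: "D \<subseteq> square" "D \<in> sets lebesgue" "0 < emeasure lebesgue D"
      and lim: "\<And>x \<psi>. x \<in> D \<Longrightarrow> continuous_on square \<psi> \<Longrightarrow> (\<lambda>n. (\<Sum>k<n. \<psi> ((T ^^ k) x)) / real n) \<longlonglongrightarrow> (\<integral>x. \<psi> x \<partial>\<nu>')"
      unfolding physical_measure_def by auto
    have "\<not> D \<subseteq> Z"
    proof
      assume "D \<subseteq> Z"
      then have "emeasure lebesgue D \<le> emeasure lebesgue Z" using Zl by (intro emeasure_mono) auto
      then show False using D(3) Zl by auto
    qed
    then obtain z where z: "z \<in> D" "z \<in> square" "z \<notin> Z" using D(1) by blast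
    show "\<nu>' = \<nu>"
    proof (rule measure_on_square_eqI[OF m \<nu>(1)])
      fix \<psi> :: "point \<Rightarrow> real" and K assume "K-lipschitz_on UNIV \<psi>"
      then have "continuous_on square \<psi>"
        by (rule continuous_on_subset[OF lipschitz_on_continuous_on]) simp
      from LIMSEQ_unique[OF lim[OF z(1) this] typical[OF z(2,3) this]]
      show "(\<integral>x. \<psi> x \<partial>\<nu>') = (\<integral>x. \<psi> x \<partial>\<nu>)" .
    qed
  qed
qed

end

text \<open>The offsets and orientations are existentially quantified for each branch; choice turns
  them into functions of the index.\<close>

lemma baker_systemE:
  assumes "2 \<le> \<kappa>" and "0 < l" and "l \<le> 1 / real \<kappa>"
    and "0 < \<alpha>" and "\<alpha> < 1" and "0 < \<beta>" and "\<beta> < 1" and "baker \<kappa> l b T"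
  obtains p q e d where "baker_system \<alpha> \<beta> \<kappa> l p q e d b T"
proof -
  note bd = assms(8)[unfolded baker_def]
  note branches = bd[THEN conjunct1] and rest = bd[THEN conjunct2]
  have "\<forall>i. \<exists>p q e d. i < \<kappa> \<longrightarrow> e \<in> {1, -1} \<and> d \<in> {1, -1} \<and>
      (\<forall>x y. b i (x, y) = (p + e * real \<kappa> * x, q + d * l * y))"
    using branches by (simp only: Bex_def) blast
  then obtain p q e d where pq: "\<And>i. i < \<kappa> \<Longrightarrow> e i \<in> {1, -1} \<and> d i \<in> {1, -1} \<and>
      (\<forall>x y. b i (x, y) = (p i + e i * real \<kappa> * x, q i + d i * l * y))"
    unfolding choice_iff by auto
  have "baker_system \<alpha> \<beta> \<kappa> l p q e d b T"
  proof unfold_locales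
    show "b i ` rectangle \<kappa> i \<subseteq> square" if "i < \<kappa>" for i
      using rest[THEN conjunct1] that by simp
    show "T z = b i z" if "i < \<kappa>" "z \<in> rectangle \<kappa> i - (\<Union>j\<in>{..<\<kappa>} - {i}. rectangle \<kappa> j)" for i z
      using rest[THEN conjunct2, THEN conjunct2, THEN conjunct1] that by blast
    show "T \<in> measurable borel_square borel_square"
      using rest[THEN conjunct2, THEN conjunct2, THEN conjunct2] .
  qed (use assms(1-7) pq in simp_all)
  then show thesis by (rule that)
qed

theorem theorem2p5:
  fixes \<kappa> :: nat and l \<alpha> \<beta> :: real
    and b :: "nat \<Rightarrow> point \<Rightarrow> point" and T :: "point \<Rightarrow> point"
  assumes "2 \<le> \<kappa>" and "0 < l" and "l \<le> 1 / real \<kappa>"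
    and "0 < \<alpha>" and "\<alpha> < 1" and "0 < \<beta>" and "\<beta> < 1" and "\<beta> \<le> 1 - \<alpha>"
    and "baker \<kappa> l b T"
  shows "let L = transfer_op \<kappa> b; B = banach_B \<alpha> \<beta>; N = B_norm \<alpha> \<beta>;
             LC = complexify_op L; BC = complexify_space B; NC = complexify_norm N;
             \<rho> = max (l powr \<alpha>) (real \<kappa> powr (- \<beta>))
    in quasi_compact BC NC LC \<and>
       spectral_radius_on BC NC LC = 1 \<and>
       essential_spectral_radius BC NC LC \<le> \<rho> \<and> \<rho> < 1 \<and>
       simple_eigenvalue_on BC LC 1 \<and>
       (\<forall>z. eigenvalue_on BC LC z \<and> z \<noteq> 1 \<longrightarrow> cmod z < 1) \<and>
       (\<exists>\<mu>\<^sub>0. (\<forall>\<mu>. \<mu> \<in> B \<and> L \<mu> = \<mu> \<and> \<mu> (\<lambda>_. 1) = 1 \<longleftrightarrow> \<mu> = \<mu>\<^sub>0) \<and>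
          (\<exists>\<nu>. measure_on_square \<nu> \<and> \<mu>\<^sub>0 = functional_of_measure \<nu> \<and>
               (\<forall>\<nu>'. physical_measure T \<nu>' \<longleftrightarrow> \<nu>' = \<nu>) \<and>
               conditional_measures_unstable \<nu> arclength_unstable) \<and>
          (\<exists>\<sigma> C. \<sigma> < 1 \<and> 0 < C \<and>
             (\<forall>f\<in>B. f (\<lambda>_. 1) = 1 \<longrightarrow>
                (\<forall>n. N (\<lambda>\<phi>. (L ^^ n) f \<phi> - \<mu>\<^sub>0 \<phi>) \<le> C * \<sigma> ^ n * N f))))"
proof -
  obtain p q e d where "baker_system \<alpha> \<beta> \<kappa> l p q e d b T"
    using baker_systemE[OF assms(1-7,9)] by blast
  then interpret baker_system \<alpha> \<beta> \<kappa> l p q e d b T .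
  obtain \<nu> where \<nu>: "measure_on_square \<nu>" "prob_space \<nu>" "\<mu>\<^sub>0 = functional_of_measure \<nu>"
    "conditional_measures_unstable \<nu> arclength_unstable" "\<And>S. countable S \<Longrightarrow> AE z in \<nu>. fst z \<notin> S"
    using mu0_measure by blast
  obtain \<sigma> C where conv: "\<sigma> < 1" "0 < C"
    "\<And>f n. f \<in> B \<Longrightarrow> f (\<lambda>_. 1) = 1 \<Longrightarrow> N (\<lambda>\<phi>. (L ^^ n) f \<phi> - \<mu>\<^sub>0 \<phi>) \<le> C * \<sigma> ^ n * N f"
    using exponential_convergence by blast
  show ?thesis unfolding Let_def \<rho>_def[symmetric]
  proof (intro conjI)
    show "quasi_compact BC NC LC" by (rule spectral.quasi_compact)
    show "spectral_radius_on BC NC LC = 1" by (rule spectral.spectral_radius)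
    show "essential_spectral_radius BC NC LC \<le> \<rho>" by (rule spectral.essential_radius)
    show "\<rho> < 1" by (rule rho)
    show "simple_eigenvalue_on BC LC 1" by (rule spectral.simple_one)
    show "\<forall>z. eigenvalue_on BC LC z \<and> z \<noteq> 1 \<longrightarrow> cmod z < 1" using spectral.eigenvalue_less_one by blast
    show "\<exists>\<mu>\<^sub>0. (\<forall>\<mu>. \<mu> \<in> B \<and> L \<mu> = \<mu> \<and> \<mu> (\<lambda>_. 1) = 1 \<longleftrightarrow> \<mu> = \<mu>\<^sub>0) \<and>
          (\<exists>\<nu>. measure_on_square \<nu> \<and> \<mu>\<^sub>0 = functional_of_measure \<nu> \<and>
               (\<forall>\<nu>'. physical_measure T \<nu>' \<longleftrightarrow> \<nu>' = \<nu>) \<and>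
               conditional_measures_unstable \<nu> arclength_unstable) \<and>
          (\<exists>\<sigma> C. \<sigma> < 1 \<and> 0 < C \<and>
             (\<forall>f\<in>B. f (\<lambda>_. 1) = 1 \<longrightarrow>
                (\<forall>n. N (\<lambda>\<phi>. (L ^^ n) f \<phi> - \<mu>\<^sub>0 \<phi>) \<le> C * \<sigma> ^ n * N f)))"
    proof (intro exI[of _ \<mu>\<^sub>0] conjI)
      show "\<forall>\<mu>. \<mu> \<in> B \<and> L \<mu> = \<mu> \<and> \<mu> (\<lambda>_. 1) = 1 \<longleftrightarrow> \<mu> = \<mu>\<^sub>0"
        using mu0_unique mu0_B mu0_invariant mu0_one by blast
      show "\<exists>\<nu>. measure_on_square \<nu> \<and> \<mu>\<^sub>0 = functional_of_measure \<nu> \<and>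
               (\<forall>\<nu>'. physical_measure T \<nu>' \<longleftrightarrow> \<nu>' = \<nu>) \<and> conditional_measures_unstable \<nu> arclength_unstable"
        using \<nu> physical_measure_unique[OF \<nu>(1-3,5)] by (intro exI[of _ \<nu>] conjI allI)
      show "\<exists>\<sigma> C. \<sigma> < 1 \<and> 0 < C \<and> (\<forall>f\<in>B. f (\<lambda>_. 1) = 1 \<longrightarrow>
                (\<forall>n. N (\<lambda>\<phi>. (L ^^ n) f \<phi> - \<mu>\<^sub>0 \<phi>) \<le> C * \<sigma> ^ n * N f))"
        using conv by (intro exI[of _ \<sigma>] exI[of _ C] conjI ballI allI impI)
    qed
  qed
qed

end
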